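(* Let $\Sigma$ be a closed, connected, orientable surface, let $\mathcal P$ be a polygonal subdivision of $\Sigma$, let $\mathbb D$ be a division ring and let $n\ge 1$. Then the incidence theorem in $\mathbb P^n(\mathbb D)$ associated with $\mathcal P$ holds if and only if at least one of the following conditions is satisfied: (1) $\mathcal P$ has a face with more than $n+1$ vertices; (2) $\mathbb D$ is a field (i.e. commutative); (3) $\Sigma$ is a sphere.
   Context: A polygonal subdivision of a closed, connected, orientable surface $\Sigma$ is a cellular decomposition of $\Sigma$ in which the closure of every $2$-cell (face) is an embedded polygon with at least two vertices. $\mathbb P^n(\mathbb D)$ denotes the left projective space of dimension $n$ over $\mathbb D$, i.e. the set of rank-one left submodules of $\mathbb D^{n+1}$. Points are linearly independent if some (equivalently any) choice of representing vectors in $\mathbb D^{n+1}$ is left-linearly independent; three points are collinear if their representing vectors span a submodule of rank at most $2$. A realization of $\mathcal P$ in $\mathbb P^n(\mathbb D)$ is an assignment of a point of $\mathbb P^n(\mathbb D)$ to each vertex and to each edge of $\mathcal P$ such that: (i) if an edge $e$ joins vertices $v$ and $w$, then the points assigned to $e$, $v$, $w$ are collinear and pairwise distinct; (ii) the points assigned to the vertices of each face are linearly independent. Given a realization, the Menelaus condition holds for a face if the points assigned to the edges of that face are linearly dependent. The incidence theorem in $\mathbb P^n(\mathbb D)$ associated with $\mathcal P$ is the statement: for every realization of $\mathcal P$ in $\mathbb P^n(\mathbb D)$, if the Menelaus condition holds for all faces except one, then it also holds for the remaining face. *)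

theory Defs
  imports "HOL-Analysis.Analysis"
begin

section \<open>Surfaces\<close>

text \<open>A closed surface is a nonempty compact \<open>2\<close>-manifold without boundary; second countability
  follows from compactness.\<close>

definition closed_surface :: "'a topology \<Rightarrow> bool" where
  "closed_surface X \<longleftrightarrow>
     topspace X \<noteq> {} \<and> compact_space X \<and> Hausdorff_space X \<and>
     (\<forall>x\<in>topspace X. \<exists>U. openin X U \<and> x \<in> U \<and>
        subtopology X U homeomorphic_space (euclidean :: (real^2) topology))"

text \<open>The subspace \<open>M\<close> is homeomorphic to the quotient of the unit square that identifies
  \<open>(0,t)\<close> with \<open>(1,1-t)\<close>.\<close>

definition moebius_band_in :: "'a topology \<Rightarrow> 'a set \<Rightarrow> bool" where
  "moebius_band_in X M \<longleftrightarrow>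
     M \<subseteq> topspace X \<and>
     (\<exists>q. quotient_map (top_of_set ({0..1} \<times> {0..1} :: (real \<times> real) set)) (subtopology X M) q \<and>
        (\<forall>s\<in>{0..1}. \<forall>t\<in>{0..1}. \<forall>s'\<in>{0..1}. \<forall>t'\<in>{0..1}.
           q (s, t) = q (s', t') \<longleftrightarrow>
             (s = s' \<and> t = t') \<or>
             (s = 0 \<and> s' = 1 \<and> t' = 1 - t) \<or>
             (s = 1 \<and> s' = 0 \<and> t' = 1 - t)))"

definition orientable_surface :: "'a topology \<Rightarrow> bool" where
  "orientable_surface X \<longleftrightarrow> (\<nexists>M. moebius_band_in X M)"

section \<open>Polygonal subdivisions\<close>

text \<open>\<open>\<phi>\<close> is a characteristic map, in the sense of CW complexes, of the open cell \<open>c\<close>, whose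
  dimension is that of the Euclidean space \<open>'b\<close>; the boundary of the cell is attached to \<open>A\<close>.\<close>

definition characteristic_map ::
    "'a topology \<Rightarrow> 'a set \<Rightarrow> 'a set \<Rightarrow> ('b::euclidean_space \<Rightarrow> 'a) \<Rightarrow> bool" where
  "characteristic_map X A c \<phi> \<longleftrightarrow>
     continuous_map (top_of_set (cball 0 1)) X \<phi> \<and>
     homeomorphic_map (top_of_set (ball 0 1)) (subtopology X c) \<phi> \<and>
     \<phi> ` sphere 0 1 \<subseteq> A"

text \<open>\<open>V\<close> is the set of vertices (as points); \<open>E\<close> and \<open>F\<close> are the sets of edges and faces, which
  are open cells, i.e. do not contain their boundaries. For compact spaces, finiteness is no
  restriction.\<close>

definition cellular_decomposition ::
    "'a topology \<Rightarrow> 'a set \<Rightarrow> 'a set set \<Rightarrow> 'a set set \<Rightarrow> bool" where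
  "cellular_decomposition X V E F \<longleftrightarrow>
     finite V \<and> finite E \<and> finite F \<and>
     partition_on (topspace X) ((\<lambda>v. {v}) ` V \<union> E \<union> F) \<and>
     (\<forall>e\<in>E. \<exists>\<phi> :: real \<Rightarrow> 'a. characteristic_map X V e \<phi>) \<and>
     (\<forall>f\<in>F. \<exists>\<phi> :: complex \<Rightarrow> 'a. characteristic_map X (V \<union> \<Union>E) f \<phi>)"

text \<open>The closure of the face \<open>f\<close> is an embedded polygon with \<open>k\<close> vertices. The model \<open>k\<close>-gon is
  the closed unit disc whose boundary circle is cut at the \<open>k\<close>-th roots of unity; this
  accommodates bigons.\<close>

definition embedded_polygon ::
    "'a topology \<Rightarrow> 'a set \<Rightarrow> 'a set set \<Rightarrow> 'a set \<Rightarrow> nat \<Rightarrow> bool" where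
  "embedded_polygon X V E f k \<longleftrightarrow>
     (\<exists>\<phi> :: complex \<Rightarrow> 'a.
        homeomorphic_map (top_of_set (cball 0 1)) (subtopology X (X closure_of f)) \<phi> \<and>
        \<phi> ` ball 0 1 = f \<and>
        (\<forall>j<k. \<phi> (cis (2 * pi * real j / real k)) \<in> V \<and>
               \<phi> ` cis ` {2 * pi * real j / real k <..< 2 * pi * real (Suc j) / real k} \<in> E))"

definition polygonal_subdivision ::
    "'a topology \<Rightarrow> 'a set \<Rightarrow> 'a set set \<Rightarrow> 'a set set \<Rightarrow> bool" where
  "polygonal_subdivision X V E F \<longleftrightarrow>
     cellular_decomposition X V E F \<and>
     (\<forall>f\<in>F. \<exists>k\<ge>2. embedded_polygon X V E f k)"

definition joins :: "'a topology \<Rightarrow> 'a set \<Rightarrow> 'a \<Rightarrow> 'a \<Rightarrow> bool" where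
  "joins X e v w \<longleftrightarrow> X closure_of e - e = {v, w}"

definition face_vertices :: "'a topology \<Rightarrow> 'a set \<Rightarrow> 'a set \<Rightarrow> 'a set" where
  "face_vertices X V f = {v \<in> V. v \<in> X closure_of f}"

definition face_edges :: "'a topology \<Rightarrow> 'a set set \<Rightarrow> 'a set \<Rightarrow> 'a set set" where
  "face_edges X E f = {e \<in> E. e \<subseteq> X closure_of f}"

section \<open>Left projective spaces over division rings\<close>

text \<open>The library's \<open>module\<close> and \<open>vector_space\<close> locales require commutative scalars.
  Note that \<open>c *s x\<close> multiplies the components of \<open>x\<close> by \<open>c\<close> from the left.\<close>

definition left_submodule :: "('d::division_ring ^ 'm) set \<Rightarrow> bool" where
  "left_submodule M \<longleftrightarrow>
     0 \<in> M \<and> (\<forall>x\<in>M. \<forall>y\<in>M. x + y \<in> M) \<and> (\<forall>c. \<forall>x\<in>M. c *s x \<in> M)"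

definition left_span :: "('d::division_ring ^ 'm) set \<Rightarrow> ('d ^ 'm) set" where
  "left_span S = left_submodule hull S"

text \<open>Independence is a property of families: a family with a repeated member is dependent.\<close>

definition left_independent :: "'i set \<Rightarrow> ('i \<Rightarrow> 'd::division_ring ^ 'm) \<Rightarrow> bool" where
  "left_independent I r \<longleftrightarrow>
     (\<forall>c :: 'i \<Rightarrow> 'd. (\<Sum>i\<in>I. c i *s r i) = 0 \<longrightarrow> (\<forall>i\<in>I. c i = 0))"

definition has_left_rank :: "('d::division_ring ^ 'm) set \<Rightarrow> nat \<Rightarrow> bool" where
  "has_left_rank M k \<longleftrightarrow>
     (\<exists>b. left_independent {..<k} b \<and> M = left_span (b ` {..<k}))"

text \<open>\<open>\<P>\<^sup>n(\<D>)\<close>, where \<open>'d\<close> is \<open>\<D>\<close> and the index type \<open>'m\<close> has \<open>n + 1\<close> elements.\<close>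

definition proj_space :: "('d::division_ring ^ 'm) set set" where
  "proj_space = {P. left_submodule P \<and> has_left_rank P 1}"

definition represents :: "'d::division_ring ^ 'm \<Rightarrow> ('d ^ 'm) set \<Rightarrow> bool" where
  "represents v P \<longleftrightarrow> v \<noteq> 0 \<and> P = left_span {v}"

definition points_independent :: "'i set \<Rightarrow> ('i \<Rightarrow> ('d::division_ring ^ 'm) set) \<Rightarrow> bool" where
  "points_independent I p \<longleftrightarrow>
     (\<exists>r. (\<forall>i\<in>I. represents (r i) (p i)) \<and> left_independent I r)"

definition points_collinear ::
    "('d::division_ring ^ 'm) set \<Rightarrow> ('d ^ 'm) set \<Rightarrow> ('d ^ 'm) set \<Rightarrow> bool" where
  "points_collinear P Q R \<longleftrightarrow>
     (\<exists>u v w. represents u P \<and> represents v Q \<and> represents w R \<and>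
        (\<exists>k\<le>2. has_left_rank (left_span {u, v, w}) k))"

section \<open>Realizations and the incidence theorem\<close>

definition realization ::
    "'a topology \<Rightarrow> 'a set \<Rightarrow> 'a set set \<Rightarrow> 'a set set \<Rightarrow>
     ('a \<Rightarrow> ('d::division_ring ^ 'm) set) \<Rightarrow> ('a set \<Rightarrow> ('d ^ 'm) set) \<Rightarrow> bool" where
  "realization X V E F pv pe \<longleftrightarrow>
     (\<forall>v\<in>V. pv v \<in> proj_space) \<and>
     (\<forall>e\<in>E. pe e \<in> proj_space) \<and>
     (\<forall>e\<in>E. \<forall>v\<in>V. \<forall>w\<in>V. joins X e v w \<longrightarrow>
        points_collinear (pe e) (pv v) (pv w) \<and> distinct [pe e, pv v, pv w]) \<and>
     (\<forall>f\<in>F. points_independent (face_vertices X V f) pv)"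

definition menelaus ::
    "'a topology \<Rightarrow> 'a set set \<Rightarrow> ('a set \<Rightarrow> ('d::division_ring ^ 'm) set) \<Rightarrow> 'a set \<Rightarrow> bool" where
  "menelaus X E pe f \<longleftrightarrow> \<not> points_independent (face_edges X E f) pe"

text \<open>The coordinate space enters only through its type, hence the \<open>itself\<close> argument.\<close>

definition incidence_theorem ::
    "('d::division_ring ^ 'm) itself \<Rightarrow> 'a topology \<Rightarrow> 'a set \<Rightarrow> 'a set set \<Rightarrow> 'a set set \<Rightarrow> bool" where
  "incidence_theorem _ X V E F \<longleftrightarrow>
     (\<forall>(pv :: 'a \<Rightarrow> ('d ^ 'm) set) pe. realization X V E F pv pe \<longrightarrow>
        (\<forall>f\<in>F. (\<forall>g\<in>F - {f}. menelaus X E pe g) \<longrightarrow> menelaus X E pe f))"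

end

theory Submission
  imports Defs "HOL-Library.Sublist"
begin

text \<open>Representing the vertices by vectors \<open>r v\<close>, the point of an edge from \<open>v\<close> to \<open>w\<close> is spanned by
  \<open>r v - a *s r w\<close> for a unique \<open>a \<noteq> 0\<close>, and reversing the edge inverts \<open>a\<close>. The Menelaus condition for a
  face says that the product of these gains along its boundary is \<open>1\<close>. Gluing all faces along a spanning tree of
  the dual graph presents the surface as a disc whose boundary word contains every remaining edge exactly twice,
  in opposite directions by orientability. When all faces but one have trivial holonomy, the remaining
  one has trivial holonomy iff this word has. Over a commutative ring the word always does. In general, either
  the word cancels completely, in which case folding the disc yields a sphere, or it contains a crossing
  \<open>r \<dots> s \<dots> r\<^sup>-\<^sup>1 \<dots> s\<^sup>-\<^sup>1\<close>. A crossing is impossible on a sphere by the Jordan curve theorem, and assigning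
  noncommuting gains to \<open>r\<close> and \<open>s\<close> gives nontrivial holonomy. Such gains come from a realization
  once the vertices of every face can be put in general position, for which the division ring has
  to be infinite; it is, by Wedderburn's theorem.\<close>

section \<open>Wedderburn's theorem\<close>

subsection \<open>Values of cyclotomic polynomials\<close>

text \<open>The surface is given only topologically, so every combinatorial fact has to be won from
  local topology: invariance of domain, and the fact that a point does not locally separate a
  surface. A disc is therefore a continuous map that is injective on the interior only;
  identifications are allowed along the boundary, where edges recur. Rotating a boundary word
  conjugates its holonomy and reversing the word inverts it, so over a noncommutative ring the value
  has no invariant meaning. What survives gluing is the statement that the holonomy is
  \<open>1\<close>, and nothing else is tracked. Conversely, the gain of each gluing edge is free to
  make the face glued along it trivial, while the gains on the final word stay arbitrary; this turns
  a crossing into a counterexample, with a commutator as holonomy. The alternative between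
  cancelling and crossing is purely combinatorial: a shortest pair \<open>r\<close>,
  \<open>rv r\<close> is either adjacent or crossed by another pair. Orientability enters only to
  exclude that an edge is run twice in the same direction, which would sweep out a Moebius
  band.\<close>

definition integral_poly :: "complex poly \<Rightarrow> bool" where
  "integral_poly p \<longleftrightarrow> (\<forall>i. coeff p i \<in> \<int>)"

lemma integral_poly_arith:
  assumes "integral_poly p" "integral_poly q"
  shows "integral_poly (p + q)" "integral_poly (p - q)" "integral_poly (p * q)"
  using assms by (auto simp: integral_poly_def coeff_mult intro!: Ints_sum Ints_mult)

lemma integral_poly_prod: "(\<And>i. i \<in> A \<Longrightarrow> integral_poly (f i)) \<Longrightarrow> integral_poly (prod f A)"
proof (induction A rule: infinite_finite_induct)
  case (insert x A)
  then show ?case using integral_poly_arith(3) by simp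
qed (auto simp: integral_poly_def coeff_1)

lemma integral_poly_value:
  assumes "integral_poly p"
  shows "poly p (of_int x) \<in> \<int>"
  unfolding poly_altdef using assms by (auto simp: integral_poly_def intro!: Ints_sum Ints_mult Ints_power)

text \<open>Division by a monic polynomial never leaves the integers: the leading coefficient of
  \<open>b\<close> is that of the product, hence integral, and subtracting the leading term of
  \<open>b\<close> lowers the degree.\<close>

lemma integral_poly_quotient:
  assumes "integral_poly g" "lead_coeff g = 1" "integral_poly (g * b)"
  shows "integral_poly b"
  using assms(3)
\<comment> \<open>The zero polynomial gets a smaller measure than nonzero constants, so that the
  step from a constant to zero decreases as well.\<close>
proof (induction "if b = 0 then 0 else Suc (degree b)" arbitrary: b rule: less_induct)
  case less
  show ?case
  proof (cases "b = 0")
    case False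
    define l where "l = lead_coeff b"
    define m where "m = monom l (degree b)"
    have g0: "g \<noteq> 0" using assms(2) by auto
    have "lead_coeff (g * b) = l" using assms(2) by (simp add: lead_coeff_mult l_def)
    then have l: "l \<in> \<int>" using less.prems by (metis integral_poly_def)
    then have m: "integral_poly m" by (auto simp: integral_poly_def m_def)
    have "integral_poly (g * (b - m))"
      using integral_poly_arith(2)[OF less.prems integral_poly_arith(3)[OF assms(1) m]] by (simp add: algebra_simps)
    moreover have "b - m = 0 \<or> degree (b - m) < degree b"
    proof (cases "degree b = 0")
      case True
      then show ?thesis by (auto simp: m_def l_def poly_eq_iff coeff_eq_0)
    next
      case d: False
      have "coeff (b - m) i = 0" if "i \<ge> degree b" for i
        using that by (cases "i = degree b") (auto simp: m_def l_def coeff_eq_0)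
      then have "degree (b - m) \<le> degree b - 1" by (intro degree_le) auto
      then have "degree (b - m) < degree b" using d by linarith
      then show ?thesis by blast
    qed
    ultimately have "integral_poly (b - m)"
      using less.hyps[of "b - m"] False by (cases "b - m = 0") auto
    from integral_poly_arith(1)[OF this m] show ?thesis by simp
  qed (simp add: integral_poly_def)
qed

definition unity_roots :: "nat \<Rightarrow> complex set" where
  "unity_roots n = {z. z ^ n = 1}"

text \<open>For positive \<open>n\<close> these are the elements of multiplicative order exactly
  \<open>n\<close>. Minimality of the exponent is the form needed to sort the roots of unity by
  order.\<close>

definition primitive_roots :: "nat \<Rightarrow> complex set" where
  "primitive_roots n = {z. z ^ n = 1 \<and> (\<forall>m. 0 < m \<and> m < n \<longrightarrow> z ^ m \<noteq> 1)}"

lemma finite_unity_roots: "0 < n \<Longrightarrow> finite (unity_roots n)"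
  using finite_roots_unity[of n] by (simp add: unity_roots_def)

lemma primitive_sub: "primitive_roots n \<subseteq> unity_roots n"
  by (auto simp: primitive_roots_def unity_roots_def)

lemma primitive_dvd:
  assumes "z \<in> primitive_roots d" "0 < d"
  shows "z ^ n = 1 \<longleftrightarrow> d dvd n"
proof
  assume "z ^ n = 1"
  have "z ^ n = (z ^ d) ^ (n div d) * z ^ (n mod d)" by (simp flip: power_mult power_add)
  then have "z ^ (n mod d) = 1" using assms \<open>z ^ n = 1\<close> by (simp add: primitive_roots_def)
  then have "n mod d = 0" using assms by (auto simp: primitive_roots_def)
  then show "d dvd n" by auto
next
  assume "d dvd n"
  then show "z ^ n = 1" using assms by (auto simp: primitive_roots_def power_mult)
qed

lemma primitive_disjoint:
  assumes "0 < d" "0 < e" "d \<noteq> e"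
  shows "primitive_roots d \<inter> primitive_roots e = {}"
proof (rule ccontr)
  assume "\<not> ?thesis"
  then obtain z where z: "z \<in> primitive_roots d" "z \<in> primitive_roots e" by blast
  then have "d dvd e" "e dvd d"
    using primitive_dvd[OF z(1) assms(1), of e] primitive_dvd[OF z(2) assms(2), of d] by (auto simp: primitive_roots_def)
  then show False using assms(3) dvd_antisym by blast
qed

lemma unity_roots_primitive:
  assumes "0 < n" "z \<in> unity_roots n"
  obtains d where "d dvd n" "0 < d" "z \<in> primitive_roots d"
proof -
  define P where "P d \<longleftrightarrow> 0 < d \<and> z ^ d = 1" for d
  have "P n" using assms by (simp add: P_def unity_roots_def)
  then obtain d where d: "P d" "\<And>m. m < d \<Longrightarrow> \<not> P m" by (metis exists_least_iff)
  then have "z \<in> primitive_roots d" "0 < d" by (auto simp: P_def primitive_roots_def)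
  moreover from this have "d dvd n" using primitive_dvd assms(2) by (simp add: unity_roots_def)
  ultimately show ?thesis using that by blast
qed

text \<open>On \<open>primitive_roots n\<close> with \<open>n > 0\<close> this is the cyclotomic
  polynomial of index \<open>n\<close>.\<close>

definition root_poly :: "complex set \<Rightarrow> complex poly" where
  "root_poly R = (\<Prod>z\<in>R. [:- z, 1:])"

lemma root_poly_monic: "lead_coeff (root_poly R) = 1"
  by (simp add: root_poly_def lead_coeff_prod)

lemma degree_root_poly: "degree (root_poly R) = card R"
  unfolding root_poly_def by (subst degree_prod_eq_sum_degree) auto

text \<open>Both sides are monic of degree \<open>n\<close>, so a nonzero difference would have
  degree below \<open>n\<close>, yet it vanishes at all \<open>n\<close> roots of unity.\<close>

lemma root_poly_unity:
  assumes n: "0 < n"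
  shows "root_poly (unity_roots n) = monom 1 n - 1"
proof (rule ccontr)
  let ?R = "unity_roots n" and ?p = "root_poly (unity_roots n) - (monom 1 n - 1)"
  assume "root_poly ?R \<noteq> monom 1 n - 1"
  then have nz: "?p \<noteq> 0" by simp
  have card: "card ?R = n" using n card_complex_roots_unity[of n] by (simp add: unity_roots_def)
  have lc: "coeff (root_poly ?R) n = 1" using root_poly_monic[of ?R] degree_root_poly[of ?R] card by simp
  have "coeff ?p i = 0" if "i \<ge> n" for i
  proof (cases "i = n")
    case True then show ?thesis using lc n by simp
  next
    case False
    then show ?thesis using that degree_root_poly[of ?R] card n by (simp add: coeff_eq_0)
  qed
  then have "degree ?p \<le> n - 1" by (intro degree_le) auto
  then have "degree ?p < n" using n by simp
  moreover have "?R \<subseteq> {z. poly ?p z = 0}"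
    using finite_unity_roots[OF n] by (auto simp: root_poly_def poly_prod unity_roots_def poly_monom)
  then have "card ?R \<le> card {z. poly ?p z = 0}" using poly_roots_finite[OF nz] by (rule card_mono[rotated])
  then have "n \<le> degree ?p" using card_poly_roots_bound[OF nz] card by simp
  ultimately show False by simp
qed

lemma integral_monom_minus_1: "integral_poly (monom 1 n - 1)"
  by (auto simp: integral_poly_def coeff_1)

lemma root_poly_union: "finite R \<Longrightarrow> finite S \<Longrightarrow> R \<inter> S = {} \<Longrightarrow> root_poly (R \<union> S) = root_poly R * root_poly S"
  unfolding root_poly_def by (rule prod.union_disjoint)

text \<open>Sorting the roots of \<open>X^n - 1\<close> by order writes it as the product of the
  cyclotomic polynomials of the divisors of \<open>n\<close>. Those of the proper divisors are monic
  and integral by induction, so the remaining factor is integral too.\<close>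

lemma integral_cyclotomic: "0 < n \<Longrightarrow> integral_poly (root_poly (primitive_roots n))"
proof (induction n rule: less_induct)
  case (less n)
  define D where "D = {d. d dvd n \<and> d < n}"
  have finD: "finite D" by (simp add: D_def)
  have pos: "0 < d" "d < n" if "d \<in> D" for d using that less.prems by (auto simp: D_def intro: Nat.gr0I)
  have fin: "finite (primitive_roots d)" if "0 < d" for d
    using finite_subset[OF primitive_sub finite_unity_roots[OF that]] .
  define S where "S = (\<Union>d\<in>D. primitive_roots d)"
  have "root_poly S = (\<Prod>d\<in>D. root_poly (primitive_roots d))"
    unfolding root_poly_def S_def
  proof (rule prod.UNION_disjoint[OF finD])
    show "\<forall>d\<in>D. finite (primitive_roots d)" using fin pos by blast
    show "\<forall>d\<in>D. \<forall>e\<in>D. d \<noteq> e \<longrightarrow> primitive_roots d \<inter> primitive_roots e = {}" using primitive_disjoint pos by blast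
  qed
  then have "integral_poly (root_poly S)" using less.IH pos by (auto intro!: integral_poly_prod)
  moreover have "unity_roots n = S \<union> primitive_roots n"
  proof
    show "unity_roots n \<subseteq> S \<union> primitive_roots n"
    proof
      fix z assume "z \<in> unity_roots n"
      then obtain d where d: "d dvd n" "0 < d" "z \<in> primitive_roots d" using unity_roots_primitive less.prems by blast
      then show "z \<in> S \<union> primitive_roots n"
        using dvd_imp_le[OF d(1) less.prems] by (cases "d = n") (auto simp: S_def D_def)
    qed
    show "S \<union> primitive_roots n \<subseteq> unity_roots n"
      using primitive_sub by (auto simp: S_def D_def unity_roots_def primitive_roots_def power_mult)
  qed
  moreover have "S \<inter> primitive_roots n = {}" using primitive_disjoint[OF pos(1) less.prems] pos(2) by (force simp: S_def)
  moreover have "finite S" using fin pos finD by (auto simp: S_def)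
  ultimately have "root_poly S * root_poly (primitive_roots n) = monom 1 n - 1"
    using root_poly_union[of S "primitive_roots n"] root_poly_unity[OF less.prems] fin[OF less.prems] by simp
  then show ?case
    using integral_poly_quotient[OF \<open>integral_poly (root_poly S)\<close> root_poly_monic] integral_monom_minus_1 by metis
qed

text \<open>The integer \<open>c\<close> is the value at \<open>q\<close> of the cyclotomic
  polynomial of index \<open>n\<close>. It is large because \<open>q\<close> is farther than
  \<open>q - 1\<close> from every point of the unit circle other than \<open>1\<close>. The
  divisibility holds already between polynomials.\<close>

lemma cyclotomic_value:
  fixes q n :: nat
  assumes q: "2 \<le> q" and n: "1 < n"
  obtains c :: int where "\<bar>c\<bar> > int q - 1"
    "\<And>d. d dvd n \<Longrightarrow> d < n \<Longrightarrow> c * (int q ^ d - 1) dvd int q ^ n - 1"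
proof -
  let ?P = "root_poly (primitive_roots n)"
  have fin: "finite (primitive_roots n)" using finite_subset[OF primitive_sub finite_unity_roots] n by simp
  obtain c where c: "poly ?P (of_nat q) = of_int c"
    using integral_poly_value[OF integral_cyclotomic[of n], of "int q"] n by (auto elim: Ints_cases)
  have norm1: "norm z = 1" if "z \<in> primitive_roots n" for z
  proof (rule power_eq_imp_eq_base)
    show "norm z ^ n = 1 ^ n" using that by (simp add: primitive_roots_def norm_power[symmetric])
  qed (use n in auto)
  have big: "norm (of_nat q - z) > real q - 1" if z: "z \<in> primitive_roots n" for z
  proof -
    have "z \<noteq> 1" using z n by (auto simp: primitive_roots_def)
    have "Re z \<le> 1" using complex_Re_le_cmod[of z] norm1[OF z] by simp
    moreover have "Re z \<noteq> 1"
    proof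
      assume "Re z = 1"
      then have "Im z = 0" using norm1[OF z] by (simp add: cmod_def)
      then show False using \<open>z \<noteq> 1\<close> \<open>Re z = 1\<close> by (simp add: complex_eq_iff)
    qed
    ultimately have "real q - 1 < Re (of_nat q - z)" by simp
    then show ?thesis using complex_Re_le_cmod[of "of_nat q - z"] by linarith
  qed
  \<comment> \<open>The product over the primitive roots must not be empty: the empty product
    \<open>1\<close> does not exceed \<open>q - 1\<close>.\<close>
  have "cis (2 * pi / n) \<in> primitive_roots n"
  proof -
    have "cis (2 * pi / n) ^ m \<noteq> 1" if "0 < m" "m < n" for m
    proof
      assume "cis (2 * pi / n) ^ m = 1"
      then have "cis (real m * (2 * pi / real n)) = 1" using Complex.DeMoivre[of "2 * pi / real n" m] by metis
      then have "cis (2 * pi * real m / real n) = cis (2 * pi * real 0 / real n)" by (simp add: mult.commute)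
      moreover have "inj_on (\<lambda>k. cis (2 * pi * real k / real n)) {..<n}"
        using Complex.bij_betw_roots_unity[of n] n by (auto simp: bij_betw_def)
      ultimately have "m = 0" using that by (auto simp: inj_on_def)
      then show False using that by simp
    qed
    moreover have "cis (2 * pi / n) ^ n = 1" using n Complex.DeMoivre[of "2 * pi / real n" n] by simp
    ultimately show ?thesis by (simp add: primitive_roots_def)
  qed
  then obtain z0 where z0: "z0 \<in> primitive_roots n" by blast
  have "real q - 1 < (\<Prod>z\<in>primitive_roots n. norm (of_nat q - z))"
  proof -
    have "(\<Prod>z\<in>primitive_roots n. norm (of_nat q - z)) = norm (of_nat q - z0) * (\<Prod>z\<in>primitive_roots n - {z0}. norm (of_nat q - z))"
      by (rule prod.remove[OF fin z0])
    moreover have "1 \<le> (\<Prod>z\<in>primitive_roots n - {z0}. norm (of_nat q - z))"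
    proof (rule prod_ge_1)
      fix z assume "z \<in> primitive_roots n - {z0}"
      then show "1 \<le> norm (of_nat q - z)" using big[of z] q by simp
    qed
    then have "norm (of_nat q - z0) * 1 \<le> norm (of_nat q - z0) * (\<Prod>z\<in>primitive_roots n - {z0}. norm (of_nat q - z))"
      by (intro mult_left_mono) auto
    ultimately show ?thesis using big[OF z0] by simp
  qed
  also have "\<dots> = norm (poly ?P (of_nat q))" by (simp add: root_poly_def poly_prod prod_norm)
  also have "\<dots> = \<bar>real_of_int c\<bar>" by (simp add: c)
  finally have "\<bar>c\<bar> > int q - 1" by linarith
  moreover have "c * (int q ^ d - 1) dvd int q ^ n - 1" if d: "d dvd n" "d < n" for d
  proof -
    have d0: "0 < d" using d by (auto intro: Nat.gr0I)
    \<comment> \<open>The roots of \<open>X^n - 1\<close> that are neither primitive nor roots of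
      \<open>X^d - 1\<close>; the two excluded sets are disjoint since \<open>d < n\<close>.\<close>
    define R where "R = unity_roots n - (primitive_roots n \<union> unity_roots d)"
    have finn: "finite (unity_roots n)" "finite (unity_roots d)" using finite_unity_roots n d0 by auto
    have dn: "unity_roots d \<subseteq> unity_roots n" using d(1) by (auto simp: unity_roots_def power_mult)
    have pd: "primitive_roots n \<inter> unity_roots d = {}" using d d0 by (auto simp: primitive_roots_def unity_roots_def)
    have "unity_roots n = (primitive_roots n \<union> unity_roots d) \<union> R" using dn primitive_sub by (auto simp: R_def)
    then have "root_poly (unity_roots n) = root_poly (primitive_roots n) * root_poly (unity_roots d) * root_poly R"
      using root_poly_union[of "primitive_roots n \<union> unity_roots d" R] root_poly_union[OF fin finn(2) pd] fin finn
      by (simp add: R_def Int_commute)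
    then have e: "monom 1 n - 1 = (?P * (monom 1 d - 1)) * root_poly R"
      using root_poly_unity n d0 by simp
    have "integral_poly (?P * (monom 1 d - 1))"
      using integral_cyclotomic[of n] n integral_monom_minus_1 integral_poly_arith(3) by simp
    moreover have "lead_coeff (?P * (monom 1 d - 1)) = 1"
      unfolding lead_coeff_mult using root_poly_monic[of "unity_roots d"] root_poly_unity[OF d0] by (simp add: root_poly_monic)
    ultimately have "integral_poly (root_poly R)"
      using integral_poly_quotient[of "?P * (monom 1 d - 1)" "root_poly R"] integral_monom_minus_1[of n] e by metis
    then obtain t where t: "poly (root_poly R) (of_nat q) = of_int t"
      using integral_poly_value[of "root_poly R" "int q"] by (auto elim: Ints_cases)
    have "complex_of_int (int q ^ n - 1) = poly (monom 1 n - 1) (of_nat q)" by (simp add: poly_monom)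
    also have "\<dots> = of_int c * (of_nat q ^ d - 1) * of_int t" unfolding e poly_mult c t by (simp add: poly_monom)
    also have "\<dots> = complex_of_int (c * (int q ^ d - 1) * t)" by simp
    finally have "int q ^ n - 1 = c * (int q ^ d - 1) * t" by (simp only: of_int_eq_iff)
    then show ?thesis by simp
  qed
  ultimately show ?thesis using that by blast
qed

subsection \<open>The class equation\<close>

definition sub_division_ring :: "'a::division_ring set \<Rightarrow> bool" where
  "sub_division_ring K \<longleftrightarrow> 1 \<in> K \<and> (\<forall>x\<in>K. \<forall>y\<in>K. x - y \<in> K \<and> x * y \<in> K) \<and> (\<forall>x\<in>K. inverse x \<in> K)"

text \<open>A dimension count without bases: among the submodules whose size is a power of
  \<open>card K\<close> take a largest one \<open>N\<close>. A vector \<open>x\<close> outside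
  \<open>N\<close> would give the direct sum of \<open>N\<close> and the line \<open>K x\<close>,
  which is larger by the factor \<open>card K\<close>.\<close>

lemma card_module_power:
  fixes K M :: "'a::division_ring set"
  assumes K: "sub_division_ring K" and fin: "finite (UNIV :: 'a set)"
    and M: "0 \<in> M" "\<And>x y. x \<in> M \<Longrightarrow> y \<in> M \<Longrightarrow> x + y \<in> M" "\<And>k x. k \<in> K \<Longrightarrow> x \<in> M \<Longrightarrow> k * x \<in> M"
  obtains n where "card M = card K ^ n"
proof -
  have K1: "1 \<in> K" and Kd: "\<And>x y. x \<in> K \<Longrightarrow> y \<in> K \<Longrightarrow> x - y \<in> K" "\<And>x y. x \<in> K \<Longrightarrow> y \<in> K \<Longrightarrow> x * y \<in> K"
    "\<And>x. x \<in> K \<Longrightarrow> inverse x \<in> K"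
    using K by (simp_all add: sub_division_ring_def)
  have "1 - 1 \<in> K" by (rule Kd(1)[OF K1 K1])
  then have K01: "1 \<in> K" "0 \<in> K" using K1 by simp_all
  have K_ops: "x - y \<in> K" "x * y \<in> K" "inverse x \<in> K" "- x \<in> K" "x + y \<in> K" if "x \<in> K" "y \<in> K" for x y
  proof -
    show "x - y \<in> K" by (rule Kd(1)[OF that])
    show "x * y \<in> K" by (rule Kd(2)[OF that])
    show "inverse x \<in> K" by (rule Kd(3)[OF that(1)])
    show "- x \<in> K" using Kd(1)[OF K01(2) that(1)] by simp
    show "x + y \<in> K" using Kd(1)[OF that(1) Kd(1)[OF K01(2) that(2)]] by simp
  qed
  have finA: "finite A" for A :: "'a set" by (rule finite_subset[OF subset_UNIV fin])
  have "card {0, 1 :: 'a} \<le> card K" using K01 finA by (intro card_mono) auto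
  then have cK: "2 \<le> card K" by simp
  define good where "good N \<longleftrightarrow> N \<subseteq> M \<and> 0 \<in> N \<and> (\<forall>x\<in>N. \<forall>y\<in>N. x + y \<in> N) \<and> (\<forall>k\<in>K. \<forall>x\<in>N. k * x \<in> N) \<and> (\<exists>j. card N = card K ^ j)" for N
  have "card {0::'a} = card K ^ 0" by simp
  then have "good {0}" unfolding good_def using M(1) by (intro conjI exI[of _ 0]) auto
  moreover have "card N < Suc (card (UNIV :: 'a set))" for N :: "'a set" using card_mono[OF fin subset_UNIV[of N]] by simp
  ultimately obtain N where N: "good N" "\<And>N'. good N' \<Longrightarrow> card N' \<le> card N"
    using ex_has_greatest_nat[of good "{0}" card "Suc (card (UNIV :: 'a set))"] by blast
  have NM: "N \<subseteq> M" and N0: "0 \<in> N" and N_add: "\<And>x y. x \<in> N \<Longrightarrow> y \<in> N \<Longrightarrow> x + y \<in> N"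
    and N_mult: "\<And>k x. k \<in> K \<Longrightarrow> x \<in> N \<Longrightarrow> k * x \<in> N" and N_card: "\<exists>j. card N = card K ^ j"
    using N(1) unfolding good_def by simp_all
  have "N = M"
  proof (rule ccontr)
    assume "N \<noteq> M"
    then obtain x where x: "x \<in> M" "x \<notin> N" using NM by blast
    define f where "f = (\<lambda>(n, k). n + k * x)"
    have N_neg: "- n \<in> N" if "n \<in> N" for n
    proof -
      have "(-1) * n \<in> N" by (rule N_mult[OF K_ops(4)[OF K01(1) K01(1)] that])
      then show ?thesis by simp
    qed
    have inj: "inj_on f (N \<times> K)"
    proof (rule inj_onI, clarify)
      fix n k n' k' assume nk: "n \<in> N" "k \<in> K" "n' \<in> N" "k' \<in> K" "f (n, k) = f (n', k')"
      have e: "(k - k') * x = n' + - n" using nk(5) by (simp add: f_def algebra_simps)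
      \<comment> \<open>If the scalars differed, dividing by their difference would put
        \<open>x\<close> into \<open>N\<close>.\<close>
      have "k = k'"
      proof (rule ccontr)
        assume ne: "k \<noteq> k'"
        have "n' + - n \<in> N" by (rule N_add[OF nk(3) N_neg[OF nk(1)]])
        then have "inverse (k - k') * ((k - k') * x) \<in> N"
          unfolding e by (rule N_mult[OF K_ops(3)[OF K_ops(1)[OF nk(2,4)] K01(1)]])
        then show False using ne x(2) by (simp flip: mult.assoc)
      qed
      then show "n = n' \<and> k = k'" using nk(5) by (simp add: f_def)
    qed
    let ?N = "f ` (N \<times> K)"
    have "card ?N = card N * card K" using card_image[OF inj] by (simp add: card_cartesian_product)
    moreover obtain j where j: "card N = card K ^ j" using N_card by blast
    ultimately have cN: "card ?N = card K ^ Suc j" by simp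
    have "good ?N" unfolding good_def
    proof (intro conjI ballI)
      show "?N \<subseteq> M" using NM M(2) M(3)[OF _ x(1)] by (auto simp: f_def)
      have "f (0, 0) \<in> ?N" using N0 K01 by (intro imageI) simp
      then show "0 \<in> ?N" by (simp add: f_def)
      show "\<exists>j. card ?N = card K ^ j" using cN by blast
    next
      fix y z assume "y \<in> ?N" "z \<in> ?N"
      then obtain n k n' k' where nk: "n \<in> N" "k \<in> K" "n' \<in> N" "k' \<in> K" "y = n + k * x" "z = n' + k' * x" by (auto simp: f_def)
      have "f (n + n', k + k') \<in> ?N" using N_add nk K_ops(5) by (intro imageI) simp
      moreover have "f (n + n', k + k') = y + z" using nk by (simp add: f_def algebra_simps)
      ultimately show "y + z \<in> ?N" by simp
    next
      fix l y assume l: "l \<in> K" and "y \<in> ?N"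
      then obtain n k where nk: "n \<in> N" "k \<in> K" "y = n + k * x" by (auto simp: f_def)
      have "f (l * n, l * k) \<in> ?N" using N_mult nk l K_ops(2) by (intro imageI) simp
      moreover have "f (l * n, l * k) = l * y" using nk by (simp add: f_def algebra_simps)
      ultimately show "l * y \<in> ?N" by simp
    qed
    then have "card K ^ Suc j \<le> card K ^ j" using N(2) cN j by metis
    then show False using cK by (simp add: power_le_imp_le_exp)
  qed
  then show ?thesis using N_card that by blast
qed

definition centralizer :: "'a::division_ring \<Rightarrow> 'a set" where
  "centralizer x = {y. y * x = x * y}"

definition center :: "'a::division_ring set" where
  "center = {y. \<forall>x. y * x = x * y}"

lemma commute_inverse: "y * x = x * y \<Longrightarrow> inverse y * x = x * inverse (y :: 'a::division_ring)"
proof (cases "y = 0")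
  case False
  assume yx: "y * x = x * y"
  have "inverse y * x = inverse y * (x * y) * inverse y" using False by (simp add: mult.assoc)
  also have "\<dots> = inverse y * (y * x) * inverse y" by (simp only: yx)
  also have "\<dots> = x * inverse y" using False by (simp flip: mult.assoc)
  finally show ?thesis .
qed simp

lemma inverse_mem_centralizer: "y \<in> centralizer x \<Longrightarrow> inverse y \<in> centralizer x"
  using commute_inverse by (simp add: centralizer_def)

lemma centralizer_closed:
  assumes "y \<in> centralizer x" "z \<in> centralizer x"
  shows "y - z \<in> centralizer x" "y + z \<in> centralizer x" "y * z \<in> centralizer x"
proof -
  have yz: "y * x = x * y" "z * x = x * z" using assms by (simp_all add: centralizer_def)
  show "y - z \<in> centralizer x" "y + z \<in> centralizer x"
    by (simp_all only: centralizer_def mem_Collect_eq left_diff_distrib right_diff_distrib distrib_left distrib_right yz)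
  have "y * z * x = y * (x * z)" by (simp only: mult.assoc yz)
  also have "\<dots> = x * y * z" by (simp only: mult.assoc[symmetric] yz)
  finally show "y * z \<in> centralizer x" by (simp only: centralizer_def mem_Collect_eq mult.assoc)
qed

lemma center_eq: "center = (\<Inter>x. centralizer x)"
  by (auto simp: center_def centralizer_def)

lemma sub_division_ring_centralizer: "sub_division_ring (centralizer x)"
  unfolding sub_division_ring_def
proof (intro conjI ballI)
  show "1 \<in> centralizer x" by (simp add: centralizer_def)
qed (fact inverse_mem_centralizer centralizer_closed)+

lemma sub_division_ring_center: "sub_division_ring (center :: 'a::division_ring set)"
  unfolding sub_division_ring_def
proof (intro conjI ballI)
  show "1 \<in> (center :: 'a set)" by (simp add: center_def)
  fix x :: 'a assume x: "x \<in> center"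
  then show "inverse x \<in> center" unfolding center_eq by (blast intro: inverse_mem_centralizer)
  fix y :: 'a assume "y \<in> center"
  then show "x - y \<in> center" "x * y \<in> center" using x unfolding center_eq by (blast intro: centralizer_closed)+
qed

text \<open>Witt's argument. With \<open>q\<close> the size of the center and \<open>q ^ n\<close>
  that of the ring, the cyclotomic value \<open>c\<close> divides the size of every noncentral
  conjugacy class, hence their sum \<open>q ^ n - q\<close>, and it divides
  \<open>q ^ n - 1\<close>. So it divides \<open>q - 1\<close>, but it is too large for
  that.\<close>

theorem finite_division_ring_commutative:
  assumes fin: "finite (UNIV :: 'a::division_ring set)"
  shows "a * b = b * (a :: 'a)"
proof -
  have finA: "finite A" for A :: "'a set" by (rule finite_subset[OF subset_UNIV fin])
  define q where "q = card (center :: 'a set)"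
  have "{0, 1} \<subseteq> (center :: 'a set)" by (auto simp: center_def)
  then have "card {0, 1 :: 'a} \<le> q" unfolding q_def using finA by (intro card_mono) auto
  then have q: "2 \<le> q" by simp
  obtain n where n: "card (UNIV :: 'a set) = q ^ n"
    unfolding q_def by (rule card_module_power[OF sub_division_ring_center fin, of UNIV]) auto
  show ?thesis
  proof (cases "n \<le> 1")
    case True
    have "card (UNIV :: 'a set) \<le> q ^ 1" unfolding n using True q by (intro power_increasing) auto
    then have "(center :: 'a set) = UNIV" using card_seteq[OF fin subset_UNIV, of center] by (simp add: q_def)
    then show ?thesis by (auto simp: center_def)
  next
    case False
    have cent: "\<exists>d. card (centralizer x) = q ^ d \<and> d dvd n \<and> (x \<notin> center \<longrightarrow> d < n)" for x :: 'a
    proof -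
      obtain d where d: "card (centralizer x) = q ^ d" unfolding q_def
      proof (rule card_module_power[OF sub_division_ring_center fin, of "centralizer x"])
        show "0 \<in> centralizer x" by (simp add: centralizer_def)
        show "y + z \<in> centralizer x" if "y \<in> centralizer x" "z \<in> centralizer x" for y z
          using that by (rule centralizer_closed)
        show "k * y \<in> centralizer x" if "k \<in> center" "y \<in> centralizer x" for k y
          using that centralizer_closed(3)[of k x y] unfolding center_eq by blast
      qed
      obtain k where k: "card (UNIV :: 'a set) = card (centralizer x) ^ k"
        by (rule card_module_power[OF sub_division_ring_centralizer fin, of UNIV x]) auto
      have "q ^ n = q ^ (d * k)" using k d n by (simp add: power_mult)
      then have nk: "n = d * k" using q by (simp add: power_inject_exp)
      moreover have "d < n" if x: "x \<notin> center"
      proof -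
        obtain y where "x * y \<noteq> y * x" using x unfolding center_def by blast
        then have "y \<notin> centralizer x" by (metis (mono_tags, lifting) centralizer_def mem_Collect_eq)
        then have "centralizer x \<noteq> UNIV" by blast
        then have "card (centralizer x) < card (UNIV :: 'a set)" using fin by (intro psubset_card_mono) auto
        then show ?thesis using d n q by (simp add: power_strict_increasing_iff)
      qed
      ultimately show ?thesis using d by auto
    qed
    obtain c :: int where c: "\<bar>c\<bar> > int q - 1" "\<And>d. d dvd n \<Longrightarrow> d < n \<Longrightarrow> c * (int q ^ d - 1) dvd int q ^ n - 1"
      using cyclotomic_value[OF q, of n] False by auto
    define orb where "orb x = (\<lambda>g. g * x * inverse g) ` (UNIV - {0})" for x :: 'a
    \<comment> \<open>Orbit and stabilizer: the fibres of conjugation are the left cosets of the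
      multiplicative group of the centralizer.\<close>
    have orb_size: "card (orb x) * (card (centralizer x) - 1) = q ^ n - 1" for x
    proof -
      let ?f = "\<lambda>g. g * x * inverse g" and ?G = "UNIV - {0 :: 'a}"
      have fib: "card {g \<in> ?G. ?f g = y} = card (centralizer x) - 1" if "y \<in> orb x" for y
      proof -
        obtain h where h: "h \<noteq> 0" "y = h * x * inverse h" using \<open>y \<in> orb x\<close> by (auto simp: orb_def)
        have "{g \<in> ?G. ?f g = y} = (*) h ` (centralizer x - {0})"
        proof
          show "{g \<in> ?G. ?f g = y} \<subseteq> (*) h ` (centralizer x - {0})"
          proof
            fix g assume "g \<in> {g \<in> ?G. ?f g = y}"
            then have g: "g \<noteq> 0" "g * x * inverse g = h * x * inverse h" using h by auto
            have "inverse h * g * x = inverse h * (g * x * inverse g) * g" using g(1) by (simp add: mult.assoc)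
            also have "\<dots> = x * (inverse h * g)" unfolding g(2) using h(1) by (simp add: mult.assoc[symmetric])
            finally have "inverse h * g \<in> centralizer x - {0}" using g(1) h(1) by (simp add: centralizer_def)
            moreover have "g = h * (inverse h * g)" using h(1) by (simp flip: mult.assoc)
            ultimately show "g \<in> (*) h ` (centralizer x - {0})" by blast
          qed
          show "(*) h ` (centralizer x - {0}) \<subseteq> {g \<in> ?G. ?f g = y}"
          proof
            fix g assume "g \<in> (*) h ` (centralizer x - {0})"
            then obtain z where z: "z * x = x * z" "z \<noteq> 0" "g = h * z" by (auto simp: centralizer_def)
            have "g * x * inverse g = h * (z * x * inverse z) * inverse h"
              by (simp only: z(3) nonzero_inverse_mult_distrib[OF h(1) z(2)] mult.assoc)
            also have "z * x * inverse z = x"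
              by (simp only: z(1) mult.assoc right_inverse[OF z(2)] mult_1_right)
            finally have "g * x * inverse g = y" by (simp only: h(2))
            then show "g \<in> {g \<in> ?G. ?f g = y}" using h(1) z(2,3) by (simp only: mem_Collect_eq Diff_iff UNIV_I mult_eq_0_iff insert_iff empty_iff simp_thms)
          qed
        qed
        moreover have "inj_on ((*) h) (centralizer x - {0})" using h(1) by (auto simp: inj_on_def)
        ultimately have "card {g \<in> ?G. ?f g = y} = card (centralizer x - {0})" by (simp add: card_image)
        also have "\<dots> = card (centralizer x) - 1" by (rule card_Diff_singleton) (simp add: centralizer_def)
        finally show ?thesis .
      qed
      have "card ?G = (\<Sum>y\<in>orb x. card {g \<in> ?G. ?f g = y})"
        unfolding orb_def card_eq_sum by (rule sum.image_gen[OF finA])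
      also have "\<dots> = card (orb x) * (card (centralizer x) - 1)" using fib by simp
      finally show ?thesis using n fin by (simp add: card_Diff_singleton)
    qed
    \<comment> \<open>The class size times \<open>q ^ d - 1\<close> equals \<open>q ^ n - 1\<close>,
      which is divisible by \<open>c\<close> times \<open>q ^ d - 1\<close>; cancel the common
      factor.\<close>
    have orb_dvd: "nat \<bar>c\<bar> dvd card (orb x)" if x: "x \<notin> center" for x
    proof -
      obtain d where d: "card (centralizer x) = q ^ d" "d dvd n" "d < n" using cent[of x] x by blast
      have d0: "0 < d" using d False by (auto intro: Nat.gr0I)
      have p1: "1 \<le> q ^ d" "1 \<le> q ^ n" using q by simp_all
      have "int (card (orb x)) * (int q ^ d - 1) = int q ^ n - 1"
        using arg_cong[OF orb_size[of x], of int] d(1) p1 by (simp add: of_nat_diff)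
      moreover have "int q ^ d - 1 \<noteq> 0"
      proof -
        have "(1::int) < int q ^ d" using q d0 by (intro one_less_power) auto
        then show ?thesis by simp
      qed
      ultimately have "c dvd int (card (orb x))" using c(2)[OF d(2,3)] by (metis dvd_times_right_cancel_iff)
      then show ?thesis by (simp add: nat_abs_dvd_iff)
    qed
    define S where "S = UNIV - (center :: 'a set)"
    have "\<Union>(orb ` S) = S"
    proof
      have "x \<in> orb x" for x by (auto simp: orb_def intro!: image_eqI[of _ _ 1])
      then show "S \<subseteq> \<Union>(orb ` S)" by blast
      have "x \<in> center" if "g \<noteq> 0" "g * x * inverse g \<in> center" for g x :: 'a
      proof -
        have "(g * x * inverse g) * g = g * (g * x * inverse g)" using that(2) by (simp add: center_def)
        then have "g * x = g * (g * x * inverse g)" using that(1) by (simp add: mult.assoc)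
        then have "x = g * x * inverse g" using that(1) by simp
        then show ?thesis using that(2) by simp
      qed
      then show "\<Union>(orb ` S) \<subseteq> S" by (auto simp: S_def orb_def)
    qed
    moreover have "nat \<bar>c\<bar> dvd card (\<Union>(orb ` S))"
    proof (rule dvd_partition)
      show "finite (\<Union>(orb ` S))" using finA .
      show "\<forall>c0\<in>orb ` S. nat \<bar>c\<bar> dvd card c0" using orb_dvd by (auto simp: S_def)
      have sub: "orb x \<subseteq> orb y" if z: "z \<in> orb x" "z \<in> orb y" for x y z
      proof
        fix u assume "u \<in> orb x"
        then obtain g where g: "g \<noteq> 0" "u = g * x * inverse g" by (auto simp: orb_def)
        obtain h where h: "h \<noteq> 0" "z = h * x * inverse h" using z by (auto simp: orb_def)
        obtain k where k: "k \<noteq> 0" "z = k * y * inverse k" using z by (auto simp: orb_def)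
        have "x = inverse h * z * h" using h by (simp add: mult.assoc) (simp flip: mult.assoc)
        also have "\<dots> = inverse h * k * y * inverse k * h" unfolding k(2) by (simp add: mult.assoc)
        finally have "u = (g * inverse h * k) * y * inverse (g * inverse h * k)"
          using g h k by (simp add: nonzero_inverse_mult_distrib mult.assoc)
        then show "u \<in> orb y" using g(1) h(1) k(1) unfolding orb_def by (intro image_eqI[of _ _ "g * inverse h * k"]) auto
      qed
      show "\<forall>c1\<in>orb ` S. \<forall>c2\<in>orb ` S. c1 \<noteq> c2 \<longrightarrow> c1 \<inter> c2 = {}" using sub by blast
    qed
    ultimately have cS: "nat \<bar>c\<bar> dvd card S" by simp
    have "card S = q ^ n - q" unfolding S_def q_def[symmetric] n[symmetric] using finA by (subst card_Diff_subset) (auto simp: q_def)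
    moreover have "q \<le> q ^ n" using q False by (intro self_le_power) auto
    ultimately have "c dvd int q ^ n - int q" using cS by (metis nat_abs_dvd_iff of_nat_diff of_nat_power)
    moreover have "c dvd int q ^ n - 1"
      using c(2)[of 1] False dvd_mult_left by fastforce
    ultimately have "c dvd (int q ^ n - 1) - (int q ^ n - int q)" by (rule dvd_diff[rotated])
    then have "c dvd int q - 1" by simp
    moreover have "int q - 1 \<noteq> 0" using q by simp
    ultimately have "\<bar>c\<bar> \<le> \<bar>int q - 1\<bar>" by (rule dvd_imp_le_int[rotated])
    then show ?thesis using c(1) q by simp
  qed
qed

section \<open>Boundary parametrizations of convex discs\<close>

text \<open>The sides of the \<open>N\<close>-gon whose underlying disc is the unit disc, each run
  over the unit interval so that labels do not depend on \<open>N\<close>.\<close>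

definition arcpt :: "nat \<Rightarrow> nat \<Rightarrow> real \<Rightarrow> complex" where
  "arcpt N j t = cis (2 * pi * (real j + t) / real N)"

lemma norm_arcpt [simp]: "norm (arcpt N j t) = 1"
  by (simp add: arcpt_def)

lemma continuous_on_arcpt: "continuous_on S (arcpt N j)"
  unfolding arcpt_def cis_conv_exp divide_inverse by (intro continuous_intros)

lemma cis_inj_Ico:
  assumes "cis x = cis y" "0 \<le> x" "x < 2*pi" "0 \<le> y" "y < 2*pi"
  shows "x = y"
proof -
  have "Arg2pi (cis x) = x" "Arg2pi (cis y) = y"
    using assms by (auto intro!: Arg2pi_unique[of 1] simp: cis_conv_exp)
  then show ?thesis using assms(1) by metis
qed

lemma arcpt_join:
  assumes "j < N"
  shows "arcpt N j 1 = arcpt N (Suc j mod N) 0"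
proof (cases "Suc j = N")
  case True
  then have "2 * pi * (real j + 1) / real N = 2*pi" using assms by (auto simp: field_simps split: if_splits)
  then show ?thesis using True by (simp add: arcpt_def)
next
  case False
  then show ?thesis using assms by (simp add: arcpt_def add.commute)
qed

lemma arcpt_inj:
  assumes "arcpt N i s = arcpt N j t" "i < N" "j < N" "0 \<le> s" "s < 1" "0 \<le> t" "t < 1"
  shows "i = j \<and> s = t"
proof -
  have less: "2 * pi * (real i + s) / real N < 2*pi" if "i < N" "s < 1" for i s
  proof -
    have "real i + s < real N" using that by linarith
    then have "(real i + s) / real N < 1" using that by (simp add: field_simps)
    then have "(2*pi) * ((real i + s) / real N) < 2*pi * 1"
      by (intro mult_strict_left_mono) auto
    then show ?thesis by simp
  qed
  have "2 * pi * (real i + s) / real N = 2 * pi * (real j + t) / real N"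
    by (rule cis_inj_Ico) (use assms less in \<open>auto simp: arcpt_def\<close>)
  then have "(2 * pi / real N) * (real i + s) = (2 * pi / real N) * (real j + t)" by simp
  then have "real i + s = real j + t" using assms(2) by (subst (asm) mult_cancel_left) auto
  moreover have "\<lfloor>real i + s\<rfloor> = int i" "\<lfloor>real j + t\<rfloor> = int j" using assms by linarith+
  ultimately show ?thesis by auto
qed

lemma arcpt_surj:
  assumes "norm z = 1" "0 < N"
  obtains j t where "j < N" "0 \<le> t" "t < 1" "z = arcpt N j t"
proof -
  define x where "x = real N * Arg2pi z / (2*pi)"
  have x0: "0 \<le> x" unfolding x_def using Arg2pi_ge_0 by simp
  have xN: "x < real N" unfolding x_def using Arg2pi_lt_2pi[of z] assms(2) by (simp add: field_simps)
  have z: "z = cis (Arg2pi z)" using Arg2pi_eq[of z] assms(1) by (simp add: cis_conv_exp)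
  have a: "Arg2pi z = 2*pi*x/real N" unfolding x_def using assms(2) by (simp add: field_simps)
  show ?thesis
  proof
    show "nat \<lfloor>x\<rfloor> < N" using x0 xN by linarith
    show "0 \<le> frac x" "frac x < 1" by (auto simp: frac_lt_1)
    have "real (nat \<lfloor>x\<rfloor>) + frac x = x" using x0 by (simp add: frac_def)
    then show "z = arcpt N (nat \<lfloor>x\<rfloor>) (frac x)" unfolding arcpt_def using z a by simp
  qed
qed

text \<open>A corner has two names, as the end of one side and as the start of the next. Passing to
  parameters below \<open>1\<close> makes names unique, and every family \<open>q\<close> that joins
  up at the corners respects the renaming.\<close>

lemma arcpt_normalize:
  assumes "i < N" "0 \<le> s" "s \<le> 1"
  obtains i' s' where "i' < N" "0 \<le> s'" "s' < 1" "arcpt N i s = arcpt N i' s'"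
    "\<And>q :: nat \<Rightarrow> real \<Rightarrow> 'b. (\<And>j. j < N \<Longrightarrow> q j 1 = q (Suc j mod N) 0) \<Longrightarrow> q i s = q i' s'"
proof (cases "s = 1")
  case True
  show ?thesis
    by (rule that[of "Suc i mod N" 0]) (use assms True arcpt_join in auto)
next
  case False
  then show ?thesis using assms by (intro that[of i s]) auto
qed

lemma arcpt_compatible:
  fixes q :: "nat \<Rightarrow> real \<Rightarrow> 'b"
  assumes "\<And>j. j < N \<Longrightarrow> q j 1 = q (Suc j mod N) 0"
    and "arcpt N i s = arcpt N j t" "i < N" "j < N" "0 \<le> s" "s \<le> 1" "0 \<le> t" "t \<le> 1"
  shows "q i s = q j t"
proof -
  obtain i' s' where 1: "i' < N" "0 \<le> s'" "s' < 1" "arcpt N i s = arcpt N i' s'" "q i s = q i' s'"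
    using arcpt_normalize[of i N s thesis] assms by metis
  obtain j' t' where 2: "j' < N" "0 \<le> t'" "t' < 1" "arcpt N j t = arcpt N j' t'" "q j t = q j' t'"
    using arcpt_normalize[of j N t thesis] assms by metis
  have "i' = j' \<and> s' = t'" using 1 2 assms(2) by (intro arcpt_inj) auto
  then show ?thesis using 1 2 by simp
qed

text \<open>A continuous map from a compact to a Hausdorff space is closed, hence a quotient map
  onto its image.\<close>

lemma continuous_on_compact_quotient:
  fixes f :: "'a::topological_space \<Rightarrow> 'b::t2_space" and g :: "'b \<Rightarrow> 'c::topological_space"
  assumes S: "compact S" and f: "continuous_on S f" and gf: "continuous_on S (g \<circ> f)"
  shows "continuous_on (f ` S) g"
proof -
  have "closed (f ` S)" using S f by (simp add: compact_continuous_image compact_imp_closed)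
  then show ?thesis unfolding continuous_on_closed_vimage[OF \<open>closed (f ` S)\<close>]
  proof (intro allI impI)
    fix B :: "'c set" assume "closed B"
    obtain A where A: "closed A" "A \<inter> S = (g \<circ> f) -` B \<inter> S"
      using gf \<open>closed B\<close> unfolding continuous_on_closed_invariant by blast
    have "g -` B \<inter> f ` S = f ` (A \<inter> S)" unfolding A(2) by auto
    moreover have "compact (A \<inter> S)" using S A(1) by (metis Int_commute compact_Int_closed)
    then have "compact (f ` (A \<inter> S))"
      using f by (meson compact_continuous_image continuous_on_subset inf_le2)
    ultimately show "closed (g -` B \<inter> f ` S)" by (simp add: compact_imp_closed)
  qed
qed

text \<open>The description by \<open>THE\<close> is well defined because the joining condition
  makes both names of a corner give the same value; continuity follows by pasting finitely many
  closed arcs.\<close>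

lemma circle_map_of_arcs:
  fixes q :: "nat \<Rightarrow> real \<Rightarrow> 'b::topological_space"
  assumes N: "0 < N"
    and cont: "\<And>j. j < N \<Longrightarrow> continuous_on {0..1} (q j)"
    and join: "\<And>j. j < N \<Longrightarrow> q j 1 = q (Suc j mod N) 0"
  obtains \<gamma> where "continuous_on (sphere 0 1) \<gamma>"
    "\<And>j t. j < N \<Longrightarrow> 0 \<le> t \<Longrightarrow> t \<le> 1 \<Longrightarrow> \<gamma> (arcpt N j t) = q j t"
proof -
  define \<gamma> where "\<gamma> z = (THE y. \<exists>j t. j < N \<and> 0 \<le> t \<and> t \<le> 1 \<and> z = arcpt N j t \<and> y = q j t)" for z
  have \<gamma>: "\<gamma> (arcpt N j t) = q j t" if "j < N" "0 \<le> t" "t \<le> 1" for j t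
    unfolding \<gamma>_def
  proof (rule the_equality)
    show "\<exists>j' t'. j' < N \<and> 0 \<le> t' \<and> t' \<le> 1 \<and> arcpt N j t = arcpt N j' t' \<and> q j t = q j' t'"
      using that by blast
    fix y assume "\<exists>j' t'. j' < N \<and> 0 \<le> t' \<and> t' \<le> 1 \<and> arcpt N j t = arcpt N j' t' \<and> y = q j' t'"
    then show "y = q j t" using arcpt_compatible[of N q, OF join] that by metis
  qed
  have "sphere 0 1 = (\<Union>j<N. arcpt N j ` {0..1})"
  proof
    show "sphere 0 1 \<subseteq> (\<Union>j<N. arcpt N j ` {0..1})"
    proof
      fix z :: complex assume "z \<in> sphere 0 1"
      then obtain j t where "j < N" "0 \<le> t" "t < 1" "z = arcpt N j t" using arcpt_surj[OF _ N, of z] by auto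
      then show "z \<in> (\<Union>j<N. arcpt N j ` {0..1})" by (intro UN_I[of j]) auto
    qed
  qed auto
  moreover have "continuous_on (\<Union>j<N. arcpt N j ` {0..1}) \<gamma>"
  proof (intro continuous_on_closed_Union)
    fix j assume j: "j \<in> {..<N}"
    show "closed (arcpt N j ` {0..1})"
      by (intro compact_imp_closed compact_continuous_image continuous_on_arcpt) auto
    have "continuous_on {0..1} (\<gamma> \<circ> arcpt N j)"
      using cont[of j] j \<gamma> by (subst continuous_on_cong[OF refl, of _ _ "q j"]) auto
    then show "continuous_on (arcpt N j ` {0..1}) \<gamma>"
      by (intro continuous_on_compact_quotient continuous_on_arcpt) auto
  qed auto
  ultimately show ?thesis using that \<gamma> by metis
qed

text \<open>The cone over the boundary curve with apex \<open>a\<close>. Convexity makes every ray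
  from \<open>a\<close> meet the frontier exactly once, which gives both injectivity and
  surjectivity.\<close>

lemma radial_extension:
  fixes K :: "complex set" and \<gamma> :: "complex \<Rightarrow> complex"
  assumes K: "convex K" "compact K" and a: "a \<in> interior K"
    and \<gamma>: "continuous_on (sphere 0 1) \<gamma>" "inj_on \<gamma> (sphere 0 1)" "\<gamma> ` sphere 0 1 = frontier K"
  obtains \<theta> where "continuous_on (cball 0 1) \<theta>" "inj_on \<theta> (cball 0 1)" "\<theta> ` cball 0 1 = K"
    "\<theta> ` ball 0 1 = interior K" "\<And>z. norm z = 1 \<Longrightarrow> \<theta> z = \<gamma> z"
proof -
  define \<theta> where "\<theta> z = a + norm z *\<^sub>R (\<gamma> (z /\<^sub>R norm z) - a)" for z
  have closK: "closed K" using K by (simp add: compact_imp_closed)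
  have frK: "frontier K \<subseteq> K" using closK by (simp add: frontier_subset_eq)
  have \<gamma>fr: "\<gamma> u \<in> frontier K" if "norm u = 1" for u
    using that \<gamma>(3) by auto
  have scale: "\<theta> z = \<gamma> z" if "norm z = 1" for z using that by (simp add: \<theta>_def)
  have unit: "norm (z /\<^sub>R norm z) = 1" if "z \<noteq> 0" for z :: complex using that by simp
  have inner: "a + r *\<^sub>R (y - a) \<in> interior K" if "y \<in> K" "0 \<le> r" "r < 1" for y r
  proof (cases "r = 0 \<or> y = a")
    case True then show ?thesis using a by auto
  next
    case False
    have "y - (1-r) *\<^sub>R (y - a) \<in> interior K"
      by (rule mem_interior_closure_convex_shrink) (use K a that False closure_subset in auto)
    then show ?thesis by (simp add: algebra_simps)
  qed
  have contne: "continuous_on (cball 0 1 - {0}) \<theta>"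
    unfolding \<theta>_def
    by (intro continuous_intros continuous_on_compose2[OF \<gamma>(1)]) (auto simp: field_simps split: if_splits)
  obtain B where B: "\<And>y. y \<in> K \<Longrightarrow> norm (y - a) \<le> B" "B > 0"
  proof -
    have "bounded ((\<lambda>y. y - a) ` K)" using K(2) by (simp add: bounded_translation_minus compact_imp_bounded)
    then show ?thesis using that unfolding bounded_pos by auto
  qed
  \<comment> \<open>The direction \<open>z /\<^sub>R norm z\<close> has no limit at the centre, but
    the distance from \<open>a\<close> is at most \<open>norm z\<close> times a bound for
    \<open>K\<close>.\<close>
  have "isCont \<theta> 0"
  proof -
    have "((\<lambda>z. \<theta> z - a) \<longlongrightarrow> 0) (at 0)"
    proof (rule Lim_null_comparison)
      show "\<forall>\<^sub>F z in at 0. norm (\<theta> z - a) \<le> norm z * B"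
        unfolding eventually_at_filter
      proof (intro always_eventually allI impI)
        fix z :: complex assume "z \<noteq> 0"
        then have "norm (\<gamma> (z /\<^sub>R norm z) - a) \<le> B" using B(1) \<gamma>fr[OF unit] frK by blast
        then show "norm (\<theta> z - a) \<le> norm z * B" by (simp add: \<theta>_def mult_left_mono)
      qed
      show "((\<lambda>z::complex. norm z * B) \<longlongrightarrow> 0) (at 0)"
        by (auto intro!: tendsto_eq_intros)
    qed
    then have "(\<theta> \<longlongrightarrow> a) (at 0)" using LIM_zero_cancel by blast
    then show ?thesis by (simp add: isCont_def \<theta>_def)
  qed
  then have "continuous_on (cball 0 1) \<theta>"
    unfolding continuous_on_eq_continuous_within
  proof (intro ballI)
    fix z :: complex assume z: "z \<in> cball 0 1"
    show "continuous (at z within cball 0 1) \<theta>"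
    proof (cases "z = 0")
      case True
      then show ?thesis using \<open>isCont \<theta> 0\<close> continuous_at_imp_continuous_at_within by blast
    next
      case False
      have "continuous (at z within (cball 0 1 - {0})) \<theta>"
        using contne z False by (simp add: continuous_on_eq_continuous_within)
      moreover have "at z within (cball 0 1 - {0}) = at z within cball 0 1"
      proof (rule at_within_nhd)
        show "z \<in> -{0}" "open (-{0::complex})" using False by auto
      qed auto
      ultimately show ?thesis by simp
    qed
  qed
  \<comment> \<open>A frontier point that lay strictly between \<open>a\<close> and another frontier
    point would be an interior point.\<close>
  moreover have ray: "r = s"
    if "y \<in> frontier K" "y' \<in> frontier K" "r *\<^sub>R (y - a) = s *\<^sub>R (y' - a)" "0 < r" "0 < s" for y y' r s
  proof -
    have *: False if "y \<in> frontier K" "y' \<in> frontier K" "r *\<^sub>R (y - a) = s *\<^sub>R (y' - a)" "0 < r" "r < s" for y y' r s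
    proof -
      have "y' - a = (1/s) *\<^sub>R (s *\<^sub>R (y' - a))" using that by simp
      also have "\<dots> = (r/s) *\<^sub>R (y - a)" using that(3)[symmetric] by simp
      finally have "y' = a + (r/s) *\<^sub>R (y - a)" by (simp add: algebra_simps)
      moreover have "a + (r/s) *\<^sub>R (y - a) \<in> interior K"
        by (rule inner) (use that frK in auto)
      ultimately show False using that(2) by (simp add: frontier_def)
    qed
    show ?thesis
      using *[of y y' r s] *[of y' y s r] that by (metis linorder_neqE_linordered_idom)
  qed
  have neqa: "\<gamma> u \<noteq> a" if "norm u = 1" for u
    using \<gamma>fr[OF that] a by (auto simp: frontier_def)
  moreover have "inj_on \<theta> (cball 0 1)"
  proof (rule inj_onI)
    fix z w :: complex assume z: "z \<in> cball 0 1" and w: "w \<in> cball 0 1" and e: "\<theta> z = \<theta> w"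
    show "z = w"
    proof (cases "z = 0 \<or> w = 0")
      case True
      then show ?thesis using e neqa unit[of z] unit[of w]
        by (cases "z = 0"; cases "w = 0") (auto simp: \<theta>_def simp del: norm_scaleR)
    next
      case False
      have e': "norm z *\<^sub>R (\<gamma> (z /\<^sub>R norm z) - a) = norm w *\<^sub>R (\<gamma> (w /\<^sub>R norm w) - a)"
        using e by (simp add: \<theta>_def)
      have n: "norm z = norm w"
        by (rule ray[OF _ _ e']) (use False \<gamma>fr unit in auto)
      then have "\<gamma> (z /\<^sub>R norm z) = \<gamma> (w /\<^sub>R norm w)" using e' False by simp
      then have "z /\<^sub>R norm z = w /\<^sub>R norm w"
        using \<gamma>(2) False unit by (auto simp: inj_on_def)
      then show ?thesis using n False by simp
    qed
  qed
  moreover have ballint: "\<theta> z \<in> interior K" if "norm z < 1" for z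
  proof (cases "z = 0")
    case True then show ?thesis using a by (simp add: \<theta>_def)
  next
    case False
    then show ?thesis unfolding \<theta>_def using that unit \<gamma>fr frK by (intro inner) auto
  qed
  have sub: "\<theta> ` cball 0 1 \<subseteq> K"
  proof
    fix y assume "y \<in> \<theta> ` cball 0 1"
    then obtain z where z: "norm z \<le> 1" "y = \<theta> z" by auto
    show "y \<in> K"
    proof (cases "norm z = 1")
      case True
      then show ?thesis using z scale \<gamma>fr frK by auto
    next
      case False
      then show ?thesis using z ballint[of z] interior_subset by auto
    qed
  qed
  moreover have sup: "K \<subseteq> \<theta> ` cball 0 1"
  proof
    fix y assume y: "y \<in> K"
    show "y \<in> \<theta> ` cball 0 1"
    proof (cases "y = a")
      case True
      then have "y = \<theta> 0" by (simp add: \<theta>_def)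
      then show ?thesis by simp
    next
      case False
      \<comment> \<open>The ray from \<open>a\<close> through \<open>y\<close> leaves
        \<open>K\<close> no earlier than at \<open>y\<close>, whence \<open>d\<close> is at least
        \<open>1\<close> and \<open>y\<close> comes from the disc.\<close>
      obtain d where d: "0 < d" "a + d *\<^sub>R (y - a) \<in> frontier K"
        using ray_to_frontier[OF compact_imp_bounded[OF K(2)] a, of "y - a"] False by auto
      have "d \<ge> 1" using inner[OF y, of d] d by (cases "d < 1") (auto simp: frontier_def)
      obtain u where u: "norm u = 1" "\<gamma> u = a + d *\<^sub>R (y - a)"
        using d(2) \<gamma>(3) by (metis (no_types, lifting) imageE mem_sphere_0)
      have "\<theta> ((1/d) *\<^sub>R u) = y"
        unfolding \<theta>_def using u d(1) by (simp add: )
      moreover have "(1/d) *\<^sub>R u \<in> cball 0 1" using u \<open>d \<ge> 1\<close> by simp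
      ultimately show ?thesis by (metis imageI)
    qed
  qed
  moreover have "\<theta> ` ball 0 1 = interior K"
  proof
    show "\<theta> ` ball 0 1 \<subseteq> interior K" using ballint by auto
    show "interior K \<subseteq> \<theta> ` ball 0 1"
    proof
      fix y assume y: "y \<in> interior K"
      then obtain z where z: "z \<in> cball 0 1" "\<theta> z = y" using sup interior_subset by blast
      have "norm z \<noteq> 1" using y z scale[of z] \<gamma>fr[of z] by (auto simp: frontier_def)
      then show "y \<in> \<theta> ` ball 0 1" using z by (auto simp: less_le)
    qed
  qed
  ultimately show ?thesis using that scale by (metis subset_antisym)
qed

text \<open>Any convex body with its frontier cut into \<open>N\<close> arcs can stand in for the
  disc with \<open>N\<close> standard sides. Gluing and folding can thus be done on half discs and
  transported back.\<close>

lemma polygon_model: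
  fixes K :: "complex set" and q :: "nat \<Rightarrow> real \<Rightarrow> complex"
  assumes K: "convex K" "compact K" "interior K \<noteq> {}" and N: "0 < N"
    and cont: "\<And>j. j < N \<Longrightarrow> continuous_on {0..1} (q j)"
    and join: "\<And>j. j < N \<Longrightarrow> q j 1 = q (Suc j mod N) 0"
    and inj: "\<And>i j s t. \<lbrakk>i < N; j < N; 0 \<le> s; s < 1; 0 \<le> t; t < 1; q i s = q j t\<rbrakk> \<Longrightarrow> i = j \<and> s = t"
    and front: "(\<Union>j<N. q j ` {0..1}) = frontier K"
  obtains \<theta> where "continuous_on (cball 0 1) \<theta>" "inj_on \<theta> (cball 0 1)" "\<theta> ` cball 0 1 = K"
    "\<theta> ` ball 0 1 = interior K"
    "\<And>j t. j < N \<Longrightarrow> 0 \<le> t \<Longrightarrow> t \<le> 1 \<Longrightarrow> \<theta> (arcpt N j t) = q j t"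
proof -
  obtain \<gamma> where \<gamma>: "continuous_on (sphere 0 1) \<gamma>"
    "\<And>j t. j < N \<Longrightarrow> 0 \<le> t \<Longrightarrow> t \<le> 1 \<Longrightarrow> \<gamma> (arcpt N j t) = q j t"
    using circle_map_of_arcs[of N q] N cont join by blast
  have im: "\<gamma> ` sphere 0 1 = frontier K"
  proof
    show "\<gamma> ` sphere 0 1 \<subseteq> frontier K"
    proof
      fix y assume "y \<in> \<gamma> ` sphere 0 1"
      then obtain z where z: "norm z = 1" "y = \<gamma> z" by auto
      obtain j t where "j < N" "0 \<le> t" "t < 1" "z = arcpt N j t" by (rule arcpt_surj[OF z(1) N])
      then show "y \<in> frontier K" using \<gamma>(2)[of j t] z front by force
    qed
    show "frontier K \<subseteq> \<gamma> ` sphere 0 1"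
    proof
      fix y assume "y \<in> frontier K"
      then obtain j t where "j < N" "0 \<le> t" "t \<le> 1" "y = q j t" using front by force
      then show "y \<in> \<gamma> ` sphere 0 1" using \<gamma>(2)[of j t] by (metis imageI mem_sphere_0 norm_arcpt)
    qed
  qed
  have "inj_on \<gamma> (sphere 0 1)"
  proof (rule inj_onI)
    fix z w assume z: "z \<in> sphere 0 1" and w: "w \<in> sphere 0 1" and e: "\<gamma> z = \<gamma> w"
    obtain i s where 1: "i < N" "0 \<le> s" "s < 1" "z = arcpt N i s"
      using arcpt_surj[OF _ N, of z] z by auto
    obtain j t where 2: "j < N" "0 \<le> t" "t < 1" "w = arcpt N j t"
      using arcpt_surj[OF _ N, of w] w by auto
    have "q i s = q j t" using 1 2 e \<gamma>(2) by simp
    then show "z = w" using inj 1 2 by blast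
  qed
  moreover obtain a where "a \<in> interior K" using K(3) by blast
  ultimately obtain \<theta> where "continuous_on (cball 0 1) \<theta>" "inj_on \<theta> (cball 0 1)" "\<theta> ` cball 0 1 = K"
    "\<theta> ` ball 0 1 = interior K" "\<And>z. norm z = 1 \<Longrightarrow> \<theta> z = \<gamma> z"
    using radial_extension[OF K(1,2) _ \<gamma>(1) _ im] by metis
  then show ?thesis using that \<gamma>(2) by simp
qed

section \<open>Local structure of surfaces\<close>

text \<open>Charts can be taken centred at \<open>x\<close>, inside a prescribed open set and
  modelled on the open unit disc of the complex plane: restrict a chart to a small ball and
  rescale.\<close>

lemma surface_chart:
  assumes X: "closed_surface X" and O: "openin X O'" "x \<in> O'"
  obtains U k h where "openin X U" "x \<in> U" "U \<subseteq> O'"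
    "homeomorphic_maps (top_of_set (ball (0::complex) 1)) (subtopology X U) k h" "k 0 = x"
proof -
  have xX: "x \<in> topspace X" using O openin_subset by blast
  obtain U0 f g where U0: "openin X U0" "x \<in> U0"
    and fg: "homeomorphic_maps (subtopology X U0) (euclidean :: (real^2) topology) f g"
    using X xX unfolding closed_surface_def homeomorphic_space_def by meson
  have "DIM(real^2) = DIM(complex)" by simp
  then obtain l :: "real^2 \<Rightarrow> complex" and m where l: "linear l" "linear m"
      "\<And>z. m (l z) = z" "\<And>z. l (m z) = z"
    using isomorphisms_UNIV_UNIV[where 'M="real^2" and 'N=complex] by metis
  have f: "continuous_map (subtopology X U0) euclidean f" and g: "continuous_map euclidean (subtopology X U0) g"
    and gf: "\<And>y. y \<in> U0 \<Longrightarrow> g (f y) = y" and fgi: "\<And>z. f (g z) = z" and gU: "\<And>z. g z \<in> U0"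
    using fg U0 openin_subset[OF U0(1)] unfolding homeomorphic_maps_def
    by (auto simp: continuous_map_def)
  define F where "F = l \<circ> f"
  define G where "G = g \<circ> m"
  have Fc: "continuous_map (subtopology X U0) euclidean F" unfolding F_def
    by (rule continuous_map_compose[OF f])
      (use l in \<open>simp add: linear_continuous_on linear_conv_bounded_linear\<close>)
  have Gc: "continuous_map euclidean (subtopology X U0) G" unfolding G_def
    by (rule continuous_map_compose[OF _ g])
      (use l in \<open>simp add: linear_continuous_on linear_conv_bounded_linear\<close>)
  have GF: "\<And>y. y \<in> U0 \<Longrightarrow> G (F y) = y" and FG: "\<And>z. F (G z) = z" and GU: "\<And>z. G z \<in> U0"
    using gf fgi l gU by (auto simp: F_def G_def)
  define W where "W = {z. G z \<in> O'}"
  have "openin (subtopology X U0) (U0 \<inter> O')" using O(1) by (simp add: openin_subtopology_Int2)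
  from openin_continuous_map_preimage[OF Gc this] have "open W"
    by (simp add: W_def GU)
  moreover have "F x \<in> W" using GF U0 O by (simp add: W_def)
  ultimately obtain r where r: "r > 0" "ball (F x) r \<subseteq> W" by (meson openE)
  define s where "s z = F x + r *\<^sub>R z" for z
  define k where "k = G \<circ> s"
  define h where "h y = (1/r) *\<^sub>R (F y - F x)" for y
  define U where "U = {y \<in> U0. F y \<in> ball (F x) r}"
  have "openin (subtopology X U0) {y \<in> topspace (subtopology X U0). F y \<in> ball (F x) r}"
    by (rule openin_continuous_map_preimage[OF Fc]) simp
  moreover have "{y \<in> topspace (subtopology X U0). F y \<in> ball (F x) r} = U"
    using U0 openin_subset by (auto simp: U_def)
  ultimately have Uo: "openin X U" using U0 openin_trans_full by metis
  have UU0: "U \<subseteq> U0" by (auto simp: U_def)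
  have ss: "s z \<in> ball (F x) r" if "norm z < 1" for z
    using that r by (simp add: s_def dist_norm)
  have kU: "k z \<in> U" if "norm z < 1" for z
    using ss[OF that] GU FG by (simp add: U_def k_def)
  have "continuous_map euclidean (subtopology X U0) k"
    unfolding k_def by (rule continuous_map_compose[OF _ Gc]) (auto simp: s_def intro!: continuous_intros)
  then have kc: "continuous_map (top_of_set (ball 0 1)) (subtopology X U) k"
    using kU unfolding continuous_map_in_subtopology
    by (auto intro: continuous_map_from_subtopology)
  have "continuous_map (subtopology X U) euclidean F"
    using Fc UU0 by (metis continuous_map_from_subtopology_mono)
  then have "continuous_map (subtopology X U) euclidean ((\<lambda>w. (1/r) *\<^sub>R (w - F x)) \<circ> F)"
    by (rule continuous_map_compose) (auto intro!: continuous_intros)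
  moreover have "(\<lambda>w. (1/r) *\<^sub>R (w - F x)) \<circ> F = h" by (auto simp: h_def fun_eq_iff)
  ultimately have "continuous_map (subtopology X U) euclidean h" by metis
  moreover have "h y \<in> ball 0 1" if "y \<in> U" for y
  proof -
    have "norm (F y - F x) < r" using that by (auto simp: U_def dist_norm norm_minus_commute)
    then show ?thesis using r by (simp add: h_def)
  qed
  ultimately have hc: "continuous_map (subtopology X U) (top_of_set (ball 0 1)) h"
    unfolding continuous_map_in_subtopology by auto
  have hk: "h (k z) = z" for z using r FG by (simp add: h_def k_def s_def)
  have kh: "k (h y) = y" if "y \<in> U" for y
    using r GF that UU0 by (simp add: h_def k_def s_def subset_iff)
  show ?thesis
  proof
    show "openin X U" by fact
    show "x \<in> U" using U0 r by (simp add: U_def)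
    show "U \<subseteq> O'"
    proof
      fix y assume "y \<in> U"
      then have "F y \<in> W" "y \<in> U0" using r by (auto simp: U_def)
      then show "y \<in> O'" using GF by (simp add: W_def)
    qed
    show "homeomorphic_maps (top_of_set (ball 0 1)) (subtopology X U) k h"
      unfolding homeomorphic_maps_def using kc hc hk kh by auto
    show "k 0 = x" using GF U0 by (simp add: k_def s_def)
  qed
qed

text \<open>A punctured disc is connected. This is the form in which two-dimensionality is used
  later: no point of a surface is isolated or locally separates it.\<close>

lemma surface_punctured_nbhd:
  assumes X: "closed_surface X" and O: "openin X O'" "x \<in> O'"
  obtains U where "openin X U" "x \<in> U" "U \<subseteq> O'" "connectedin X U" "connectedin X (U - {x})" "U \<noteq> {x}"
proof -
  obtain U k h where U: "openin X U" "x \<in> U" "U \<subseteq> O'"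
    "homeomorphic_maps (top_of_set (ball (0::complex) 1)) (subtopology X U) k h" "k 0 = x"
    using surface_chart[OF X O] .
  have UX: "U \<subseteq> topspace X" using U openin_subset by blast
  have kc: "continuous_map (top_of_set (ball 0 1)) (subtopology X U) k"
    and hk: "\<And>z. z \<in> ball 0 1 \<Longrightarrow> h (k z) = z" and kh: "\<And>y. y \<in> U \<Longrightarrow> k (h y) = y \<and> h y \<in> ball 0 1"
    using U(4) UX unfolding homeomorphic_maps_def continuous_map_def by auto
  have kU: "\<And>z. z \<in> ball 0 1 \<Longrightarrow> k z \<in> U" using kc by (auto simp: continuous_map_def)
  have kX: "continuous_map (top_of_set (ball 0 1)) X k" using kc continuous_map_into_fulltopology by blast
  have im: "k ` (ball 0 1 - {0}) = U - {x}"
  proof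
    show "k ` (ball 0 1 - {0}) \<subseteq> U - {x}"
      using kU hk U(5) by (metis (no_types, lifting) Diff_iff centre_in_ball image_subsetI singletonD singletonI zero_less_one)
    show "U - {x} \<subseteq> k ` (ball 0 1 - {0})"
    proof
      fix y assume "y \<in> U - {x}"
      then show "y \<in> k ` (ball 0 1 - {0})" using kh[of y] U(5) by (intro image_eqI[of _ _ "h y"]) auto
    qed
  qed
  have imU: "k ` ball 0 1 = U" using kU kh by (metis (no_types, lifting) image_eqI image_subsetI subsetI subset_antisym)
  show ?thesis
  proof (rule that[of U])
    have "connectedin (top_of_set (ball 0 1)) (ball (0::complex) 1 - {0})"
      by (simp add: connectedin_subtopology connected_punctured_ball)
    then have "connectedin X (k ` (ball 0 1 - {0}))"
      using kX connectedin_continuous_map_image by blast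
    then show "connectedin X (U - {x})" by (simp add: im)
    have "connectedin (top_of_set (ball 0 1)) (ball (0::complex) 1)"
      by (simp add: connectedin_subtopology)
    then have "connectedin X (k ` ball 0 1)"
      using kX connectedin_continuous_map_image by blast
    then show "connectedin X U" by (simp add: imU)
    have "ball (0::complex) 1 - {0} \<noteq> {}"
    proof -
      have "(1/2::complex) \<in> ball 0 1 - {0}" by simp
      then show ?thesis by blast
    qed
    then show "U \<noteq> {x}" using im by blast
  qed (use U in auto)
qed

text \<open>Openness is local, so the map can be read in a chart around each value, where Brouwer's
  invariance of domain applies.\<close>

lemma surface_invariance_of_domain:
  fixes \<Psi> :: "complex \<Rightarrow> 'a"
  assumes X: "closed_surface X" and S: "open S" and c: "continuous_map (top_of_set S) X \<Psi>" and i: "inj_on \<Psi> S"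
  shows "openin X (\<Psi> ` S)"
proof (subst openin_subopen, intro ballI)
  fix y assume "y \<in> \<Psi> ` S"
  then obtain z where z: "z \<in> S" "y = \<Psi> z" by blast
  have yX: "y \<in> topspace X" using c z by (auto simp: continuous_map_def)
  obtain U k h where U: "openin X U" "y \<in> U" "U \<subseteq> topspace X"
    "homeomorphic_maps (top_of_set (ball (0::complex) 1)) (subtopology X U) k h" "k 0 = y"
    using surface_chart[OF X openin_topspace yX] .
  have hc: "continuous_map (subtopology X U) (top_of_set (ball 0 1)) h"
    and kh: "\<And>y. y \<in> U \<Longrightarrow> k (h y) = y \<and> h y \<in> ball 0 1"
    using U(3,4) unfolding homeomorphic_maps_def continuous_map_def by auto
  define T where "T = {s \<in> S. \<Psi> s \<in> U}"
  have "openin (top_of_set S) T"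
    using openin_continuous_map_preimage[OF c U(1)] by (simp add: T_def)
  then have T: "open T" using S by (metis openin_open_eq)
  have "continuous_map (top_of_set T) (subtopology X U) \<Psi>"
    unfolding continuous_map_in_subtopology
    using continuous_map_from_subtopology_mono[OF c, of T] by (auto simp: T_def)
  from continuous_map_compose[OF this hc] have "continuous_on T (h \<circ> \<Psi>)"
    by (simp add: continuous_map_in_subtopology)
  moreover have "inj_on (h \<circ> \<Psi>) T"
    using i kh unfolding inj_on_def T_def comp_def by (metis (mono_tags, lifting) mem_Collect_eq)
  ultimately have op: "open ((h \<circ> \<Psi>) ` T)" using T invariance_of_domain by blast
  have sub: "(h \<circ> \<Psi>) ` T \<subseteq> ball 0 1" using kh by (auto simp: T_def)
  have "homeomorphic_map (top_of_set (ball 0 1)) (subtopology X U) k"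
    using U(4) homeomorphic_maps_map by blast
  then have "openin (subtopology X U) (k ` ((h \<circ> \<Psi>) ` T))"
    using op sub by (metis homeomorphic_imp_open_map open_map_def openin_open_eq open_ball)
  moreover have "k ` ((h \<circ> \<Psi>) ` T) = \<Psi> ` T" using kh by (force simp: T_def image_iff)
  ultimately have "openin X (\<Psi> ` T)" using U(1) openin_trans_full by metis
  moreover have "y \<in> \<Psi> ` T" using z U by (auto simp: T_def)
  moreover have "\<Psi> ` T \<subseteq> \<Psi> ` S" by (auto simp: T_def)
  ultimately show "\<exists>T. openin X T \<and> y \<in> T \<and> T \<subseteq> \<Psi> ` S" by blast
qed

section \<open>Polygon models\<close>

text \<open>Exactly the hypotheses of \<open>polygon_model\<close>. Parameters below
  \<open>1\<close> in the injectivity clause count every corner once.\<close>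

definition polygon_pieces :: "complex set \<Rightarrow> nat \<Rightarrow> (nat \<Rightarrow> real \<Rightarrow> complex) \<Rightarrow> bool" where
  "polygon_pieces K N q \<longleftrightarrow> convex K \<and> compact K \<and> interior K \<noteq> {} \<and> 0 < N \<and>
     (\<forall>j<N. continuous_on {0..1} (q j)) \<and> (\<forall>j<N. q j 1 = q (Suc j mod N) 0) \<and>
     (\<forall>i<N. \<forall>j<N. \<forall>s t. 0 \<le> s \<and> s < 1 \<and> 0 \<le> t \<and> t < 1 \<and> q i s = q j t \<longrightarrow> i = j \<and> s = t) \<and>
     (\<Union>j<N. q j ` {0..1}) = frontier K"

lemma polygon_pieces_model:
  assumes "polygon_pieces K N q"
  obtains \<theta> where "continuous_on (cball 0 1) \<theta>" "inj_on \<theta> (cball 0 1)" "\<theta> ` cball 0 1 = K"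
    "\<theta> ` ball 0 1 = interior K"
    "\<And>j t. j < N \<Longrightarrow> 0 \<le> t \<Longrightarrow> t \<le> 1 \<Longrightarrow> \<theta> (arcpt N j t) = q j t"
proof -
  note P = assms[unfolded polygon_pieces_def]
  have K: "convex K" "compact K" "interior K \<noteq> {}" "0 < N" and fr: "(\<Union>j<N. q j ` {0..1}) = frontier K"
    using P by blast+
  show ?thesis
  proof (rule polygon_model[OF K _ _ _ fr])
    show "continuous_on {0..1} (q j)" "q j 1 = q (Suc j mod N) 0" if "j < N" for j using P that by blast+
    show "i = j \<and> s = t"
      if "i < N" "j < N" "0 \<le> s" "s < 1" "0 \<le> t" "t < 1" "q i s = q j t" for i j s t
      using P that by blast
  qed (rule that)
qed

lemma unit_interval_pieces:
  fixes x :: real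
  assumes "0 < m" "0 \<le> x" "x \<le> 1"
  obtains j t where "j < m" "0 \<le> t" "t \<le> 1" "x = (real j + t) / real m"
proof (cases "x = 1")
  case True
  show ?thesis by (rule that[of "m-1" 1]) (use assms True in \<open>auto simp: of_nat_diff\<close>)
next
  case False
  define j where "j = nat \<lfloor>x * m\<rfloor>"
  have "x * m < m" using False assms by simp
  then have "j < m" unfolding j_def using assms by (metis floor_less_iff nat_less_iff of_int_of_nat_eq of_nat_0_le_iff mult_nonneg_nonneg zero_le_floor)
  moreover have "0 \<le> x * m" using assms by simp
  then have "real j \<le> x * m" "x * m < real j + 1" unfolding j_def by linarith+
  ultimately show ?thesis using assms by (intro that[of j "x * m - j"]) (auto simp: field_simps)
qed

text \<open>Two shapes arise in this way: the half disc, bounded by a diameter and a semicircle, and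
  the disc, bounded by two semicircles.\<close>

definition two_arcs :: "(real \<Rightarrow> complex) \<Rightarrow> (real \<Rightarrow> complex) \<Rightarrow> nat \<Rightarrow> nat \<Rightarrow> nat \<Rightarrow> real \<Rightarrow> complex" where
  "two_arcs A B k m j t =
     (if j < k then A ((real j + t) / real k) else B ((real (j - k) + t) / real m))"

lemma two_arcs_pieces:
  assumes K: "convex K" "compact K" "interior K \<noteq> {}" and km: "0 < k" "0 < m"
    and A: "continuous_on {0..1} A" "inj_on A {0..<1}" and B: "continuous_on {0..1} B" "inj_on B {0..<1}"
    and AB: "A 1 = B 0" "B 1 = A 0" "A ` {0..<1} \<inter> B ` {0..<1} = {}"
    and fr: "A ` {0..1} \<union> B ` {0..1} = frontier K"
  shows "polygon_pieces K (k + m) (two_arcs A B k m)"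
proof -
  have rng: "0 \<le> (real j + t) / real k \<and> (real j + t) / real k \<le> 1" if "j < k" "0 \<le> t" "t \<le> 1" for j k t
  proof -
    have "real j + 1 \<le> real k" using that by linarith
    then show ?thesis using that by (auto simp: field_simps)
  qed
  have rng': "0 \<le> (real j + t) / real k \<and> (real j + t) / real k < 1" if "j < k" "0 \<le> t" "t < 1" for j k t
  proof -
    have "real j + 1 \<le> real k" using that by linarith
    then show ?thesis using that by (auto simp: field_simps)
  qed
  have det: "i = j \<and> s = t" if "(real i + s) / real k = (real j + t) / real k" "0 < k" "0 \<le> s" "s < 1" "0 \<le> t" "t < 1" for i j k s t
  proof -
    have "real i + s = real j + t" using that by (simp add: field_simps)
    moreover have "\<lfloor>real i + s\<rfloor> = int i" "\<lfloor>real j + t\<rfloor> = int j" using that by linarith+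
    ultimately show ?thesis by auto
  qed
  have "continuous_on {0..1} (two_arcs A B k m j)" if "j < k + m" for j
  proof (cases "j < k")
    case True
    have "continuous_on {0..1} (\<lambda>t. A ((real j + t) / real k))"
      by (rule continuous_on_compose2[OF A(1)]) (use True rng km in \<open>auto intro!: continuous_intros\<close>)
    then show ?thesis using True by (simp add: two_arcs_def[abs_def])
  next
    case False
    then have "j - k < m" using that by simp
    then have "continuous_on {0..1} (\<lambda>t. B ((real (j-k) + t) / real m))"
      by (intro continuous_on_compose2[OF B(1)]) (use rng[of "j-k" m] km in \<open>auto intro!: continuous_intros\<close>)
    then show ?thesis using False by (simp add: two_arcs_def[abs_def])
  qed
  moreover have "two_arcs A B k m j 1 = two_arcs A B k m (Suc j mod (k + m)) 0" if jm: "j < k + m" for j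
  proof -
    consider "Suc j < k" | "Suc j = k" | "k \<le> j" "Suc j < k + m" | "Suc j = k + m"
      using jm by atomize_elim arith
    then show ?thesis
    proof cases
      case 1 then show ?thesis by (simp add: two_arcs_def add.commute)
    next
      case 2
      have "(real j + 1) / real k = 1" using 2 km by (simp add: field_simps)
      moreover have "two_arcs A B k m j 1 = A ((real j + 1) / real k)" using 2 by (simp add: two_arcs_def)
      ultimately have "two_arcs A B k m j 1 = A 1" by metis
      then show ?thesis using 2 km AB by (simp add: two_arcs_def)
    next
      case 3
      then have "real (j - k) + 1 = real (Suc j - k)" by (simp add: of_nat_diff)
      then show ?thesis using 3 by (simp add: two_arcs_def del: of_nat_diff)
    next
      case 4
      then have "(real (j - k) + 1) / real m = 1" "\<not> j < k" using km by (auto simp: field_simps of_nat_diff)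
      then have "two_arcs A B k m j 1 = B 1" by (simp add: two_arcs_def)
      then show ?thesis using 4 km AB by (simp add: two_arcs_def)
    qed
  qed
  moreover have "i = j \<and> s = t"
    if "i < k + m" "j < k + m" "0 \<le> s" "s < 1" "0 \<le> t" "t < 1" "two_arcs A B k m i s = two_arcs A B k m j t" for i j s t
  proof -
    consider "i < k" "j < k" | "i < k" "\<not> j < k" | "\<not> i < k" "j < k" | "\<not> i < k" "\<not> j < k" by atomize_elim blast
    then show ?thesis
    proof cases
      case 1
      then have "A ((real i + s) / real k) = A ((real j + t) / real k)" using that by (simp add: two_arcs_def)
      then have "(real i + s) / real k = (real j + t) / real k"
        by (rule inj_onD[OF A(2)]) (use 1 that rng'[of i k s] rng'[of j k t] in auto)
      then show ?thesis using det km that by blast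
    next
      case 2
      then have "(real i + s) / real k \<in> {0..<1}" "(real (j-k) + t) / real m \<in> {0..<1}"
        using that rng'[of i k s] rng'[of "j - k" m t] by auto
      moreover have "A ((real i + s) / real k) = B ((real (j-k) + t) / real m)"
        using 2 that by (simp add: two_arcs_def del: of_nat_diff)
      ultimately show ?thesis using AB(3) by (metis IntI empty_iff imageI)
    next
      case 3
      then have "(real j + t) / real k \<in> {0..<1}" "(real (i-k) + s) / real m \<in> {0..<1}"
        using that rng'[of j k t] rng'[of "i - k" m s] by auto
      moreover have "A ((real j + t) / real k) = B ((real (i-k) + s) / real m)"
        using 3 that by (simp add: two_arcs_def del: of_nat_diff)
      ultimately show ?thesis using AB(3) by (metis IntI empty_iff imageI)
    next
      case 4
      then have "B ((real (i-k) + s) / real m) = B ((real (j-k) + t) / real m)"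
        using that by (simp add: two_arcs_def del: of_nat_diff)
      then have "(real (i-k) + s) / real m = (real (j-k) + t) / real m"
        by (rule inj_onD[OF B(2)]) (use 4 that rng'[of "i-k" m s] rng'[of "j-k" m t] in auto)
      then have "i - k = j - k \<and> s = t" using det km that by blast
      then show ?thesis using 4 by auto
    qed
  qed
  moreover have "(\<Union>j<k + m. two_arcs A B k m j ` {0..1}) = frontier K"
    unfolding fr[symmetric]
  proof
    show "(\<Union>j<k + m. two_arcs A B k m j ` {0..1}) \<subseteq> A ` {0..1} \<union> B ` {0..1}"
    proof
      fix y assume "y \<in> (\<Union>j<k + m. two_arcs A B k m j ` {0..1})"
      then obtain j t where jt: "j < k + m" "0 \<le> t" "t \<le> 1" "y = two_arcs A B k m j t" by auto
      show "y \<in> A ` {0..1} \<union> B ` {0..1}"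
        using jt rng[of j k t] rng[of "j-k" m t] by (cases "j < k") (auto simp: two_arcs_def)
    qed
    show "A ` {0..1} \<union> B ` {0..1} \<subseteq> (\<Union>j<k + m. two_arcs A B k m j ` {0..1})"
    proof
      fix y assume "y \<in> A ` {0..1} \<union> B ` {0..1}"
      then consider x where "0 \<le> x" "x \<le> 1" "y = A x" | x where "0 \<le> x" "x \<le> 1" "y = B x" by auto
      then show "y \<in> (\<Union>j<k + m. two_arcs A B k m j ` {0..1})"
      proof cases
        case 1
        then obtain j t where "j < k" "0 \<le> t" "t \<le> 1" "x = (real j + t) / real k"
          using unit_interval_pieces km by blast
        then show ?thesis using 1 by (intro UN_I[of j]) (auto simp: two_arcs_def)
      next
        case 2
        then obtain j t where "j < m" "0 \<le> t" "t \<le> 1" "x = (real j + t) / real m"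
          using unit_interval_pieces km by blast
        then show ?thesis using 2 by (intro UN_I[of "k + j"]) (auto simp: two_arcs_def)
      qed
    qed
  qed
  ultimately show ?thesis unfolding polygon_pieces_def using K km by blast
qed

definition upper_half_disc :: "complex set" where
  "upper_half_disc = {z. 0 \<le> Im z \<and> norm z \<le> 1}"

lemma upper_half_disc_eq: "upper_half_disc = cball 0 1 \<inter> {z. Im z \<ge> 0}"
  by (auto simp: upper_half_disc_def)

lemma interior_upper_half_disc: "interior upper_half_disc = {z. 0 < Im z \<and> norm z < 1}"
proof -
  have "interior {z. Im z \<ge> 0} = {z. Im z > 0}"
    using interior_halfspace_ge[of \<i> 0] by (simp add: inner_complex_def)
  then show ?thesis by (auto simp: upper_half_disc_eq)
qed

lemma closed_upper_half_disc: "closed upper_half_disc"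
  unfolding upper_half_disc_eq
  by (intro closed_Int closed_cball closed_Collect_le continuous_intros)

lemma frontier_upper_half_disc:
  "z \<in> frontier upper_half_disc \<longleftrightarrow> 0 \<le> Im z \<and> norm z \<le> 1 \<and> (Im z = 0 \<or> norm z = 1)"
  unfolding frontier_def closure_closed[OF closed_upper_half_disc] interior_upper_half_disc
  by (auto simp: upper_half_disc_def)

lemma unit_upper_cis:
  assumes "norm z = 1" "Im z \<ge> 0"
  obtains x where "0 \<le> x" "x \<le> 1" "z = cis (pi * x)"
proof (rule that[of "Arg2pi z / pi"])
  have "Arg2pi z \<le> pi" using assms(2) Arg2pi_le_pi by blast
  then show "Arg2pi z / pi \<le> 1" by simp
  show "0 \<le> Arg2pi z / pi" using Arg2pi_ge_0 by simp
  show "z = cis (pi * (Arg2pi z / pi))"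
    using Arg2pi_eq[of z] assms(1) by (simp add: cis_conv_exp)
qed

text \<open>The letters to be operated on lie on the diameter and the rest on the semicircle:
  \<open>k = 1\<close> serves for gluing along one side, \<open>k = 2\<close> for folding two
  adjacent sides together.\<close>

lemma half_disc_pieces:
  assumes "0 < k" "0 < m"
  shows "polygon_pieces upper_half_disc (k + m) (two_arcs (\<lambda>x. of_real (2 * x - 1)) (\<lambda>x. cis (pi * x)) k m)"
proof (rule two_arcs_pieces)
  have "convex {z. Im z \<ge> 0}"
    using convex_halfspace_ge[of 0 \<i>] by (simp add: inner_complex_def)
  then show "convex upper_half_disc"
    unfolding upper_half_disc_eq by (intro convex_Int convex_cball)
  show "compact upper_half_disc"
    using closed_upper_half_disc compact_Int_closed[of "cball 0 1" upper_half_disc]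
    by (simp add: upper_half_disc_eq Int_absorb1)
  have "\<i> / 2 \<in> interior upper_half_disc"
    by (simp add: interior_upper_half_disc norm_divide)
  then show "interior upper_half_disc \<noteq> {}" by blast
  show "continuous_on {0..1} (\<lambda>x. complex_of_real (2 * x - 1))" by (intro continuous_intros)
  show "continuous_on {0..1} (\<lambda>x. cis (pi * x))" unfolding cis_conv_exp by (intro continuous_intros)
  show "inj_on (\<lambda>x. complex_of_real (2 * x - 1)) {0..<1}" by (auto simp: inj_on_def)
  show "inj_on (\<lambda>x. cis (pi * x)) {0..<1}"
  proof (rule inj_onI)
    fix x y :: real assume xy: "x \<in> {0..<1}" "y \<in> {0..<1}" "cis (pi * x) = cis (pi * y)"
    have "pi * x = pi * y"
    proof (rule cis_inj_Ico[OF xy(3)])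
      have "pi * x < pi * 2" "pi * y < pi * 2" using xy by (intro mult_strict_left_mono; simp)+
      then show "pi * x < 2 * pi" "pi * y < 2 * pi" by simp_all
    qed (use xy in auto)
    then show "x = y" by simp
  qed
  have "complex_of_real (2 * x - 1) \<noteq> cis (pi * y)" if "0 \<le> x" "x < 1" "0 \<le> y" "y < 1" for x y
  proof
    assume e: "complex_of_real (2 * x - 1) = cis (pi * y)"
    then have "sin (pi * y) = 0" by (metis Im_complex_of_real cis.simps(2))
    moreover have "pi * y < pi * 1" using that by (intro mult_strict_left_mono) auto
    ultimately have "y = 0" using that sin_gt_zero[of "pi * y"] by (cases "y = 0") auto
    then have "complex_of_real (2 * x - 1) = 1" using e by simp
    then have "2 * x - 1 = 1" by (metis of_real_eq_1_iff)
    then show False using that by simp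
  qed
  then show "(\<lambda>x. complex_of_real (2 * x - 1)) ` {0..<1} \<inter> (\<lambda>x. cis (pi * x)) ` {0..<1} = {}" by auto
  show "(\<lambda>x. complex_of_real (2 * x - 1)) ` {0..1} \<union> (\<lambda>x. cis (pi * x)) ` {0..1} = frontier upper_half_disc"
  proof
    have sn: "0 \<le> sin (pi * x)" if "0 \<le> x" "x \<le> 1" for x
      using that by (intro sin_ge_zero) (auto simp: mult_left_le)
    show "(\<lambda>x. complex_of_real (2 * x - 1)) ` {0..1} \<union> (\<lambda>x. cis (pi * x)) ` {0..1} \<subseteq> frontier upper_half_disc"
    proof -
      have "\<bar>2 * x - 1\<bar> \<le> 1" if "0 \<le> x" "x \<le> 1" for x :: real using that by linarith
      then show ?thesis using sn by (auto simp: frontier_upper_half_disc simp del: of_real_diff of_real_mult)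
    qed
    show "frontier upper_half_disc \<subseteq> (\<lambda>x. complex_of_real (2 * x - 1)) ` {0..1} \<union> (\<lambda>x. cis (pi * x)) ` {0..1}"
    proof
      fix z assume "z \<in> frontier upper_half_disc"
      then have z: "0 \<le> Im z" "norm z \<le> 1" "Im z = 0 \<or> norm z = 1"
        by (auto simp: frontier_upper_half_disc)
      show "z \<in> (\<lambda>x. complex_of_real (2 * x - 1)) ` {0..1} \<union> (\<lambda>x. cis (pi * x)) ` {0..1}"
      proof (cases "norm z = 1")
        case True
        then show ?thesis using unit_upper_cis[OF True z(1)] by (metis (no_types, lifting) UnI2 atLeastAtMost_iff imageI)
      next
        case False
        then have im: "Im z = 0" using z by auto
        then have "z = of_real (2 * ((Re z + 1)/2) - 1)" by (simp add: complex_eq_iff field_simps)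
        moreover have "\<bar>Re z\<bar> \<le> 1" using z(2) abs_Re_le_cmod[of z] by linarith
        then have "(Re z + 1) / 2 \<in> {0..1}" by auto
        ultimately show ?thesis by blast
      qed
    qed
  qed
qed (use assms in auto)

text \<open>The shape that results from gluing two half discs along their diameters: one remaining
  word on each semicircle.\<close>

lemma circle_pieces:
  assumes "0 < k" "0 < m"
  shows "polygon_pieces (cball 0 1) (k + m) (two_arcs (\<lambda>x. cis (pi * x)) (\<lambda>x. - cis (pi * x)) k m)"
proof (rule two_arcs_pieces)
  show "continuous_on {0..1} (\<lambda>x. cis (pi * x))" unfolding cis_conv_exp by (intro continuous_intros)
  show "continuous_on {0..1} (\<lambda>x. - cis (pi * x))" unfolding cis_conv_exp by (intro continuous_intros)
  show *: "inj_on (\<lambda>x. cis (pi * x)) {0..<1}"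
  proof (rule inj_onI)
    fix x y :: real assume xy: "x \<in> {0..<1}" "y \<in> {0..<1}" "cis (pi * x) = cis (pi * y)"
    have "pi * x = pi * y"
    proof (rule cis_inj_Ico[OF xy(3)])
      have "pi * x < pi * 2" "pi * y < pi * 2" using xy by (intro mult_strict_left_mono; simp)+
      then show "pi * x < 2 * pi" "pi * y < 2 * pi" by simp_all
    qed (use xy in auto)
    then show "x = y" by simp
  qed
  then show "inj_on (\<lambda>x. - cis (pi * x)) {0..<1}" by (simp add: inj_on_def)
  have "cis (pi * x) \<noteq> - cis (pi * y)" if "0 \<le> x" "x < 1" "0 \<le> y" "y < 1" for x y
  proof
    assume e: "cis (pi * x) = - cis (pi * y)"
    have "- cis (pi * y) = cis (pi * y + pi)" by (simp add: complex_eq_iff)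
    then have "cis (pi * x) = cis (pi * y + pi)" using e by simp
    moreover have "pi * x < pi * 1" "pi * y < pi * 1" using that by (intro mult_strict_left_mono; simp)+
    ultimately have "pi * x = pi * y + pi" using that by (intro cis_inj_Ico) auto
    moreover have "0 \<le> pi * y" using that by simp
    ultimately show False using \<open>pi * x < pi * 1\<close> by linarith
  qed
  then show "(\<lambda>x. cis (pi * x)) ` {0..<1} \<inter> (\<lambda>x. - cis (pi * x)) ` {0..<1} = {}" by auto
  show "(\<lambda>x. cis (pi * x)) ` {0..1} \<union> (\<lambda>x. - cis (pi * x)) ` {0..1} = frontier (cball (0::complex) 1)"
  proof
    show "frontier (cball (0::complex) 1) \<subseteq> (\<lambda>x. cis (pi * x)) ` {0..1} \<union> (\<lambda>x. - cis (pi * x)) ` {0..1}"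
    proof
      fix z :: complex assume "z \<in> frontier (cball 0 1)"
      then have z: "norm z = 1" by simp
      show "z \<in> (\<lambda>x. cis (pi * x)) ` {0..1} \<union> (\<lambda>x. - cis (pi * x)) ` {0..1}"
      proof (cases "Im z \<ge> 0")
        case True
        then show ?thesis using unit_upper_cis[OF z True] by (metis (no_types, lifting) UnI1 atLeastAtMost_iff imageI)
      next
        case False
        have "norm (- z) = 1" "0 \<le> Im (- z)" using z False by auto
        then obtain x where "0 \<le> x" "x \<le> 1" "- z = cis (pi * x)" using unit_upper_cis by blast
        then have "x \<in> {0..1}" "z = - cis (pi * x)" by (simp, metis minus_minus)
        then show ?thesis by blast
      qed
    qed
  qed auto
qed (use assms in auto)

section \<open>Discs spanned by edge words\<close>

text \<open>An oriented edge; the Boolean tells whether the edge is run along its fixed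
  parametrization or against it.\<close>

type_synonym 'a dart = "'a set \<times> bool"

definition rv :: "'a dart \<Rightarrow> 'a dart" where
  "rv d = (fst d, \<not> snd d)"

lemma rv_simps [simp]: "rv (rv d) = d" "fst (rv d) = fst d" "rv d \<noteq> d" "d \<noteq> rv d"
  by (auto simp: rv_def prod_eq_iff)

lemma dart_cases: "fst d = fst d' \<Longrightarrow> d = d' \<or> d = rv d'"
  by (auto simp: rv_def prod_eq_iff)

text \<open>Only what disc surgery needs of the graph of vertices and edges: parametrized arcs that
  are disjoint off their ends. Faces do not appear, so the surgery applies to partly glued discs as
  well as to single faces.\<close>

locale arc_system =
  fixes X :: "'a topology" and V :: "'a set" and E :: "'a set set" and p :: "'a set \<Rightarrow> real \<Rightarrow> 'a"
  assumes surface: "closed_surface X"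
    and arc_cont: "e \<in> E \<Longrightarrow> continuous_map (top_of_set {0..1}) X (p e)"
    and arc_inj: "e \<in> E \<Longrightarrow> inj_on (p e) {0..1}"
    and arc_open: "e \<in> E \<Longrightarrow> p e ` {0<..<1} = e"
    and arc_ends: "e \<in> E \<Longrightarrow> p e 0 \<in> V" "e \<in> E \<Longrightarrow> p e 1 \<in> V"
    and edges_disjoint: "e \<in> E \<Longrightarrow> e' \<in> E \<Longrightarrow> e \<noteq> e' \<Longrightarrow> e \<inter> e' = {}"
    and edge_vertex_disjoint: "e \<in> E \<Longrightarrow> e \<inter> V = {}"
begin

definition dpath :: "'a dart \<Rightarrow> real \<Rightarrow> 'a" where
  "dpath d t = (if snd d then p (fst d) t else p (fst d) (1 - t))"

text \<open>Boundary points may be identified with one another, but never with an interior point.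
  Full injectivity would be lost as soon as an edge occurs twice on the boundary.\<close>

definition disc_map :: "complex set \<Rightarrow> (complex \<Rightarrow> 'a) \<Rightarrow> bool" where
  "disc_map K \<Psi> \<longleftrightarrow> continuous_map (top_of_set K) X \<Psi> \<and>
     (\<forall>z\<in>interior K. \<forall>z'\<in>K. \<Psi> z = \<Psi> z' \<longrightarrow> z = z')"

definition fill :: "'a dart list \<Rightarrow> (complex \<Rightarrow> 'a) \<Rightarrow> bool" where
  "fill w \<Phi> \<longleftrightarrow> w \<noteq> [] \<and> fst ` set w \<subseteq> E \<and> disc_map (cball 0 1) \<Phi> \<and>
     (\<forall>j<length w. \<forall>t. 0 \<le> t \<and> t \<le> 1 \<longrightarrow> \<Phi> (arcpt (length w) j t) = dpath (w ! j) t)"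

lemma Hausdorff: "Hausdorff_space X" and compact: "compact_space X"
  using surface by (auto simp: closed_surface_def)

lemma dpath_rv: "dpath (rv d) t = dpath d (1 - t)"
  by (simp add: dpath_def rv_def)

lemma dpath_open: "fst d \<in> E \<Longrightarrow> 0 < t \<Longrightarrow> t < 1 \<Longrightarrow> dpath d t \<in> fst d"
  using arc_open[of "fst d"] by (auto simp: dpath_def)

lemma dpath_ends: "fst d \<in> E \<Longrightarrow> dpath d 0 \<in> V" "fst d \<in> E \<Longrightarrow> dpath d 1 \<in> V"
  using arc_ends by (auto simp: dpath_def)

lemma dpath_mem: "fst d \<in> E \<Longrightarrow> 0 \<le> t \<Longrightarrow> t \<le> 1 \<Longrightarrow> dpath d t \<in> V \<union> fst d"
  using dpath_open[of d t] dpath_ends[of d] by (cases "t = 0"; cases "t = 1") auto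

lemma dpath_image_open: "fst d \<in> E \<Longrightarrow> dpath d ` {0<..<1} = fst d"
proof
  assume d: "fst d \<in> E"
  show "dpath d ` {0<..<1} \<subseteq> fst d" using dpath_open[OF d] by auto
  show "fst d \<subseteq> dpath d ` {0<..<1}"
  proof
    fix x assume "x \<in> fst d"
    then have "x \<in> p (fst d) ` {0<..<1}" using arc_open[OF d] by simp
    then obtain t where t: "0 < t" "t < 1" "x = p (fst d) t" by auto
    then have "x = dpath d (if snd d then t else 1 - t)" by (simp add: dpath_def)
    then show "x \<in> dpath d ` {0<..<1}" using t by auto
  qed
qed

lemma dpath_inj:
  assumes "fst d \<in> E" "0 \<le> s" "s \<le> 1" "0 \<le> t" "t \<le> 1" "dpath d s = dpath d t"
  shows "s = t"
proof (cases "snd d")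
  case True
  then show ?thesis using inj_onD[OF arc_inj[OF assms(1)], of s t] assms by (simp add: dpath_def)
next
  case False
  then show ?thesis using inj_onD[OF arc_inj[OF assms(1)], of "1 - s" "1 - t"] assms by (simp add: dpath_def)
qed

lemma continuous_dpath: "fst d \<in> E \<Longrightarrow> continuous_map (top_of_set {0..1}) X (dpath d)"
proof -
  assume d: "fst d \<in> E"
  have "continuous_map (top_of_set {0..1}) (top_of_set {0..1}) (\<lambda>t::real. 1 - t)"
    by (auto simp: continuous_map_in_subtopology intro!: continuous_intros)
  from continuous_map_compose[OF this arc_cont[OF d]]
  show ?thesis using arc_cont[OF d] by (cases "snd d") (auto simp: dpath_def[abs_def] comp_def)
qed

lemma fill_boundary:
  assumes "fill w \<Phi>" "norm z = 1"
  obtains j t where "j < length w" "0 \<le> t" "t < 1" "z = arcpt (length w) j t" "\<Phi> z = dpath (w ! j) t"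
    "fst (w ! j) \<in> E"
proof -
  have "0 < length w" using assms by (simp add: fill_def)
  then obtain j t where jt: "j < length w" "0 \<le> t" "t < 1" "z = arcpt (length w) j t"
    by (rule arcpt_surj[OF assms(2)])
  then have "\<Phi> z = dpath (w ! j) t" "fst (w ! j) \<in> E" using assms(1) by (auto simp: fill_def)
  then show ?thesis using that jt by blast
qed

lemma fill_boundary_mem:
  assumes "fill w \<Phi>" "norm z = 1"
  shows "\<Phi> z \<in> V \<union> \<Union>(fst ` set w)"
proof -
  obtain j t where "j < length w" "0 \<le> t" "t < 1" "\<Phi> z = dpath (w ! j) t" "fst (w ! j) \<in> E"
    using fill_boundary[OF assms] by metis
  then show ?thesis using dpath_mem[of "w ! j" t] nth_mem[of j w] by fastforce
qed

text \<open>Transport along the homeomorphism of \<open>polygon_pieces_model\<close>;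
  \<open>model_to_fill\<close> is the way back. Images of disc and interior are recorded because
  they say which part of the surface is covered.\<close>

lemma fill_to_model:
  assumes f: "fill w \<Phi>" and q: "polygon_pieces K (length w) q"
  obtains \<Psi> where "disc_map K \<Psi>" "\<Psi> ` K = \<Phi> ` cball 0 1" "\<Psi> ` interior K = \<Phi> ` ball 0 1"
    "\<And>j t. j < length w \<Longrightarrow> 0 \<le> t \<Longrightarrow> t \<le> 1 \<Longrightarrow> \<Psi> (q j t) = dpath (w ! j) t"
proof -
  obtain \<theta> where \<theta>: "continuous_on (cball 0 1) \<theta>" "inj_on \<theta> (cball 0 1)" "\<theta> ` cball 0 1 = K"
    "\<theta> ` ball 0 1 = interior K"
    and lab: "\<And>j t. j < length w \<Longrightarrow> 0 \<le> t \<Longrightarrow> t \<le> 1 \<Longrightarrow> \<theta> (arcpt (length w) j t) = q j t"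
    using polygon_pieces_model[OF q] by metis
  define \<eta> where "\<eta> = inv_into (cball 0 1) \<theta>"
  have \<eta>\<theta>: "\<eta> (\<theta> z) = z" if "z \<in> cball 0 1" for z using that \<theta>(2) by (simp add: \<eta>_def)
  have \<eta>c: "continuous_on K \<eta>"
    using continuous_on_inv[OF \<theta>(1) compact_cball] \<eta>\<theta> \<theta>(3) by metis
  have \<eta>K: "\<eta> ` K = cball 0 1" using \<theta>(3) \<eta>\<theta> by (force simp: image_iff)
  have \<eta>I: "\<eta> ` interior K = ball 0 1" unfolding \<theta>(4)[symmetric] using \<eta>\<theta> by (force simp: image_iff)
  have \<Phi>: "continuous_map (top_of_set (cball 0 1)) X \<Phi>"
    "\<And>z z'. z \<in> ball 0 1 \<Longrightarrow> z' \<in> cball 0 1 \<Longrightarrow> \<Phi> z = \<Phi> z' \<Longrightarrow> z = z'"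
    using f by (auto simp: fill_def disc_map_def)
  have "continuous_map (top_of_set K) (top_of_set (cball 0 1)) \<eta>"
    using \<eta>c \<eta>K by (auto simp: continuous_map_in_subtopology)
  then have c: "continuous_map (top_of_set K) X (\<Phi> \<circ> \<eta>)" using \<Phi>(1) continuous_map_compose by blast
  have inj: "z = z'" if z: "z \<in> interior K" "z' \<in> K" "(\<Phi> \<circ> \<eta>) z = (\<Phi> \<circ> \<eta>) z'" for z z'
  proof -
    have "\<eta> z \<in> ball 0 1" "\<eta> z' \<in> cball 0 1" using \<eta>I \<eta>K z(1,2) by blast+
    then have "\<eta> z = \<eta> z'" using \<Phi>(2) z(3) by simp
    moreover have "z \<in> K" using z(1) interior_subset by blast
    ultimately show "z = z'" using z(2) \<theta>(3) unfolding \<eta>_def by (metis f_inv_into_f)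
  qed
  have "disc_map K (\<Phi> \<circ> \<eta>)" unfolding disc_map_def using c inj by blast
  moreover have "(\<Phi> \<circ> \<eta>) ` K = \<Phi> ` cball 0 1" "(\<Phi> \<circ> \<eta>) ` interior K = \<Phi> ` ball 0 1"
    by (simp_all only: image_comp[symmetric] \<eta>K \<eta>I)
  moreover have "(\<Phi> \<circ> \<eta>) (q j t) = dpath (w ! j) t" if "j < length w" "0 \<le> t" "t \<le> 1" for j t
    using lab[OF that] \<eta>\<theta>[of "arcpt (length w) j t"] f that by (auto simp: fill_def)
  ultimately show ?thesis using that by blast
qed

lemma model_to_fill:
  assumes d: "disc_map K \<Psi>" and q: "polygon_pieces K (length w) q" and w: "fst ` set w \<subseteq> E"
    and lab: "\<And>j t. j < length w \<Longrightarrow> 0 \<le> t \<Longrightarrow> t \<le> 1 \<Longrightarrow> \<Psi> (q j t) = dpath (w ! j) t"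
  obtains \<Phi> where "fill w \<Phi>" "\<Phi> ` cball 0 1 = \<Psi> ` K" "\<Phi> ` ball 0 1 = \<Psi> ` interior K"
proof -
  obtain \<theta> where \<theta>: "continuous_on (cball 0 1) \<theta>" "inj_on \<theta> (cball 0 1)" "\<theta> ` cball 0 1 = K"
    "\<theta> ` ball 0 1 = interior K"
    and lab': "\<And>j t. j < length w \<Longrightarrow> 0 \<le> t \<Longrightarrow> t \<le> 1 \<Longrightarrow> \<theta> (arcpt (length w) j t) = q j t"
    using polygon_pieces_model[OF q] by metis
  have "continuous_map (top_of_set (cball 0 1)) (top_of_set K) \<theta>"
    using \<theta> by (auto simp: continuous_map_in_subtopology)
  then have c: "continuous_map (top_of_set (cball 0 1)) X (\<Psi> \<circ> \<theta>)"
    using d continuous_map_compose unfolding disc_map_def by blast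
  have inj: "z = z'" if z: "z \<in> ball 0 1" "z' \<in> cball 0 1" "(\<Psi> \<circ> \<theta>) z = (\<Psi> \<circ> \<theta>) z'" for z z'
  proof -
    have "\<theta> z \<in> interior K" "\<theta> z' \<in> K" using \<theta>(3,4) z(1,2) by blast+
    then have "\<theta> z = \<theta> z'" using d z(3) by (auto simp: disc_map_def)
    then show "z = z'" using \<theta>(2) z(1,2) by (auto simp: inj_on_def)
  qed
  have "disc_map (cball 0 1) (\<Psi> \<circ> \<theta>)" unfolding disc_map_def using c inj by simp
  moreover have "w \<noteq> []" using q by (auto simp: polygon_pieces_def)
  ultimately have "fill w (\<Psi> \<circ> \<theta>)" using w lab lab' by (simp add: fill_def)
  moreover have "(\<Psi> \<circ> \<theta>) ` cball 0 1 = \<Psi> ` K" "(\<Psi> \<circ> \<theta>) ` ball 0 1 = \<Psi> ` interior K"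
    by (simp_all only: image_comp[symmetric] \<theta>(3,4))
  ultimately show ?thesis using that by blast
qed

text \<open>Only the reading of the boundary changes. Rotation and reflection are the two
  instances.\<close>

lemma fill_isometry:
  assumes f: "fill w \<Phi>" and r: "continuous_on UNIV r" "\<And>z. norm (r z) = norm z" "\<And>z. r (r' z) = z" "inj r"
    and w': "length w' = length w" "fst ` set w' \<subseteq> E"
    and lab: "\<And>j t. j < length w \<Longrightarrow> 0 \<le> t \<Longrightarrow> t \<le> 1 \<Longrightarrow> \<Phi> (r (arcpt (length w) j t)) = dpath (w' ! j) t"
  shows "fill w' (\<Phi> \<circ> r) \<and> (\<Phi> \<circ> r) ` cball 0 1 = \<Phi> ` cball 0 1 \<and> (\<Phi> \<circ> r) ` ball 0 1 = \<Phi> ` ball 0 1"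
proof -
  have n: "norm (r' z) = norm z" for z using r(2)[of "r' z"] r(3) by simp
  have im: "r ` cball 0 1 = cball 0 1" "r ` ball 0 1 = ball 0 1"
  proof -
    have "z \<in> r ` cball 0 1" if "norm z \<le> 1" for z
      using that n[of z] r(3)[of z] by (intro image_eqI[of _ _ "r' z"]) auto
    then show "r ` cball 0 1 = cball 0 1" using r(2) by auto
    have "z \<in> r ` ball 0 1" if "norm z < 1" for z
      using that n[of z] r(3)[of z] by (intro image_eqI[of _ _ "r' z"]) auto
    then show "r ` ball 0 1 = ball 0 1" using r(2) by auto
  qed
  have \<Phi>: "continuous_map (top_of_set (cball 0 1)) X \<Phi>"
    "\<And>z z'. z \<in> ball 0 1 \<Longrightarrow> z' \<in> cball 0 1 \<Longrightarrow> \<Phi> z = \<Phi> z' \<Longrightarrow> z = z'"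
    using f by (auto simp: fill_def disc_map_def)
  have "continuous_map (top_of_set (cball 0 1)) (top_of_set (cball 0 1)) r"
    using r(1,2) by (auto simp: continuous_map_in_subtopology intro: continuous_on_subset)
  then have "continuous_map (top_of_set (cball 0 1)) X (\<Phi> \<circ> r)" using \<Phi>(1) continuous_map_compose by blast
  moreover have "z = z'" if "z \<in> ball 0 1" "z' \<in> cball 0 1" "(\<Phi> \<circ> r) z = (\<Phi> \<circ> r) z'" for z z'
  proof -
    have "r z = r z'" using \<Phi>(2)[of "r z" "r z'"] that r(2) by simp
    then show ?thesis using r(4) by (simp add: inj_def)
  qed
  ultimately have "disc_map (cball 0 1) (\<Phi> \<circ> r)" by (auto simp: disc_map_def)
  moreover have "w' \<noteq> []" using f w' by (auto simp: fill_def)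
  ultimately have "fill w' (\<Phi> \<circ> r)" using lab w' by (simp add: fill_def)
  then show ?thesis by (simp only: image_comp[symmetric] im)
qed

lemma fill_rotate1:
  assumes f: "fill w \<Phi>"
  shows "\<exists>\<Psi>. fill (rotate1 w) \<Psi> \<and> \<Psi> ` cball 0 1 = \<Phi> ` cball 0 1 \<and> \<Psi> ` ball 0 1 = \<Phi> ` ball 0 1"
proof -
  define c where "c = cis (2 * pi / real (length w))"
  have c: "norm c = 1" "c \<noteq> 0" by (auto simp: c_def)
  have w: "0 < length w" using f by (simp add: fill_def)
  have "fill (rotate1 w) (\<Phi> \<circ> (*) c) \<and> (\<Phi> \<circ> (*) c) ` cball 0 1 = \<Phi> ` cball 0 1 \<and> (\<Phi> \<circ> (*) c) ` ball 0 1 = \<Phi> ` ball 0 1"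
  proof (rule fill_isometry[OF f, where r' = "\<lambda>z. z / c"])
    fix j t assume jt: "j < length w" "0 \<le> t" "(t::real) \<le> 1"
    have *: "c * arcpt (length w) j t = arcpt (length w) (Suc j) t"
      by (simp add: c_def arcpt_def cis_mult add_divide_distrib[symmetric] distrib_left)
        (simp add: add_ac distrib_left)
    have "arcpt (length w) (Suc j) t = arcpt (length w) (Suc j mod length w) t"
    proof (cases "Suc j = length w")
      case True
      have "arcpt (length w) (Suc j) t = cis (2*pi + 2*pi*t/real (length w))"
        unfolding arcpt_def True using w by (simp add: field_simps)
      then show ?thesis using True by (simp add: arcpt_def cis_mult[symmetric])
    next
      case False
      then show ?thesis using jt by simp
    qed
    then show "\<Phi> (c * arcpt (length w) j t) = dpath (rotate1 w ! j) t"
      using * f jt by (auto simp: fill_def nth_rotate1)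
  qed (use f c in \<open>auto simp: fill_def norm_mult inj_def intro!: continuous_intros\<close>)
  then show ?thesis by blast
qed

lemma fill_rotate:
  assumes "fill (u @ v) \<Phi>"
  shows "\<exists>\<Psi>. fill (v @ u) \<Psi> \<and> \<Psi> ` cball 0 1 = \<Phi> ` cball 0 1 \<and> \<Psi> ` ball 0 1 = \<Phi> ` ball 0 1"
  using assms
proof (induction u arbitrary: v \<Phi>)
  case Nil then show ?case by auto
next
  case (Cons d u)
  obtain \<Psi> where \<Psi>: "fill (rotate1 ((d # u) @ v)) \<Psi>" "\<Psi> ` cball 0 1 = \<Phi> ` cball 0 1" "\<Psi> ` ball 0 1 = \<Phi> ` ball 0 1"
    using fill_rotate1[OF Cons.prems] by blast
  then have "fill (u @ (v @ [d])) \<Psi>" by simp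
  from Cons.IH[OF this] \<Psi> show ?case by (metis append.assoc append_Cons append_Nil)
qed

lemma fill_reverse:
  assumes f: "fill w \<Phi>"
  shows "\<exists>\<Psi>. fill (rev (map rv w)) \<Psi> \<and> \<Psi> ` cball 0 1 = \<Phi> ` cball 0 1 \<and> \<Psi> ` ball 0 1 = \<Phi> ` ball 0 1"
proof -
  have "fill (rev (map rv w)) (\<Phi> \<circ> cnj) \<and> (\<Phi> \<circ> cnj) ` cball 0 1 = \<Phi> ` cball 0 1 \<and> (\<Phi> \<circ> cnj) ` ball 0 1 = \<Phi> ` ball 0 1"
  proof (rule fill_isometry[OF f, where r' = cnj])
    fix j t assume jt: "j < length w" "0 \<le> t" "(t::real) \<le> 1"
    define N where "N = length w"
    \<comment> \<open>Conjugation runs the circle backwards: side \<open>j\<close> read from its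
      start becomes side \<open>N - 1 - j\<close> read from its end.\<close>
    define i where "i = N - Suc j"
    have iN: "i < N" "real i = real N - real j - 1" using jt by (auto simp: i_def N_def of_nat_diff)
    have "cnj (arcpt N j t) = cis (- (2 * pi * (real j + t) / real N))"
      by (simp add: arcpt_def cis_cnj)
    also have "\<dots> = cis (2*pi) * cis (- (2 * pi * (real j + t) / real N))" by simp
    also have "\<dots> = cis (2*pi + - (2 * pi * (real j + t) / real N))" by (rule cis_mult)
    also have "2*pi + - (2 * pi * (real j + t) / real N) = 2 * pi * (real i + (1 - t)) / real N"
    proof -
      have N: "real N = real i + real j + 1" using iN by simp
      have "real N > 0" using N by linarith
      then show ?thesis by (simp add: field_simps) (simp add: N algebra_simps)
    qed
    finally have "cnj (arcpt N j t) = arcpt N i (1 - t)" by (simp add: arcpt_def)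
    moreover have "\<Phi> (arcpt N i (1 - t)) = dpath (w ! i) (1 - t)"
      using f jt iN by (auto simp: fill_def N_def)
    moreover have "rev (map rv w) ! j = rv (w ! i)"
      using jt by (simp add: rev_nth i_def N_def)
    ultimately show "\<Phi> (cnj (arcpt (length w) j t)) = dpath (rev (map rv w) ! j) t"
      by (simp add: dpath_rv N_def)
  qed (use f in \<open>auto simp: fill_def image_image inj_def intro!: continuous_intros\<close>)
  then show ?thesis by blast
qed

end

section \<open>The disc with boundary word \<open>d\<close>, \<open>rv d\<close> closes up to a
  sphere\<close>

lemma complex_real_sphere_homeomorphic:
  "top_of_set (sphere (0::complex \<times> real) 1) homeomorphic_space top_of_set (sphere (0::real^3) 1)"
proof -
  have "sphere (0::complex \<times> real) 1 homeomorphic sphere (0::real^3) 1"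
    by (rule homeomorphic_spheres_gen) auto
  then obtain f g where fg: "homeomorphism (sphere (0::complex \<times> real) 1) (sphere (0::real^3) 1) f g"
    unfolding homeomorphic_def by blast
  have "homeomorphic_maps (top_of_set (sphere (0::complex \<times> real) 1)) (top_of_set (sphere (0::real^3) 1)) f g"
    using fg unfolding homeomorphic_maps_def homeomorphism_def
    by (auto simp: continuous_map_in_subtopology)
  then show ?thesis unfolding homeomorphic_space_def by blast
qed

text \<open>Each vertical chord of the unit disc is wrapped once around a circle, so that exactly the
  pairs of conjugate boundary points are identified.\<close>

definition wrap_disc :: "complex \<Rightarrow> complex \<times> real" where
  "wrap_disc z = (let c = sqrt (1 - (Re z)\<^sup>2) in (complex_of_real c * cis (pi * Im z / c), Re z))"

lemma sqrt_Re_pos: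
  assumes "norm z \<le> 1"
  shows "0 \<le> 1 - (Re z)\<^sup>2" "\<bar>Im z\<bar> \<le> sqrt (1 - (Re z)\<^sup>2)"
proof -
  have "(Re z)\<^sup>2 + (Im z)\<^sup>2 \<le> 1" using assms by (simp add: cmod_def)
  then show "0 \<le> 1 - (Re z)\<^sup>2" using zero_le_power2[of "Im z"] by linarith
  have "sqrt ((Im z)\<^sup>2) \<le> sqrt (1 - (Re z)\<^sup>2)" using \<open>(Re z)\<^sup>2 + (Im z)\<^sup>2 \<le> 1\<close> by (intro real_sqrt_le_mono) simp
  then show "\<bar>Im z\<bar> \<le> sqrt (1 - (Re z)\<^sup>2)" by simp
qed

text \<open>At \<open>1\<close> and \<open>-1\<close> the chord degenerates and the angle is a
  division by zero, but there the first component is squeezed to zero by the factor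
  \<open>c\<close>.\<close>

lemma continuous_on_wrap_disc: "continuous_on (cball 0 1) wrap_disc"
proof -
  let ?c = "\<lambda>z. sqrt (1 - (Re z)\<^sup>2)"
  let ?f = "\<lambda>z. complex_of_real (?c z) * cis (pi * Im z / ?c z)"
  have cont_c: "continuous (at z within cball 0 1) ?c" for z
    unfolding continuous_within by (intro tendsto_intros)
  have "continuous (at z within cball 0 1) ?f" if z: "z \<in> cball 0 1" for z
  proof (cases "?c z = 0")
    case True
    have "((\<lambda>w. ?f w) \<longlongrightarrow> 0) (at z within cball 0 1)"
    proof (rule Lim_null_comparison)
      show "\<forall>\<^sub>F w in at z within cball 0 1. norm (?f w) \<le> \<bar>?c w\<bar>"
        by (intro always_eventually allI) (simp add: norm_mult)
      have "((\<lambda>w. \<bar>?c w\<bar>) \<longlongrightarrow> \<bar>?c z\<bar>) (at z within cball 0 1)"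
        using cont_c[of z] unfolding continuous_within by (rule tendsto_rabs)
      then show "((\<lambda>w. \<bar>?c w\<bar>) \<longlongrightarrow> 0) (at z within cball 0 1)" using True by simp
    qed
    then show ?thesis using True by (simp add: continuous_within)
  next
    case False
    then show ?thesis
      unfolding cis_conv_exp by (intro continuous_intros cont_c) auto
  qed
  then have "continuous_on (cball 0 1) ?f" by (simp add: continuous_on_eq_continuous_within)
  then have "continuous_on (cball 0 1) (\<lambda>z. (?f z, Re z))"
    by (intro continuous_on_Pair continuous_on_Re continuous_on_id)
  then show ?thesis by (simp add: wrap_disc_def[abs_def] Let_def)
qed

lemma wrap_disc_image: "wrap_disc ` cball 0 1 = sphere 0 1"
proof
  show "wrap_disc ` cball 0 1 \<subseteq> sphere 0 1"
  proof
    fix y assume "y \<in> wrap_disc ` cball 0 1"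
    then obtain z where z: "norm z \<le> 1" "y = wrap_disc z" by auto
    have "norm y = sqrt ((sqrt (1 - (Re z)\<^sup>2))\<^sup>2 + (Re z)\<^sup>2)"
      using sqrt_Re_pos[OF z(1)] by (simp add: z(2) wrap_disc_def Let_def norm_Pair norm_mult)
    also have "\<dots> = 1" using sqrt_Re_pos[OF z(1)] by simp
    finally show "y \<in> sphere 0 1" by simp
  qed
  show "sphere 0 1 \<subseteq> wrap_disc ` cball 0 1"
  proof
    fix y :: "complex \<times> real" assume "y \<in> sphere 0 1"
    then obtain w x where y: "y = (w, x)" "norm (w, x) = 1" by (cases y) auto
    then have n: "(norm w)\<^sup>2 + x\<^sup>2 = 1" by (simp add: norm_Pair real_sqrt_eq_1_iff)
    then have c: "sqrt (1 - x\<^sup>2) = norm w" by (simp add: real_sqrt_unique flip: n)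
    define z where "z = Complex x (norm w * Arg w / pi)"
    have a: "\<bar>Arg w / pi\<bar> \<le> 1" using Arg_bounded[of w] by (simp add: abs_le_iff)
    have "\<bar>norm w * Arg w / pi\<bar> \<le> norm w"
    proof -
      have "norm w * \<bar>Arg w / pi\<bar> \<le> norm w * 1" using a by (intro mult_left_mono) auto
      then show ?thesis by (simp add: abs_mult)
    qed
    then have "(norm w * Arg w / pi)\<^sup>2 \<le> (norm w)\<^sup>2" by (simp add: abs_le_square_iff[symmetric])
    then have "norm z \<le> 1" using n by (simp add: z_def cmod_def)
    moreover have "wrap_disc z = y"
    proof -
      have "complex_of_real (norm w) * cis (pi * (norm w * Arg w / pi) / norm w) = w"
      proof (cases "w = 0")
        case False
        then have "pi * (norm w * Arg w / pi) / norm w = Arg w" by simp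
        then show ?thesis using rcis_cmod_Arg[of w] by (simp add: rcis_def)
      qed auto
      then show ?thesis unfolding wrap_disc_def z_def y(1) Let_def by (simp only: complex.sel c)
    qed
    ultimately show "y \<in> wrap_disc ` cball 0 1" by (metis image_eqI mem_cball_0)
  qed
qed

lemma wrap_disc_eqD:
  assumes "wrap_disc z = wrap_disc z'" "norm z \<le> 1" "norm z' \<le> 1"
  shows "z = z' \<or> norm z = 1 \<and> norm z' = 1 \<and> Re z = Re z'"
proof -
  define c where "c = sqrt (1 - (Re z)\<^sup>2)"
  have x: "Re z = Re z'" and e: "of_real c * cis (pi * Im z / c) = of_real c * cis (pi * Im z' / c)"
    using assms(1) by (auto simp: wrap_disc_def Let_def c_def)
  have b: "\<bar>Im z\<bar> \<le> c" "\<bar>Im z'\<bar> \<le> c" "c\<^sup>2 = 1 - (Re z)\<^sup>2"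
    using sqrt_Re_pos[OF assms(2)] sqrt_Re_pos[OF assms(3)] x by (auto simp: c_def)
  show ?thesis
  proof (cases "c = 0")
    case True
    then show ?thesis using b x by (auto simp: complex_eq_iff)
  next
    case False
    then have c: "c > 0" using b by linarith
    have "cis (pi * (Im z / c)) = cis (pi * (Im z' / c))" using e False by simp
    then obtain n :: int where n: "pi * (Im z / c) = pi * (Im z' / c) + 2 * pi * n"
      using sin_cos_eq_iff[of "pi * (Im z / c)" "pi * (Im z' / c)"] by (auto simp: complex_eq_iff mult_ac)
    \<comment> \<open>Heights on the chord in units of its half length. They lie in the interval
      from \<open>-1\<close> to \<open>1\<close> and differ by an even integer, so a nonzero
      difference forces opposite ends of the chord.\<close>
    define s t where "s = Im z / c" and "t = Im z' / c"
    have st: "\<bar>s\<bar> \<le> 1" "\<bar>t\<bar> \<le> 1" using b c by (auto simp: s_def t_def)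
    have "pi * s = pi * (t + 2 * n)" using n by (simp add: s_def t_def distrib_left mult_ac)
    then have stn: "s = t + 2 * n" by simp
    then have "\<bar>real_of_int n\<bar> \<le> 1" using st by linarith
    then consider "n = 0" | "n = 1" | "n = -1" by linarith
    then show ?thesis
    proof cases
      case 1
      then have "Im z = Im z'" using stn c by (simp add: s_def t_def)
      then show ?thesis using x by (simp add: complex_eq_iff)
    next
      case 2
      then have "s = 1" "t = -1" using stn st by auto
      then have "Im z = c" "Im z' = -c" using c by (auto simp: s_def t_def field_simps)
      then show ?thesis using b x by (simp add: cmod_def)
    next
      case 3
      then have "s = -1" "t = 1" using stn st by auto
      then have "Im z = -c" "Im z' = c" using c by (auto simp: s_def t_def field_simps)
      then show ?thesis using b x by (simp add: cmod_def)
    qed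
  qed
qed

lemma wrap_disc_boundary:
  assumes "norm z = 1" "norm z' = 1" "Re z = Re z'"
  shows "wrap_disc z = wrap_disc z'"
proof -
  have "(Im z)\<^sup>2 = (Im z')\<^sup>2" using assms by (simp add: cmod_def real_sqrt_eq_1_iff)
  then have "Im z = Im z' \<or> Im z = - Im z'" using power2_eq_iff by blast
  then consider "Im z' = Im z" | "Im z' = - Im z" by linarith
  then show ?thesis
  proof cases
    case 1 then show ?thesis using assms by (simp add: wrap_disc_def)
  next
    case 2
    define c where "c = sqrt (1 - (Re z)\<^sup>2)"
    have "(Re z)\<^sup>2 + (Im z)\<^sup>2 = 1" using assms by (simp add: cmod_def real_sqrt_eq_1_iff)
    then have "1 - (Re z)\<^sup>2 = (Im z)\<^sup>2" by simp
    then have "c = \<bar>Im z\<bar>" by (simp add: c_def)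
    then have "of_real c * cis (pi * Im z / c) = of_real c * cis (pi * - Im z / c)"
      by (cases "Im z > 0"; cases "Im z = 0") (auto simp: complex_eq_iff)
    then show ?thesis using assms 2 by (simp add: wrap_disc_def Let_def c_def)
  qed
qed

context arc_system
begin

text \<open>The map \<open>\<Phi>\<close> and \<open>wrap_disc\<close> identify the same pairs of
  points, so \<open>wrap_disc\<close> descends along the quotient map \<open>\<Phi>\<close> to a
  continuous bijection from a compact space to a Hausdorff one.\<close>

lemma fill_sphere:
  assumes f: "fill [d, rv d] \<Phi>" and surj: "\<Phi> ` cball 0 1 = topspace X"
  shows "X homeomorphic_space top_of_set (sphere (0::real^3) 1)"
proof -
  let ?D = "top_of_set (cball (0::complex) 1)" and ?S = "top_of_set (sphere (0::complex \<times> real) 1)"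
  have d: "fst d \<in> E" using f by (simp add: fill_def)
  have \<Phi>: "continuous_map ?D X \<Phi>"
    "\<And>z z'. z \<in> ball 0 1 \<Longrightarrow> z' \<in> cball 0 1 \<Longrightarrow> \<Phi> z = \<Phi> z' \<Longrightarrow> z = z'"
    using f by (auto simp: fill_def disc_map_def)
  have "\<forall>j<2. \<forall>t. 0 \<le> t \<and> t \<le> 1 \<longrightarrow> \<Phi> (arcpt 2 j t) = dpath ([d, rv d] ! j) t"
    using f by (simp add: fill_def numeral_2_eq_2)
  then have l0: "\<Phi> (arcpt 2 0 t) = dpath d t" and l1: "\<Phi> (arcpt 2 1 t) = dpath d (1 - t)" if "0 \<le> t" "t \<le> 1" for t
    using that by (auto simp: dpath_rv)
  \<comment> \<open>The side \<open>d\<close> is the upper semicircle and \<open>rv d\<close> the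
    lower one run back; on both, the point with parameter \<open>t\<close> of \<open>d\<close> has
    real part \<open>cos (pi * t)\<close>. Equal labels therefore mean equal real parts.\<close>
  have lab: "\<exists>t. 0 \<le> t \<and> t \<le> 1 \<and> \<Phi> z = dpath d t \<and> Re z = cos (pi * t)" if z: "norm z = 1" for z
  proof (cases "Im z \<ge> 0")
    case True
    obtain x where x: "0 \<le> x" "x \<le> 1" "z = cis (pi * x)" using unit_upper_cis[OF z True] .
    then have "\<Phi> z = dpath d x" using l0[OF x(1,2)] by (simp add: arcpt_def)
    then show ?thesis using x by (intro exI[of _ x]) simp
  next
    case False
    have "norm (- z) = 1" "0 \<le> Im (- z)" using z False by auto
    then obtain x where x: "0 \<le> x" "x \<le> 1" "- z = cis (pi * x)" using unit_upper_cis by blast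
    have "2 * pi * (real 1 + x) / real 2 = pi + pi * x" by (simp add: field_simps)
    then have "arcpt 2 1 x = cis (pi + pi * x)" by (simp only: arcpt_def)
    also have "\<dots> = - cis (pi * x)" by (simp add: complex_eq_iff)
    also have "\<dots> = z" using x(3) by (metis minus_minus)
    finally have z1: "z = arcpt 2 1 x" by simp
    have "Re z = - cos (pi * x)" using x(3) by (metis cis.simps(1) minus_equation_iff uminus_complex.simps(1))
    also have "\<dots> = cos (pi * (1 - x))" by (simp add: right_diff_distrib)
    finally show ?thesis using x l1 z1 by (intro exI[of _ "1 - x"]) auto
  qed
  have kernel: "\<Phi> z = \<Phi> z' \<longleftrightarrow> wrap_disc z = wrap_disc z'" if zz: "z \<in> cball 0 1" "z' \<in> cball 0 1" for z z'
  proof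
    assume e: "\<Phi> z = \<Phi> z'"
    show "wrap_disc z = wrap_disc z'"
    proof (cases "norm z < 1 \<or> norm z' < 1")
      case True
      then have "z = z'"
        using \<Phi>(2)[OF _ zz(2) e] \<Phi>(2)[OF _ zz(1) e[symmetric]] by fastforce
      then show ?thesis by simp
    next
      case False
      then have n: "norm z = 1" "norm z' = 1" using zz by auto
      obtain t where t: "0 \<le> t" "t \<le> 1" "\<Phi> z = dpath d t" "Re z = cos (pi * t)" using lab[OF n(1)] by blast
      obtain t' where t': "0 \<le> t'" "t' \<le> 1" "\<Phi> z' = dpath d t'" "Re z' = cos (pi * t')" using lab[OF n(2)] by blast
      have "dpath d t = dpath d t'" using t(3) t'(3) e by metis
      then have "t = t'" using dpath_inj[OF d t(1,2) t'(1,2)] by blast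
      then have "Re z = Re z'" using t(4) t'(4) by metis
      then show ?thesis by (rule wrap_disc_boundary[OF n])
    qed
  next
    assume e: "wrap_disc z = wrap_disc z'"
    show "\<Phi> z = \<Phi> z'"
    proof (cases "z = z'")
      case False
      then have n: "norm z = 1" "norm z' = 1" "Re z = Re z'" using wrap_disc_eqD[OF e] zz by auto
      obtain t where t: "0 \<le> t" "t \<le> 1" "\<Phi> z = dpath d t" "Re z = cos (pi * t)" using lab[OF n(1)] by blast
      obtain t' where t': "0 \<le> t'" "t' \<le> 1" "\<Phi> z' = dpath d t'" "Re z' = cos (pi * t')" using lab[OF n(2)] by blast
      have "cos (pi * t) = cos (pi * t')" using t(4) t'(4) n(3) by metis
      moreover have "0 \<le> pi * t" "pi * t \<le> pi" "0 \<le> pi * t'" "pi * t' \<le> pi"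
        using t(1,2) t'(1,2) by (simp_all add: mult_left_le)
      ultimately have "pi * t = pi * t'" using cos_inj_pi by blast
      then show ?thesis using t(3) t'(3) by simp
    qed simp
  qed
  have cD: "compact_space ?D" by (simp add: compact_space_subtopology)
  have q: "quotient_map ?D X \<Phi>"
    using continuous_imp_quotient_map[OF \<Phi>(1) cD Hausdorff] surj by simp
  have s: "continuous_map ?D ?S wrap_disc"
    using continuous_on_wrap_disc wrap_disc_image by (auto simp: continuous_map_in_subtopology)
  obtain g where g: "continuous_map X ?S g" "g ` topspace X = wrap_disc ` topspace ?D"
     "\<And>z. z \<in> topspace ?D \<Longrightarrow> g (\<Phi> z) = wrap_disc z"
  proof (rule quotient_map_lift_exists[OF q s])
    show "wrap_disc z = wrap_disc z'" if "z \<in> topspace ?D" "z' \<in> topspace ?D" "\<Phi> z = \<Phi> z'" for z z'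
      using kernel that by simp
  qed (use that in blast)
  have "homeomorphic_map X ?S g"
  proof (rule continuous_imp_homeomorphic_map[OF g(1) compact])
    show "Hausdorff_space ?S" by (simp add: Hausdorff_space_subtopology)
    show "g ` topspace X = topspace ?S" using g(2) wrap_disc_image by simp
    show "inj_on g (topspace X)"
    proof (rule inj_onI)
      fix x y assume "x \<in> topspace X" "y \<in> topspace X" "g x = g y"
      then have "x \<in> \<Phi> ` cball 0 1" "y \<in> \<Phi> ` cball 0 1" by (simp_all add: surj)
      then obtain z z' where "z \<in> cball 0 1" "x = \<Phi> z" "z' \<in> cball 0 1" "y = \<Phi> z'" by blast
      then show "x = y" using g(3) kernel \<open>g x = g y\<close> by simp
    qed
  qed
  then have "X homeomorphic_space ?S" using homeomorphic_map_imp_homeomorphic_space by blast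
  then show ?thesis using complex_real_sphere_homeomorphic homeomorphic_space_trans by blast
qed

end

section \<open>Gluing two discs along a common edge\<close>

context arc_system
begin

text \<open>Both discs become half discs with the common edge as diameter, and the second is turned
  by half a revolution, which matches \<open>rv d\<close> with \<open>d\<close>. The open edge moves
  into the interior; injectivity there needs that the edge occurs nowhere else on the two
  boundaries.\<close>

lemma fill_glue:
  assumes f1: "fill (d # u) \<Phi>" and f2: "fill (rv d # v) \<Phi>'" and ne: "u \<noteq> []" "v \<noteq> []"
    and new: "fst d \<notin> fst ` set u" "fst d \<notin> fst ` set v"
    and disj: "\<Phi> ` ball 0 1 \<inter> \<Phi>' ` cball 0 1 = {}" "\<Phi>' ` ball 0 1 \<inter> \<Phi> ` cball 0 1 = {}"
  shows "\<exists>\<Psi>. fill (u @ v) \<Psi> \<and> \<Psi> ` cball 0 1 = \<Phi> ` cball 0 1 \<union> \<Phi>' ` cball 0 1 \<and>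
     \<Psi> ` ball 0 1 \<subseteq> \<Phi> ` ball 0 1 \<union> \<Phi>' ` ball 0 1 \<union> fst d \<and> fst d \<subseteq> \<Psi> ` ball 0 1"
proof -
  let ?H = upper_half_disc
  let ?q = "\<lambda>m. two_arcs (\<lambda>x. complex_of_real (2 * x - 1)) (\<lambda>x. cis (pi * x)) 1 m"
  have dE: "fst d \<in> E" and uvE: "fst ` set u \<subseteq> E" "fst ` set v \<subseteq> E" using f1 f2 by (auto simp: fill_def)
  have P1: "polygon_pieces ?H (length (d # u)) (?q (length u))"
    using half_disc_pieces[of 1 "length u"] ne by simp
  obtain A where A: "disc_map ?H A" "A ` ?H = \<Phi> ` cball 0 1" "A ` interior ?H = \<Phi> ` ball 0 1"
    "\<And>j t. j < length (d # u) \<Longrightarrow> 0 \<le> t \<Longrightarrow> t \<le> 1 \<Longrightarrow> A (?q (length u) j t) = dpath ((d # u) ! j) t"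
    using fill_to_model[OF f1 P1] by metis
  have P2: "polygon_pieces ?H (length (rv d # v)) (?q (length v))"
    using half_disc_pieces[of 1 "length v"] ne by simp
  obtain B where B: "disc_map ?H B" "B ` ?H = \<Phi>' ` cball 0 1" "B ` interior ?H = \<Phi>' ` ball 0 1"
    "\<And>j t. j < length (rv d # v) \<Longrightarrow> 0 \<le> t \<Longrightarrow> t \<le> 1 \<Longrightarrow> B (?q (length v) j t) = dpath ((rv d # v) ! j) t"
    using fill_to_model[OF f2 P2] by metis
  have A0: "A (of_real x) = dpath d ((1 + x) / 2)" if "\<bar>x\<bar> \<le> 1" for x
    using A(4)[of 0 "(1+x)/2"] that by (simp add: two_arcs_def abs_le_iff field_simps)
  have B0: "B (of_real x) = dpath d ((1 - x) / 2)" if "\<bar>x\<bar> \<le> 1" for x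
  proof -
    have 1: "1 - (1 + x)/2 = (1 - x) / 2" "2 * ((1 + x) / 2) - 1 = x" by (simp_all add: field_simps)
    have "B (complex_of_real (2 * ((1+x)/2) - 1)) = dpath d (1 - (1+x)/2)"
      using B(4)[of 0 "(1+x)/2"] that by (simp add: two_arcs_def dpath_rv abs_le_iff del: of_real_diff of_real_mult)
    then show ?thesis unfolding 1 .
  qed
  have A1: "A (cis (pi * ((real j + t) / real (length u)))) = dpath (u ! j) t"
    if "j < length u" "0 \<le> t" "t \<le> 1" for j t
    using A(4)[of "Suc j" t] that by (simp add: two_arcs_def)
  have B1: "B (cis (pi * ((real j + t) / real (length v)))) = dpath (v ! j) t"
    if "j < length v" "0 \<le> t" "t \<le> 1" for j t
    using B(4)[of "Suc j" t] that by (simp add: two_arcs_def)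
  \<comment> \<open>The round sides carry other edges, so the open edge of \<open>d\<close> is met
    on the diameter only.\<close>
  have A2: "A z \<notin> fst d" if z: "norm z = 1" "Im z \<ge> 0" for z
  proof -
    obtain x where x: "0 \<le> x" "x \<le> 1" "z = cis (pi * x)" using unit_upper_cis[OF z] .
    obtain j t where jt: "j < length u" "0 \<le> t" "t \<le> 1" "x = (real j + t) / real (length u)"
      using unit_interval_pieces[of "length u" x] x ne by auto
    have m: "u ! j \<in> set u" using jt by simp
    then have E': "fst (u ! j) \<noteq> fst d" "fst (u ! j) \<in> E" using uvE new by auto
    have "A z = dpath (u ! j) t" using A1[OF jt(1-3)] jt(4) x(3) by simp
    then have "A z \<in> V \<union> fst (u ! j)" "fst (u ! j) \<noteq> fst d" "fst (u ! j) \<in> E"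
      using dpath_mem[OF E'(2) jt(2,3)] E' by auto
    then show ?thesis using edges_disjoint[of "fst (u ! j)" "fst d"] edge_vertex_disjoint[OF dE] dE by blast
  qed
  have B2: "B z \<notin> fst d" if z: "norm z = 1" "Im z \<ge> 0" for z
  proof -
    obtain x where x: "0 \<le> x" "x \<le> 1" "z = cis (pi * x)" using unit_upper_cis[OF z] .
    obtain j t where jt: "j < length v" "0 \<le> t" "t \<le> 1" "x = (real j + t) / real (length v)"
      using unit_interval_pieces[of "length v" x] x ne by auto
    have m: "v ! j \<in> set v" using jt by simp
    then have E': "fst (v ! j) \<noteq> fst d" "fst (v ! j) \<in> E" using uvE new by auto
    have "B z = dpath (v ! j) t" using B1[OF jt(1-3)] jt(4) x(3) by simp
    then have "B z \<in> V \<union> fst (v ! j)" "fst (v ! j) \<noteq> fst d" "fst (v ! j) \<in> E"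
      using dpath_mem[OF E'(2) jt(2,3)] E' by auto
    then show ?thesis using edges_disjoint[of "fst (v ! j)" "fst d"] edge_vertex_disjoint[OF dE] dE by blast
  qed
  have real_of: "z = of_real (Re z) \<and> \<bar>Re z\<bar> \<le> norm z" if "Im z = 0" for z
    using that abs_Re_le_cmod by (auto simp: complex_eq_iff)
  have mid: "A z \<in> fst d" if "Im z = 0" "norm z < 1" for z
  proof -
    define x where "x = Re z"
    have x: "z = of_real x" "\<bar>x\<bar> < 1" using that real_of[of z] by (auto simp: x_def)
    then have "A z = dpath d ((1 + x) / 2)" using A0 by simp
    then show ?thesis using x(2) dpath_open[OF dE, of "(1+x)/2"] by (simp add: abs_less_iff)
  qed
  \<comment> \<open>The half turn \<open>z\<close> to \<open>- z\<close> sends the lower half disc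
    to the upper one and reverses the diameter, which cancels the reversal of \<open>d\<close> in
    the second word.\<close>
  define \<Psi> where "\<Psi> z = (if 0 \<le> Im z then A z else B (- z))" for z
  have agree: "A z = B (- z)" if "Im z = 0" "norm z \<le> 1" for z
    using A0[of "Re z"] B0[of "- Re z"] real_of[of z] that by auto
  have cont: "continuous_map (top_of_set (cball 0 1)) X \<Psi>"
    unfolding \<Psi>_def
  proof (rule continuous_map_cases_le)
    show "continuous_map (top_of_set (cball 0 1)) euclideanreal (\<lambda>z::complex. 0)"
      "continuous_map (top_of_set (cball 0 1)) euclideanreal Im"
      by (auto intro!: continuous_intros)
    have "{z \<in> topspace (top_of_set (cball 0 1)). 0 \<le> Im z} = ?H" by (auto simp: upper_half_disc_def)
    then show "continuous_map (subtopology (top_of_set (cball 0 1)) {z \<in> topspace (top_of_set (cball 0 1)). 0 \<le> Im z}) X A"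
      using A(1) by (simp add: disc_map_def subtopology_subtopology upper_half_disc_eq Int_absorb1 Int_absorb)
    let ?L = "cball 0 1 \<inter> {z \<in> cball 0 1. Im z \<le> 0}"
    have "continuous_map (top_of_set ?L) (top_of_set ?H) uminus"
      by (auto simp: continuous_map_in_subtopology upper_half_disc_def intro!: continuous_intros)
    moreover have "continuous_map (top_of_set ?H) X B" using B(1) by (simp add: disc_map_def)
    ultimately have "continuous_map (top_of_set ?L) X (B \<circ> uminus)" by (rule continuous_map_compose)
    then show "continuous_map (subtopology (top_of_set (cball 0 1)) {z \<in> topspace (top_of_set (cball 0 1)). Im z \<le> 0}) X (\<lambda>z. B (- z))"
      by (simp add: subtopology_subtopology comp_def)
    show "A z = B (- z)" if "z \<in> topspace (top_of_set (cball 0 1))" "0 = Im z" for z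
      using agree that by simp
  qed
  have Ainj: "z = z'" if "0 < Im z" "norm z < 1" "0 \<le> Im z'" "norm z' \<le> 1" "A z = A z'" for z z'
    using A(1) that unfolding disc_map_def interior_upper_half_disc by (auto simp: upper_half_disc_def)
  have Binj: "z = z'" if "0 < Im z" "norm z < 1" "0 \<le> Im z'" "norm z' \<le> 1" "B z = B z'" for z z'
    using B(1) that unfolding disc_map_def interior_upper_half_disc by (auto simp: upper_half_disc_def)
  have Aim: "A z \<in> \<Phi> ` ball 0 1" if "0 < Im z" "norm z < 1" for z
    using A(3) that by (auto simp: interior_upper_half_disc)
  have Bim: "B z \<in> \<Phi>' ` ball 0 1" if "0 < Im z" "norm z < 1" for z
    using B(3) that by (auto simp: interior_upper_half_disc)
  have Acl: "A z \<in> \<Phi> ` cball 0 1" "B z \<in> \<Phi>' ` cball 0 1" if "0 \<le> Im z" "norm z \<le> 1" for z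
    using A(2) B(2) that by (auto simp: upper_half_disc_def)
  have inj: "z = z'" if z: "z \<in> ball 0 1" "z' \<in> cball 0 1" "\<Psi> z = \<Psi> z'" for z z'
  proof -
    have n: "norm z < 1" "norm z' \<le> 1" using z by auto
    \<comment> \<open>Opposite signs are excluded because the interior of each disc avoids the
      closed other disc. On the diameter the map is the arc of \<open>d\<close>, which is injective
      and not met on the round sides.\<close>
    consider "Im z > 0" "Im z' \<ge> 0" | "Im z > 0" "Im z' < 0" | "Im z < 0" "Im z' > 0" | "Im z < 0" "Im z' < 0"
      | "Im z \<le> 0" "Im z' = 0" | "Im z = 0" "Im z' > 0" | "Im z = 0" "Im z' < 0"
      using linorder_less_linear[of "Im z" 0] linorder_less_linear[of "Im z'" 0] by atomize_elim auto
    then show ?thesis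
    proof cases
      case 1 then show ?thesis using Ainj[of z z'] n z by (simp add: \<Psi>_def)
    next
      case 2
      then show ?thesis using Aim[of z] Acl(2)[of "- z'"] n z disj by (auto simp: \<Psi>_def)
    next
      case 3
      then show ?thesis using Bim[of "- z"] Acl(1)[of "z'"] n z disj by (auto simp: \<Psi>_def)
    next
      case 4
      then show ?thesis using Binj[of "- z" "- z'"] n z by (simp add: \<Psi>_def)
    next
      case 5
      show ?thesis
      proof (cases "Im z = 0")
        case True
        have "A z = A z'" using 5 True z by (simp add: \<Psi>_def)
        then have "dpath d ((1 + Re z) / 2) = dpath d ((1 + Re z') / 2)"
          using A0[of "Re z"] A0[of "Re z'"] real_of[of z] real_of[of z'] True 5 n by auto
        then have "(1 + Re z) / 2 = (1 + Re z') / 2"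
          by (rule dpath_inj[OF dE, rotated -1]) (use real_of[of z] real_of[of z'] True 5 n in \<open>auto simp: abs_le_iff\<close>)
        then show ?thesis using True 5 by (simp add: complex_eq_iff)
      next
        case False
        then have "B (- z) = A z'" using 5 z by (simp add: \<Psi>_def)
        then have "B (- z) = B (- z')" using agree[of z'] 5 n by simp
        then show ?thesis using Binj[of "- z" "- z'"] 5 False n by simp
      qed
    next
      case 6
      have e: "A z' = A z" using 6 z by (simp add: \<Psi>_def)
      then have "norm z' \<noteq> 1" using A2[of z'] mid[of z] 6 n by auto
      then have "norm z' < 1" using n by simp
      then show ?thesis using Ainj[OF _ _ _ _ e] 6 n by simp
    next
      case 7
      have e: "B (- z') = B (- z)" using 7 z agree[of z] n by (simp add: \<Psi>_def)
      have "B (- z) \<in> fst d" using mid[of z] agree[of z] 7 n by simp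
      then have "norm (- z') \<noteq> 1" using B2[of "- z'"] e 7 by auto
      then have "norm (- z') < 1" using n by simp
      then have "- z' = - z" using Binj[OF _ _ _ _ e] 7 n by simp
      then show ?thesis by simp
    qed
  qed
  have dm: "disc_map (cball 0 1) \<Psi>" using cont inj by (simp add: disc_map_def)
  have Q: "polygon_pieces (cball 0 1) (length (u @ v)) (two_arcs (\<lambda>x. cis (pi * x)) (\<lambda>x. - cis (pi * x)) (length u) (length v))"
    using circle_pieces[of "length u" "length v"] ne by simp
  have lab: "\<Psi> (two_arcs (\<lambda>x. cis (pi * x)) (\<lambda>x. - cis (pi * x)) (length u) (length v) j t) = dpath ((u @ v) ! j) t"
    if jt: "j < length (u @ v)" "0 \<le> t" "t \<le> 1" for j t
  proof (cases "j < length u")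
    case True
    have le: "(real j + t) / real (length u) \<le> 1"
    proof -
      have "real j + 1 \<le> real (length u)" using True by linarith
      then show ?thesis using jt ne by (simp add: field_simps)
    qed
    have "0 \<le> sin (pi * ((real j + t) / real (length u)))"
      using le jt by (intro sin_ge_zero mult_left_le) auto
    then show ?thesis using A1[OF True jt(2,3)] True by (simp add: two_arcs_def \<Psi>_def nth_append)
  next
    case False
    define i where "i = j - length u"
    have i: "i < length v" using False jt by (auto simp: i_def)
    have le: "(real i + t) / real (length v) \<le> 1"
    proof -
      have "real i + 1 \<le> real (length v)" using i by linarith
      then show ?thesis using jt ne by (simp add: field_simps)
    qed
    define z where "z = cis (pi * ((real i + t) / real (length v)))"
    have "0 \<le> Im z" unfolding z_def cis.simps
      using le jt by (intro sin_ge_zero mult_left_le) auto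
    then have "\<Psi> (- z) = B z" using agree[of "- z"] by (cases "Im z = 0") (auto simp: \<Psi>_def z_def)
    then show ?thesis using B1[OF i jt(2,3)] False by (simp add: two_arcs_def z_def nth_append flip: i_def)
  qed
  obtain \<Omega> where \<Omega>: "fill (u @ v) \<Omega>" "\<Omega> ` cball 0 1 = \<Psi> ` cball 0 1" "\<Omega> ` ball 0 1 = \<Psi> ` interior (cball 0 1)"
    by (rule model_to_fill[OF dm Q _ lab]) (use uvE in auto)
  have "\<Psi> ` cball 0 1 = \<Phi> ` cball 0 1 \<union> \<Phi>' ` cball 0 1"
  proof
    show "\<Psi> ` cball 0 1 \<subseteq> \<Phi> ` cball 0 1 \<union> \<Phi>' ` cball 0 1"
      using Acl by (auto simp: \<Psi>_def)
    have "A z \<in> \<Psi> ` cball 0 1" if "z \<in> ?H" for z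
      using that by (intro image_eqI[of _ _ z]) (auto simp: \<Psi>_def upper_half_disc_def)
    moreover have "B z \<in> \<Psi> ` cball 0 1" if "z \<in> ?H" for z
      using that agree[of "- z"]
      by (intro image_eqI[of _ _ "- z"]) (auto simp: \<Psi>_def upper_half_disc_def)
    ultimately show "\<Phi> ` cball 0 1 \<union> \<Phi>' ` cball 0 1 \<subseteq> \<Psi> ` cball 0 1"
      unfolding A(2)[symmetric] B(2)[symmetric] by blast
  qed
  moreover have "\<Psi> ` ball 0 1 \<subseteq> \<Phi> ` ball 0 1 \<union> \<Phi>' ` ball 0 1 \<union> fst d"
  proof
    fix y assume "y \<in> \<Psi> ` ball 0 1"
    then obtain z where z: "norm z < 1" "y = \<Psi> z" by auto
    consider "Im z > 0" | "Im z = 0" | "Im z < 0" by linarith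
    then show "y \<in> \<Phi> ` ball 0 1 \<union> \<Phi>' ` ball 0 1 \<union> fst d"
      by cases (use Aim[of z] mid[of z] Bim[of "- z"] z in \<open>auto simp: \<Psi>_def\<close>)
  qed
  moreover have "fst d \<subseteq> \<Psi> ` ball 0 1"
  proof
    fix y assume "y \<in> fst d"
    then have "y \<in> dpath d ` {0<..<1}" using dpath_image_open[OF dE] by simp
    then obtain t where t: "0 < t" "t < 1" "y = dpath d t" by auto
    have "\<Psi> (of_real (2 * t - 1)) = dpath d ((1 + (2 * t - 1)) / 2)"
      unfolding \<Psi>_def using A0[of "2 * t - 1"] t by (simp add: abs_le_iff del: of_real_diff of_real_mult)
    then have "y = \<Psi> (of_real (2 * t - 1))" using t(3) by simp
    moreover have "complex_of_real (2 * t - 1) \<in> ball 0 1"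
      using t by (simp add: abs_less_iff del: of_real_diff of_real_mult)
    ultimately show "y \<in> \<Psi> ` ball 0 1" by blast
  qed
  ultimately show ?thesis using \<Omega> by (intro exI[of _ \<Omega>]) simp
qed

end

section \<open>Folding two adjacent inverse sides of a disc\<close>

text \<open>The branch of the root with values in the closed upper half plane: a right inverse of
  squaring on the half disc, discontinuous only across the ray that comes from the diameter.\<close>

lemma square_root_upper:
  fixes z :: complex
  defines "s \<equiv> \<i> * csqrt (- z)"
  shows "s\<^sup>2 = z" "0 \<le> Im s" "norm s = sqrt (norm z)"
proof -
  show "s\<^sup>2 = z" by (simp add: s_def power_mult_distrib)
  then have "(norm s)\<^sup>2 = norm z" by (metis norm_power)
  then show "norm s = sqrt (norm z)" by (metis norm_ge_zero real_sqrt_unique)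
  show "0 \<le> Im s" using Re_csqrt[of "- z"] by (simp add: s_def)
qed

lemma compact_upper_half_disc: "compact upper_half_disc"
  using closed_upper_half_disc compact_Int_closed[of "cball 0 1" upper_half_disc]
  by (simp add: upper_half_disc_eq Int_absorb1)

lemma (in arc_system) preimage_contains_near:
  assumes c: "continuous_map (top_of_set (cball (0::complex) 1)) X \<Phi>" and U: "openin X U" "\<Phi> z \<in> U" "norm z \<le> 1"
  obtains e where "e > 0" "\<And>w. norm w \<le> 1 \<Longrightarrow> dist z w < e \<Longrightarrow> \<Phi> w \<in> U"
proof -
  have "openin (top_of_set (cball 0 1)) {w \<in> topspace (top_of_set (cball 0 1)). \<Phi> w \<in> U}"
    using openin_continuous_map_preimage[OF c U(1)] .
  then obtain T where T: "open T" "{w \<in> cball 0 1. \<Phi> w \<in> U} = cball 0 1 \<inter> T"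
    by (auto simp: openin_open)
  then have "z \<in> T" using U by auto
  then obtain e where e: "e > 0" "ball z e \<subseteq> T" using T(1) openE by blast
  show ?thesis
  proof (rule that[OF e(1)])
    fix w :: complex assume "norm w \<le> 1" "dist z w < e"
    then have "w \<in> cball 0 1 \<inter> T" using e(2) by auto
    then show "\<Phi> w \<in> U" using T(2) by blast
  qed
qed

context arc_system
begin

text \<open>If the tip were identified with a boundary point of the disc, the image of a small disc around
  the tip and the rest of \<open>X\<close> would separate every punctured neighbourhood of the tip.\<close>

lemma tip_not_identified:
  assumes c: "continuous_map (top_of_set (cball (0::complex) 1)) X \<Phi>"
    and inj: "\<And>z z'. \<lbrakk>norm z < 1; z \<noteq> 0; norm z' \<le> 1; \<Phi> z = \<Phi> z'\<rbrakk> \<Longrightarrow> z = z'"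
    and z': "norm z' = 1"
  shows "\<Phi> z' \<noteq> \<Phi> 0"
proof
  assume e: "\<Phi> z' = \<Phi> 0"
  define v where "v = \<Phi> 0"
  have vX: "v \<in> topspace X" using c by (auto simp: continuous_map_def v_def)
  have cl: "closedin X (\<Phi> ` T)" if "closed T" "T \<subseteq> cball 0 1" for T
  proof (rule compactin_imp_closedin[OF Hausdorff])
    have "compact T" using that by (meson bounded_cball bounded_subset compact_eq_bounded_closed)
    then have "compactin (top_of_set (cball 0 1)) T" using that by (simp add: compactin_subtopology)
    then show "compactin X (\<Phi> ` T)" using c image_compactin by blast
  qed
  have inj': "\<Phi> z \<noteq> v" if "z \<noteq> 0" "norm z < 1" for z
    using inj[of z 0] that by (auto simp: v_def)
  \<comment> \<open>The image of this circle misses \<open>v\<close>, so a small neighbourhood of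
    \<open>v\<close> avoids it and, without \<open>v\<close>, falls apart into the inner part
    \<open>A\<close> and the outer part \<open>B\<close>.\<close>
  have "sphere (0::complex) (1/2) \<subseteq> cball 0 1" by auto
  then have "openin X (topspace X - \<Phi> ` sphere 0 (1/2))" using cl[of "sphere 0 (1/2)"]
    by (intro openin_diff openin_topspace) simp
  moreover have "v \<in> topspace X - \<Phi> ` sphere 0 (1/2)"
  proof -
    have "v \<noteq> \<Phi> z" if "z \<in> sphere 0 (1/2)" for z using inj'[of z] that by force
    then show ?thesis using vX by blast
  qed
  ultimately obtain U where U: "openin X U" "v \<in> U" "U \<subseteq> topspace X - \<Phi> ` sphere 0 (1/2)"
      "connectedin X (U - {v})"
    using surface_punctured_nbhd[OF surface] by metis
  define A where "A = \<Phi> ` (ball 0 (1/2) - {0})"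
  define B where "B = topspace X - \<Phi> ` cball 0 (1/2)"
  have "openin X A" unfolding A_def
  proof (rule surface_invariance_of_domain[OF surface])
    show "open (ball (0::complex) (1/2) - {0})" by auto
    show "continuous_map (top_of_set (ball 0 (1/2) - {0})) X \<Phi>"
      by (rule continuous_map_from_subtopology_mono[OF c]) auto
    show "inj_on \<Phi> (ball 0 (1/2) - {0})" using inj by (auto simp: inj_on_def)
  qed
  moreover have "cball (0::complex) (1/2) \<subseteq> cball 0 1" by (auto simp: subset_iff)
  then have "openin X B" unfolding B_def using cl[of "cball 0 (1/2)"]
    by (intro openin_diff openin_topspace) simp
  moreover have "U - {v} \<subseteq> A \<union> B"
  proof
    fix x assume x: "x \<in> U - {v}"
    then have xX: "x \<in> topspace X" "x \<notin> \<Phi> ` sphere 0 (1/2)" using U by auto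
    show "x \<in> A \<union> B"
    proof (cases "x \<in> \<Phi> ` cball 0 (1/2)")
      case True
      then obtain z where z: "norm z \<le> 1/2" "x = \<Phi> z" by auto
      then have "norm z \<noteq> 1/2" "z \<noteq> 0" using xX x by (auto simp: v_def)
      then show ?thesis using z by (auto simp: A_def)
    qed (use xX in \<open>auto simp: B_def\<close>)
  qed
  moreover have "A \<inter> B = {}" by (auto simp: A_def B_def)
  moreover have "A \<inter> (U - {v}) \<noteq> {}"
  proof -
    obtain e where e: "e > 0" "\<And>w. norm w \<le> 1 \<Longrightarrow> dist 0 w < e \<Longrightarrow> \<Phi> w \<in> U"
      using preimage_contains_near[OF c U(1), of 0] U(2) by (auto simp: v_def)
    define w where "w = complex_of_real (min (e/2) (1/4))"
    have w: "norm w < 1/2" "w \<noteq> 0" "norm w < e" using e(1) by (auto simp: w_def min_def)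
    then have "\<Phi> w \<in> A \<inter> (U - {v})" using e(2)[of w] inj'[of w] by (auto simp: A_def)
    then show ?thesis by blast
  qed
  \<comment> \<open>Points slightly inside the disc next to \<open>z'\<close> are mapped close to
    \<open>v\<close>, yet by injectivity not into the image of the inner disc.\<close>
  moreover have "B \<inter> (U - {v}) \<noteq> {}"
  proof -
    obtain e where e: "e > 0" "\<And>w. norm w \<le> 1 \<Longrightarrow> dist z' w < e \<Longrightarrow> \<Phi> w \<in> U"
      using preimage_contains_near[OF c U(1), of z'] U(2) z' \<open>\<Phi> z' = \<Phi> 0\<close> by (auto simp: v_def)
    define r where "r = 1 - min (e/2) (1/4)"
    define w where "w = r *\<^sub>R z'"
    have r: "1/2 < r" "r < 1" "1 - r < e" using e(1) by (auto simp: r_def min_def)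
    have w: "norm w = r" "dist z' w = 1 - r"
    proof -
      show "norm w = r" using z' r by (simp add: w_def)
      have "z' - w = (1 - r) *\<^sub>R z'" by (simp add: w_def scaleR_diff_left)
      then show "dist z' w = 1 - r" using z' r by (simp add: dist_norm)
    qed
    have "w \<noteq> 0" using w(1) r by auto
    have "\<Phi> w \<notin> \<Phi> ` cball 0 (1/2)"
    proof
      assume "\<Phi> w \<in> \<Phi> ` cball 0 (1/2)"
      then obtain y where y: "norm y \<le> 1/2" "\<Phi> w = \<Phi> y" by auto
      then have "w = y" using inj[of w y] w r \<open>w \<noteq> 0\<close> by auto
      then show False using y w r by simp
    qed
    moreover have "\<Phi> w \<in> U" using e(2) w r by simp
    ultimately have "\<Phi> w \<in> B \<inter> (U - {v})"
      using inj'[of w] w r U(3) \<open>w \<noteq> 0\<close> by (auto simp: B_def)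
    then show ?thesis by blast
  qed
  ultimately show False using U(4) unfolding connectedin by blast
qed

text \<open>With \<open>d\<close> and \<open>rv d\<close> on the two halves of the diameter, the map
  is even there, so it factors through squaring. Squaring zips the diameter up to a radius and
  spreads the half disc over the whole disc, whose boundary then reads \<open>u\<close>.\<close>

lemma fill_fold:
  assumes f: "fill (d # rv d # u) \<Phi>" and u: "u \<noteq> []" "fst d \<notin> fst ` set u"
  shows "\<exists>\<Psi>. fill u \<Psi> \<and> \<Psi> ` cball 0 1 = \<Phi> ` cball 0 1"
proof -
  let ?H = upper_half_disc and ?m = "length u"
  let ?q = "two_arcs (\<lambda>x. complex_of_real (2 * x - 1)) (\<lambda>x. cis (pi * x)) 2 ?m"
  have dE: "fst d \<in> E" and uE: "fst ` set u \<subseteq> E" using f by (auto simp: fill_def)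
  have P: "polygon_pieces ?H (length (d # rv d # u)) ?q"
    using half_disc_pieces[of 2 ?m] u by simp
  obtain A where A: "disc_map ?H A" "A ` ?H = \<Phi> ` cball 0 1"
    "\<And>j t. j < length (d # rv d # u) \<Longrightarrow> 0 \<le> t \<Longrightarrow> t \<le> 1 \<Longrightarrow> A (?q j t) = dpath ((d # rv d # u) ! j) t"
    using fill_to_model[OF f P] by metis
  have Al: "A (of_real (t - 1)) = dpath d t" if "0 \<le> t" "t \<le> 1" for t
  proof -
    have "2 * ((real 0 + t) / real 2) - 1 = t - 1" by simp
    moreover have "A (complex_of_real (2 * ((real 0 + t) / real 2) - 1)) = dpath d t"
      using A(3)[of 0 t] that by (simp add: two_arcs_def)
    ultimately show ?thesis by metis
  qed
  have Ar: "A (of_real t) = dpath d (1 - t)" if "0 \<le> t" "t \<le> 1" for t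
  proof -
    have "2 * ((real 1 + t) / real 2) - 1 = t" by (simp add: field_simps)
    moreover have "A (complex_of_real (2 * ((real 1 + t) / real 2) - 1)) = dpath d (1 - t)"
      using A(3)[of 1 t] that by (simp add: two_arcs_def dpath_rv)
    ultimately show ?thesis by metis
  qed
  have A0: "A (of_real x) = dpath d (1 - \<bar>x\<bar>)" if "\<bar>x\<bar> \<le> 1" for x
    using Al[of "1 + x"] Ar[of x] that by (cases "x \<ge> 0") auto
  have A1: "A (cis (pi * ((real j + t) / real ?m))) = dpath (u ! j) t"
    if "j < ?m" "0 \<le> t" "t \<le> 1" for j t
    using A(3)[of "Suc (Suc j)" t] that by (simp add: two_arcs_def)
  have A2: "A z \<notin> fst d" if z: "norm z = 1" "Im z \<ge> 0" for z
  proof -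
    obtain x where x: "0 \<le> x" "x \<le> 1" "z = cis (pi * x)" using unit_upper_cis[OF z] .
    obtain j t where jt: "j < ?m" "0 \<le> t" "t \<le> 1" "x = (real j + t) / real ?m"
      using unit_interval_pieces[of ?m x] x u by auto
    have m: "u ! j \<in> set u" using jt by simp
    then have E': "fst (u ! j) \<noteq> fst d" "fst (u ! j) \<in> E" using uE u by auto
    have "A z = dpath (u ! j) t" using A1[OF jt(1-3)] jt(4) x(3) by simp
    then have "A z \<in> V \<union> fst (u ! j)" "fst (u ! j) \<noteq> fst d" "fst (u ! j) \<in> E"
      using dpath_mem[OF E'(2) jt(2,3)] E' by auto
    then show ?thesis using edges_disjoint[of "fst (u ! j)" "fst d"] edge_vertex_disjoint[OF dE] dE by blast
  qed
  have Ac: "continuous_map (top_of_set ?H) X A" and Ainj: "\<And>z z'. \<lbrakk>0 < Im z; norm z < 1; z' \<in> ?H; A z = A z'\<rbrakk> \<Longrightarrow> z = z'"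
    using A(1) unfolding disc_map_def interior_upper_half_disc by auto
  define s where "s z = \<i> * csqrt (- z)" for z :: complex
  have s: "(s z)\<^sup>2 = z" "0 \<le> Im (s z)" "norm (s z) = sqrt (norm z)" for z
    using square_root_upper[of z] by (auto simp: s_def)
  have real_of: "z = of_real (Re z) \<and> \<bar>Re z\<bar> \<le> norm z" if "Im z = 0" for z
    using that abs_Re_le_cmod by (auto simp: complex_eq_iff)
  define \<Psi> where "\<Psi> z = A (s z)" for z
  have sH: "s z \<in> ?H" if "norm z \<le> 1" for z using s[of z] that by (simp add: upper_half_disc_def)
  have sq: "\<Psi> (z\<^sup>2) = A z" if z: "z \<in> ?H" for z
  proof -
    have "(s (z\<^sup>2))\<^sup>2 = z\<^sup>2" by (rule s(1))
    then consider "s (z\<^sup>2) = z" | "s (z\<^sup>2) = - z" using power2_eq_iff by blast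
    then show ?thesis
    proof cases
      case 2
      then have "Im z = 0" using s(2)[of "z\<^sup>2"] z by (simp add: upper_half_disc_def)
      define x where "x = Re z"
      have x: "z = of_real x" "\<bar>x\<bar> \<le> 1" using real_of[OF \<open>Im z = 0\<close>] z by (auto simp: x_def upper_half_disc_def)
      have "s (z\<^sup>2) = of_real (- x)" using 2 x by simp
      then have "\<Psi> (z\<^sup>2) = dpath d (1 - \<bar>- x\<bar>)" unfolding \<Psi>_def using A0[of "- x"] x(2) by simp
      also have "\<dots> = A z" using A0[OF x(2)] x(1) by simp
      finally show ?thesis .
    qed (simp add: \<Psi>_def)
  qed
  \<comment> \<open>The chosen root jumps across the seam, so continuity of \<open>\<Psi>\<close> is
    obtained by descending along the squaring map instead.\<close>
  have q: "quotient_map (top_of_set ?H) (top_of_set (cball 0 1)) (\<lambda>z. z\<^sup>2)"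
  proof (rule continuous_imp_quotient_map)
    show "continuous_map (top_of_set ?H) (top_of_set (cball 0 1)) (\<lambda>z::complex. z\<^sup>2)"
      by (auto simp: continuous_map_in_subtopology upper_half_disc_def norm_power power_le_one intro!: continuous_intros)
    show "compact_space (top_of_set ?H)" using compact_upper_half_disc by (simp add: compact_space_subtopology)
    show "Hausdorff_space (top_of_set (cball (0::complex) 1))" by (simp add: Hausdorff_space_subtopology)
    have "z \<in> (\<lambda>z. z\<^sup>2) ` ?H" if "norm z \<le> 1" for z
      using s(1)[of z] sH[OF that] by (metis image_eqI)
    then show "(\<lambda>z. z\<^sup>2) ` topspace (top_of_set ?H) = topspace (top_of_set (cball (0::complex) 1))"
      by (auto simp: upper_half_disc_def norm_power power_le_one)
  qed
  have "continuous_map (top_of_set ?H) X (\<Psi> \<circ> (\<lambda>z. z\<^sup>2))"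
    by (rule continuous_map_eq[OF Ac]) (simp add: sq)
  then have cont: "continuous_map (top_of_set (cball 0 1)) X \<Psi>"
    using continuous_compose_quotient_map[OF q] by blast
  have inj0: "z = z'" if z: "norm z < 1" "z \<noteq> 0" "norm z' \<le> 1" "\<Psi> z = \<Psi> z'" for z z'
  proof -
    have e: "A (s z) = A (s z')" using z by (simp add: \<Psi>_def)
    have n: "norm (s z) < 1" "norm (s z') \<le> 1" "s z \<noteq> 0" "0 \<le> Im (s z)" "0 \<le> Im (s z')"
      using z s by (auto simp: power2_eq_square)
        (metis s(1) zero_power2)
    have "(s z)\<^sup>2 = (s z')\<^sup>2"
    proof (cases "0 < Im (s z)")
      case True
      then show ?thesis using Ainj[OF True n(1) sH[OF z(3)] e] by simp
    next
      case False
      define x where "x = Re (s z)"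
      have im: "Im (s z) = 0" using False n by simp
      have x: "s z = of_real x" "\<bar>x\<bar> < 1" "x \<noteq> 0"
        using real_of[OF im] n by (auto simp: x_def)
      have m: "A (s z) \<in> fst d" using x A0[of x] dpath_open[OF dE, of "1 - \<bar>x\<bar>"] by simp
      have n1: "norm (s z') \<noteq> 1" using A2[of "s z'"] e m n by metis
      show ?thesis
      proof (cases "0 < Im (s z')")
        case True
        have "s z' = s z"
          by (rule Ainj[OF True _ sH]) (use n n1 z e in auto)
        then show ?thesis by simp
      next
        case False
        then have im': "Im (s z') = 0" using n by simp
        define x' where "x' = Re (s z')"
        have x': "s z' = of_real x'" "\<bar>x'\<bar> \<le> 1" using real_of[OF im'] n by (auto simp: x'_def)
        have "dpath d (1 - \<bar>x\<bar>) = dpath d (1 - \<bar>x'\<bar>)" using A0[of x] A0[of x'] x x' e by simp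
        then have "1 - \<bar>x\<bar> = 1 - \<bar>x'\<bar>" by (rule dpath_inj[OF dE, rotated -1]) (use x x' in auto)
        then have "x\<^sup>2 = x'\<^sup>2" using power2_abs by (metis diff_left_imp_eq eq_iff_diff_eq_0 power2_abs add_left_cancel diff_add_cancel)
        then show ?thesis using x(1) x'(1) by (metis of_real_power)
      qed
    qed
    then show ?thesis using s(1) by simp
  qed
  have inj: "z = z'" if z: "z \<in> ball 0 1" "z' \<in> cball 0 1" "\<Psi> z = \<Psi> z'" for z z'
  proof (cases "z = 0")
    case False
    then show ?thesis using inj0[of z z'] z by simp
  next
    case True
    \<comment> \<open>The centre is the folded end of \<open>d\<close>. Injectivity there is not
      inherited from \<open>A\<close>, because this end is a vertex, which might recur on the
      remaining boundary.\<close>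
    have tip: "\<Psi> z' \<noteq> \<Psi> 0" if "norm z' = 1"
    proof (rule tip_not_identified[OF cont _ that])
      show "x = y" if "norm x < 1" "x \<noteq> 0" "norm y \<le> 1" "\<Psi> x = \<Psi> y" for x y
        using inj0 that by blast
    qed
    then have "norm z' \<noteq> 1" using z(3) True by metis
    then have "norm z' < 1" using z(2) by simp
    then show ?thesis using inj0[of z' z] z True by (cases "z' = 0") auto
  qed
  have "disc_map (cball 0 1) \<Psi>" using cont inj by (simp add: disc_map_def)
  moreover have "\<Psi> (arcpt ?m j t) = dpath (u ! j) t" if jt: "j < ?m" "0 \<le> t" "t \<le> 1" for j t
  proof -
    define x where "x = (real j + t) / real ?m"
    have "real j + 1 \<le> real ?m" using jt by linarith
    then have x: "0 \<le> x" "x \<le> 1" using jt u by (auto simp: x_def field_simps)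
    have "arcpt ?m j t = (cis (pi * x))\<^sup>2" by (simp add: arcpt_def x_def cis_mult power2_eq_square mult.assoc)
    moreover have "0 \<le> sin (pi * x)" using x by (intro sin_ge_zero mult_left_le) auto
    then have "cis (pi * x) \<in> ?H" by (simp add: upper_half_disc_def)
    ultimately show ?thesis using sq A1[OF jt] by (simp add: x_def)
  qed
  ultimately have "fill u \<Psi>" using u uE by (simp add: fill_def)
  moreover have "\<Psi> ` cball 0 1 = A ` ?H"
  proof
    show "\<Psi> ` cball 0 1 \<subseteq> A ` ?H" using sH by (auto simp: \<Psi>_def)
    show "A ` ?H \<subseteq> \<Psi> ` cball 0 1"
    proof
      fix y assume "y \<in> A ` ?H"
      then obtain z where z: "z \<in> ?H" "y = A z" by blast
      then have "y = \<Psi> (z\<^sup>2)" "z\<^sup>2 \<in> cball 0 1"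
        using sq by (auto simp: upper_half_disc_def norm_power power_le_one)
      then show "y \<in> \<Psi> ` cball 0 1" by blast
    qed
  qed
  ultimately show ?thesis using A(2) by metis
qed

end

section \<open>Local combinatorics of a polygonal subdivision\<close>

locale subdivided_surface =
  fixes X :: "'a topology" and V :: "'a set" and E F :: "'a set set"
  assumes surf: "closed_surface X" and conn: "connected_space X" and poly: "polygonal_subdivision X V E F"
begin

lemma finites: "finite V" "finite E" "finite F"
  and part: "partition_on (topspace X) ((\<lambda>v. {v}) ` V \<union> E \<union> F)"
  and edge_map: "e \<in> E \<Longrightarrow> \<exists>\<phi> :: real \<Rightarrow> 'a. characteristic_map X V e \<phi>"
  using poly by (auto simp: polygonal_subdivision_def cellular_decomposition_def)

lemma Haus: "Hausdorff_space X" and comp: "compact_space X"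
  using surf by (auto simp: closed_surface_def)

lemma cells_disjoint:
  "e \<in> E \<Longrightarrow> f \<in> E \<Longrightarrow> e \<noteq> f \<Longrightarrow> e \<inter> f = {}"
  "e \<in> F \<Longrightarrow> f \<in> F \<Longrightarrow> e \<noteq> f \<Longrightarrow> e \<inter> f = {}"
  using disjointD[OF partition_onD2[OF part]] by simp_all

lemma cells_sub: "V \<subseteq> topspace X" "e \<in> E \<Longrightarrow> e \<subseteq> topspace X" "f \<in> F \<Longrightarrow> f \<subseteq> topspace X"
  and cells_cover: "x \<in> topspace X \<Longrightarrow> x \<in> V \<or> (\<exists>e\<in>E. x \<in> e) \<or> (\<exists>f\<in>F. x \<in> f)"
  and cells_nonempty: "e \<in> E \<Longrightarrow> e \<noteq> {}" "f \<in> F \<Longrightarrow> f \<noteq> {}"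
proof -
  have u: "\<Union> ((\<lambda>v. {v}) ` V \<union> E \<union> F) = topspace X" using partition_onD1[OF part] by simp
  then show "V \<subseteq> topspace X" "e \<in> E \<Longrightarrow> e \<subseteq> topspace X" "f \<in> F \<Longrightarrow> f \<subseteq> topspace X" by auto
  show "x \<in> topspace X \<Longrightarrow> x \<in> V \<or> (\<exists>e\<in>E. x \<in> e) \<or> (\<exists>f\<in>F. x \<in> f)" unfolding u[symmetric] by auto
  show "e \<in> E \<Longrightarrow> e \<noteq> {}" "f \<in> F \<Longrightarrow> f \<noteq> {}" using partition_onD3[OF part] by auto
qed

lemma closed_disc_image:
  fixes \<phi> :: "'b::euclidean_space \<Rightarrow> 'a"
  assumes "continuous_map (top_of_set (cball 0 1)) X \<phi>"
  shows "closedin X (\<phi> ` cball 0 1)"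
proof (rule compactin_imp_closedin[OF Haus])
  have "compactin (top_of_set (cball 0 1)) (cball (0::'b) 1)" by (simp add: compactin_subtopology)
  then show "compactin X (\<phi> ` cball 0 1)" using assms image_compactin by blast
qed

lemma edge_closure: "e \<in> E \<Longrightarrow> X closure_of e \<subseteq> e \<union> V"
proof -
  assume e: "e \<in> E"
  obtain \<phi> :: "real \<Rightarrow> 'a" where \<phi>: "characteristic_map X V e \<phi>" using edge_map[OF e] by blast
  have c: "closedin X (\<phi> ` cball 0 1)" using \<phi> closed_disc_image by (auto simp: characteristic_map_def)
  have "\<phi> ` ball 0 1 = topspace (subtopology X e)"
    using \<phi> homeomorphic_imp_surjective_map unfolding characteristic_map_def by force
  then have im: "\<phi> ` ball 0 1 = e" using cells_sub(2)[OF e] by auto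
  have "cball (0::real) 1 = ball 0 1 \<union> sphere 0 1" by auto
  then have sub: "e \<subseteq> \<phi> ` cball 0 1" "\<phi> ` cball 0 1 \<subseteq> e \<union> V"
    using \<phi> im by (auto simp: characteristic_map_def)
  then show ?thesis using closure_of_minimal[OF sub(1) c] by blast
qed

definition polygon_map :: "'a set \<Rightarrow> nat \<Rightarrow> (complex \<Rightarrow> 'a) \<Rightarrow> bool" where
  "polygon_map f k \<phi> \<longleftrightarrow> k \<ge> 2 \<and> homeomorphic_map (top_of_set (cball 0 1)) (subtopology X (X closure_of f)) \<phi> \<and>
     \<phi> ` ball 0 1 = f \<and> (\<forall>j<k. \<phi> (arcpt k j 0) \<in> V \<and> (\<lambda>t. \<phi> (arcpt k j t)) ` {0<..<1} \<in> E)"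

lemma arcpt_open_image:
  assumes "0 < k"
  shows "arcpt k j ` {0<..<1} = cis ` {2 * pi * real j / real k <..< 2 * pi * real (Suc j) / real k}"
proof
  have k: "real k > 0" using assms by simp
  show "arcpt k j ` {0<..<1} \<subseteq> cis ` {2 * pi * real j / real k <..< 2 * pi * real (Suc j) / real k}"
    using k by (auto simp: arcpt_def divide_strict_right_mono)
  show "cis ` {2 * pi * real j / real k <..< 2 * pi * real (Suc j) / real k} \<subseteq> arcpt k j ` {0<..<1}"
  proof
    fix y assume "y \<in> cis ` {2 * pi * real j / real k <..< 2 * pi * real (Suc j) / real k}"
    then obtain x where x: "2 * pi * real j / real k < x" "x < 2 * pi * real (Suc j) / real k" "y = cis x" by auto
    define t where "t = x * real k / (2*pi) - real j"
    have "2 * pi * (real j + t) / real k = x" using k by (simp add: t_def field_simps)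
    then have "y = arcpt k j t" using x by (simp add: arcpt_def)
    moreover have "0 < t" "t < 1" using x k by (auto simp: t_def field_simps)
    ultimately show "y \<in> arcpt k j ` {0<..<1}" by auto
  qed
qed

lemma polygon_map_exists: "f \<in> F \<Longrightarrow> \<exists>k \<phi>. polygon_map f k \<phi>"
proof -
  assume "f \<in> F"
  then obtain k where k: "k \<ge> 2" "embedded_polygon X V E f k"
    using poly by (auto simp: polygonal_subdivision_def)
  then obtain \<phi> :: "complex \<Rightarrow> 'a" where \<phi>:
    "homeomorphic_map (top_of_set (cball 0 1)) (subtopology X (X closure_of f)) \<phi>" "\<phi> ` ball 0 1 = f"
    "\<And>j. j < k \<Longrightarrow> \<phi> (cis (2 * pi * real j / real k)) \<in> V \<and>
               \<phi> ` cis ` {2 * pi * real j / real k <..< 2 * pi * real (Suc j) / real k} \<in> E"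
    unfolding embedded_polygon_def by blast
  have "(\<lambda>t. \<phi> (arcpt k j t)) ` {0<..<1} = \<phi> ` cis ` {2 * pi * real j / real k <..< 2 * pi * real (Suc j) / real k}" for j
  proof -
    have "(\<lambda>t. \<phi> (arcpt k j t)) ` {0<..<1} = \<phi> ` (arcpt k j ` {0<..<1})" by (simp only: image_image)
    then show ?thesis using arcpt_open_image[of k j] k by simp
  qed
  then have "polygon_map f k \<phi>" unfolding polygon_map_def using k \<phi> by (simp add: arcpt_def)
  then show ?thesis by blast
qed

lemma polygon_mapD:
  assumes "polygon_map f k \<phi>"
  shows "continuous_map (top_of_set (cball 0 1)) X \<phi>" "inj_on \<phi> (cball 0 1)" "\<phi> ` cball 0 1 = X closure_of f"
    "\<phi> ` ball 0 1 = f" "k \<ge> 2" "\<And>j. j < k \<Longrightarrow> \<phi> (arcpt k j 0) \<in> V" "\<And>j. j < k \<Longrightarrow> \<phi> (arcpt k j 1) \<in> V"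
    "\<And>j. j < k \<Longrightarrow> (\<lambda>t. \<phi> (arcpt k j t)) ` {0<..<1} \<in> E"
    "closedin X (X closure_of f)"
    "continuous_map (subtopology X (X closure_of f)) (top_of_set (cball 0 1)) (inv_into (cball 0 1) \<phi>)"
proof -
  have h: "homeomorphic_map (top_of_set (cball 0 1)) (subtopology X (X closure_of f)) \<phi>"
    using assms by (simp add: polygon_map_def)
  show "continuous_map (top_of_set (cball 0 1)) X \<phi>"
    using h homeomorphic_imp_continuous_map continuous_map_into_fulltopology by blast
  show inj: "inj_on \<phi> (cball 0 1)" using homeomorphic_imp_injective_map[OF h] by simp
  show im: "\<phi> ` cball 0 1 = X closure_of f"
    using homeomorphic_imp_surjective_map[OF h] closure_of_subset_topspace[of X f] by (simp add: Int_absorb1)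
  show "\<phi> ` ball 0 1 = f" "k \<ge> 2" "\<And>j. j < k \<Longrightarrow> \<phi> (arcpt k j 0) \<in> V"
    "\<And>j. j < k \<Longrightarrow> (\<lambda>t. \<phi> (arcpt k j t)) ` {0<..<1} \<in> E"
    using assms by (auto simp: polygon_map_def)
  show "\<phi> (arcpt k j 1) \<in> V" if "j < k" for j
    using assms arcpt_join[OF that] that by (auto simp: polygon_map_def)
  show "closedin X (X closure_of f)" by simp
  obtain g where g: "homeomorphic_maps (top_of_set (cball 0 1)) (subtopology X (X closure_of f)) \<phi> g"
    using h homeomorphic_map_maps by blast
  have "g y = inv_into (cball 0 1) \<phi> y" if "y \<in> X closure_of f" for y
  proof -
    have "y \<in> \<phi> ` cball 0 1" using that im by simp
    then obtain z where "z \<in> cball 0 1" "y = \<phi> z" by blast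
    then show ?thesis using g inj by (simp add: homeomorphic_maps_def)
  qed
  moreover have "continuous_map (subtopology X (X closure_of f)) (top_of_set (cball 0 1)) g"
    using g by (simp add: homeomorphic_maps_def)
  ultimately show "continuous_map (subtopology X (X closure_of f)) (top_of_set (cball 0 1)) (inv_into (cball 0 1) \<phi>)"
    using closure_of_subset_topspace[of X f] by (elim continuous_map_eq) auto
qed

lemma face_closure_sub:
  assumes "polygon_map f k \<phi>" "x \<in> X closure_of f" "x \<notin> f"
  shows "x \<in> V \<or> (\<exists>j<k. x \<in> (\<lambda>t. \<phi> (arcpt k j t)) ` {0<..<1})"
proof -
  note P = polygon_mapD[OF assms(1)]
  obtain z where z: "z \<in> cball 0 1" "x = \<phi> z" using assms(2) P(3) by blast
  have "z \<notin> ball 0 1" using z(2) assms(3) P(4) by blast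
  then have "norm z = 1" using z by auto
  have "0 < k" using P(5) by simp
  obtain j t where jt: "j < k" "0 \<le> t" "t < 1" "z = arcpt k j t"
    by (rule arcpt_surj[OF \<open>norm z = 1\<close> \<open>0 < k\<close>])
  show ?thesis
  proof (cases "t = 0")
    case True then show ?thesis using P(6) jt z by auto
  next
    case False
    then have "t \<in> {0<..<1}" using jt by auto
    then have "x \<in> (\<lambda>t. \<phi> (arcpt k j t)) ` {0<..<1}" using z(2) jt(4) by blast
    then show ?thesis using jt(1) by blast
  qed
qed

text \<open>The partition separates cells only when they are different sets, so one set might a
  priori be a cell of two dimensions. A vertex is excluded from the other kinds by counting points,
  an edge from being a face by invariance of domain.\<close>

lemma vertex_not_edge: "x \<in> V \<Longrightarrow> e \<in> E \<Longrightarrow> x \<notin> e"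
  and vertex_not_face: "x \<in> V \<Longrightarrow> f \<in> F \<Longrightarrow> x \<notin> f"
  and edge_not_face: "e \<in> E \<Longrightarrow> f \<in> F \<Longrightarrow> x \<in> e \<Longrightarrow> x \<notin> f"
proof -
  have F2: "\<exists>y\<in>f. y \<noteq> x" if f: "f \<in> F" for f x
  proof -
    obtain k \<phi> where "polygon_map f k \<phi>" using polygon_map_exists[OF f] by blast
    note P = polygon_mapD[OF this]
    have "\<phi> 0 \<noteq> \<phi> (1/2)" using inj_onD[OF P(2), of 0 "1/2"] by force
    moreover have "\<phi> 0 \<in> f" "\<phi> (1/2) \<in> f" using P(4) by force+
    ultimately show ?thesis by metis
  qed
  have E2: "\<exists>y\<in>e. y \<noteq> x" if e: "e \<in> E" for e x
  proof -
    obtain \<phi> :: "real \<Rightarrow> 'a" where \<phi>: "characteristic_map X V e \<phi>" using edge_map[OF e] by blast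
    then have h: "homeomorphic_map (top_of_set (ball 0 1)) (subtopology X e) \<phi>" by (auto simp: characteristic_map_def)
    have "inj_on \<phi> (ball 0 1)" using homeomorphic_imp_injective_map[OF h] by simp
    then have "\<phi> 0 \<noteq> \<phi> (1/2)" using inj_onD[of \<phi> "ball 0 1" 0 "1/2"] by force
    moreover have "\<phi> ` ball 0 1 = e"
      using homeomorphic_imp_surjective_map[OF h] cells_sub(2)[OF e] by (simp add: Int_absorb1)
    then have "\<phi> 0 \<in> e" "\<phi> (1/2) \<in> e" by force+
    ultimately show ?thesis by metis
  qed
  have disj: "a = b" if "a \<in> (\<lambda>v. {v}) ` V \<union> E \<union> F" "b \<in> (\<lambda>v. {v}) ` V \<union> E \<union> F" "y \<in> a" "y \<in> b" for a b y
    using disjointD[OF partition_onD2[OF part] that(1,2)] that(3,4) by blast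
  show "x \<notin> e" if x: "x \<in> V" and e: "e \<in> E"
  proof
    assume "x \<in> e"
    then have "{x} = e" using disj[of "{x}" e x] x e by simp
    then show False using E2[OF e, of x] by blast
  qed
  show "x \<notin> f" if x: "x \<in> V" and f: "f \<in> F"
  proof
    assume "x \<in> f"
    then have "{x} = f" using disj[of "{x}" f x] x f by simp
    then show False using F2[OF f, of x] by blast
  qed
  show "x \<notin> f" if e: "e \<in> E" and f: "f \<in> F" and xe: "x \<in> e"
  proof
    assume "x \<in> f"
    then have ef: "e = f" using disj[of e f x] xe e f by simp
    text \<open>A cell cannot have dimension both \<open>1\<close> and \<open>2\<close>: remove a point.\<close>
    obtain \<phi> :: "real \<Rightarrow> 'a" where \<phi>: "characteristic_map X V e \<phi>" using edge_map[OF e] by blast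
    then have h: "homeomorphic_map (top_of_set (ball 0 1)) (subtopology X e) \<phi>" by (auto simp: characteristic_map_def)
    obtain g where g: "homeomorphic_maps (top_of_set (ball 0 1)) (subtopology X e) \<phi> g"
      using h homeomorphic_map_maps by blast
    obtain k \<psi> where "polygon_map f k \<psi>" using polygon_map_exists[OF f] by blast
    note P = polygon_mapD[OF this]
    have "continuous_map (top_of_set (ball 0 1)) (subtopology X e) \<psi>"
      using continuous_map_from_subtopology_mono[OF P(1), of "ball 0 1"] P(4) ef
      by (auto simp: continuous_map_in_subtopology)
    then have "continuous_map (top_of_set (ball 0 1)) (top_of_set (ball 0 1)) (g \<circ> \<psi>)"
      using continuous_map_compose g unfolding homeomorphic_maps_def by blast
    then have c: "continuous_on (ball 0 1) (g \<circ> \<psi>)" by (simp add: continuous_map_in_subtopology)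
    have \<phi>g: "\<phi> (g y) = y" if "y \<in> e" for y
      using g that cells_sub(2)[OF e] unfolding homeomorphic_maps_def by auto
    have i: "inj_on (g \<circ> \<psi>) (ball 0 1)"
    proof (rule inj_onI)
      fix z w assume zw: "z \<in> ball (0::complex) 1" "w \<in> ball 0 1" "(g \<circ> \<psi>) z = (g \<circ> \<psi>) w"
      have "\<psi> z \<in> e" "\<psi> w \<in> e" using P(4) ef zw by blast+
      then have "\<psi> z = \<psi> w" using \<phi>g zw(3) by (metis comp_apply)
      then show "z = w" using P(2) zw by (auto simp: inj_on_def)
    qed
    \<comment> \<open>The disc would embed into the real line inside the plane; an injective
      continuous image must be open, but this one contains real numbers only.\<close>
    define \<eta> where "\<eta> z = complex_of_real ((g \<circ> \<psi>) z)" for z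
    have "continuous_on (ball 0 1) \<eta>" unfolding \<eta>_def using c by (intro continuous_intros)
    moreover have "inj_on \<eta> (ball 0 1)" using i by (auto simp: inj_on_def \<eta>_def)
    ultimately have "open (\<eta> ` ball 0 1)" by (intro invariance_of_domain) auto
    moreover have "\<eta> 0 \<in> \<eta> ` ball 0 1" by simp
    ultimately obtain r where r: "r > 0" "ball (\<eta> 0) r \<subseteq> \<eta> ` ball 0 1" using openE by blast
    have "\<eta> 0 + \<i> * of_real (r/2) \<in> ball (\<eta> 0) r" using r by (simp add: dist_norm norm_mult)
    then have "\<eta> 0 + \<i> * of_real (r/2) \<in> \<eta> ` ball 0 1" using r by blast
    then obtain w where "\<eta> 0 + \<i> * of_real (r/2) = \<eta> w" by blast
    then have "Im (\<eta> 0 + \<i> * of_real (r/2)) = 0" by (metis Im_complex_of_real \<eta>_def)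
    then show False using r by (simp add: \<eta>_def)
  qed
qed

text \<open>Otherwise a point of the edge has a neighbourhood inside the edge alone, a piece of an
  interval. Removing the point disconnects it, which cannot happen on a surface.\<close>

lemma edge_in_some_face:
  assumes e: "e \<in> E"
  shows "\<exists>f\<in>F. \<exists>k \<phi> j. polygon_map f k \<phi> \<and> j < k \<and> e = (\<lambda>t. \<phi> (arcpt k j t)) ` {0<..<1}"
proof (rule ccontr)
  assume no: "\<not> ?thesis"
  obtain x where x: "x \<in> e" using cells_nonempty(1)[OF e] by blast
  have nf: "x \<notin> X closure_of f" if f: "f \<in> F" for f
  proof
    assume "x \<in> X closure_of f"
    obtain k \<phi> where P: "polygon_map f k \<phi>" using polygon_map_exists[OF f] by blast
    have "x \<notin> f" "x \<notin> V" using x e f edge_not_face vertex_not_edge by blast+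
    then obtain j where j: "j < k" "x \<in> (\<lambda>t. \<phi> (arcpt k j t)) ` {0<..<1}"
      using face_closure_sub[OF P \<open>x \<in> X closure_of f\<close>] by blast
    then have "(\<lambda>t. \<phi> (arcpt k j t)) ` {0<..<1} = e"
      using cells_disjoint(1)[OF _ e] polygon_mapD(8)[OF P j(1)] x by blast
    then show False using no f P j(1) by blast
  qed
  define O' where "O' = topspace X - (\<Union>f\<in>F. X closure_of f) - (\<Union>e'\<in>E - {e}. X closure_of e') - V"
  have "closedin X (\<Union>f\<in>F. X closure_of f)" "closedin X (\<Union>e'\<in>E - {e}. X closure_of e')"
    using finites by (auto intro!: closedin_Union)
  moreover have "closedin X V"
    using finites(1) cells_sub(1) Haus by (meson Hausdorff_imp_t1_space t1_space_closedin_finite)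
  ultimately have O: "openin X O'" unfolding O'_def by (intro openin_diff openin_topspace)
  have xe': "x \<notin> X closure_of e'" if "e' \<in> E - {e}" for e'
    using that edge_closure[of e'] cells_disjoint(1)[of e' e] e x vertex_not_edge by blast
  then have "x \<in> O'" using x nf cells_sub(2)[OF e] vertex_not_edge e by (auto simp: O'_def)
  have "O' \<subseteq> e"
  proof
    fix y assume y: "y \<in> O'"
    then have "y \<in> topspace X" "y \<notin> V" by (auto simp: O'_def)
    moreover have "y \<notin> f" if "f \<in> F" for f
      using y closure_of_subset[OF cells_sub(3)[OF that]] that by (auto simp: O'_def)
    moreover have "y \<notin> e'" if "e' \<in> E - {e}" for e'
      using y closure_of_subset[OF cells_sub(2)[of e']] that by (auto simp: O'_def)
    ultimately show "y \<in> e" using cells_cover by blast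
  qed
  obtain U where U: "openin X U" "x \<in> U" "U \<subseteq> O'" "connectedin X (U - {x})"
    using surface_punctured_nbhd[OF surf O \<open>x \<in> O'\<close>] by metis
  obtain \<phi> :: "real \<Rightarrow> 'a" where \<phi>: "characteristic_map X V e \<phi>" using edge_map[OF e] by blast
  then have h: "homeomorphic_map (top_of_set (ball 0 1)) (subtopology X e) \<phi>" by (auto simp: characteristic_map_def)
  obtain g where g: "homeomorphic_maps (top_of_set (ball 0 1)) (subtopology X e) \<phi> g"
    using h homeomorphic_map_maps by blast
  have \<phi>g: "\<phi> (g y) = y \<and> g y \<in> ball 0 1" if "y \<in> e" for y
    using g that cells_sub(2)[OF e] unfolding homeomorphic_maps_def continuous_map_def by auto
  have g\<phi>: "g (\<phi> t) = t" if "t \<in> ball 0 1" for t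
    using g that unfolding homeomorphic_maps_def by auto
  have Ue: "U \<subseteq> e" using U(3) \<open>O' \<subseteq> e\<close> by blast
  have gc: "continuous_map (subtopology X e) euclideanreal g"
    using g unfolding homeomorphic_maps_def by (auto simp: continuous_map_in_subtopology)
  have "connectedin (subtopology X e) (U - {x})"
    using U(4) Ue by (auto simp: connectedin_subtopology)
  then have con: "connected (g ` (U - {x}))" using connectedin_continuous_map_image[OF gc] by simp
  have "continuous_map (top_of_set (ball 0 1)) X \<phi>" using h homeomorphic_imp_continuous_map continuous_map_into_fulltopology by blast
  then have "openin (top_of_set (ball 0 1)) {t \<in> topspace (top_of_set (ball 0 1)). \<phi> t \<in> U}"
    using openin_continuous_map_preimage[OF _ U(1)] by blast
  then have "open {t \<in> ball 0 1. \<phi> t \<in> U}" using openin_open_eq[of "ball (0::real) 1"] by auto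
  moreover have "g x \<in> {t \<in> ball 0 1. \<phi> t \<in> U}" using \<phi>g[OF x] U(2) by auto
  ultimately obtain r where r: "r > 0" "ball (g x) r \<subseteq> {t \<in> ball 0 1. \<phi> t \<in> U}"
    by (metis (no_types, lifting) openE)
  have mem: "t \<in> g ` (U - {x})" if "t \<in> ball (g x) r" "t \<noteq> g x" for t
  proof -
    have "\<phi> t \<in> U" "t \<in> ball 0 1" using r that by auto
    moreover have "\<phi> t \<noteq> x" using that g\<phi>[OF \<open>t \<in> ball 0 1\<close>] by metis
    ultimately show ?thesis using g\<phi>[of t] by (metis Diff_iff image_eqI singletonD)
  qed
  \<comment> \<open>Points on both sides of \<open>g x\<close> are reached, so a connected subset of
    the line contains \<open>g x\<close> as well.\<close>
  have "g x - r/2 \<in> g ` (U - {x})" "g x + r/2 \<in> g ` (U - {x})" using mem r(1) by (auto simp: dist_real_def)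
  then have "g x \<in> g ` (U - {x})"
    using connectedD_interval[OF con, of "g x - r/2" "g x + r/2" "g x"] r(1) by auto
  then obtain y where "y \<in> U - {x}" "g y = g x" by (metis imageE)
  then show False using \<phi>g[of y] \<phi>g[OF x] Ue by auto
qed

end

section \<open>Edge paths and boundary words of faces\<close>

context subdivided_surface
begin

text \<open>A side of some embedded polygon is taken rather than a characteristic map of the edge:
  the latter might identify its two ends, whereas a polygon side is injective up to and including
  them. So no edge is a loop.\<close>

definition edge_path :: "'a set \<Rightarrow> real \<Rightarrow> 'a" where
  "edge_path e = (SOME q. \<exists>f\<in>F. \<exists>k \<phi> j. polygon_map f k \<phi> \<and> j < k \<and>
     e = (\<lambda>t. \<phi> (arcpt k j t)) ` {0<..<1} \<and> q = (\<lambda>t. \<phi> (arcpt k j t)))"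

lemma edge_path_polygon:
  assumes "e \<in> E"
  obtains f k \<phi> j where "f \<in> F" "polygon_map f k \<phi>" "j < k" "e = (\<lambda>t. \<phi> (arcpt k j t)) ` {0<..<1}"
    "edge_path e = (\<lambda>t. \<phi> (arcpt k j t))"
proof -
  have "\<exists>q. \<exists>f\<in>F. \<exists>k \<phi> j. polygon_map f k \<phi> \<and> j < k \<and>
     e = (\<lambda>t. \<phi> (arcpt k j t)) ` {0<..<1} \<and> q = (\<lambda>t. \<phi> (arcpt k j t))"
    using edge_in_some_face[OF assms] by blast
  from someI_ex[OF this] show ?thesis using that unfolding edge_path_def by blast
qed

lemma polygon_arc:
  assumes P: "polygon_map f k \<phi>" and j: "j < k"
  shows "continuous_map (top_of_set {0..1}) X (\<lambda>t. \<phi> (arcpt k j t))"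
    "inj_on (\<lambda>t. \<phi> (arcpt k j t)) {0..1}"
proof -
  note D = polygon_mapD[OF P]
  have "continuous_map (top_of_set {0..1}) (top_of_set (cball 0 1)) (arcpt k j)"
    using continuous_on_arcpt by (auto simp: continuous_map_in_subtopology)
  from continuous_map_compose[OF this D(1)]
  show "continuous_map (top_of_set {0..1}) X (\<lambda>t. \<phi> (arcpt k j t))" by (simp add: comp_def)
  show "inj_on (\<lambda>t. \<phi> (arcpt k j t)) {0..1}"
  proof (rule inj_onI)
    fix s t :: real assume st: "s \<in> {0..1}" "t \<in> {0..1}" "\<phi> (arcpt k j s) = \<phi> (arcpt k j t)"
    have e: "arcpt k j s = arcpt k j t" using inj_onD[OF D(2) st(3)] by simp
    have ne: "arcpt k j 1 \<noteq> arcpt k j t" if "0 \<le> t" "t < 1" for t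
    proof
      assume "arcpt k j 1 = arcpt k j t"
      then have "arcpt k (Suc j mod k) 0 = arcpt k j t" using arcpt_join[OF j] by simp
      then have "Suc j mod k = j" using arcpt_inj[of k "Suc j mod k" 0 j t] j that by simp
      then show False using D(5) j by (cases "Suc j = k") auto
    qed
    show "s = t"
    proof (cases "s = 1 \<or> t = 1")
      case True then show ?thesis using ne[of s] ne[of t] e st by force
    next
      case False then show ?thesis using arcpt_inj[OF e j j] st by auto
    qed
  qed
qed

sublocale arc_system X V E edge_path
proof
  show "closed_surface X" by (rule surf)
  fix e assume e: "e \<in> E"
  obtain f k \<phi> j where P: "f \<in> F" "polygon_map f k \<phi>" "j < k" "e = (\<lambda>t. \<phi> (arcpt k j t)) ` {0<..<1}"
    "edge_path e = (\<lambda>t. \<phi> (arcpt k j t))" using edge_path_polygon[OF e] .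
  show "continuous_map (top_of_set {0..1}) X (edge_path e)" "inj_on (edge_path e) {0..1}"
    unfolding P(5) using polygon_arc[OF P(2,3)] by auto
  show "edge_path e ` {0<..<1} = e" unfolding P(5) using P(4) by simp
  show "edge_path e 0 \<in> V" "edge_path e 1 \<in> V" unfolding P(5) using polygon_mapD(6,7)[OF P(2,3)] by auto
next
  show "e \<inter> e' = {}" if "e \<in> E" "e' \<in> E" "e \<noteq> e'" for e e' using cells_disjoint(1) that by blast
  show "e \<inter> V = {}" if "e \<in> E" for e using vertex_not_edge that by blast
qed

lemma arc_closure:
  assumes e: "e \<in> E" and c: "continuous_map (top_of_set {0..1}) X \<alpha>" and o: "\<alpha> ` {0<..<1} = e"
  shows "X closure_of e = \<alpha> ` {0..1::real}"
proof
  have "compactin (top_of_set {0..1::real}) {0..1}" by (simp add: compactin_subtopology)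
  then have "compactin X (\<alpha> ` {0..1})" using c image_compactin by blast
  then have "closedin X (\<alpha> ` {0..1})" by (rule compactin_imp_closedin[OF Haus])
  moreover have "e \<subseteq> \<alpha> ` {0..1}" unfolding o[symmetric] by (intro image_mono) auto
  ultimately show "X closure_of e \<subseteq> \<alpha> ` {0..1}" by (simp add: closure_of_minimal)
  have "\<alpha> ` ((top_of_set {0..1}) closure_of {0<..<1}) \<subseteq> X closure_of (\<alpha> ` {0<..<1})"
    by (rule continuous_map_image_closure_subset[OF c])
  moreover have "(top_of_set {0..1::real}) closure_of {0<..<1} = {0..1}"
  proof -
    have "{0..1::real} \<inter> {0<..<1} = {0<..<1}" by auto
    then show ?thesis by (simp add: closure_of_subtopology)
  qed
  ultimately show "\<alpha> ` {0..1} \<subseteq> X closure_of e" by (simp add: o)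
qed

lemma edge_ends:
  assumes d: "fst d \<in> E"
  shows "X closure_of (fst d) = dpath d ` {0..1}" "X closure_of (fst d) - fst d = {dpath d 0, dpath d 1}"
    "dpath d 0 \<noteq> dpath d 1"
proof -
  show 1: "X closure_of (fst d) = dpath d ` {0..1}"
    by (rule arc_closure[OF d continuous_dpath[OF d] dpath_image_open[OF d]])
  show "dpath d 0 \<noteq> dpath d 1" using dpath_inj[OF d, of 0 1] by auto
  have "{0..1::real} = {0<..<1} \<union> {0,1}" by auto
  then have "dpath d ` {0..1} = fst d \<union> {dpath d 0, dpath d 1}"
    using dpath_image_open[OF d] by (metis image_Un image_empty image_insert)
  moreover have "dpath d 0 \<notin> fst d" "dpath d 1 \<notin> fst d"
    using dpath_ends[OF d] edge_vertex_disjoint[OF d] by blast+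
  ultimately show "X closure_of (fst d) - fst d = {dpath d 0, dpath d 1}" unfolding 1 by blast
qed

text \<open>The boundary is labelled by the fixed edge paths, not by the sides of the polygon of
  \<open>f\<close>, so that words of different faces can be glued. Both distinctness clauses record
  that the polygon is embedded.\<close>

definition face_word :: "'a set \<Rightarrow> 'a dart list \<Rightarrow> (complex \<Rightarrow> 'a) \<Rightarrow> bool" where
  "face_word f w \<Phi> \<longleftrightarrow> fill w \<Phi> \<and> \<Phi> ` cball 0 1 = X closure_of f \<and> \<Phi> ` ball 0 1 = f \<and> 2 \<le> length w \<and>
     distinct (map fst w) \<and> distinct (map (\<lambda>d. dpath d 0) w)"

text \<open>The polygon side and the fixed path have the same closure and hence the same pair of
  ends; the direction is chosen to match them. The parametrizations need not agree.\<close>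

lemma dart_along_arc:
  assumes P: "polygon_map f k \<phi>" and j: "j < k"
  obtains d where "fst d = (\<lambda>t. \<phi> (arcpt k j t)) ` {0<..<1}" "fst d \<in> E"
    "dpath d 0 = \<phi> (arcpt k j 0)" "dpath d 1 = \<phi> (arcpt k j 1)"
    "dpath d ` {0..1} = (\<lambda>t. \<phi> (arcpt k j t)) ` {0..1}"
proof -
  define \<alpha> where "\<alpha> = (\<lambda>t. \<phi> (arcpt k j t))"
  define e where "e = \<alpha> ` {0<..<1}"
  have e: "e \<in> E" using polygon_mapD(8)[OF P j] by (simp add: e_def \<alpha>_def)
  have c: "continuous_map (top_of_set {0..1}) X \<alpha>" and i: "inj_on \<alpha> {0..1}"
    using polygon_arc[OF P j] by (auto simp: \<alpha>_def)
  have cl: "X closure_of e = \<alpha> ` {0..1}" by (rule arc_closure[OF e c e_def[symmetric]])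
  have "{0..1::real} = {0<..<1} \<union> {0,1}" by auto
  then have "\<alpha> ` {0..1} = e \<union> {\<alpha> 0, \<alpha> 1}" by (metis image_Un image_empty image_insert e_def)
  moreover have "\<alpha> 0 \<in> V" "\<alpha> 1 \<in> V" using polygon_mapD(6,7)[OF P j] by (auto simp: \<alpha>_def)
  then have "\<alpha> 0 \<notin> e" "\<alpha> 1 \<notin> e" using edge_vertex_disjoint[OF e] by blast+
  ultimately have ends: "X closure_of e - e = {\<alpha> 0, \<alpha> 1}" using cl by blast
  define d where "d = (e, True)"
  have d: "fst d = e" "fst d \<in> E" using e by (auto simp: d_def)
  have "{dpath d 0, dpath d 1} = {\<alpha> 0, \<alpha> 1}" using edge_ends(2)[OF d(2)] ends d by simp
  then consider "dpath d 0 = \<alpha> 0" "dpath d 1 = \<alpha> 1" | "dpath d 0 = \<alpha> 1" "dpath d 1 = \<alpha> 0"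
    by (metis doubleton_eq_iff)
  then show ?thesis
  proof cases
    case 1
    then show ?thesis using that[of d] d cl edge_ends(1)[OF d(2)] by (simp add: e_def \<alpha>_def)
  next
    case 2
    then show ?thesis using that[of "rv d"] d cl edge_ends(1)[of "rv d"]
      by (simp add: e_def \<alpha>_def dpath_rv)
  qed
qed

text \<open>The polygon may run along an edge at another speed than the fixed path. The fixed paths
  are pulled back to the circle by the inverse of the polygon map, and \<open>polygon_model\<close>
  extends this new subdivision of the circle over the disc.\<close>

lemma face_word_exists:
  assumes f: "f \<in> F"
  shows "\<exists>w \<Phi>. face_word f w \<Phi>"
proof -
  obtain k \<phi> where P: "polygon_map f k \<phi>" using polygon_map_exists[OF f] by blast
  note D = polygon_mapD[OF P]
  have "\<forall>j. \<exists>d. j < k \<longrightarrow> fst d = (\<lambda>t. \<phi> (arcpt k j t)) ` {0<..<1} \<and> fst d \<in> E \<and>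
    dpath d 0 = \<phi> (arcpt k j 0) \<and> dpath d 1 = \<phi> (arcpt k j 1) \<and>
    dpath d ` {0..1} = (\<lambda>t. \<phi> (arcpt k j t)) ` {0..1}"
    using dart_along_arc[OF P] by metis
  then obtain d where d: "\<And>j. j < k \<Longrightarrow> fst (d j) = (\<lambda>t. \<phi> (arcpt k j t)) ` {0<..<1}"
    "\<And>j. j < k \<Longrightarrow> fst (d j) \<in> E"
    "\<And>j. j < k \<Longrightarrow> dpath (d j) 0 = \<phi> (arcpt k j 0)" "\<And>j. j < k \<Longrightarrow> dpath (d j) 1 = \<phi> (arcpt k j 1)"
    "\<And>j. j < k \<Longrightarrow> dpath (d j) ` {0..1} = (\<lambda>t. \<phi> (arcpt k j t)) ` {0..1}"
    by metis
  define g where "g = inv_into (cball 0 1) \<phi>"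
  define q where "q j t = g (dpath (d j) t)" for j t
  define w where "w = map d [0..<k]"
  have k: "0 < k" using D(5) by simp
  have sub: "dpath (d j) t \<in> X closure_of f" if "j < k" "0 \<le> t" "t \<le> 1" for j t
  proof -
    have "dpath (d j) t \<in> (\<lambda>t. \<phi> (arcpt k j t)) ` {0..1}" using d(5)[OF that(1)] that by auto
    then show ?thesis using D(3) by (force simp: image_iff)
  qed
  have \<phi>q: "\<phi> (q j t) = dpath (d j) t" if "j < k" "0 \<le> t" "t \<le> 1" for j t
    using sub[OF that] D(3) unfolding q_def g_def by (metis f_inv_into_f)
  have g\<phi>: "g (\<phi> z) = z" if "z \<in> cball 0 1" for z using D(2) that by (simp add: g_def)
  have arcs_distinct: "i = j" if "i < k" "j < k" "fst (d i) = fst (d j)" for i j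
  proof -
    have "\<phi> (arcpt k i (1/2)) \<in> (\<lambda>t. \<phi> (arcpt k j t)) ` {0<..<1}" using that d(1) by force
    then obtain t where t: "0 < t" "t < 1" "\<phi> (arcpt k i (1/2)) = \<phi> (arcpt k j t)" by auto
    then have "arcpt k i (1/2) = arcpt k j t" using inj_onD[OF D(2) t(3)] by simp
    then show ?thesis using arcpt_inj[of k i "1/2" j t] t that by simp
  qed
  have verts_distinct: "i = j" if "i < k" "j < k" "dpath (d i) 0 = dpath (d j) 0" for i j
  proof -
    have "\<phi> (arcpt k i 0) = \<phi> (arcpt k j 0)" using that d(3) by simp
    then have "arcpt k i 0 = arcpt k j 0" using inj_onD[OF D(2), of "arcpt k i 0" "arcpt k j 0"] by simp
    then show ?thesis using arcpt_inj[of k i 0 j 0] that by simp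
  qed
  have pieces: "polygon_pieces (cball 0 1) (length w) q"
    unfolding polygon_pieces_def
  proof (intro conjI allI impI)
    show "0 < length w" using k by (simp add: w_def)
    fix j assume "j < length w"
    then have j: "j < k" by (simp add: w_def)
    have "continuous_map (top_of_set {0..1}) (subtopology X (X closure_of f)) (dpath (d j))"
      using continuous_dpath[OF d(2)[OF j]] sub[OF j] by (auto simp: continuous_map_in_subtopology)
    then have "continuous_map (top_of_set {0..1}) (top_of_set (cball 0 1)) (g \<circ> dpath (d j))"
      using D(10) continuous_map_compose unfolding g_def by blast
    then show "continuous_on {0..1} (q j)"
      by (simp add: continuous_map_in_subtopology q_def[abs_def] comp_def)
    have "Suc j mod k < k" using k by simp
    then show "q j 1 = q (Suc j mod length w) 0"
      using d(3)[of "Suc j mod k"] d(4)[OF j] arcpt_join[OF j] by (simp add: q_def w_def)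
  next
    fix i j s t assume "i < length w" "j < length w" and st: "0 \<le> s \<and> s < 1 \<and> 0 \<le> t \<and> t < 1 \<and> q i s = q j t"
    then have ij: "i < k" "j < k" by (auto simp: w_def)
    have e: "dpath (d i) s = dpath (d j) t" using \<phi>q[OF ij(1), of s] \<phi>q[OF ij(2), of t] st by simp
    have *: "i = j"
    proof (cases "s = 0")
      case True
      then have "dpath (d j) t \<in> V" using e dpath_ends(1)[OF d(2)[OF ij(1)]] by simp
      then have "t = 0" using dpath_open[OF d(2)[OF ij(2)], of t] edge_vertex_disjoint[OF d(2)[OF ij(2)]] st by force
      then show ?thesis using verts_distinct[OF ij] e True by simp
    next
      case False
      then have s: "dpath (d i) s \<in> fst (d i)" using dpath_open[OF d(2)[OF ij(1)], of s] st by simp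
      then have "t \<noteq> 0" using e dpath_ends(1)[OF d(2)[OF ij(2)]] edge_vertex_disjoint[OF d(2)[OF ij(1)]] by force
      then have "dpath (d i) s \<in> fst (d j)" using e dpath_open[OF d(2)[OF ij(2)], of t] st by simp
      then have "fst (d i) = fst (d j)" using s edges_disjoint[OF d(2)[OF ij(1)] d(2)[OF ij(2)]] by blast
      then show ?thesis by (rule arcs_distinct[OF ij])
    qed
    then show "i = j" "s = t" using dpath_inj[OF d(2)[OF ij(1)], of s t] e st by auto
  next
    have "q j ` {0..1} = arcpt k j ` {0..1}" if "j < k" for j
    proof -
      have "q j ` {0..1} = g ` (dpath (d j) ` {0..1})" by (simp only: q_def[abs_def] image_image)
      also have "\<dots> = (\<lambda>t. g (\<phi> (arcpt k j t))) ` {0..1}" by (simp only: d(5)[OF that] image_image)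
      also have "\<dots> = arcpt k j ` {0..1}" by (simp add: g\<phi>)
      finally show ?thesis .
    qed
    then have "(\<Union>j<length w. q j ` {0..1}) = (\<Union>j<k. arcpt k j ` {0..1})" by (simp add: w_def)
    also have "\<dots> = frontier (cball 0 1)"
    proof
      show "frontier (cball 0 1) \<subseteq> (\<Union>j<k. arcpt k j ` {0..1})"
      proof
        fix z :: complex assume "z \<in> frontier (cball 0 1)"
        then have z: "norm z = 1" by simp
        obtain j t where "j < k" "0 \<le> t" "t < 1" "z = arcpt k j t" by (rule arcpt_surj[OF z k])
        then show "z \<in> (\<Union>j<k. arcpt k j ` {0..1})" by (intro UN_I[of j]) auto
      qed
    qed auto
    finally show "(\<Union>j<length w. q j ` {0..1}) = frontier (cball 0 1)" .
  qed auto
  have dm: "disc_map (cball 0 1) \<phi>"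
    unfolding disc_map_def using D(1,2) by (auto simp: inj_on_def)
  obtain \<Phi> where "fill w \<Phi>" "\<Phi> ` cball 0 1 = \<phi> ` cball 0 1" "\<Phi> ` ball 0 1 = \<phi> ` interior (cball 0 1)"
  proof (rule model_to_fill[OF dm pieces])
    show "fst ` set w \<subseteq> E" using d(2) by (auto simp: w_def)
    show "\<phi> (q j t) = dpath (w ! j) t" if "j < length w" "0 \<le> t" "t \<le> 1" for j t
      using \<phi>q that by (simp add: w_def)
  qed
  moreover have "distinct (map fst w)" "distinct (map (\<lambda>d. dpath d 0) w)"
    using arcs_distinct verts_distinct by (auto simp: w_def distinct_map inj_on_def)
  ultimately show ?thesis unfolding face_word_def using D(3,4,5)
    by (intro exI[of _ w] exI[of _ \<Phi>]) (simp add: w_def)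
qed

end

context arc_system
begin

text \<open>Rotation brings the edge to the front, and a reversal corrects its direction where
  necessary. The explicit shape of \<open>v\<close> is kept for the comparison of
  holonomies.\<close>

lemma fill_front:
  assumes f: "fill w \<Phi>" and d: "fst d \<in> fst ` set w"
  obtains v \<Psi> A B where "fill (d # v) \<Psi>" "\<Psi> ` cball 0 1 = \<Phi> ` cball 0 1" "\<Psi> ` ball 0 1 = \<Phi> ` ball 0 1"
    "w = A @ d # B \<and> v = B @ A \<or> w = A @ rv d # B \<and> v = rev (map rv (B @ A))"
proof -
  obtain d' where d': "d' \<in> set w" "fst d' = fst d" using d by auto
  then obtain A B where w: "w = A @ d' # B" by (meson split_list)
  obtain \<Psi> where \<Psi>: "fill (d' # B @ A) \<Psi>" "\<Psi> ` cball 0 1 = \<Phi> ` cball 0 1" "\<Psi> ` ball 0 1 = \<Phi> ` ball 0 1"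
    using fill_rotate[of A "d' # B" \<Phi>] f w by auto
  show ?thesis
  proof (cases "d' = d")
    case True
    then show ?thesis using that[OF \<Psi>(1)[unfolded True] \<Psi>(2,3)] w by blast
  next
    case False
    then have r: "d' = rv d" using dart_cases d'(2) by blast
    obtain \<Psi>' where \<Psi>': "fill (rev (map rv (d' # B @ A))) \<Psi>'" "\<Psi>' ` cball 0 1 = \<Phi> ` cball 0 1" "\<Psi>' ` ball 0 1 = \<Phi> ` ball 0 1"
      using fill_reverse[OF \<Psi>(1)] \<Psi>(2,3) by auto
    have "fill (rev (map rv (B @ A)) @ [d]) \<Psi>'" using \<Psi>'(1) r by simp
    then obtain \<Omega> where \<Omega>: "fill (d # rev (map rv (B @ A))) \<Omega>" "\<Omega> ` cball 0 1 = \<Phi> ` cball 0 1" "\<Omega> ` ball 0 1 = \<Phi> ` ball 0 1"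
      using fill_rotate[of "rev (map rv (B @ A))" "[d]" \<Psi>'] \<Psi>'(2,3) by auto
    show ?thesis by (rule that[OF \<Omega>]) (use w r in blast)
  qed
qed

lemma fill_interior_open: "fill w \<Phi> \<Longrightarrow> openin X (\<Phi> ` ball 0 1)"
proof (rule surface_invariance_of_domain[OF surface])
  assume f: "fill w \<Phi>"
  then have c: "continuous_map (top_of_set (cball 0 1)) X \<Phi>" by (simp add: fill_def disc_map_def)
  show "continuous_map (top_of_set (ball 0 1)) X \<Phi>"
    by (rule continuous_map_from_subtopology_mono[OF c]) auto
  show "inj_on \<Phi> (ball 0 1)" using f by (simp add: fill_def disc_map_def inj_on_def)
qed auto

end

section \<open>Incidence of faces with edges and vertices, and connectedness of the dual
  graph\<close>

context subdivided_surface
begin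

definition fw :: "'a set \<Rightarrow> 'a dart list" where
  "fw f = (SOME w. \<exists>\<Phi>. face_word f w \<Phi>)"

lemma fw:
  assumes "f \<in> F"
  obtains \<Phi> where "face_word f (fw f) \<Phi>"
proof -
  have "\<exists>\<Phi>. face_word f (fw f) \<Phi>"
    unfolding fw_def using someI_ex[OF face_word_exists[OF assms]] .
  then show ?thesis using that by blast
qed

lemma face_wordD:
  assumes "face_word f w \<Phi>"
  shows "fill w \<Phi>" "\<Phi> ` cball 0 1 = X closure_of f" "\<Phi> ` ball 0 1 = f" "2 \<le> length w"
    "distinct (map fst w)" "distinct (map (\<lambda>d. dpath d 0) w)" "fst ` set w \<subseteq> E"
proof -
  note D = assms[unfolded face_word_def]
  show f: "fill w \<Phi>" by (rule conjunct1[OF D])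
  show "\<Phi> ` cball 0 1 = X closure_of f" by (rule D[THEN conjunct2, THEN conjunct1])
  show "\<Phi> ` ball 0 1 = f" by (rule D[THEN conjunct2, THEN conjunct2, THEN conjunct1])
  show "2 \<le> length w" "distinct (map fst w)" "distinct (map (\<lambda>d. dpath d 0) w)"
    using D[THEN conjunct2, THEN conjunct2, THEN conjunct2] by simp_all
  show "fst ` set w \<subseteq> E" using f unfolding fill_def by (elim conjE)
qed

lemma face_word_point:
  assumes "face_word f w \<Phi>" "x \<in> X closure_of f"
  obtains z where "norm z \<le> 1" "x = \<Phi> z" "norm z = 1 \<or> x \<in> f"
proof -
  obtain z where z: "z \<in> cball 0 1" "x = \<Phi> z" using assms face_wordD(2)[OF assms(1)] by blast
  moreover have "x \<in> f" if "norm z \<noteq> 1"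
  proof -
    have "z \<in> ball 0 1" using z that by auto
    then show ?thesis using face_wordD(3)[OF assms(1)] z(2) by blast
  qed
  ultimately show ?thesis using that by auto
qed

lemma fw_props:
  assumes "f \<in> F"
  shows "fst ` set (fw f) \<subseteq> E" "2 \<le> length (fw f)" "distinct (map fst (fw f))" "distinct (map (\<lambda>d. dpath d 0) (fw f))"
proof -
  obtain \<Phi> where "face_word f (fw f) \<Phi>" using fw[OF assms] .
  note D = face_wordD[OF this]
  show "fst ` set (fw f) \<subseteq> E" "2 \<le> length (fw f)" "distinct (map fst (fw f))" "distinct (map (\<lambda>d. dpath d 0) (fw f))"
    by (rule D)+
qed

lemma face_closure_cells:
  assumes "f \<in> F"
  shows "X closure_of f \<subseteq> f \<union> V \<union> \<Union>(fst ` set (fw f))"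
proof
  obtain \<Phi> where w: "face_word f (fw f) \<Phi>" using fw[OF assms] .
  fix x assume "x \<in> X closure_of f"
  then obtain z where z: "x = \<Phi> z" "norm z = 1 \<or> x \<in> f" using face_word_point[OF w] by blast
  then show "x \<in> f \<union> V \<union> \<Union>(fst ` set (fw f))"
    using fill_boundary_mem[OF face_wordD(1)[OF w], of z] by blast
qed

lemma fill_label_mem:
  assumes "fill w \<Phi>" "d \<in> set w" "0 \<le> t" "t \<le> 1"
  shows "dpath d t \<in> \<Phi> ` cball 0 1"
proof -
  obtain j where j: "j < length w" "d = w ! j" using assms(2) by (auto simp: in_set_conv_nth)
  then have "dpath d t = \<Phi> (arcpt (length w) j t)" using assms by (simp add: fill_def)
  then show ?thesis by simp
qed

text \<open>The boundary of a face is a union of whole cells, so a single point decides for the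
  entire edge.\<close>

lemma edge_meets_face_closure:
  assumes f: "f \<in> F" and e: "e \<in> E" "x \<in> e"
  shows "x \<in> X closure_of f \<longleftrightarrow> e \<in> fst ` set (fw f)"
proof
  assume "x \<in> X closure_of f"
  then have "x \<in> f \<union> V \<union> \<Union>(fst ` set (fw f))" using face_closure_cells[OF f] by blast
  then obtain e' where e': "e' \<in> fst ` set (fw f)" "x \<in> e'"
    using edge_not_face[OF e(1) f e(2)] vertex_not_edge[OF _ e(1)] e(2) by blast
  then have "e' \<in> E" using fw_props(1)[OF f] by blast
  then have "e' = e" using e e'(2) edges_disjoint by blast
  then show "e \<in> fst ` set (fw f)" using e' by simp
next
  assume "e \<in> fst ` set (fw f)"
  then obtain d where d: "d \<in> set (fw f)" "fst d = e" by auto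
  have "x \<in> dpath d ` {0<..<1}" using dpath_image_open[of d] d e by simp
  then obtain t where "0 < t" "t < 1" "x = dpath d t" by auto
  moreover obtain \<Phi> where w: "face_word f (fw f) \<Phi>" using fw[OF f] .
  ultimately show "x \<in> X closure_of f" using fill_label_mem[OF _ d(1), of \<Phi> t] w by (simp add: face_word_def)
qed

lemma face_edges_eq:
  assumes f: "f \<in> F"
  shows "face_edges X E f = fst ` set (fw f)"
proof
  show "face_edges X E f \<subseteq> fst ` set (fw f)"
  proof
    fix e assume "e \<in> face_edges X E f"
    then have e: "e \<in> E" "e \<subseteq> X closure_of f" by (auto simp: face_edges_def)
    obtain x where "x \<in> e" using cells_nonempty(1)[OF e(1)] by blast
    then show "e \<in> fst ` set (fw f)" using edge_meets_face_closure[OF f e(1)] e(2) by blast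
  qed
  show "fst ` set (fw f) \<subseteq> face_edges X E f"
  proof
    fix e assume e: "e \<in> fst ` set (fw f)"
    then have "e \<in> E" using fw_props(1)[OF f] by blast
    then show "e \<in> face_edges X E f" using edge_meets_face_closure[OF f \<open>e \<in> E\<close>] e by (auto simp: face_edges_def)
  qed
qed

lemma fw_consecutive:
  assumes f: "f \<in> F" and j: "j < length (fw f)"
  shows "dpath (fw f ! j) 1 = dpath (fw f ! (Suc j mod length (fw f))) 0"
proof -
  obtain \<Phi> where w: "face_word f (fw f) \<Phi>" using fw[OF f] .
  define k where "k = length (fw f)"
  have lab: "\<Phi> (arcpt k j t) = dpath (fw f ! j) t" if "j < k" "0 \<le> t" "t \<le> 1" for j t
    using w that by (auto simp: face_word_def fill_def k_def)
  have "Suc j mod k < k" using j k_def by (metis gr_implies_not0 mod_less_divisor neq0_conv)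
  then show ?thesis using lab[of j 1] lab[of "Suc j mod k" 0] arcpt_join[of j k] j by (simp add: k_def)
qed

lemma face_vertices_eq:
  assumes f: "f \<in> F"
  shows "face_vertices X V f = (\<lambda>d. dpath d 0) ` set (fw f)"
proof
  obtain \<Phi> where w: "face_word f (fw f) \<Phi>" using fw[OF f] .
  show "face_vertices X V f \<subseteq> (\<lambda>d. dpath d 0) ` set (fw f)"
  proof
    fix v assume "v \<in> face_vertices X V f"
    then have v: "v \<in> V" "v \<in> X closure_of f" by (auto simp: face_vertices_def)
    have "v \<notin> f" using vertex_not_face[OF v(1) f] .
    then obtain z where z: "v = \<Phi> z" "norm z = 1" using face_word_point[OF w v(2)] by blast
    obtain j t where jt: "j < length (fw f)" "0 \<le> t" "t < 1" "\<Phi> z = dpath (fw f ! j) t" "fst (fw f ! j) \<in> E"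
      using fill_boundary[OF face_wordD(1)[OF w] z(2)] by metis
    have "t = 0" using dpath_open[OF jt(5), of t] jt z vertex_not_edge[OF v(1) jt(5)] by force
    then show "v \<in> (\<lambda>d. dpath d 0) ` set (fw f)" using jt z by simp
  qed
  show "(\<lambda>d. dpath d 0) ` set (fw f) \<subseteq> face_vertices X V f"
  proof
    fix v assume "v \<in> (\<lambda>d. dpath d 0) ` set (fw f)"
    then obtain d where d: "d \<in> set (fw f)" "v = dpath d 0" by blast
    then have "fst d \<in> E" using fw_props(1)[OF f] by blast
    then have "v \<in> V" using dpath_ends d(2) by simp
    moreover have "v \<in> X closure_of f"
      using fill_label_mem[of "fw f" \<Phi> d 0] w d by (simp add: face_word_def)
    ultimately show "v \<in> face_vertices X V f" by (simp add: face_vertices_def)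
  qed
qed

lemma face_word_front:
  assumes f: "f \<in> F" and d: "fst d \<in> fst ` set (fw f)"
  obtains v \<Psi> A B where "fill (d # v) \<Psi>" "\<Psi> ` cball 0 1 = X closure_of f" "\<Psi> ` ball 0 1 = f" "v \<noteq> []"
    "fst d \<notin> fst ` set v" "fst ` set (fw f) = insert (fst d) (fst ` set v)" "distinct (map fst v)"
    "fw f = A @ d # B \<and> v = B @ A \<or> fw f = A @ rv d # B \<and> v = rev (map rv (B @ A))"
proof -
  obtain \<Phi> where w: "face_word f (fw f) \<Phi>" using fw[OF f] .
  then have fill: "fill (fw f) \<Phi>" by (simp add: face_word_def)
  obtain v \<Psi> A B where v: "fill (d # v) \<Psi>" "\<Psi> ` cball 0 1 = \<Phi> ` cball 0 1" "\<Psi> ` ball 0 1 = \<Phi> ` ball 0 1"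
    "fw f = A @ d # B \<and> v = B @ A \<or> fw f = A @ rv d # B \<and> v = rev (map rv (B @ A))"
    using fill_front[OF fill d] .
  have "length (fw f) = Suc (length v)" using v(4) by auto
  then have "v \<noteq> []" using fw_props(2)[OF f] by auto
  moreover have "fst \<circ> rv = fst" by auto
  then have m: "map fst (map rv xs) = map fst xs" for xs by simp
  have dist: "distinct (map fst (fw f))" by (rule fw_props(3)[OF f])
  have "map fst v = map fst (B @ A) \<or> map fst v = rev (map fst (B @ A))"
    using v(4) m[of "B @ A"] by (metis rev_map)
  then have s: "set (map fst v) = set (map fst (B @ A))" "distinct (map fst v) = distinct (map fst (B @ A))"
    by (elim disjE; simp only: set_rev distinct_rev)+
  have "map fst (fw f) = map fst A @ fst d # map fst B" using v(4) by auto
  then have "fst d \<notin> set (map fst v)" "distinct (map fst v)" "set (map fst (fw f)) = insert (fst d) (set (map fst v))"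
    using dist unfolding s by auto
  then have "fst d \<notin> fst ` set v" "distinct (map fst v)" "fst ` set (fw f) = insert (fst d) (fst ` set v)" by simp_all
  ultimately show ?thesis using that v face_wordD(2,3)[OF w] by metis
qed

text \<open>Gluing two of the faces along the edge gives a disc whose open interior contains the
  edge and otherwise only points of these two faces. A third face would have to accumulate at the
  edge without entering this open set.\<close>

lemma edge_three_faces:
  assumes f: "f \<in> F" "g \<in> F" "h \<in> F" "f \<noteq> g" "f \<noteq> h" "g \<noteq> h" and e: "e \<in> E"
    and s: "e \<in> fst ` set (fw f)" "e \<in> fst ` set (fw g)" "e \<in> fst ` set (fw h)"
  shows False
proof -
  define d where "d = (e, True)"
  have d: "fst d = e" "fst (rv d) = e" by (auto simp: d_def)
  obtain u \<Phi> where u: "fill (d # u) \<Phi>" "\<Phi> ` cball 0 1 = X closure_of f" "\<Phi> ` ball 0 1 = f" "u \<noteq> []" "fst d \<notin> fst ` set u"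
    using face_word_front[OF f(1), of d] s(1) d by metis
  obtain v \<Psi> where v: "fill (rv d # v) \<Psi>" "\<Psi> ` cball 0 1 = X closure_of g" "\<Psi> ` ball 0 1 = g" "v \<noteq> []" "fst d \<notin> fst ` set v"
    using face_word_front[OF f(2), of "rv d"] s(2) d by metis
  have dis: "f \<inter> X closure_of g = {}" if "f \<in> F" "g \<in> F" "f \<noteq> g" for f g
    using face_closure_cells[OF that(2)] cells_disjoint(2)[OF that] vertex_not_face[OF _ that(1)]
      edge_not_face[OF _ that(1)] fw_props(1)[OF that(2)] by blast
  obtain \<Omega> where \<Omega>: "fill (u @ v) \<Omega>" "\<Omega> ` ball 0 1 \<subseteq> f \<union> g \<union> e" "e \<subseteq> \<Omega> ` ball 0 1"
    using fill_glue[OF u(1) v(1) u(4) v(4) u(5) v(5)] dis[OF f(1,2,4)] dis[OF f(2,1)] f(4) u(2,3) v(2,3) d(1) by metis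
  obtain x where x: "x \<in> e" using cells_nonempty(1)[OF e] by blast
  have "x \<in> X closure_of h" using edge_meets_face_closure[OF f(3) e x] s(3) by simp
  then have "\<Omega> ` ball 0 1 \<inter> h \<noteq> {}"
    using fill_interior_open[OF \<Omega>(1)] \<Omega>(3) x unfolding in_closure_of by blast
  then show False
    using \<Omega>(2) cells_disjoint(2)[OF f(1,3,5)] cells_disjoint(2)[OF f(2,3,6)] edge_not_face[OF e f(3)] by blast
qed

text \<open>Remove the vertices and the finitely many closed cells that miss \<open>x\<close>; what
  is left is open.\<close>

lemma edge_neighbourhood:
  assumes e: "e \<in> E" "x \<in> e"
  obtains O' where "openin X O'" "x \<in> O'" "O' \<subseteq> e \<union> \<Union>{f \<in> F. e \<in> fst ` set (fw f)}"
proof -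
  define O' where "O' = topspace X - (\<Union>f\<in>{f \<in> F. e \<notin> fst ` set (fw f)}. X closure_of f) - (\<Union>e'\<in>E - {e}. X closure_of e') - V"
  have "closedin X (\<Union>f\<in>{f \<in> F. e \<notin> fst ` set (fw f)}. X closure_of f)" "closedin X (\<Union>e'\<in>E - {e}. X closure_of e')"
    using finites by (auto intro!: closedin_Union)
  moreover have "closedin X V"
    using finites(1) cells_sub(1) Haus by (meson Hausdorff_imp_t1_space t1_space_closedin_finite)
  ultimately have "openin X O'" unfolding O'_def by (intro openin_diff openin_topspace)
  moreover have xe': "x \<notin> X closure_of e'" if "e' \<in> E - {e}" for e'
    using that edge_closure[of e'] cells_disjoint(1)[of e' e] e vertex_not_edge by blast
  have "x \<in> topspace X" "x \<notin> V" using e cells_sub(2)[OF e(1)] vertex_not_edge[OF _ e(1)] by blast+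
  then have "x \<in> O'" using xe' edge_meets_face_closure[OF _ e] by (auto simp: O'_def)
  moreover have "O' \<subseteq> e \<union> \<Union>{f \<in> F. e \<in> fst ` set (fw f)}"
  proof
    fix y assume y: "y \<in> O'"
    then have "y \<in> topspace X" "y \<notin> V" by (auto simp: O'_def)
    moreover have "y \<notin> f" if "f \<in> F" "e \<notin> fst ` set (fw f)" for f
      using y closure_of_subset[OF cells_sub(3)[OF that(1)]] that by (auto simp: O'_def)
    moreover have "y \<notin> e'" if "e' \<in> E - {e}" for e'
      using y closure_of_subset[OF cells_sub(2)[of e']] that by (auto simp: O'_def)
    ultimately have *: "y \<in> topspace X" "y \<notin> V" "\<And>f. f \<in> F \<Longrightarrow> e \<notin> fst ` set (fw f) \<Longrightarrow> y \<notin> f"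
      "\<And>e'. e' \<in> E - {e} \<Longrightarrow> y \<notin> e'" by simp_all
    from cells_cover[OF *(1)] *(2) consider e' where "e' \<in> E" "y \<in> e'" | f where "f \<in> F" "y \<in> f" by blast
    then show "y \<in> e \<union> \<Union>{f \<in> F. e \<in> fst ` set (fw f)}"
    proof cases
      case 1 then show ?thesis using *(4)[of e'] by blast
    next
      case 2 then show ?thesis using *(3)[of f] by blast
    qed
  qed
  ultimately show ?thesis using that by blast
qed

text \<open>The closed face would be a neighbourhood of a point \<open>x\<close> of the edge. A
  chart around \<open>x\<close> then embeds into the closed disc, by invariance of domain into its
  interior, which puts \<open>x\<close> into the open face.\<close>

lemma edge_not_one_face:
  assumes e: "e \<in> E" and one: "{f \<in> F. e \<in> fst ` set (fw f)} = {f}"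
  shows False
proof -
  have f: "f \<in> F" "e \<in> fst ` set (fw f)" using one by auto
  obtain x where x: "x \<in> e" using cells_nonempty(1)[OF e] by blast
  obtain O' where O: "openin X O'" "x \<in> O'" "O' \<subseteq> e \<union> f"
    using edge_neighbourhood[OF e x] one by auto
  obtain U k h where U: "openin X U" "x \<in> U" "U \<subseteq> O'"
    "homeomorphic_maps (top_of_set (ball (0::complex) 1)) (subtopology X U) k h" "k 0 = x"
    using surface_chart[OF surf O(1,2)] .
  have e_cl: "e \<subseteq> X closure_of f" using edge_meets_face_closure[OF f(1) e] f(2) by blast
  have sub: "U \<subseteq> X closure_of f" using U(3) O(3) e_cl closure_of_subset[OF cells_sub(3)[OF f(1)]] by blast
  obtain n \<phi> where P: "polygon_map f n \<phi>" using polygon_map_exists[OF f(1)] by blast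
  note D = polygon_mapD[OF P]
  define g where "g = inv_into (cball 0 1) \<phi>"
  have \<phi>g: "\<phi> (g y) = y" "g y \<in> cball 0 1" if "y \<in> X closure_of f" for y
    using that D(3) unfolding g_def by (metis f_inv_into_f, metis inv_into_into)
  have kc: "continuous_map (top_of_set (ball 0 1)) (subtopology X U) k" and hk: "\<And>z. z \<in> ball 0 1 \<Longrightarrow> h (k z) = z"
    using U(4) by (auto simp: homeomorphic_maps_def)
  have kU: "k z \<in> U" if "z \<in> ball 0 1" for z using kc that by (auto simp: continuous_map_def)
  have "continuous_map (top_of_set (ball 0 1)) (subtopology X (X closure_of f)) k"
    using kc sub kU by (auto simp: continuous_map_in_subtopology)
  then have "continuous_map (top_of_set (ball 0 1)) (top_of_set (cball 0 1)) (g \<circ> k)"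
    using D(10) continuous_map_compose unfolding g_def by blast
  then have "continuous_on (ball 0 1) (g \<circ> k)" by (simp add: continuous_map_in_subtopology)
  moreover have "inj_on (g \<circ> k) (ball 0 1)"
  proof (rule inj_onI)
    fix z w assume zw: "z \<in> ball (0::complex) 1" "w \<in> ball 0 1" "(g \<circ> k) z = (g \<circ> k) w"
    then have "k z = k w" using \<phi>g(1) kU sub by (metis comp_apply subsetD)
    then show "z = w" using hk zw by metis
  qed
  ultimately have "open ((g \<circ> k) ` ball 0 1)" by (intro invariance_of_domain) auto
  moreover have "(g \<circ> k) ` ball 0 1 \<subseteq> cball 0 1" using \<phi>g(2) kU sub by (auto simp: subset_iff)
  ultimately have "(g \<circ> k) ` ball 0 1 \<subseteq> interior (cball 0 1)" by (rule interior_maximal[rotated])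
  then have "(g \<circ> k) 0 \<in> ball 0 1" by (metis (no_types, lifting) centre_in_ball image_subset_iff interior_cball zero_less_one)
  then have "g x \<in> ball 0 1" using U(5) by simp
  then have "\<phi> (g x) \<in> f" using D(4) by blast
  then have "x \<in> f" using \<phi>g(1)[of x] e_cl x by auto
  then show False using edge_not_face[OF e f(1) x] by blast
qed

lemma edge_two_faces:
  assumes e: "e \<in> E"
  shows "card {f \<in> F. e \<in> fst ` set (fw f)} = 2"
proof -
  let ?S = "{f \<in> F. e \<in> fst ` set (fw f)}"
  have fin: "finite ?S" using finites by simp
  obtain f k \<phi> j where f: "f \<in> F" "polygon_map f k \<phi>" "j < k" "e = (\<lambda>t. \<phi> (arcpt k j t)) ` {0<..<1}"
    using edge_in_some_face[OF e] by blast
  have "\<phi> (arcpt k j (1/2)) \<in> e" "\<phi> (arcpt k j (1/2)) \<in> X closure_of f"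
    using f(4) polygon_mapD(3)[OF f(2)] by force+
  then have "f \<in> ?S" using edge_meets_face_closure[OF f(1) e] f(1) by blast
  then have "card ?S \<noteq> 0" using fin by auto
  moreover have "card ?S \<noteq> 1" using edge_not_one_face[OF e] by (metis (no_types, lifting) card_1_singletonE)
  moreover have "\<not> card ?S \<ge> 3"
  proof
    assume "card ?S \<ge> 3"
    then obtain T where T: "T \<subseteq> ?S" "card T = 3" by (meson obtain_subset_with_card_n)
    then obtain a b c where "T = {a,b,c}" "a \<noteq> b" "a \<noteq> c" "b \<noteq> c" by (metis card_3_iff)
    moreover from this have "a \<in> ?S" "b \<in> ?S" "c \<in> ?S" using T(1) by blast+
    ultimately show False using edge_three_faces[of a b c e] e by simp
  qed
  ultimately show ?thesis by linarith
qed

text \<open>Off the closed faces there is no edge either, so the vertex would be an isolated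
  point.\<close>

lemma vertex_in_some_face:
  assumes v: "v \<in> V"
  shows "\<exists>f\<in>F. v \<in> X closure_of f"
proof (rule ccontr)
  assume no: "\<not> ?thesis"
  define O' where "O' = topspace X - (\<Union>f\<in>F. X closure_of f) - (V - {v})"
  have "closedin X (\<Union>f\<in>F. X closure_of f)" using finites by (auto intro!: closedin_Union)
  moreover have "closedin X (V - {v})"
    using finites(1) cells_sub(1) Haus by (meson Diff_subset Hausdorff_imp_t1_space finite_Diff subset_trans t1_space_closedin_finite)
  ultimately have O: "openin X O'" unfolding O'_def by (intro openin_diff openin_topspace)
  have vO: "v \<in> O'" using v no cells_sub(1) by (auto simp: O'_def)
  have "O' \<subseteq> {v}"
  proof
    fix y assume y: "y \<in> O'"
    have "y \<notin> f" if "f \<in> F" for f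
      using y closure_of_subset[OF cells_sub(3)[OF that]] that by (auto simp: O'_def)
    moreover have "y \<notin> e" if e: "e \<in> E" for e
    proof
      assume "y \<in> e"
      have "{f \<in> F. e \<in> fst ` set (fw f)} \<noteq> {}" using edge_two_faces[OF e] by (metis card.empty zero_neq_numeral)
      then obtain f where "f \<in> F" "e \<in> fst ` set (fw f)" by blast
      then have "y \<in> X closure_of f" using edge_meets_face_closure[OF _ e \<open>y \<in> e\<close>] by blast
      then show False using y \<open>f \<in> F\<close> by (auto simp: O'_def)
    qed
    ultimately show "y \<in> {v}" using y cells_cover[of y] by (auto simp: O'_def)
  qed
  obtain U where "openin X U" "v \<in> U" "U \<subseteq> O'" "U \<noteq> {v}" using surface_punctured_nbhd[OF surf O vO] by metis
  then show False using \<open>O' \<subseteq> {v}\<close> by blast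
qed

lemma faces_cover: "topspace X \<subseteq> (\<Union>f\<in>F. X closure_of f)"
proof
  fix x assume "x \<in> topspace X"
  then consider "x \<in> V" | e where "e \<in> E" "x \<in> e" | f where "f \<in> F" "x \<in> f" using cells_cover by blast
  then show "x \<in> (\<Union>f\<in>F. X closure_of f)"
  proof cases
    case 1 then show ?thesis using vertex_in_some_face by blast
  next
    case 2
    have "{f \<in> F. e \<in> fst ` set (fw f)} \<noteq> {}" using edge_two_faces[OF 2(1)] by (metis card.empty zero_neq_numeral)
    then obtain f where "f \<in> F" "e \<in> fst ` set (fw f)" by blast
    then show ?thesis using edge_meets_face_closure[OF _ 2] by blast
  next
    case 3 then show ?thesis using closure_of_subset[OF cells_sub(3)] by blast
  qed
qed

text \<open>Without a common edge the two closed unions of faces meet in vertices only. At such a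
  vertex they would disconnect every small punctured neighbourhood, so they are disjoint, against
  connectedness of the surface.\<close>

lemma dual_connected:
  assumes S: "S \<subseteq> F" "S \<noteq> {}" "S \<noteq> F"
  shows "\<exists>f\<in>S. \<exists>g\<in>F - S. \<exists>e\<in>E. e \<in> fst ` set (fw f) \<and> e \<in> fst ` set (fw g)"
proof (rule ccontr)
  assume no: "\<not> ?thesis"
  define A where "A = (\<Union>f\<in>S. X closure_of f)"
  define B where "B = (\<Union>f\<in>F - S. X closure_of f)"
  have cl: "closedin X A" "closedin X B" unfolding A_def B_def
    using finites(3) finite_subset[OF S(1)] by (auto intro!: closedin_Union)
  have cov: "topspace X \<subseteq> A \<union> B" using faces_cover by (auto simp: A_def B_def)
  have AB: "A \<inter> B \<subseteq> V"
  proof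
    fix x assume "x \<in> A \<inter> B"
    then obtain f g where fg: "f \<in> S" "g \<in> F - S" "x \<in> X closure_of f" "x \<in> X closure_of g" by (auto simp: A_def B_def)
    then have F: "f \<in> F" "g \<in> F" "f \<noteq> g" using S(1) by auto
    have "x \<notin> e" if "e \<in> E" for e
    proof
      assume "x \<in> e"
      then have "e \<in> fst ` set (fw f)" "e \<in> fst ` set (fw g)"
        using edge_meets_face_closure[OF F(1) that] edge_meets_face_closure[OF F(2) that] fg(3,4) by simp_all
      then show False using no fg(1,2) that by blast
    qed
    then have "x \<in> f \<union> V" "x \<in> g \<union> V"
      using subsetD[OF face_closure_cells[OF F(1)] fg(3)] subsetD[OF face_closure_cells[OF F(2)] fg(4)]
        fw_props(1)[OF F(1)] fw_props(1)[OF F(2)] by blast+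
    then show "x \<in> V" using cells_disjoint(2)[OF F] by blast
  qed
  have ne: "A \<inter> topspace X \<noteq> {}" "B \<inter> topspace X \<noteq> {}"
  proof -
    have *: "(\<Union>f\<in>T. X closure_of f) \<inter> topspace X \<noteq> {}" if T: "T \<subseteq> F" "T \<noteq> {}" for T
    proof -
      obtain f where "f \<in> T" "f \<in> F" using T by blast
      then obtain x where "x \<in> f" using cells_nonempty(2) by blast
      then have "x \<in> X closure_of f" "x \<in> topspace X"
        using closure_of_subset[OF cells_sub(3)[OF \<open>f \<in> F\<close>]] cells_sub(3)[OF \<open>f \<in> F\<close>] by blast+
      then show ?thesis using \<open>f \<in> T\<close> by blast
    qed
    show "A \<inter> topspace X \<noteq> {}" "B \<inter> topspace X \<noteq> {}" unfolding A_def B_def using *[OF S(1,2)] *[of "F - S"] S(1,3) by auto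
  qed
  have "A \<inter> B = {}"
  proof (rule ccontr)
    assume "A \<inter> B \<noteq> {}"
    then obtain v where v: "v \<in> A" "v \<in> B" "v \<in> V" using AB by blast
    have "closedin X (V - {v})"
      using finites(1) cells_sub(1) Haus by (meson Diff_subset Hausdorff_imp_t1_space finite_Diff subset_trans t1_space_closedin_finite)
    \<comment> \<open>Near \<open>v\<close> there is no other vertex, so off \<open>v\<close> the
      sets \<open>A\<close> and \<open>B\<close> are disjoint; both come arbitrarily close to
      \<open>v\<close> because faces accumulate there.\<close>
    then have O: "openin X (topspace X - (V - {v}))" by (intro openin_diff openin_topspace)
    have "v \<in> topspace X - (V - {v})" using v cells_sub(1) by blast
    then obtain U where U: "openin X U" "v \<in> U" "U \<subseteq> topspace X - (V - {v})" "connectedin X (U - {v})"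
      using surface_punctured_nbhd[OF surf O] by metis
    have "(U - {v}) \<inter> A \<noteq> {}"
    proof -
      obtain f where f: "f \<in> S" "v \<in> X closure_of f" using v(1) by (auto simp: A_def)
      then obtain y where y: "y \<in> f" "y \<in> U" using U(1,2) unfolding in_closure_of by blast
      then have "y \<noteq> v" using vertex_not_face[OF v(3)] f(1) S(1) by blast
      moreover have "f \<subseteq> X closure_of f" using closure_of_subset[OF cells_sub(3)] f(1) S(1) by blast
      then have "y \<in> A" using y(1) f(1) by (auto simp: A_def)
      ultimately show ?thesis using y by blast
    qed
    moreover have "(U - {v}) \<inter> B \<noteq> {}"
    proof -
      obtain f where f: "f \<in> F - S" "v \<in> X closure_of f" using v(2) by (auto simp: B_def)
      then obtain y where y: "y \<in> f" "y \<in> U" using U(1,2) unfolding in_closure_of by blast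
      then have "y \<noteq> v" using vertex_not_face[OF v(3)] f(1) by blast
      moreover have "f \<subseteq> X closure_of f" using closure_of_subset[OF cells_sub(3)] f(1) by blast
      then have "y \<in> B" using y(1) f(1) by (auto simp: B_def)
      ultimately show ?thesis using y by blast
    qed
    moreover have "U - {v} \<subseteq> A \<union> B" "A \<inter> B \<inter> (U - {v}) = {}" using U(3) cov AB by blast+
    moreover have "\<nexists>E1 E2. closedin X E1 \<and> closedin X E2 \<and> U - {v} \<subseteq> E1 \<union> E2 \<and> E1 \<inter> E2 \<inter> (U - {v}) = {} \<and>
        E1 \<inter> (U - {v}) \<noteq> {} \<and> E2 \<inter> (U - {v}) \<noteq> {}"
      using U(4) unfolding connectedin_closedin by (rule conjunct2)
    ultimately show False using cl by (metis Int_commute)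
  qed
  moreover have "A \<noteq> {}" "B \<noteq> {}" using ne by auto
  ultimately show False using conn cl cov unfolding connected_space_closedin by blast
qed

end

section \<open>Holonomy\<close>

text \<open>The dart \<open>d\<close> from \<open>v\<close> to \<open>w\<close> has gain \<open>a d\<close> if its edge is assigned the point of
  \<open>r v - a d *s r w\<close>.\<close>

definition gain :: "('a dart \<Rightarrow> 'd::division_ring) \<Rightarrow> bool" where
  "gain a \<longleftrightarrow> (\<forall>d. a d \<noteq> 0 \<and> a (rv d) = inverse (a d))"

definition hol :: "('a dart \<Rightarrow> 'd::division_ring) \<Rightarrow> 'a dart list \<Rightarrow> 'd" where
  "hol a w = prod_list (map a w)"

lemma hol_simps [simp]: "hol a [] = 1" "hol a (d # w) = a d * hol a w" "hol a (u @ v) = hol a u * hol a v"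
  by (simp_all add: hol_def)

lemma gainD: "gain a \<Longrightarrow> a d \<noteq> 0" "gain a \<Longrightarrow> a (rv d) = inverse (a d)"
  unfolding gain_def by blast+

lemma hol_nonzero: "gain a \<Longrightarrow> hol a w \<noteq> 0"
  by (induction w) (simp_all add: gainD(1))

lemma hol_reverse: "gain a \<Longrightarrow> hol a (rev (map rv w)) = inverse (hol a w)"
  by (induction w) (simp_all add: gainD hol_nonzero nonzero_inverse_mult_distrib)

lemma mult_eq_1_commute: "x * y = 1 \<longleftrightarrow> y * x = (1 :: 'd::division_ring)"
proof -
  have "y * x = 1" if "x * y = 1" for x y :: 'd
    using that by (metis inverse_unique left_inverse mult_zero_left zero_neq_one)
  then show ?thesis by blast
qed

lemma inverse_mult_eq_1_iff: "x \<noteq> 0 \<Longrightarrow> inverse x * y = 1 \<longleftrightarrow> y = (x :: 'd::division_ring)"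
proof
  assume x: "x \<noteq> 0" and "inverse x * y = 1"
  then have "x * (inverse x * y) = x" by simp
  then show "y = x" using x by (simp flip: mult.assoc)
qed simp

lemma hol_cong: "(\<And>d. d \<in> set w \<Longrightarrow> a d = b d) \<Longrightarrow> hol a w = hol b w"
  by (induction w) simp_all

text \<open>Rotation conjugates the holonomy and reversal inverts it. Its value changes, but not
  whether it is \<open>1\<close>.\<close>

lemma hol_front:
  assumes "gain a" "w = A @ d # B \<and> v = B @ A \<or> w = A @ rv d # B \<and> v = rev (map rv (B @ A))"
  shows "hol a (d # v) = 1 \<longleftrightarrow> hol a w = 1"
  using assms(2)
proof
  assume "w = A @ d # B \<and> v = B @ A"
  then show ?thesis using mult_eq_1_commute[of "hol a A" "a d * hol a B"] by (simp add: mult.assoc)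
next
  assume w: "w = A @ rv d # B \<and> v = rev (map rv (B @ A))"
  have ad: "a d \<noteq> 0" "a (rv d) = inverse (a d)" using gainD[OF assms(1)] by blast+
  have nz: "hol a (B @ A) \<noteq> 0" using hol_nonzero[OF assms(1)] .
  have "hol a w = 1 \<longleftrightarrow> inverse (a d) * hol a (B @ A) = 1"
    using w ad mult_eq_1_commute[of "hol a A" "inverse (a d) * hol a B"] by (simp add: mult.assoc)
  also have "\<dots> \<longleftrightarrow> hol a (B @ A) = a d" by (rule inverse_mult_eq_1_iff[OF ad(1)])
  also have "\<dots> \<longleftrightarrow> a d * inverse (hol a (B @ A)) = 1"
    using right_inverse_eq[OF nz, of "a d"] by (simp only: divide_inverse eq_commute)
  also have "\<dots> \<longleftrightarrow> hol a (d # v) = 1" using hol_reverse[OF assms(1), of "B @ A"] w by (simp del: hol_simps(3))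
  finally show ?thesis by simp
qed

section \<open>Gluing all faces along a spanning tree of the dual graph\<close>

context subdivided_surface
begin

abbreviation sides :: "'a set \<Rightarrow> 'a set set" where
  "sides f \<equiv> fst ` set (fw f)"

text \<open>The faces in \<open>S\<close> have been glued to a disc along the edges in \<open>I\<close>. Over this disc the holonomy of the
  boundary word is that of the face \<open>f0\<close> as soon as all other faces have trivial holonomy, and the
  latter can be achieved by changing the gains on \<open>I\<close> only.\<close>

definition glued :: "'d::division_ring itself \<Rightarrow> 'a set \<Rightarrow> 'a set set \<Rightarrow> 'a dart list \<Rightarrow> (complex \<Rightarrow> 'a) \<Rightarrow> 'a set set \<Rightarrow> bool" where
  "glued _ f0 S w \<Phi> I \<longleftrightarrow> fill w \<Phi> \<and> \<Union>S \<subseteq> \<Phi> ` cball 0 1 \<and> \<Phi> ` ball 0 1 \<subseteq> \<Union>S \<union> \<Union>I \<and> I \<subseteq> E \<and>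
     (\<forall>e\<in>I. {f \<in> F. e \<in> sides f} \<subseteq> S \<and> e \<notin> fst ` set w) \<and>
     (\<forall>e\<in>E - I. count (mset (map fst w)) e = card {f \<in> S. e \<in> sides f}) \<and>
     (\<forall>a :: 'a dart \<Rightarrow> 'd. gain a \<longrightarrow> (\<forall>g\<in>S - {f0}. hol a (fw g) = 1) \<longrightarrow> (hol a w = 1 \<longleftrightarrow> hol a (fw f0) = 1)) \<and>
     (\<forall>a :: 'a dart \<Rightarrow> 'd. gain a \<longrightarrow>
        (\<exists>a'. gain a' \<and> (\<forall>d. fst d \<notin> I \<longrightarrow> a' d = a d) \<and> (\<forall>g\<in>S - {f0}. hol a' (fw g) = 1)))"

lemma gluedD:
  assumes "glued (T :: 'd::division_ring itself) f0 S w \<Phi> I"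
  shows "fill w \<Phi>" "\<Union>S \<subseteq> \<Phi> ` cball 0 1" "\<Phi> ` ball 0 1 \<subseteq> \<Union>S \<union> \<Union>I" "I \<subseteq> E"
    "\<And>e. e \<in> I \<Longrightarrow> {f \<in> F. e \<in> sides f} \<subseteq> S" "\<And>e. e \<in> I \<Longrightarrow> e \<notin> fst ` set w"
    "\<And>e. e \<in> E \<Longrightarrow> e \<notin> I \<Longrightarrow> count (mset (map fst w)) e = card {f \<in> S. e \<in> sides f}"
    "\<And>a :: 'a dart \<Rightarrow> 'd. gain a \<Longrightarrow> (\<And>g. g \<in> S \<Longrightarrow> g \<noteq> f0 \<Longrightarrow> hol a (fw g) = 1) \<Longrightarrow> hol a w = 1 \<longleftrightarrow> hol a (fw f0) = 1"
    "\<And>a :: 'a dart \<Rightarrow> 'd. gain a \<Longrightarrow>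
        \<exists>a'. gain a' \<and> (\<forall>d. fst d \<notin> I \<longrightarrow> a' d = a d) \<and> (\<forall>g\<in>S - {f0}. hol a' (fw g) = 1)"
proof -
  note D = assms[unfolded glued_def]
  show "fill w \<Phi>" "\<Union>S \<subseteq> \<Phi> ` cball 0 1" "\<Phi> ` ball 0 1 \<subseteq> \<Union>S \<union> \<Union>I" "I \<subseteq> E"
    using D by simp_all
  note D' = D[THEN conjunct2, THEN conjunct2, THEN conjunct2, THEN conjunct2]
  show "{f \<in> F. e \<in> sides f} \<subseteq> S" "e \<notin> fst ` set w" if "e \<in> I" for e
    using D'[THEN conjunct1] that by blast+
  note D'' = D'[THEN conjunct2]
  show "count (mset (map fst w)) e = card {f \<in> S. e \<in> sides f}" if "e \<in> E" "e \<notin> I" for e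
    using D''[THEN conjunct1] that by blast
  note D3 = D''[THEN conjunct2]
  show "hol a w = 1 \<longleftrightarrow> hol a (fw f0) = 1" if "gain a" "\<And>g. g \<in> S \<Longrightarrow> g \<noteq> f0 \<Longrightarrow> hol a (fw g) = 1"
    for a :: "'a dart \<Rightarrow> 'd"
    using D3[THEN conjunct1] that by blast
  show "\<exists>a'. gain a' \<and> (\<forall>d. fst d \<notin> I \<longrightarrow> a' d = a d) \<and> (\<forall>g\<in>S - {f0}. hol a' (fw g) = 1)" if "gain a"
    for a :: "'a dart \<Rightarrow> 'd"
    using D3[THEN conjunct2] that by blast
qed

lemma gluedI:
  assumes "fill w \<Phi>" "\<Union>S \<subseteq> \<Phi> ` cball 0 1" "\<Phi> ` ball 0 1 \<subseteq> \<Union>S \<union> \<Union>I" "I \<subseteq> E"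
    and "\<And>e. e \<in> I \<Longrightarrow> {f \<in> F. e \<in> sides f} \<subseteq> S \<and> e \<notin> fst ` set w"
    and "\<And>e. e \<in> E - I \<Longrightarrow> count (mset (map fst w)) e = card {f \<in> S. e \<in> sides f}"
    and "\<And>a :: 'a dart \<Rightarrow> 'd::division_ring. gain a \<Longrightarrow> \<forall>g\<in>S - {f0}. hol a (fw g) = 1 \<Longrightarrow> hol a w = 1 \<longleftrightarrow> hol a (fw f0) = 1"
    and "\<And>a :: 'a dart \<Rightarrow> 'd. gain a \<Longrightarrow>
        \<exists>a'. gain a' \<and> (\<forall>d. fst d \<notin> I \<longrightarrow> a' d = a d) \<and> (\<forall>g\<in>S - {f0}. hol a' (fw g) = 1)"
  shows "glued (T :: 'd itself) f0 S w \<Phi> I"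
  unfolding glued_def
proof (intro conjI ballI allI impI)
  show "fill w \<Phi>" "\<Union>S \<subseteq> \<Phi> ` cball 0 1" "\<Phi> ` ball 0 1 \<subseteq> \<Union>S \<union> \<Union>I" "I \<subseteq> E"
    by (fact assms)+
  fix e assume e: "e \<in> I"
  show "{f \<in> F. e \<in> sides f} \<subseteq> S" using assms(5)[OF e] by (rule conjunct1)
  show "e \<notin> fst ` set w" using assms(5)[OF e] by (rule conjunct2)
next
  fix e assume "e \<in> E - I"
  then show "count (mset (map fst w)) e = card {f \<in> S. e \<in> sides f}" by (rule assms(6))
next
  fix a :: "'a dart \<Rightarrow> 'd" assume "gain a" "\<forall>g\<in>S - {f0}. hol a (fw g) = 1"
  then show "hol a w = 1 \<longleftrightarrow> hol a (fw f0) = 1" by (rule assms(7))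
next
  fix a :: "'a dart \<Rightarrow> 'd" assume "gain a"
  then show "\<exists>a'. gain a' \<and> (\<forall>d. fst d \<notin> I \<longrightarrow> a' d = a d) \<and> (\<forall>g\<in>S - {f0}. hol a' (fw g) = 1)" by (rule assms(8))
qed

lemma count_mset_distinct: "distinct xs \<Longrightarrow> count (mset xs) x = (if x \<in> set xs then 1 else 0)"
  by (metis distinct_count_atmost_1)

lemma count_sides:
  assumes "f \<in> F"
  shows "count (mset (map fst (fw f))) e = (if e \<in> sides f then 1 else 0)"
  unfolding count_mset_distinct[OF fw_props(3)[OF assms]] set_map by (rule refl)

lemma glued_start:
  assumes f0: "f0 \<in> F"
  shows "\<exists>\<Phi>. glued (T :: 'd::division_ring itself) f0 {f0} (fw f0) \<Phi> {}"
proof -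
  obtain \<Phi> where w: "face_word f0 (fw f0) \<Phi>" using fw[OF f0] .
  note D = face_wordD[OF w]
  have "f0 \<subseteq> \<Phi> ` cball 0 1" using D(2) closure_of_subset[OF cells_sub(3)[OF f0]] by simp
  moreover have "count (mset (map fst (fw f0))) e = card {f \<in> {f0}. e \<in> sides f}" for e
  proof -
    have "{f \<in> {f0}. e \<in> sides f} = (if e \<in> sides f0 then {f0} else {})" by auto
    then show ?thesis using count_sides[OF f0, of e] by simp
  qed
  ultimately have "glued T f0 {f0} (fw f0) \<Phi> {}" unfolding glued_def using D(1,3) by (auto intro!: exI)
  then show ?thesis by blast
qed

text \<open>An edge \<open>e\<close> between \<open>S\<close> and a new face \<open>g\<close>
  belongs to one face of \<open>S\<close>, so it occurs once in \<open>w\<close>, and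
  \<open>g\<close> can be glued on along it. The gain of \<open>e\<close> is then spent on making
  \<open>g\<close> trivial.\<close>

lemma glued_step:
  assumes G: "glued (T :: 'd::division_ring itself) f0 S w \<Phi> I" and S: "f0 \<in> S" "S \<subseteq> F" "S \<noteq> F"
  shows "\<exists>g w' \<Phi>' I'. g \<in> F - S \<and> glued T f0 (insert g S) w' \<Phi>' I'"
proof -
  note D = gluedD[OF G]
  obtain f g e where fg: "f \<in> S" "g \<in> F - S" "e \<in> E" "e \<in> sides f" "e \<in> sides g"
    using dual_connected[OF S(2) _ S(3)] S(1) by blast
  have F: "f \<in> F" "g \<in> F" "f \<noteq> g" "g \<noteq> f0" "g \<notin> S" using fg S by auto
  have faces: "{h \<in> F. e \<in> sides h} = {f, g}"
  proof (rule card_subset_eq[symmetric])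
    show "finite {h \<in> F. e \<in> sides h}" using finites by simp
    show "{f, g} \<subseteq> {h \<in> F. e \<in> sides h}" using F fg by blast
    show "card {f, g} = card {h \<in> F. e \<in> sides h}" using edge_two_faces[OF fg(3)] F by simp
  qed
  \<comment> \<open>Both faces of an edge in \<open>I\<close> already belong to \<open>S\<close>,
    but \<open>g\<close> does not.\<close>
  have eI: "e \<notin> I"
  proof
    assume "e \<in> I"
    from D(5)[OF this] have "{f, g} \<subseteq> S" unfolding faces .
    then show False using F(5) by simp
  qed
  have "{h \<in> S. e \<in> sides h} = {h \<in> F. e \<in> sides h} \<inter> S" using S(2) by auto
  then have "{h \<in> S. e \<in> sides h} = {f}" using faces fg(1) F(5) by auto
  then have cnt: "count (mset (map fst w)) e = 1" using D(7)[OF fg(3) eI] by simp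
  then have "e \<in># mset (map fst w)" by (metis count_eq_zero_iff zero_neq_one)
  then have ew: "e \<in> fst ` set w" by simp
  define d where "d = (e, True)"
  have d: "fst d = e" "fst (rv d) = e" by (auto simp: d_def)
  obtain u \<Phi>1 A B where u: "fill (d # u) \<Phi>1" "\<Phi>1 ` cball 0 1 = \<Phi> ` cball 0 1" "\<Phi>1 ` ball 0 1 = \<Phi> ` ball 0 1"
    "w = A @ d # B \<and> u = B @ A \<or> w = A @ rv d # B \<and> u = rev (map rv (B @ A))"
    using fill_front[OF D(1), of d] ew d by metis
  have "fst (rv d) \<in> sides g" using fg(5) d(2) by simp
  then obtain v \<Phi>2 A' B' where v0: "fill (rv d # v) \<Phi>2" "\<Phi>2 ` cball 0 1 = X closure_of g" "\<Phi>2 ` ball 0 1 = g" "v \<noteq> []"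
    "fst (rv d) \<notin> fst ` set v" "sides g = insert (fst (rv d)) (fst ` set v)" "distinct (map fst v)"
    "fw g = A' @ rv d # B' \<and> v = B' @ A' \<or> fw g = A' @ rv (rv d) # B' \<and> v = rev (map rv (B' @ A'))"
    by (rule face_word_front[OF F(2)])
  note v = v0[unfolded d(2)]
  have "fst \<circ> (rv :: 'a dart \<Rightarrow> 'a dart) = fst" by auto
  then have "image_mset (fst \<circ> rv) (mset xs) = image_mset fst (mset xs)" for xs :: "'a dart list" by simp
  then have ms: "mset (map fst w) = add_mset e (mset (map fst u))"
    using u(4) d by (auto simp: image_mset.compositionality)
  then have eu: "count (mset (map fst u)) e = 0" using cnt by simp
  then have eu: "e \<notin> fst ` set u" by (metis count_eq_zero_iff list.set_map set_mset_mset)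
  have wu: "fst ` set w = insert e (fst ` set u)"
    using arg_cong[OF ms, of set_mset] by simp
  have uw: "mset (map fst (d # u)) = mset (map fst w)" using ms d by simp
  \<comment> \<open>A disc bounded by a single edge would make that edge a loop.\<close>
  have "u \<noteq> []"
  proof
    assume "u = []"
    then have one: "fill [d] \<Phi>1" using u(1) by simp
    have "\<Phi>1 (arcpt 1 0 0) = dpath d 0" "\<Phi>1 (arcpt 1 0 1) = dpath d 1" using one by (auto simp: fill_def)
    moreover have "arcpt 1 0 0 = arcpt 1 0 1" using arcpt_join[of 0 1] by simp
    ultimately have "dpath d 0 = dpath d 1" by simp
    then show False using edge_ends(3)[of d] d fg(3) by simp
  qed
  have ball: "\<Phi> ` ball 0 1 \<subseteq> \<Union>S \<union> \<Union>I" by (rule D(3))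
  have clg: "X closure_of g \<subseteq> g \<union> V \<union> \<Union>(sides g)" by (rule face_closure_cells[OF F(2)])
  have sgE: "sides g \<subseteq> E" by (rule fw_props(1)[OF F(2)])
  have Ig: "I \<inter> sides g = {}" using D(5) F(2,5) by blast
  have Sg: "\<Union>S \<inter> g = {}" using cells_disjoint(2) S(2) F(2,5) by blast
  have SV: "\<Union>S \<inter> V = {}" using vertex_not_face S(2) by blast
  have SE: "\<Union>S \<inter> \<Union>E = {}" using edge_not_face S(2) by blast
  have IV: "\<Union>I \<inter> V = {}" using edge_vertex_disjoint D(4) by blast
  have Igg: "\<Union>I \<inter> g = {}" using edge_not_face D(4) F(2) by blast
  have Isg: "\<Union>I \<inter> \<Union>(sides g) = {}"
  proof -
    have "i \<inter> e' = {}" if "i \<in> I" "e' \<in> sides g" for i e'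
      using edges_disjoint[of i e'] that D(4) sgE Ig by blast
    then show ?thesis by blast
  qed
  have disj1: "\<Phi>1 ` ball 0 1 \<inter> \<Phi>2 ` cball 0 1 = {}"
  proof -
    have "(\<Union>S \<union> \<Union>I) \<inter> (g \<union> V \<union> \<Union>(sides g)) = {}"
      using Sg SV SE IV Igg Isg sgE by blast
    moreover have "\<Phi>1 ` ball 0 1 \<subseteq> \<Union>S \<union> \<Union>I" "\<Phi>2 ` cball 0 1 \<subseteq> g \<union> V \<union> \<Union>(sides g)"
      using ball clg u(3) v(2) by simp_all
    ultimately show ?thesis by (meson disjoint_iff subsetD)
  qed
  have disj2: "\<Phi>2 ` ball 0 1 \<inter> \<Phi>1 ` cball 0 1 = {}"
  proof -
    have "\<Phi> z \<notin> g" if "norm z \<le> 1" for z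
    proof (cases "norm z = 1")
      case True
      have "\<Phi> z \<in> V \<union> \<Union>(fst ` set w)" using fill_boundary_mem[OF D(1) True] .
      moreover have "fst ` set w \<subseteq> E" using D(1) by (simp add: fill_def)
      ultimately show ?thesis using vertex_not_face[OF _ F(2)] edge_not_face[OF _ F(2)] by blast
    next
      case False
      then have "z \<in> ball 0 1" using that by simp
      then have "\<Phi> z \<in> \<Union>S \<union> \<Union>I" using ball by (meson imageI subsetD)
      then show ?thesis using Sg Igg by blast
    qed
    then have "g \<inter> \<Phi> ` cball 0 1 = {}" by auto
    then show ?thesis unfolding u(2) v(3) .
  qed
  obtain \<Omega> where \<Omega>: "fill (u @ v) \<Omega>" "\<Omega> ` cball 0 1 = \<Phi>1 ` cball 0 1 \<union> \<Phi>2 ` cball 0 1"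
    "\<Omega> ` ball 0 1 \<subseteq> \<Phi>1 ` ball 0 1 \<union> \<Phi>2 ` ball 0 1 \<union> fst d"
    using fill_glue[OF u(1) v(1) \<open>u \<noteq> []\<close> v(4) _ _ disj1 disj2] eu v(5) d(1) by auto
  define I' where "I' = insert e I"
  have "\<Union>(insert g S) \<subseteq> \<Omega> ` cball 0 1"
    using \<Omega>(2) u(2) v(2) D(2) closure_of_subset[OF cells_sub(3)[OF F(2)]] by auto
  moreover have "\<Omega> ` ball 0 1 \<subseteq> \<Union>(insert g S) \<union> \<Union>I'"
  proof -
    have "\<Omega> ` ball 0 1 \<subseteq> (\<Union>S \<union> \<Union>I) \<union> g \<union> e"
      using \<Omega>(3)[unfolded u(3) v(3) d(1)] ball by (meson Un_mono subset_refl subset_trans)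
    then show ?thesis by (auto simp: I'_def)
  qed
  moreover have "I' \<subseteq> E" using D(4) fg(3) by (simp add: I'_def)
  moreover have "{h \<in> F. e' \<in> sides h} \<subseteq> insert g S \<and> e' \<notin> fst ` set (u @ v)" if e': "e' \<in> I'" for e'
  proof (cases "e' = e")
    case True
    have "{h \<in> F. e \<in> sides h} \<subseteq> insert g S" unfolding faces using fg(1) by simp
    moreover have "e \<notin> fst ` set (u @ v)" using eu v(5) by (simp add: image_Un)
    ultimately show ?thesis unfolding True by simp
  next
    case False
    then have "e' \<in> I" using e' by (simp add: I'_def)
    have "e' \<notin> fst ` set u" using D(6)[OF \<open>e' \<in> I\<close>] wu by simp
    moreover have "e' \<notin> sides g" using Ig \<open>e' \<in> I\<close> by blast
    then have "e' \<notin> fst ` set v" unfolding v(6) by simp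
    ultimately have "e' \<notin> fst ` set (u @ v)" by (simp add: image_Un)
    then show ?thesis using subset_insertI2[OF D(5)[OF \<open>e' \<in> I\<close>]] by blast
  qed
  moreover have "count (mset (map fst (u @ v))) e' = card {h \<in> insert g S. e' \<in> sides h}" if e': "e' \<in> E - I'" for e'
  proof -
    have ne: "e' \<noteq> e" "e' \<notin> I" "e' \<in> E" using e' by (auto simp: I'_def)
    have cu: "count (mset (map fst u)) e' = card {h \<in> S. e' \<in> sides h}"
      using D(7)[OF ne(3,2)] ms ne(1) by simp
    have cv: "count (mset (map fst v)) e' = (if e' \<in> sides g then 1 else 0)"
      unfolding count_mset_distinct[OF v(7)] set_map v(6) using ne(1) by simp
    have fin: "finite {h \<in> S. e' \<in> sides h}" using finite_subset[OF S(2) finites(3)] by simp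
    have "{h \<in> insert g S. e' \<in> sides h} = (if e' \<in> sides g then insert g {h \<in> S. e' \<in> sides h} else {h \<in> S. e' \<in> sides h})"
      by auto
    then show ?thesis using cu cv fin F(5) by simp
  qed
  moreover have "hol a (u @ v) = 1 \<longleftrightarrow> hol a (fw f0) = 1"
    if a: "gain a" "\<forall>h\<in>insert g S - {f0}. hol a (fw h) = 1" for a :: "'a dart \<Rightarrow> 'd"
  proof -
    have ad: "a d \<noteq> 0" "a (rv d) = inverse (a d)" using gainD[OF a(1)] by blast+
    have "hol a (fw g) = 1" using a(2) F(4) by simp
    then have "hol a (rv d # v) = 1" using hol_front[OF a(1) v(8)] by simp
    \<comment> \<open>Since \<open>g\<close> is trivial, the rest of its boundary has the gain of
      \<open>d\<close>, so replacing \<open>d\<close> by \<open>v\<close> in the old word leaves the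
      product unchanged.\<close>
    then have "hol a v = a d" using inverse_mult_eq_1_iff[OF ad(1)] ad(2) by simp
    then have "hol a (u @ v) = 1 \<longleftrightarrow> hol a (d # u) = 1" using mult_eq_1_commute[of "hol a u"] by simp
    also have "\<dots> \<longleftrightarrow> hol a w = 1" by (rule hol_front[OF a(1) u(4)])
    also have "\<dots> \<longleftrightarrow> hol a (fw f0) = 1" by (rule D(8)[OF a(1)]) (use a(2) in blast)
    finally show ?thesis .
  qed
  moreover have "\<exists>a'. gain a' \<and> (\<forall>d. fst d \<notin> I' \<longrightarrow> a' d = a d) \<and> (\<forall>h\<in>insert g S - {f0}. hol a' (fw h) = 1)"
    if a: "gain a" for a :: "'a dart \<Rightarrow> 'd"
  proof -
    \<comment> \<open>The one value of the gain on \<open>d\<close> for which \<open>g\<close> has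
      trivial holonomy; the rest \<open>v\<close> of its boundary does not contain the edge
      \<open>e\<close>.\<close>
    define c where "c = hol a v"
    have c: "c \<noteq> 0" using hol_nonzero[OF a] by (simp add: c_def)
    define a1 where "a1 = a(d := c, rv d := inverse c)"
    have a1d: "a1 d = c" "a1 (rv d) = inverse c" by (simp_all add: a1_def)
    have a1o: "a1 d' = a d'" if "fst d' \<noteq> e" for d' using that d by (auto simp: a1_def)
    have g1: "gain a1" unfolding gain_def
    proof
      fix d'
      show "a1 d' \<noteq> 0 \<and> a1 (rv d') = inverse (a1 d')"
      proof (cases "fst d' = e")
        case True
        then have "d' = d \<or> d' = rv d" using dart_cases[of d' d] d by simp
        then show ?thesis using a1d c by auto
      next
        case False
        then show ?thesis using gainD[OF a, of d'] a1o[of d'] a1o[of "rv d'"] by simp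
      qed
    qed
    have "hol a1 v = hol a v"
    proof (rule hol_cong)
      fix d' assume "d' \<in> set v"
      then have "fst d' \<noteq> e" using v(5) by blast
      then show "a1 d' = a d'" by (rule a1o)
    qed
    then have "hol a1 v = c" by (simp only: c_def)
    then have "hol a1 (rv d # v) = inverse c * c" by (simp only: hol_simps a1d)
    also have "\<dots> = 1" by (rule left_inverse[OF c])
    finally have "hol a1 (rv d # v) = 1" .
    then have h1: "hol a1 (fw g) = 1" using hol_front[OF g1 v(8)] by simp
    \<comment> \<open>The faces of \<open>S\<close> are made trivial afterwards. This alters gains
      on \<open>I\<close> only, and no side of \<open>g\<close> lies in \<open>I\<close>, so
      \<open>g\<close> stays trivial.\<close>
    obtain a' where a': "gain a'" "\<And>d. fst d \<notin> I \<Longrightarrow> a' d = a1 d" "\<And>h. h \<in> S - {f0} \<Longrightarrow> hol a' (fw h) = 1"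
      using D(9)[OF g1] by blast
    have "hol a' (fw g) = hol a1 (fw g)"
    proof (rule hol_cong)
      fix d' assume "d' \<in> set (fw g)"
      then have "fst d' \<in> sides g" by simp
      then have "fst d' \<notin> I" using Ig by blast
      then show "a' d' = a1 d'" by (rule a'(2))
    qed
    then have "hol a' (fw h) = 1" if "h \<in> insert g S - {f0}" for h using that a'(3) h1 by auto
    moreover have "a' d' = a d'" if "fst d' \<notin> I'" for d' using that a'(2)[of d'] a1o[of d'] by (simp add: I'_def)
    ultimately show ?thesis using a'(1) by blast
  qed
  ultimately have "glued T f0 (insert g S) (u @ v) \<Omega> I'" by (rule gluedI[OF \<Omega>(1)])
  then show ?thesis using fg(2) by blast
qed

lemma glued_all:
  assumes f0: "f0 \<in> F"
  shows "\<exists>w \<Phi> I. glued (T :: 'd::division_ring itself) f0 F w \<Phi> I"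
proof -
  have "\<exists>w \<Phi> I. glued T f0 F w \<Phi> I" if "glued T f0 S w \<Phi> I" "f0 \<in> S" "S \<subseteq> F" for S w \<Phi> I
    using that
  proof (induction "card (F - S)" arbitrary: S w \<Phi> I rule: less_induct)
    case less
    show ?case
    proof (cases "S = F")
      case False
      obtain g w' \<Phi>' I' where g: "g \<in> F - S" "glued T f0 (insert g S) w' \<Phi>' I'"
        using glued_step[OF less.prems False] by blast
      have "card (F - insert g S) < card (F - S)"
        using g(1) finites(3) by (intro psubset_card_mono) auto
      from less.hyps[OF this g(2)] less.prems g(1) show ?thesis by auto
    qed (use less.prems in blast)
  qed
  then show ?thesis using glued_start[OF f0] f0 by (meson empty_subsetI insert_subset singletonI)
qed

end

section \<open>Words in which every edge occurs twice\<close>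

text \<open>Darts, not edges, are distinct: every edge that occurs is run exactly twice, once in
  each direction.\<close>

definition balanced :: "'a dart list \<Rightarrow> bool" where
  "balanced w \<longleftrightarrow> distinct w \<and> (\<forall>d\<in>set w. rv d \<in> set w)"

text \<open>The words that represent \<open>1\<close> in the free group on the edges, with
  \<open>rv\<close> as inversion.\<close>

inductive cancels :: "'a dart list \<Rightarrow> bool" where
  cancels_Nil: "cancels []"
| cancels_insert: "cancels (u @ v) \<Longrightarrow> cancels (u @ d # rv d # v)"

text \<open>With the two sides of each pair joined by a chord of the polygon, two of the chords
  cross.\<close>

definition crossing :: "'a dart list \<Rightarrow> bool" where
  "crossing w \<longleftrightarrow> (\<exists>r s. subseq [r, s, rv r, rv s] w)"

lemma hol_cancels: "cancels w \<Longrightarrow> gain a \<Longrightarrow> hol a w = 1"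
proof (induction rule: cancels.induct)
  case (cancels_insert u v d)
  have "a d * (inverse (a d) * hol a v) = hol a v"
    using gainD(1)[OF cancels_insert.prems, of d] by (simp flip: mult.assoc)
  then show ?case using cancels_insert gainD(2)[OF cancels_insert.prems] by simp
qed simp

lemma crossingI: "w = A @ r # B @ s # C @ rv r # D @ rv s # G \<Longrightarrow> crossing w"
  unfolding crossing_def by (intro exI[of _ r] exI[of _ s]) (simp add: list_emb_append2)

lemma subseq_ConsE:
  assumes "subseq (x # xs) ys"
  obtains us vs where "ys = us @ x # vs" "subseq xs vs"
  using list_emb_ConsD[OF assms] by auto

lemma crossingE:
  assumes "crossing w"
  obtains A B C D G r s where "w = A @ r # B @ s # C @ rv r # D @ rv s # G"
proof -
  obtain r s where s: "subseq [r, s, rv r, rv s] w" using assms by (auto simp: crossing_def)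
  obtain A w1 where 1: "w = A @ r # w1" "subseq [s, rv r, rv s] w1" using s by (rule subseq_ConsE)
  obtain B w2 where 2: "w1 = B @ s # w2" "subseq [rv r, rv s] w2" using 1(2) by (rule subseq_ConsE)
  obtain C w3 where 3: "w2 = C @ rv r # w3" "subseq [rv s] w3" using 2(2) by (rule subseq_ConsE)
  obtain D w4 where 4: "w3 = D @ rv s # w4" using 3(2) by (rule subseq_ConsE)
  show ?thesis by (rule that) (use 1 2 3 4 in simp)
qed

lemma balanced_remove:
  assumes "balanced (u @ d # rv d # v)"
  shows "balanced (u @ v)"
proof -
  have "rv x \<in> set (u @ v)" if x: "x \<in> set (u @ v)" for x
  proof -
    have "rv x \<in> set (u @ d # rv d # v)" using assms x by (auto simp: balanced_def)
    moreover have "rv x \<noteq> d" "rv x \<noteq> rv d"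
      using assms x rv_simps(1) unfolding balanced_def by (metis distinct.simps(2) distinct_append not_distinct_conv_prefix Un_iff disjoint_iff list.set_intros(1) list.set_intros(2) set_append)+
    ultimately show ?thesis by auto
  qed
  then show ?thesis using assms by (auto simp: balanced_def)
qed

text \<open>Choose a pair \<open>r\<close>, \<open>rv r\<close> with the shortest gap
  \<open>B\<close>. If \<open>B\<close> is empty the pair cancels and induction applies. Otherwise
  the first letter of \<open>B\<close> has its partner outside \<open>B\<close>, by minimality, so
  the two pairs cross.\<close>

lemma cancels_or_crossing: "balanced w \<Longrightarrow> cancels w \<or> crossing w"
proof (induction "length w" arbitrary: w rule: less_induct)
  case less
  show ?case
  proof (cases "w = []")
    case True
    then show ?thesis by (simp add: cancels_Nil)
  next
    case False
    then obtain d w' where w: "w = d # w'" by (cases w) auto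
    define P where "P n \<longleftrightarrow> (\<exists>A r B C. w = A @ r # B @ rv r # C \<and> length B = n)" for n
    have "rv d \<in> set w" using less.prems w by (simp add: balanced_def)
    then have "rv d \<in> set w'" using w by simp
    then obtain B C where "w' = B @ rv d # C" by (meson split_list)
    then have "w = [] @ d # B @ rv d # C" using w by simp
    then have "\<exists>n. P n" unfolding P_def by blast
    then obtain n where n: "P n" "\<And>m. m < n \<Longrightarrow> \<not> P m" by (metis (full_types) exists_least_iff)
    then obtain A r B C where w: "w = A @ r # B @ rv r # C" "length B = n" by (auto simp: P_def)
    have dist: "distinct w" using less.prems by (simp add: balanced_def)
    show ?thesis
    proof (cases B)
      case Nil
      then have w2: "w = A @ r # rv r # C" using w by simp
      then have "balanced (A @ C)" using balanced_remove less.prems by blast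
      then have "cancels (A @ C) \<or> crossing (A @ C)" using less.hyps[of "A @ C"] w2 by simp
      then show ?thesis
      proof
        assume "cancels (A @ C)"
        then show ?thesis using cancels_insert w2 by blast
      next
        assume "crossing (A @ C)"
        moreover have "subseq (A @ C) w" unfolding w2 subseq_append' by (intro list_emb_Cons subseq_order.refl)
        ultimately show ?thesis unfolding crossing_def using subseq_order.trans by blast
      qed
    next
      case (Cons s B')
      then have w3: "w = A @ r # s # B' @ rv r # C" using w by simp
      have "rv s \<in> set w" using less.prems w3 by (simp add: balanced_def)
      moreover have "rv s \<noteq> r" using dist w3 by auto
      moreover have "rv s \<noteq> rv r" using dist w3 rv_simps(1) by (metis distinct.simps(2) distinct_append list.set_intros(1))
      ultimately consider "rv s \<in> set A" | "rv s \<in> set B'" | "rv s \<in> set C" using w3 by auto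
      then show ?thesis
      proof cases
        \<comment> \<open>The partner \<open>rv s\<close> comes before \<open>r\<close>, so it plays
          the role of the first letter of the crossing.\<close>
        case 1
        then obtain A1 A2 where "A = A1 @ rv s # A2" by (meson split_list)
        then have "w = A1 @ rv s # A2 @ r # [] @ rv (rv s) # B' @ rv r # C" using w3 by simp
        then show ?thesis using crossingI by blast
      next
        case 2
        then obtain B1 B2 where B: "B' = B1 @ rv s # B2" by (meson split_list)
        then have "w = (A @ [r]) @ s # B1 @ rv s # (B2 @ rv r # C)" using w3 by simp
        then have "P (length B1)" unfolding P_def by blast
        moreover have "length B1 < n" using w(2) Cons B by simp
        ultimately show ?thesis using n(2) by blast
      next
        case 3
        then obtain C1 C2 where "C = C1 @ rv s # C2" by (meson split_list)
        then have "w = A @ r # [] @ s # B' @ rv r # C1 @ rv s # C2" using w3 by simp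
        then show ?thesis using crossingI by blast
      qed
    qed
  qed
qed

lemma balanced_edge_once:
  assumes "balanced (u @ d # rv d # v)"
  shows "fst d \<notin> fst ` set (v @ u)"
proof
  assume "fst d \<in> fst ` set (v @ u)"
  then obtain d' where d': "d' \<in> set (v @ u)" "fst d = fst d'" by auto
  then have "d = d' \<or> d = rv d'" using dart_cases by blast
  then have "d' = d \<or> d' = rv d" by auto
  then show False using d'(1) assms by (auto simp: balanced_def)
qed

section \<open>Cancelling words give spheres, repeated darts give Moebius bands\<close>

context arc_system
begin

text \<open>The generation of \<open>w\<close> is run backwards: the pair inserted last is rotated
  to the front and folded away, until a single pair is left and the disc closes up to a
  sphere.\<close>

lemma cancels_sphere:
  assumes "cancels w" "w \<noteq> []" "balanced w" "fill w \<Phi>" "\<Phi> ` cball 0 1 = topspace X"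
  shows "X homeomorphic_space top_of_set (sphere (0::real^3) 1)"
  using assms
proof (induction arbitrary: \<Phi> rule: cancels.induct)
  case (cancels_insert u v d)
  obtain \<Psi> where \<Psi>: "fill (d # rv d # v @ u) \<Psi>" "\<Psi> ` cball 0 1 = topspace X"
    using fill_rotate[OF cancels_insert.prems(3)] cancels_insert.prems(4) by auto
  show ?case
  proof (cases "u @ v = []")
    case True
    then have "fill [d, rv d] \<Psi>" using \<Psi>(1) by simp
    then show ?thesis using fill_sphere \<Psi>(2) by blast
  next
    case False
    then obtain \<Omega> where \<Omega>: "fill (v @ u) \<Omega>" "\<Omega> ` cball 0 1 = topspace X"
      using fill_fold[OF \<Psi>(1)] \<Psi>(2) balanced_edge_once[OF cancels_insert.prems(2)] by auto
    obtain \<Omega>' where "fill (u @ v) \<Omega>'" "\<Omega>' ` cball 0 1 = topspace X"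
      using fill_rotate[OF \<Omega>(1)] \<Omega>(2) by auto
    then show ?thesis using cancels_insert.IH False balanced_remove[OF cancels_insert.prems(2)] by blast
  qed
qed simp

text \<open>The parallel chords joining the middle thirds of two equally directed arcs form a strip whose image
  is a Moebius band.\<close>

lemma repeated_dart_moebius:
  assumes f: "fill w \<Phi>" and ik: "i < k" "k < length w" "w ! i = w ! k"
  shows "\<exists>M. moebius_band_in X M"
proof -
  define N where "N = length w"
  define d where "d = w ! i"
  have N: "real N > 0" using ik by (auto simp: N_def)
  have dE: "fst d \<in> E" using f ik by (force simp: fill_def d_def)
  \<comment> \<open>The middle third keeps away from the ends of the edge, which are vertices and
    may be identified with further boundary points.\<close>
  define \<tau> where "\<tau> t = (1 + t) / 3" for t :: real
  \<comment> \<open>The mean \<open>m\<close> of the angles of the two paired points does not depend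
    on \<open>t\<close>, so all chords are orthogonal to the direction \<open>m\<close> and hence
    parallel. Side \<open>k\<close> is run with parameter \<open>1 - t\<close>, which is the twist
    of the Moebius band.\<close>
  define m where "m = pi * (real i + real k + 1) / real N"
  define \<delta> where "\<delta> t = pi * (real k - real i + 1 - 2 * \<tau> t) / real N" for t
  have ang: "m - \<delta> t = 2 * pi * (real i + \<tau> t) / real N" "m + \<delta> t = 2 * pi * (real k + \<tau> (1 - t)) / real N" for t
    unfolding m_def \<delta>_def \<tau>_def diff_divide_distrib[symmetric] add_divide_distrib[symmetric]
    by (rule arg_cong[of _ _ "\<lambda>x. x / real N"]; simp add: field_simps)+
  have \<tau>: "0 < \<tau> t" "\<tau> t < 1" if "0 \<le> t" "t \<le> 1" for t using that by (auto simp: \<tau>_def)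
  have \<delta>: "0 < \<delta> t" "\<delta> t < pi" if "0 \<le> t" "t \<le> 1" for t
  proof -
    have "real i + 1 \<le> real k" using ik(1) by linarith
    moreover have "real k + 1 \<le> real N" using ik(2) by (simp add: N_def)
    moreover have i0: "0 \<le> real i" by simp
    moreover define x where "x = real k - real i + 1 - 2 * \<tau> t"
    have "2 / 3 \<le> 2 * \<tau> t" "2 * \<tau> t \<le> 4 / 3" using that by (auto simp: \<tau>_def)
    ultimately have "0 < x \<and> x < real N" unfolding x_def by (intro conjI) linarith+
    then have x: "0 < x" "x < real N" by blast+
    have "\<delta> t = pi * (x / real N)" by (simp add: \<delta>_def x_def)
    moreover have "0 < x / real N" "x / real N < 1" using x N by auto
    then have "0 < pi * (x / real N)" "pi * (x / real N) < pi * 1" by (intro mult_pos_pos mult_strict_left_mono; simp)+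
    ultimately show "0 < \<delta> t" "\<delta> t < pi" by simp_all
  qed
  have \<delta>_inj: "t = t'" if "\<delta> t = \<delta> t'" for t t' using that N by (simp add: \<delta>_def \<tau>_def field_simps)
  have cos_inj: "t = t'" if "0 \<le> t" "t \<le> 1" "0 \<le> t'" "t' \<le> 1" "cos (\<delta> t) = cos (\<delta> t')" for t t'
  proof (rule \<delta>_inj)
    show "\<delta> t = \<delta> t'" by (rule cos_inj_pi) (use that \<delta> in \<open>auto simp: less_imp_le\<close>)
  qed
  have sin_pos: "0 < sin (\<delta> t)" if "0 \<le> t" "t \<le> 1" for t using \<delta>[OF that] sin_gt_zero by blast
  \<comment> \<open>After turning by \<open>m\<close>, the chord of \<open>t\<close> is vertical at
    abscissa \<open>cos (\<delta> t)\<close>, and \<open>s\<close> runs along it from one boundary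
    point to the other.\<close>
  define c where "c = (\<lambda>(s, t). cis m * (complex_of_real (cos (\<delta> t)) + \<i> * complex_of_real ((2 * s - 1) * sin (\<delta> t))))"
  have norm_c: "(norm (c (s, t)))\<^sup>2 = (cos (\<delta> t))\<^sup>2 + (2 * s - 1)\<^sup>2 * (sin (\<delta> t))\<^sup>2" for s t
    by (simp add: c_def norm_mult cmod_power2 power_mult_distrib)
  have c_ball: "norm (c (s, t)) < 1" if "0 < s" "s < 1" "0 \<le> t" "t \<le> 1" for s t
  proof -
    have "\<bar>2 * s - 1\<bar> < 1" using that by (simp add: abs_less_iff)
    then have "(2 * s - 1)\<^sup>2 < 1" by (simp add: abs_square_less_1)
    then have "(2 * s - 1)\<^sup>2 * (sin (\<delta> t))\<^sup>2 < 1 * (sin (\<delta> t))\<^sup>2"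
      using sin_pos[OF that(3,4)] by (intro mult_strict_right_mono) auto
    then have "(norm (c (s, t)))\<^sup>2 < 1" unfolding norm_c using sin_cos_squared_add[of "\<delta> t"] by linarith
    then show ?thesis by (simp add: abs_square_less_1)
  qed
  have c0: "c (0, t) = arcpt N i (\<tau> t)" for t
  proof -
    have "c (0, t) = cis m * cis (- \<delta> t)" by (simp add: c_def complex_eq_iff)
    also have "\<dots> = cis (m - \<delta> t)" by (simp add: cis_mult)
    finally show ?thesis by (simp add: ang(1) arcpt_def)
  qed
  have c1: "c (1, t) = arcpt N k (\<tau> (1 - t))" for t
  proof -
    have "c (1, t) = cis m * cis (\<delta> t)" by (simp add: c_def complex_eq_iff)
    also have "\<dots> = cis (m + \<delta> t)" by (simp add: cis_mult)
    finally show ?thesis by (simp add: ang(2) arcpt_def)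
  qed
  have c_cball: "c (s, t) \<in> cball 0 1" if st: "0 \<le> s" "s \<le> 1" "0 \<le> t" "t \<le> 1" for s t
  proof (cases "s = 0 \<or> s = 1")
    case True
    then show ?thesis using c0 c1 by auto
  next
    case False
    then show ?thesis using c_ball[of s t] st by auto
  qed
  have c_inj: "s = s' \<and> t = t'"
    if "c (s, t) = c (s', t')" "0 \<le> t" "t \<le> 1" "0 \<le> t'" "t' \<le> 1" for s t s' t'
  proof -
    define z where "z s t = complex_of_real (cos (\<delta> t)) + \<i> * complex_of_real ((2 * s - 1) * sin (\<delta> t))" for s t
    have "cis m * z s t = cis m * z s' t'" using that(1) by (simp add: c_def z_def)
    then have "z s t = z s' t'" by simp
    then have "cos (\<delta> t) = cos (\<delta> t') \<and> (2 * s - 1) * sin (\<delta> t) = (2 * s' - 1) * sin (\<delta> t')"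
      by (simp add: z_def complex_eq_iff)
    moreover from this have "t = t'" using cos_inj that by blast
    ultimately show ?thesis using sin_pos[of t] that by simp
  qed
  define q where "q = \<Phi> \<circ> c"
  let ?Q = "{0..1} \<times> {0..1} :: (real \<times> real) set"
  define M where "M = q ` ?Q"
  have \<Phi>: "continuous_map (top_of_set (cball 0 1)) X \<Phi>"
    "\<And>z z'. z \<in> ball 0 1 \<Longrightarrow> z' \<in> cball 0 1 \<Longrightarrow> \<Phi> z = \<Phi> z' \<Longrightarrow> z = z'"
    using f by (auto simp: fill_def disc_map_def)
  have lab: "\<Phi> (arcpt N j t) = dpath (w ! j) t" if "j < N" "0 \<le> t" "t \<le> 1" for j t
    using f that by (auto simp: fill_def N_def)
  have "continuous_on ?Q c"
    unfolding c_def case_prod_unfold \<delta>_def \<tau>_def divide_inverse by (intro continuous_intros)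
  then have "continuous_map (top_of_set ?Q) (top_of_set (cball 0 1)) c"
    using c_cball by (auto simp: continuous_map_in_subtopology)
  then have qX: "continuous_map (top_of_set ?Q) X q" unfolding q_def using \<Phi>(1) continuous_map_compose by blast
  have MX: "M \<subseteq> topspace X" using qX by (auto simp: M_def continuous_map_def)
  have "quotient_map (top_of_set ?Q) (subtopology X M) q"
  proof (rule continuous_imp_quotient_map)
    show "continuous_map (top_of_set ?Q) (subtopology X M) q"
      using qX by (auto simp: continuous_map_in_subtopology M_def)
    show "compact_space (top_of_set ?Q)" by (simp add: compact_space_subtopology compact_Times)
    show "Hausdorff_space (subtopology X M)" using Hausdorff Hausdorff_space_subtopology by blast
    show "q ` topspace (top_of_set ?Q) = topspace (subtopology X M)" using MX by (auto simp: M_def)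
  qed
  moreover have "q (s, t) = q (s', t') \<longleftrightarrow> (s = s' \<and> t = t') \<or> (s = 0 \<and> s' = 1 \<and> t' = 1 - t) \<or> (s = 1 \<and> s' = 0 \<and> t' = 1 - t)"
    if st: "s \<in> {0..1}" "t \<in> {0..1}" "s' \<in> {0..1}" "t' \<in> {0..1}" for s t s' t'
  proof -
    have q0: "q (0, t) = dpath d (\<tau> t)" if "0 \<le> t" "t \<le> 1" for t
      using lab[of i "\<tau> t"] \<tau>[OF that] ik by (simp add: q_def c0 d_def N_def)
    have q1: "q (1, t) = dpath d (\<tau> (1 - t))" if "0 \<le> t" "t \<le> 1" for t
      using lab[of k "\<tau> (1 - t)"] \<tau>[of "1 - t"] that ik by (simp add: q_def c1 d_def N_def)
    have dinj: "x = y" if "dpath d (\<tau> x) = dpath d (\<tau> y)" "0 \<le> x" "x \<le> 1" "0 \<le> y" "y \<le> 1" for x y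
      using dpath_inj[OF dE _ _ _ _ that(1)] \<tau>[of x] \<tau>[of y] that by (simp add: \<tau>_def)
    \<comment> \<open>A point inside a chord is an interior point of the disc, where
      \<open>\<Phi>\<close> identifies nothing; what remains are the ends of the chords, labelled by
      the same dart.\<close>
    show ?thesis
    proof (cases "0 < s \<and> s < 1 \<or> 0 < s' \<and> s' < 1")
      case True
      have "q (s, t) = q (s', t') \<longleftrightarrow> c (s, t) = c (s', t')"
      proof
        assume e: "q (s, t) = q (s', t')"
        then have e: "\<Phi> (c (s, t)) = \<Phi> (c (s', t'))" by (simp add: q_def)
        have cc: "c (s, t) \<in> cball 0 1" "c (s', t') \<in> cball 0 1" using c_cball st by auto
        show "c (s, t) = c (s', t')"
        proof (cases "0 < s \<and> s < 1")
          case True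
          then have "c (s, t) \<in> ball 0 1" using c_ball st by simp
          then show ?thesis using \<Phi>(2)[OF _ cc(2) e] by blast
        next
          case False
          then have "0 < s'" "s' < 1" using \<open>0 < s \<and> s < 1 \<or> 0 < s' \<and> s' < 1\<close> by blast+
          then have "c (s', t') \<in> ball 0 1" using c_ball st by simp
          then show ?thesis using \<Phi>(2)[OF _ cc(1) e[symmetric]] by simp
        qed
      qed (simp add: q_def)
      also have "\<dots> \<longleftrightarrow> s = s' \<and> t = t'" using c_inj[of s t s' t'] st by auto
      finally show ?thesis using True by auto
    next
      case False
      then consider "s = 0" "s' = 0" | "s = 1" "s' = 1" | "s = 0" "s' = 1" | "s = 1" "s' = 0" using st by fastforce
      then show ?thesis
      proof cases
        case 1 then show ?thesis using q0 dinj[of t t'] st by auto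
      next
        case 2 then show ?thesis using q1 dinj[of "1 - t" "1 - t'"] st by auto
      next
        case 3 then show ?thesis using q0 q1 dinj[of t "1 - t'"] st by auto
      next
        case 4 then show ?thesis using q0 q1 dinj[of "1 - t" t'] st by auto
      qed
    qed
  qed
  ultimately have "moebius_band_in X M"
    unfolding moebius_band_in_def using MX by (intro conjI exI[of _ q] ballI) simp_all
  then show ?thesis by blast
qed

end

lemma count_fst_filter: "count (mset (map fst w)) e = length (filter (\<lambda>d. fst d = e) w)"
  by (induction w) auto

context subdivided_surface
begin

text \<open>Each edge left on the boundary occurs twice, because it has two faces and all faces have
  been used. Both occurrences in one direction would produce a Moebius band, so the directions are
  opposite. The image of the disc is closed and contains all faces.\<close>

lemma glued_all_balanced:
  assumes G: "glued (T :: 'd::division_ring itself) f0 F w \<Phi> I" and O: "orientable_surface X"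
  shows "balanced w" "\<Phi> ` cball 0 1 = topspace X" "w \<noteq> []"
proof -
  note D = gluedD[OF G]
  have f: "fill w \<Phi>" by (rule D(1))
  show "w \<noteq> []" using f by (simp add: fill_def)
  have wE: "fst ` set w \<subseteq> E" using f by (simp add: fill_def)
  have c: "continuous_map (top_of_set (cball 0 1)) X \<Phi>" using f by (simp add: fill_def disc_map_def)
  show "\<Phi> ` cball 0 1 = topspace X"
  proof
    show "\<Phi> ` cball 0 1 \<subseteq> topspace X" using c by (auto simp: continuous_map_def)
    have "X closure_of g \<subseteq> \<Phi> ` cball 0 1" if "g \<in> F" for g
      using closure_of_minimal[of g "\<Phi> ` cball 0 1" X] D(2) that closed_disc_image[OF c] by blast
    then show "topspace X \<subseteq> \<Phi> ` cball 0 1" using faces_cover by blast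
  qed
  have dist: "distinct w"
  proof (rule ccontr)
    assume "\<not> distinct w"
    then obtain i k where "i < k" "k < length w" "w ! i = w ! k"
      unfolding distinct_conv_nth by (metis nat_neq_iff)
    then show False using repeated_dart_moebius[OF f] O unfolding orientable_surface_def by blast
  qed
  have "rv d \<in> set w" if d: "d \<in> set w" for d
  proof (rule ccontr)
    assume no: "rv d \<notin> set w"
    have "fst d \<in> E" "fst d \<notin> I" using wE D(6) d by blast+
    then have "count (mset (map fst w)) (fst d) = 2" using D(7) edge_two_faces by simp
    then have l: "length (filter (\<lambda>x. fst x = fst d) w) = 2" by (simp only: count_fst_filter)
    have "set (filter (\<lambda>x. fst x = fst d) w) \<subseteq> {d}"
    proof
      fix x assume "x \<in> set (filter (\<lambda>x. fst x = fst d) w)"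
      then have "x \<in> set w" "x = d \<or> x = rv d" using dart_cases[of x d] by auto
      then show "x \<in> {d}" using no by blast
    qed
    then have "card (set (filter (\<lambda>x. fst x = fst d) w)) \<le> 1" using card_mono[of "{d}"] by fastforce
    moreover have "card (set (filter (\<lambda>x. fst x = fst d) w)) = 2" using l distinct_card[OF distinct_filter[OF dist]] by metis
    ultimately show False by simp
  qed
  then show "balanced w" using dist by (simp add: balanced_def)
qed

end

section \<open>Crossing edge pairs on the sphere\<close>

text \<open>Makes the Jordan curve theorem of the plane available on the surface, after removal of a
  point that neither the curve nor the sectors meet.\<close>

lemma punctured_sphere_plane:
  assumes h: "X homeomorphic_space top_of_set (sphere (0::real^3) 1)" and q: "q \<in> topspace X"
  shows "subtopology X (topspace X - {q}) homeomorphic_space (euclidean :: complex topology)"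
proof -
  obtain h k where hk: "homeomorphic_maps X (top_of_set (sphere (0::real^3) 1)) h k"
    using h unfolding homeomorphic_space_def by blast
  define b where "b = h q"
  have im: "h ` topspace X = sphere 0 1" "inj_on h (topspace X)"
    using hk homeomorphic_maps_map homeomorphic_imp_surjective_map homeomorphic_imp_injective_map
    by (metis topspace_euclidean_subtopology)+
  have b: "b \<in> sphere 0 1" using im q by (auto simp: b_def)
  have "h ` (topspace X \<inter> (topspace X - {q})) = topspace (top_of_set (sphere (0::real^3) 1)) \<inter> (sphere 0 1 - {b})"
  proof -
    have "h ` (topspace X - {q}) = h ` topspace X - h ` {q}"
      using im(2) q by (intro inj_on_image_set_diff) auto
    then show ?thesis using im(1) by (simp add: b_def Int_absorb1 Diff_subset)
  qed
  then have "homeomorphic_maps (subtopology X (topspace X - {q})) (subtopology (top_of_set (sphere (0::real^3) 1)) (sphere 0 1 - {b})) h k"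
    by (rule homeomorphic_maps_subtopologies[OF hk])
  then have 1: "subtopology X (topspace X - {q}) homeomorphic_space top_of_set (sphere (0::real^3) 1 - {b})"
    unfolding homeomorphic_space_def by (auto simp: subtopology_subtopology Int_absorb1 Diff_subset)
  have "sphere (0::real^3) 1 - {b} homeomorphic {x::real^3. axis 1 1 \<bullet> x = (0::real)}"
    by (rule homeomorphic_punctured_sphere_hyperplane[OF zero_less_one b]) (simp add: axis_eq_0_iff)
  moreover have "{x::real^3. axis 1 1 \<bullet> x = (0::real)} homeomorphic (UNIV :: complex set)"
  proof (rule homeomorphic_affine_sets)
    have "axis 1 1 \<noteq> (0::real^3)" by (simp add: axis_eq_0_iff)
    then show "aff_dim {x::real^3. axis 1 1 \<bullet> x = (0::real)} = aff_dim (UNIV :: complex set)"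
      by (simp add: aff_dim_hyperplane)
  qed (auto simp: affine_hyperplane)
  ultimately have "sphere (0::real^3) 1 - {b} homeomorphic (UNIV :: complex set)" by (rule homeomorphic_trans)
  then obtain f g where "homeomorphism (sphere (0::real^3) 1 - {b}) (UNIV :: complex set) f g"
    unfolding homeomorphic_def by blast
  then have "homeomorphic_maps (top_of_set (sphere (0::real^3) 1 - {b})) (euclidean :: complex topology) f g"
    unfolding homeomorphic_maps_def homeomorphism_def by (auto simp: continuous_map_in_subtopology)
  then have "top_of_set (sphere (0::real^3) 1 - {b}) homeomorphic_space (euclidean :: complex topology)"
    unfolding homeomorphic_space_def by blast
  then show ?thesis using 1 homeomorphic_space_trans by blast
qed

context arc_system
begin

text \<open>The two radii towards the midpoints of the arcs labelled by \<open>r\<close> form a Jordan curve. The rest of the open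
  disc consists of two sectors, which are joined through the identified midpoints of the arcs
  labelled by \<open>s\<close>; so it misses one of the two components of the complement.\<close>

lemma sphere_no_crossing:
  assumes f: "fill w \<Phi>" and sph: "X homeomorphic_space top_of_set (sphere (0::real^3) 1)"
    and ix: "i < j" "j < k" "k < l" "l < length w" and rs: "w ! k = rv (w ! i)" "w ! l = rv (w ! j)" "fst (w ! i) \<noteq> fst (w ! j)"
  shows False
proof -
  define N where "N = length w"
  define r s where "r = w ! i" and "s = w ! j"
  have N: "real N > 0" using ix by (auto simp: N_def)
  have rE: "fst r \<in> E" and sE: "fst s \<in> E" using f ix by (auto simp: fill_def r_def s_def)
  \<comment> \<open>The angle of the midpoint of side \<open>n\<close>.\<close>
  define th where "th n = 2 * pi * (real n + 1/2) / real N" for n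
  have th_mono: "th m < th n" if "m < n" for m n
    using that N by (simp add: th_def divide_strict_right_mono)
  have th: "0 < th i" "th i < th j" "th j < th k" "th k < th l" "th l < th i + 2 * pi"
  proof -
    show "0 < th i" using N by (simp add: th_def)
    show "th i < th j" "th j < th k" "th k < th l" using th_mono ix by auto
    have "real l + 1 \<le> real N" using ix by (simp add: N_def)
    then have "real l + 1/2 < real i + 1/2 + real N" using of_nat_0_le_iff[of i, where 'a=real] by linarith
    then have "(real l + 1/2) / real N < (real i + 1/2 + real N) / real N" using N by (rule divide_strict_right_mono)
    then have "(real l + 1/2) / real N < (real i + 1/2) / real N + 1" using N by (simp add: add_divide_distrib)
    then have "2 * pi * ((real l + 1/2) / real N) < 2 * pi * ((real i + 1/2) / real N + 1)"
      by (intro mult_strict_left_mono) auto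
    then show "th l < th i + 2 * pi" by (simp add: th_def algebra_simps)
  qed
  have arc: "arcpt N n (1/2) = cis (th n)" for n by (simp add: arcpt_def th_def)
  have \<Phi>c: "continuous_map (top_of_set (cball 0 1)) X \<Phi>"
    and \<Phi>i: "\<And>z z'. z \<in> ball 0 1 \<Longrightarrow> z' \<in> cball 0 1 \<Longrightarrow> \<Phi> z = \<Phi> z' \<Longrightarrow> z = z'"
    using f by (auto simp: fill_def disc_map_def)
  have lab: "\<Phi> (arcpt N n t) = dpath (w ! n) t" if "n < N" "0 \<le> t" "t \<le> 1" for n t
    using f that by (auto simp: fill_def N_def)
  have mid: "\<Phi> (cis (th n)) = dpath (w ! n) (1/2)" if "n < N" for n
    using lab[OF that, of "1/2"] arc[of n] by simp
  have \<Phi>r: "\<Phi> (cis (th i)) = dpath r (1/2)" "\<Phi> (cis (th k)) = dpath r (1/2)"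
    using mid[of i] mid[of k] ix rs by (auto simp: r_def N_def dpath_rv)
  have \<Phi>s: "\<Phi> (cis (th j)) = dpath s (1/2)" "\<Phi> (cis (th l)) = dpath s (1/2)"
    using mid[of j] mid[of l] ix rs by (auto simp: s_def N_def dpath_rv)
  define v where "v = dpath r (1/2)"
  define u where "u = dpath s (1/2)"
  \<comment> \<open>The puncture: an inner point of the edge of \<open>r\<close> other than its
    midpoint \<open>v\<close>. It comes from the boundary circle, so the open disc misses it, and it
    differs from both \<open>u\<close> and \<open>v\<close>.\<close>
  define q where "q = dpath r (1/4)"
  have ver: "v \<in> fst r" "q \<in> fst r" "u \<in> fst s" using dpath_open[OF rE] dpath_open[OF sE] by (auto simp: v_def q_def u_def)
  have uv: "u \<noteq> v" "u \<noteq> q" using ver edges_disjoint[OF rE sE] rs(3) by (auto simp: r_def s_def)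
  have vq: "v \<noteq> q" using dpath_inj[OF rE, of "1/2" "1/4"] by (auto simp: v_def q_def)
  have q_arc: "\<Phi> (arcpt N i (1/4)) = q" using lab[of i "1/4"] ix by (simp add: N_def q_def r_def)
  have qX: "q \<in> topspace X" using q_arc \<Phi>c by (metis (no_types, lifting) continuous_map_image_subset_topspace image_subset_iff mem_cball_0 norm_arcpt order_refl topspace_euclidean_subtopology)
  have bnd: "\<Phi> z \<noteq> \<Phi> z'" if "norm z < 1" "norm z' = 1" for z z'
    using \<Phi>i[of z z'] that by auto
  have qball: "\<Phi> z \<noteq> q" if "norm z < 1" for z using bnd[OF that, of "arcpt N i (1/4)"] q_arc by simp
  let ?Y = "subtopology X (topspace X - {q})"
  obtain g g' where gg: "homeomorphic_maps ?Y (euclidean :: complex topology) g g'"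
    using punctured_sphere_plane[OF sph qX] unfolding homeomorphic_space_def by blast
  have gc: "continuous_map ?Y euclidean g" using gg by (simp add: homeomorphic_maps_def)
  have gi: "inj_on g (topspace X - {q})"
  proof -
    have "homeomorphic_map ?Y euclidean g" using gg homeomorphic_maps_map by blast
    from homeomorphic_imp_injective_map[OF this] show ?thesis by (simp add: Int_absorb1 Diff_subset)
  qed
  \<comment> \<open>From the midpoint of side \<open>i\<close> inwards to the centre and out again
    to the midpoint of side \<open>k\<close>. The two ends differ in the disc but are one point of
    the surface, since side \<open>k\<close> is side \<open>i\<close> run back.\<close>
  define c where "c t = (if t \<le> 1/2 then of_real (1 - 2 * t) * cis (th i) else of_real (2 * t - 1) * cis (th k))" for t :: real
  have c_norm: "norm (c t) = \<bar>1 - 2 * t\<bar>" for t by (auto simp: c_def norm_mult simp del: of_real_diff of_real_mult)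
  have c_cont: "continuous_on {0..1} c" unfolding c_def
  proof (rule continuous_on_cases_1)
    show "continuous_on {t \<in> {0..1}. t \<le> 1/2} (\<lambda>t. complex_of_real (1 - 2 * t) * cis (th i))" by (intro continuous_intros)
    show "continuous_on {t \<in> {0..1}. 1/2 \<le> t} (\<lambda>t. complex_of_real (2 * t - 1) * cis (th k))" by (intro continuous_intros)
  qed auto
  have th_2pi: "th i < 2 * pi" "th k < 2 * pi"
  proof -
    have "th n < 2 * pi" if "n < N" for n
    proof -
      have "real n + 1 \<le> real N" using that by linarith
      then have "(real n + 1/2) / real N < 1" using N by (simp add: field_simps)
      then have "2 * pi * ((real n + 1/2) / real N) < 2 * pi * 1" by (intro mult_strict_left_mono) auto
      then show ?thesis by (simp add: th_def)
    qed
    then show "th i < 2 * pi" "th k < 2 * pi" using ix by (auto simp: N_def)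
  qed
  have cis_ik: "cis (th i) \<noteq> cis (th k)"
  proof
    assume e: "cis (th i) = cis (th k)"
    have "th i = th k"
    proof (rule cis_inj_Ico[OF e])
      show "th i < 2 * pi" "th k < 2 * pi" by (rule th_2pi)+
      show "0 \<le> th i" "0 \<le> th k" using th by auto
    qed
    then show False using th by simp
  qed
  have c_inj: "t = t'" if tt: "t \<in> {0..1}" "t' \<in> {0..1}" "c t = c t'" for t t'
  proof -
    have n: "\<bar>1 - 2 * t\<bar> = \<bar>1 - 2 * t'\<bar>" using c_norm[of t] c_norm[of t'] tt by simp
    show ?thesis
    proof (rule ccontr)
      assume ne: "t \<noteq> t'"
      then have e: "1 - 2 * t = - (1 - 2 * t')" using n by linarith
      have *: False if "x \<le> 1/2" "\<not> y \<le> 1/2" "c x = c y" "1 - 2 * x = - (1 - 2 * y)" for x y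
      proof -
        have "c x = of_real (1 - 2 * x) * cis (th i)" "c y = of_real (2 * y - 1) * cis (th k)" "2 * y - 1 = 1 - 2 * x"
          using that(1,2,4) by (simp_all add: c_def)
        then have "of_real (1 - 2 * x) * cis (th i) = complex_of_real (1 - 2 * x) * cis (th k)"
          using that(3) by metis
        moreover have "complex_of_real (1 - 2 * x) \<noteq> 0" using that by (simp del: of_real_diff of_real_mult)
        ultimately show False using cis_ik by simp
      qed
      show False
      proof (cases "t \<le> 1/2")
        case True
        then show False using *[of t t'] tt e ne by (cases "t' \<le> 1/2") auto
      next
        case False
        then show False using *[of t' t] tt e ne by (cases "t' \<le> 1/2") auto
      qed
    qed
  qed
  have c_end: "\<Phi> (c 0) = v" "\<Phi> (c 1) = v" using \<Phi>r by (auto simp: c_def v_def)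
  have c_ball: "norm (c t) < 1" if "0 < t" "t < 1" for t using that c_norm[of t] by (simp add: abs_less_iff)
  define \<gamma> where "\<gamma> = g \<circ> \<Phi> \<circ> c"
  have \<Phi>cv: "\<Phi> (c t) \<noteq> q" if "t \<in> {0..1}" for t
    using c_end vq qball[OF c_ball[of t]] that by (cases "t = 0"; cases "t = 1") auto
  have \<Phi>X: "\<Phi> z \<in> topspace X" if "norm z \<le> 1" for z using \<Phi>c that by (auto simp: continuous_map_def)
  have memY: "\<Phi> (c t) \<in> topspace X - {q}" if "t \<in> {0..1}" for t
  proof -
    have "norm (c t) \<le> 1" using c_norm[of t] that by (auto simp: abs_le_iff)
    then show ?thesis using \<Phi>X \<Phi>cv[OF that] by blast
  qed
  have cX: "continuous_map (top_of_set {0..1}) ?Y (\<Phi> \<circ> c)"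
  proof -
    have "continuous_map (top_of_set {0..1}) (top_of_set (cball 0 1)) c"
      using c_cont c_norm by (auto simp: continuous_map_in_subtopology abs_le_iff)
    then have "continuous_map (top_of_set {0..1}) X (\<Phi> \<circ> c)" using \<Phi>c continuous_map_compose by blast
    moreover have "(\<Phi> \<circ> c) ` {0..1} \<subseteq> topspace X - {q}" using memY unfolding comp_def by blast
    ultimately show ?thesis unfolding continuous_map_in_subtopology by (simp add: Pi_iff image_subset_iff)
  qed
  have \<gamma>c: "continuous_on {0..1} \<gamma>"
    using continuous_map_compose[OF cX gc] by (simp add: \<gamma>_def comp_assoc)
  have "loop_free \<gamma>"
    unfolding loop_free_def
  proof (intro ballI impI)
    fix x y :: real assume xy: "x \<in> {0..1}" "y \<in> {0..1}" "\<gamma> x = \<gamma> y"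
    then have e: "\<Phi> (c x) = \<Phi> (c y)" using gi memY by (auto simp: \<gamma>_def inj_on_def)
    have cb: "c x \<in> cball 0 1" "c y \<in> cball 0 1" using c_norm[of x] c_norm[of y] xy by (auto simp: abs_le_iff)
    show "x = y \<or> x = 0 \<and> y = 1 \<or> x = 1 \<and> y = 0"
    proof (cases "(0 < x \<and> x < 1) \<or> (0 < y \<and> y < 1)")
      case True
      then have "c x = c y"
      proof
        assume "0 < x \<and> x < 1"
        then have "c x \<in> ball 0 1" using c_ball by simp
        then show ?thesis using \<Phi>i[OF _ cb(2) e] by blast
      next
        assume "0 < y \<and> y < 1"
        then have "c y \<in> ball 0 1" using c_ball by simp
        then show ?thesis using \<Phi>i[OF _ cb(1) e[symmetric]] by simp
      qed
      then show ?thesis using c_inj xy by blast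
    next
      case False
      then show ?thesis using xy by fastforce
    qed
  qed
  then have sp: "simple_path \<gamma>" using \<gamma>c by (simp add: simple_path_def path_def)
  have cl: "pathfinish \<gamma> = pathstart \<gamma>" using c_end by (simp add: \<gamma>_def pathfinish_def pathstart_def)
  define J where "J = path_image \<gamma>"
  have Jeq: "J = g ` \<Phi> ` c ` {0..1}" by (simp add: J_def path_image_def \<gamma>_def image_comp)
  define polar where "polar = (\<lambda>(\<rho>, \<phi>). complex_of_real \<rho> * cis \<phi>)"
  have polar_cont: "continuous_on A polar" for A
    unfolding polar_def case_prod_unfold cis_conv_exp by (intro continuous_intros)
  \<comment> \<open>Each open sector is enlarged by the outer end of the radius towards the midpoint
    labelled by \<open>s\<close>; the images of the two sectors then share the point
    \<open>u\<close>.\<close>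
  define S1 where "S1 = polar ` (({0<..<1} \<times> {th i<..<th k}) \<union> ({0<..1} \<times> {th j}))"
  define S2 where "S2 = polar ` (({0<..<1} \<times> {th k<..<th i + 2 * pi}) \<union> ({0<..1} \<times> {th l}))"
  have conS: "connected S1" "connected S2"
  proof -
    have "connected (({0<..<1} \<times> {th i<..<th k}) \<union> ({0<..1::real} \<times> {th j}))"
    proof (intro connected_Un connected_Times)
      have "(1/2::real, th j) \<in> ({0<..<1} \<times> {th i<..<th k}) \<inter> ({0<..1} \<times> {th j})" using th by auto
      then show "({0<..<1} \<times> {th i<..<th k}) \<inter> ({0<..1::real} \<times> {th j}) \<noteq> {}" by blast
    qed auto
    then show "connected S1" unfolding S1_def by (rule connected_continuous_image[OF polar_cont])
    have "connected (({0<..<1} \<times> {th k<..<th i + 2 * pi}) \<union> ({0<..1::real} \<times> {th l}))"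
    proof (intro connected_Un connected_Times)
      have "(1/2::real, th l) \<in> ({0<..<1} \<times> {th k<..<th i + 2 * pi}) \<inter> ({0<..1} \<times> {th l})" using th by auto
      then show "({0<..<1} \<times> {th k<..<th i + 2 * pi}) \<inter> ({0<..1::real} \<times> {th l}) \<noteq> {}" by blast
    qed auto
    then show "connected S2" unfolding S2_def by (rule connected_continuous_image[OF polar_cont])
  qed
  have Scb: "S1 \<subseteq> cball 0 1" "S2 \<subseteq> cball 0 1" by (auto simp: S1_def S2_def polar_def norm_mult)
  have Ssph: "z = cis (th j)" if "z \<in> S1" "norm z = 1" for z
    using that by (auto simp: S1_def polar_def norm_mult)
  have Ssph2: "z = cis (th l)" if "z \<in> S2" "norm z = 1" for z
    using that by (auto simp: S2_def polar_def norm_mult)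
  \<comment> \<open>Positive multiples of directions whose angles differ by less than a full turn
    are different; this keeps the sectors off the curve.\<close>
  have ang: False if "complex_of_real a * cis x = of_real b * cis y" "0 < a" "0 \<le> b" "x < y" "y < x + 2 * pi" for a b x y
  proof -
    have "norm (complex_of_real a * cis x) = norm (complex_of_real b * cis y)" by (rule arg_cong[OF that(1)])
    then have ab: "a = b" using that(2,3) by (simp add: norm_mult)
    have "cis x = cis y" using that(1,2) unfolding ab by simp
    then have "cis (y - x) = 1" by (simp flip: cis_divide)
    then have "y - x = 0" by (intro cis_inj_Ico) (use that in auto)
    then show False using that by simp
  qed
  have Sc: "z \<noteq> c t" if z: "z \<in> S1 \<union> S2" "norm z < 1" and t: "t \<in> {0..1}" for z t
  proof
    assume e: "z = c t"
    obtain \<rho> \<phi> where z': "z = of_real \<rho> * cis \<phi>" "0 < \<rho>" "th i < \<phi>" "\<phi> < th i + 2 * pi" "\<phi> \<noteq> th k"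
      using z th by (auto simp: S1_def S2_def polar_def)
    show False
    proof (cases "t \<le> 1/2")
      case True
      then have "complex_of_real \<rho> * cis \<phi> = of_real (1 - 2 * t) * cis (th i)" using e z' by (simp add: c_def)
      also have "\<dots> = of_real (1 - 2 * t) * cis (th i + 2 * pi)" by (simp flip: cis_mult)
      finally show False using ang[of \<rho> \<phi> "1 - 2 * t" "th i + 2 * pi"] z' True th by simp
    next
      case False
      then have e': "complex_of_real \<rho> * cis \<phi> = of_real (2 * t - 1) * cis (th k)" using e z' by (simp add: c_def)
      show False
      proof (cases "\<phi> < th k")
        case True
        then show False using ang[OF e'] z' False th by simp
      next
        case False2: False
        then show False using ang[OF e'[symmetric]] z' False th by simp
      qed
    qed
  qed
  define C where "C = g ` \<Phi> ` (S1 \<union> S2)"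
  have SY: "\<Phi> z \<in> topspace X - {q}" if "z \<in> S1 \<union> S2" for z
  proof -
    have "z \<in> cball 0 1" using that Scb by blast
    then have "\<Phi> z \<in> topspace X" using continuous_map_image_subset_topspace[OF \<Phi>c] by auto
    moreover have "\<Phi> z \<noteq> q"
    proof (cases "norm z = 1")
      case True
      then have "z = cis (th j) \<or> z = cis (th l)" using that Ssph Ssph2 by blast
      then show ?thesis using \<Phi>s uv by (auto simp: u_def)
    next
      case False
      then show ?thesis using qball \<open>z \<in> cball 0 1\<close> by simp
    qed
    ultimately show ?thesis by blast
  qed
  have conC: "connected C"
  proof -
    have gS: "connected (g ` \<Phi> ` S)" if "connected S" "S \<subseteq> S1 \<union> S2" for S
    proof -
      have "S \<subseteq> cball 0 1" using that(2) Scb by blast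
      then have "continuous_map (top_of_set S) X \<Phi>" using continuous_map_from_subtopology_mono[OF \<Phi>c] by blast
      moreover have "\<Phi> ` S \<subseteq> topspace X - {q}" using SY that(2) by blast
      ultimately have "continuous_map (top_of_set S) ?Y \<Phi>" by (auto simp: continuous_map_in_subtopology)
      then have "continuous_on S (g \<circ> \<Phi>)" using continuous_map_compose[OF _ gc] by fastforce
      then show ?thesis using that(1) by (metis connected_continuous_image image_comp)
    qed
    have "C = g ` \<Phi> ` S1 \<union> g ` \<Phi> ` S2" by (simp add: C_def image_Un)
    moreover have "cis (th j) \<in> S1" "cis (th l) \<in> S2"
    proof -
      have "cis (th j) = polar (1, th j)" "cis (th l) = polar (1, th l)" by (simp_all add: polar_def)
      then show "cis (th j) \<in> S1" "cis (th l) \<in> S2" unfolding S1_def S2_def by (auto intro!: image_eqI)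
    qed
    then have "\<Phi> (cis (th j)) \<in> \<Phi> ` S1" "\<Phi> (cis (th l)) \<in> \<Phi> ` S2" by blast+
    then have "g u \<in> g ` \<Phi> ` S1 \<inter> g ` \<Phi> ` S2" unfolding \<Phi>s u_def by blast
    then have "g ` \<Phi> ` S1 \<inter> g ` \<Phi> ` S2 \<noteq> {}" by blast
    moreover have "connected (g ` \<Phi> ` S1)" "connected (g ` \<Phi> ` S2)" using gS conS by blast+
    ultimately show ?thesis using connected_Un by metis
  qed
  have CJ: "C \<inter> J = {}"
  proof -
    have False if z: "z \<in> S1 \<union> S2" and t: "t \<in> {0..1}" and e: "g (\<Phi> z) = g (\<Phi> (c t))" for z t
    proof -
      have e: "\<Phi> z = \<Phi> (c t)" using inj_onD[OF gi e SY[OF z] memY[OF t]] .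
      have zc: "z \<in> cball 0 1" using z Scb by blast
      have cc: "c t \<in> cball 0 1" using c_norm[of t] t by (auto simp: abs_le_iff)
      show False
      proof (cases "norm z = 1")
        case True
        then have "z = cis (th j) \<or> z = cis (th l)" using z Ssph Ssph2 by blast
        then have zu: "\<Phi> z = u" using \<Phi>s by (auto simp: u_def)
        show False
        proof (cases "t = 0 \<or> t = 1")
          case True
          then show False using c_end e zu uv by auto
        next
          case False
          then have "norm (c t) < 1" using c_ball t by simp
          then show False using bnd[of "c t" z] \<open>norm z = 1\<close> e by simp
        qed
      next
        case False
        then have zb: "z \<in> ball 0 1" using zc by simp
        then have "z = c t" using \<Phi>i[OF zb cc e] by simp
        then show False using Sc[OF z _ t] zb by simp
      qed
    qed
    then show ?thesis unfolding C_def Jeq by blast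
  qed
  \<comment> \<open>The open disc consists of the two radii and the two sectors. Angles are
    normalized to the turn that starts at \<open>th i\<close>.\<close>
  have cover: "g ` \<Phi> ` ball 0 1 \<subseteq> C \<union> J"
  proof -
    have "z \<in> S1 \<union> S2 \<union> c ` {0..1}" if z: "norm z < 1" for z
    proof (cases "z = 0")
      case True
      then have "z = c (1/2)" by (simp add: c_def)
      then show ?thesis by auto
    next
      case False
      define \<phi> where "\<phi> = (if Arg2pi z < th i then Arg2pi z + 2 * pi else Arg2pi z)"
      have z_eq: "z = of_real (norm z) * cis \<phi>"
      proof -
        have "z = of_real (norm z) * cis (Arg2pi z)" using Arg2pi_eq[of z] by (simp add: cis_conv_exp)
        moreover have "cis (Arg2pi z + 2 * pi) = cis (Arg2pi z)" by (simp flip: cis_mult)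
        ultimately show ?thesis by (simp add: \<phi>_def)
      qed
      have n: "0 < norm z" "norm z < 1" using False z by auto
      have \<phi>: "th i \<le> \<phi>" "\<phi> < th i + 2 * pi"
        using Arg2pi_ge_0[of z] Arg2pi_lt_2pi[of z] th(1) th_2pi(1) by (auto simp: \<phi>_def)
      have pz: "z = polar (norm z, \<phi>)" using z_eq by (simp add: polar_def)
      consider "\<phi> = th i" | "th i < \<phi>" "\<phi> < th k" | "\<phi> = th k" | "th k < \<phi>" using \<phi> by atomize_elim auto
      then show ?thesis
      proof cases
        case 1
        have "1 - 2 * ((1 - norm z) / 2) = norm z" by (simp add: field_simps)
        moreover have "c ((1 - norm z) / 2) = of_real (1 - 2 * ((1 - norm z) / 2)) * cis (th i)"
          using n by (simp add: c_def del: of_real_diff of_real_mult)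
        ultimately have "z = c ((1 - norm z) / 2)" using z_eq 1 by metis
        moreover have "0 \<le> (1 - norm z) / 2 \<and> (1 - norm z) / 2 \<le> 1"
        proof
          show "0 \<le> (1 - norm z) / 2" using n(2) by simp
          have "- 1 \<le> norm z" by (rule order_trans[OF _ norm_ge_zero]) simp
          then show "(1 - norm z) / 2 \<le> 1" by simp
        qed
        then have "(1 - norm z) / 2 \<in> {0..1}" by (simp only: atLeastAtMost_iff)
        ultimately show ?thesis by blast
      next
        case 2
        then have "z \<in> S1" unfolding S1_def by (subst pz) (use n in auto)
        then show ?thesis by blast
      next
        case 3
        have "2 * ((1 + norm z) / 2) - 1 = norm z" by (simp add: field_simps)
        moreover have "c ((1 + norm z) / 2) = of_real (2 * ((1 + norm z) / 2) - 1) * cis (th k)"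
          using n by (simp add: c_def del: of_real_diff of_real_mult)
        ultimately have "z = c ((1 + norm z) / 2)" using z_eq 3 by metis
        moreover have "(1 + norm z) / 2 \<in> {0..1}" using n by simp
        ultimately show ?thesis by blast
      next
        case 4
        then have "z \<in> S2" unfolding S2_def by (subst pz) (use n \<phi> in auto)
        then show ?thesis by blast
      qed
    qed
    then show ?thesis unfolding C_def Jeq by force
  qed
  have opn: "open (g ` \<Phi> ` ball 0 1)"
  proof -
    have "openin X (\<Phi> ` ball 0 1)"
    proof (rule surface_invariance_of_domain[OF surface open_ball])
      show "continuous_map (top_of_set (ball 0 1)) X \<Phi>" by (rule continuous_map_from_subtopology_mono[OF \<Phi>c]) auto
      show "inj_on \<Phi> (ball 0 1)" using \<Phi>i by (auto simp: inj_on_def)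
    qed
    moreover have "\<Phi> ` ball 0 1 \<subseteq> topspace X - {q}" using qball calculation openin_subset by fastforce
    ultimately have "openin ?Y (\<Phi> ` ball 0 1)" by (metis openin_subset_topspace_eq openin_subtopology_alt openin_subtopology_Int2 inf.absorb2)
    moreover have "homeomorphic_map ?Y euclidean g" using gg homeomorphic_maps_map by blast
    ultimately show ?thesis using homeomorphic_imp_open_map unfolding open_map_def by (metis open_openin)
  qed
  have 0: "g (\<Phi> 0) \<in> J" "g (\<Phi> 0) \<in> g ` \<Phi> ` ball 0 1"
  proof -
    have "c (1/2) = 0" by (simp add: c_def)
    then have "0 \<in> c ` {0..1}" by (intro image_eqI[of _ _ "1/2"]) auto
    then show "g (\<Phi> 0) \<in> J" unfolding Jeq by blast
  qed auto
  note JI = Jordan_inside_outside[OF sp cl, folded J_def]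
  \<comment> \<open>Both components have all of \<open>J\<close> as frontier, in particular the
    image of the centre. So each meets the image of the open disc, which is a neighbourhood of that
    point covered by \<open>C\<close> and \<open>J\<close>.\<close>
  have no: False if O: "frontier O' = J" "O' \<inter> J = {}" "O' \<inter> C = {}" for O'
  proof -
    have "g (\<Phi> 0) \<in> closure O'" using O(1) 0(1) by (auto simp: frontier_def)
    then have "O' \<inter> g ` \<Phi> ` ball 0 1 \<noteq> {}" using opn 0(2) by (meson disjoint_iff closure_iff_nhds_not_empty open_subset subset_refl)
    then show False using O(2,3) cover by blast
  qed
  have d: "inside J \<inter> J = {}" "outside J \<inter> J = {}" using JI by blast+
  \<comment> \<open>Being connected, \<open>C\<close> lies on one side of \<open>J\<close> and
    misses the other.\<close>
  have "C \<subseteq> inside J \<union> outside J" using JI CJ by blast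
  then have "C \<inter> inside J = {} \<or> C \<inter> outside J = {}"
    using connectedD[OF conC, of "inside J" "outside J"] JI by blast
  then show False using no[of "inside J"] no[of "outside J"] JI d by blast
qed

text \<open>A word without crossing cancels and its disc folds up to a sphere; conversely the Jordan
  curve argument forbids a crossing. So the topology of the surface can be read off the
  word.\<close>

lemma balanced_sphere_iff:
  assumes f: "fill w \<Phi>" and surj: "\<Phi> ` cball 0 1 = topspace X" and b: "balanced w"
  shows "X homeomorphic_space top_of_set (sphere (0::real^3) 1) \<longleftrightarrow> \<not> crossing w"
proof
  assume s: "X homeomorphic_space top_of_set (sphere (0::real^3) 1)"
  show "\<not> crossing w"
  proof
    assume "crossing w"
    then obtain A B C D G r s where w: "w = A @ r # B @ s # C @ rv r # D @ rv s # G" by (rule crossingE)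
    define j where "j = length A + 1 + length B"
    define k where "k = j + 1 + length C"
    define l where "l = k + 1 + length D"
    have j: "w ! j = s" unfolding w j_def by (simp add: nth_append)
    have k: "w ! k = rv r" unfolding w k_def j_def by (simp add: nth_append)
    have l: "w ! l = rv s" unfolding w l_def k_def j_def by (simp add: nth_append)
    have i: "w ! length A = r" unfolding w by simp
    have "fst r \<noteq> fst s"
    proof
      assume "fst r = fst s"
      then have "r = s \<or> r = rv s" by (rule dart_cases)
      then show False using b unfolding balanced_def w by auto
    qed
    moreover have "l < length w" unfolding w l_def k_def j_def by simp
    ultimately show False
      using sphere_no_crossing[OF f s, of "length A" j k l] i j k l by (simp add: j_def k_def l_def)
  qed
next
  assume "\<not> crossing w"
  then have "cancels w" using cancels_or_crossing[OF b] by blast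
  moreover have "w \<noteq> []" using f by (simp add: fill_def)
  ultimately show "X homeomorphic_space top_of_set (sphere (0::real^3) 1)" using cancels_sphere b f surj by blast
qed

end

section \<open>Linear algebra over a division ring\<close>

lemma scalar_sum_right: "c *s (\<Sum>i\<in>I. f i) = (\<Sum>i\<in>I. c *s (f i :: 'd::division_ring ^ 'm))"
  by (induction I rule: infinite_finite_induct) (auto simp: vector_add_ldistrib)

lemma scalar_sum_left: "(\<Sum>i\<in>I. c i) *s (x :: 'd::division_ring ^ 'm) = (\<Sum>i\<in>I. c i *s x)"
  by (induction I rule: infinite_finite_induct) (auto simp: vector_sadd_rdistrib)

lemma scalar_cancel:
  fixes x y :: "'d::division_ring ^ 'm"
  assumes "c \<noteq> 0" "c *s x = y"
  shows "x = inverse c *s y"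
proof -
  have "inverse c *s y = (inverse c * c) *s x" by (simp only: assms(2)[symmetric] vector_smult_assoc)
  then show ?thesis using assms(1) by simp
qed

lemma left_submodule_span: "left_submodule (left_span S)"
proof -
  have *: "left_submodule (\<Inter>T)" if "\<forall>t\<in>T. left_submodule t" for T :: "('a ^ 'b) set set"
    using that unfolding left_submodule_def by blast
  show ?thesis unfolding left_span_def by (rule hull_in) (use * in blast)
qed

lemma left_span_superset: "S \<subseteq> left_span S"
  unfolding left_span_def by (rule hull_subset)

lemma left_span_minimal: "left_submodule M \<Longrightarrow> S \<subseteq> M \<Longrightarrow> left_span S \<subseteq> M"
  unfolding left_span_def by (rule hull_minimal)

lemma left_submodule_sum:
  assumes "left_submodule M" "\<And>i. i \<in> I \<Longrightarrow> f i \<in> M"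
  shows "(\<Sum>i\<in>I. f i) \<in> M"
  using assms by (induction I rule: infinite_finite_induct) (auto simp: left_submodule_def)

lemma left_span_combination:
  assumes "\<And>i. i \<in> I \<Longrightarrow> r i \<in> S"
  shows "(\<Sum>i\<in>I. c i *s r i) \<in> left_span S"
proof (rule left_submodule_sum[OF left_submodule_span])
  fix i assume "i \<in> I"
  then show "c i *s r i \<in> left_span S"
    using left_submodule_span[of S] left_span_superset[of S] assms unfolding left_submodule_def by blast
qed

lemma left_span_image:
  assumes "finite J"
  shows "left_span (b ` J) = {\<Sum>j\<in>J. c j *s b j | c. True}"
proof
  have "left_submodule {\<Sum>j\<in>J. c j *s b j | c. True}"
    unfolding left_submodule_def
  proof (intro conjI ballI allI)
    show "0 \<in> {\<Sum>j\<in>J. c j *s b j | c. True}" by (auto intro!: exI[of _ "\<lambda>_. 0"])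
  next
    fix x y assume "x \<in> {\<Sum>j\<in>J. c j *s b j | c. True}" "y \<in> {\<Sum>j\<in>J. c j *s b j | c. True}"
    then obtain c c' where "x = (\<Sum>j\<in>J. c j *s b j)" "y = (\<Sum>j\<in>J. c' j *s b j)" by blast
    then have "x + y = (\<Sum>j\<in>J. (c j + c' j) *s b j)" by (simp add: vector_sadd_rdistrib sum.distrib)
    then show "x + y \<in> {\<Sum>j\<in>J. c j *s b j | c. True}" by (intro CollectI exI[of _ "\<lambda>j. c j + c' j"]) simp
  next
    fix k x assume "x \<in> {\<Sum>j\<in>J. c j *s b j | c. True}"
    then obtain c where "x = (\<Sum>j\<in>J. c j *s b j)" by blast
    then have "k *s x = (\<Sum>j\<in>J. (k * c j) *s b j)" by (simp add: scalar_sum_right vector_smult_assoc)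
    then show "k *s x \<in> {\<Sum>j\<in>J. c j *s b j | c. True}" by (intro CollectI exI[of _ "\<lambda>j. k * c j"]) simp
  qed
  moreover have "b ` J \<subseteq> {\<Sum>j\<in>J. c j *s b j | c. True}"
  proof
    fix x assume "x \<in> b ` J"
    then obtain i where i: "i \<in> J" "x = b i" by blast
    have "(\<Sum>j\<in>J. (if j = i then 1 else 0) *s b j) = (\<Sum>j\<in>J. if j = i then b j else 0)"
      by (intro sum.cong) auto
    also have "\<dots> = b i" using i assms by simp
    finally show "x \<in> {\<Sum>j\<in>J. c j *s b j | c. True}" using i by (intro CollectI exI[of _ "\<lambda>j. if j = i then 1 else 0"]) simp
  qed
  ultimately show "left_span (b ` J) \<subseteq> {\<Sum>j\<in>J. c j *s b j | c. True}" by (rule left_span_minimal)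
  show "{\<Sum>j\<in>J. c j *s b j | c. True} \<subseteq> left_span (b ` J)" using left_span_combination[of J b "b ` J"] by blast
qed

lemma left_span_singleton: "left_span {v} = range (\<lambda>c. c *s v)"
proof -
  have "left_span ((\<lambda>_::unit. v) ` {()}) = {\<Sum>j\<in>{()}. c j *s v | c. True}" by (rule left_span_image) simp
  also have "\<dots> = range (\<lambda>c. c *s v)"
  proof
    show "range (\<lambda>c. c *s v) \<subseteq> {\<Sum>j\<in>{()}. c j *s v | c. True}"
    proof
      fix x assume "x \<in> range (\<lambda>c. c *s v)"
      then obtain k where "x = k *s v" by blast
      then show "x \<in> {\<Sum>j\<in>{()}. c j *s v | c. True}" by (intro CollectI exI[of _ "\<lambda>_. k"]) simp
    qed
  qed auto
  finally show ?thesis by simp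
qed

text \<open>Gaussian elimination with unknowns on the left: one equation is solved for the unknown
  of the pivot row \<open>i0\<close> and substituted into the others.\<close>

lemma homogeneous_system:
  fixes A :: "'i \<Rightarrow> 'j \<Rightarrow> 'd::division_ring"
  assumes "finite J" "finite I" "card J < card I"
  shows "\<exists>c. (\<exists>i\<in>I. c i \<noteq> 0) \<and> (\<forall>j\<in>J. (\<Sum>i\<in>I. c i * A i j) = 0)"
  using assms
proof (induction J arbitrary: I A rule: finite_induct)
  case empty
  then obtain i where "i \<in> I" by fastforce
  then show ?case by (intro exI[of _ "\<lambda>_. 1"]) auto
next
  case (insert j J)
  show ?case
  proof (cases "\<forall>i\<in>I. A i j = 0")
    case True
    obtain c where "\<exists>i\<in>I. c i \<noteq> 0" "\<forall>j\<in>J. (\<Sum>i\<in>I. c i * A i j) = 0"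
      using insert.IH[of I A] insert.prems insert.hyps by auto
    then show ?thesis using True by (intro exI[of _ c]) simp
  next
    case False
    then obtain i0 where i0: "i0 \<in> I" "A i0 j \<noteq> 0" by blast
    \<comment> \<open>Row \<open>i\<close> minus a left multiple of the pivot row; since nothing
      commutes, the inverse of the pivot has to stand between the two entries.\<close>
    define B where "B i k = A i k - A i j * inverse (A i0 j) * A i0 k" for i k
    have "card J < card (I - {i0})" using insert.prems insert.hyps i0 by simp
    then obtain c where c: "\<exists>i\<in>I - {i0}. c i \<noteq> 0" "\<And>k. k \<in> J \<Longrightarrow> (\<Sum>i\<in>I - {i0}. c i * B i k) = 0"
      using insert.IH[of "I - {i0}" B] insert.prems by auto
    \<comment> \<open>The coefficient of the pivot row that equation \<open>j\<close>
      forces.\<close>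
    define s where "s = (\<Sum>i\<in>I - {i0}. c i * A i j) * inverse (A i0 j)"
    define c' where "c' = c(i0 := - s)"
    have split: "(\<Sum>i\<in>I. c' i * A i k) = - s * A i0 k + (\<Sum>i\<in>I - {i0}. c i * A i k)" for k
    proof -
      have "(\<Sum>i\<in>I. c' i * A i k) = c' i0 * A i0 k + (\<Sum>i\<in>I - {i0}. c' i * A i k)"
        using insert.prems(1) i0(1) by (rule sum.remove)
      also have "(\<Sum>i\<in>I - {i0}. c' i * A i k) = (\<Sum>i\<in>I - {i0}. c i * A i k)"
        by (rule sum.cong) (auto simp: c'_def)
      finally show ?thesis by (simp add: c'_def)
    qed
    have "(\<Sum>i\<in>I. c' i * A i j) = 0" unfolding split s_def using i0(2) by (simp add: mult.assoc)
    moreover have "(\<Sum>i\<in>I. c' i * A i k) = 0" if k: "k \<in> J" for k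
    proof -
      have "0 = (\<Sum>i\<in>I - {i0}. c i * A i k - (c i * A i j) * (inverse (A i0 j) * A i0 k))"
        using c(2)[OF k] by (simp add: B_def right_diff_distrib mult.assoc)
      also have "\<dots> = (\<Sum>i\<in>I - {i0}. c i * A i k) - s * A i0 k"
        unfolding sum_subtractf sum_distrib_right[symmetric] s_def by (simp add: mult.assoc)
      finally show ?thesis unfolding split by simp
    qed
    moreover have "\<exists>i\<in>I. c' i \<noteq> 0" using c(1) by (auto simp: c'_def)
    ultimately show ?thesis by (intro exI[of _ c']) auto
  qed
qed

text \<open>Expanding the vectors in the spanning family turns a dependence into a solution of a
  homogeneous system with more unknowns than equations.\<close>

lemma dependent_of_card:
  fixes r :: "'i \<Rightarrow> 'd::division_ring ^ 'm"
  assumes fin: "finite J" "finite I" "card J < card I" and sp: "\<And>i. i \<in> I \<Longrightarrow> r i \<in> left_span (b ` J)"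
  shows "\<not> left_independent I r"
proof -
  have "\<forall>i. \<exists>c. i \<in> I \<longrightarrow> r i = (\<Sum>j\<in>J. c j *s b j)"
    using sp left_span_image[OF fin(1), of b] by blast
  then obtain A where A: "\<And>i. i \<in> I \<Longrightarrow> r i = (\<Sum>j\<in>J. A i j *s b j)" by metis
  obtain c where c: "\<exists>i\<in>I. c i \<noteq> 0" "\<And>j. j \<in> J \<Longrightarrow> (\<Sum>i\<in>I. c i * A i j) = 0"
    using homogeneous_system[OF fin, of A] by auto
  have "(\<Sum>i\<in>I. c i *s r i) = (\<Sum>i\<in>I. \<Sum>j\<in>J. (c i * A i j) *s b j)"
    by (intro sum.cong) (auto simp: A scalar_sum_right vector_smult_assoc)
  also have "\<dots> = (\<Sum>j\<in>J. (\<Sum>i\<in>I. c i * A i j) *s b j)"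
    by (subst sum.swap) (simp add: scalar_sum_left)
  also have "\<dots> = 0" using c(2) by simp
  finally show ?thesis using c(1) unfolding left_independent_def by blast
qed

lemma vector_axis_expansion: "(x :: 'd::division_ring ^ 'm::finite) = (\<Sum>j\<in>UNIV. (x $ j) *s axis j 1)"
proof -
  have "(\<Sum>j\<in>UNIV. ((x $ j) *s axis j 1) $ i) = (\<Sum>j\<in>UNIV. if j = i then x $ j else 0)" for i
    by (intro sum.cong) (auto simp: axis_def)
  then show ?thesis by (simp add: vec_eq_iff)
qed

lemma left_span_axis: "left_span ((\<lambda>j. axis j 1) ` UNIV) = (UNIV :: ('d::division_ring ^ 'm::finite) set)"
proof -
  have "x \<in> left_span ((\<lambda>j. axis j 1) ` UNIV)" for x :: "'d ^ 'm"
    by (subst vector_axis_expansion[of x]) (rule left_span_combination, simp)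
  then show ?thesis by blast
qed

lemma independent_card_le:
  fixes r :: "'i \<Rightarrow> 'd::division_ring ^ 'm::finite"
  assumes "finite I" "left_independent I r"
  shows "card I \<le> CARD('m)"
proof (rule ccontr)
  assume "\<not> card I \<le> CARD('m)"
  then have "\<not> left_independent I r"
    by (intro dependent_of_card[of UNIV I r "\<lambda>j. axis j 1"]) (use assms left_span_axis in auto)
  then show False using assms by blast
qed

lemma independent_axis: "left_independent UNIV (\<lambda>j. axis j 1 :: 'd::division_ring ^ 'm::finite)"
  unfolding left_independent_def
proof (intro allI impI ballI)
  fix c :: "'m \<Rightarrow> 'd" and i assume s: "(\<Sum>j\<in>UNIV. c j *s axis j 1) = (0 :: 'd ^ 'm)"
  have "(\<Sum>j\<in>UNIV. (c j *s axis j 1) $ i) = (\<Sum>j\<in>UNIV. if j = i then c j else 0)"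
    by (intro sum.cong) (auto simp: axis_def)
  then have "(\<Sum>j\<in>UNIV. c j *s axis j 1) $ i = c i" by simp
  then show "c i = 0" using s by simp
qed

lemma left_span_proper:
  fixes r :: "'i \<Rightarrow> 'd::division_ring ^ 'm::finite"
  assumes "finite A" "card A < CARD('m)"
  shows "left_span (r ` A) \<noteq> UNIV"
proof
  assume "left_span (r ` A) = UNIV"
  then have "\<not> left_independent UNIV (\<lambda>j. axis j 1 :: 'd ^ 'm)"
    using assms by (intro dependent_of_card[of A UNIV _ r]) auto
  then show False using independent_axis by blast
qed

text \<open>A module over an infinite division ring is no finite union of proper submodules. If
  \<open>x\<close> avoids the old ones but lies in \<open>W\<close>, and \<open>y\<close> lies
  outside \<open>W\<close>, then the line of all \<open>c *s x + y\<close> misses \<open>W\<close>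
  and meets each old one at most once.\<close>

lemma avoid_submodules:
  fixes \<W> :: "('d::division_ring ^ 'm) set set"
  assumes inf: "infinite (UNIV :: 'd set)" and "finite \<W>" "\<And>W. W \<in> \<W> \<Longrightarrow> left_submodule W \<and> W \<noteq> UNIV"
  shows "\<exists>x. \<forall>W\<in>\<W>. x \<notin> W"
  using assms(2,3)
proof (induction \<W> rule: finite_induct)
  case (insert W \<W>)
  then obtain x where x: "\<And>W'. W' \<in> \<W> \<Longrightarrow> x \<notin> W'" by auto
  show ?case
  proof (cases "x \<in> W")
    case True
    obtain y where y: "y \<notin> W" using insert.prems[of W] by auto
    have sub: "left_submodule W'" if "W' \<in> insert W \<W>" for W' using insert.prems that by blast
    define bad where "bad W' = {c. c *s x + y \<in> W'}" for W'
    have "\<exists>c0. bad W' \<subseteq> {c0}" if W': "W' \<in> \<W>" for W'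
    proof -
      have "c = c'" if "c \<in> bad W'" "c' \<in> bad W'" for c c'
      proof (rule ccontr)
        assume ne: "c \<noteq> c'"
        have S: "left_submodule W'" using sub W' by blast
        have 1: "c *s x + y \<in> W'" and 2: "c' *s x + y \<in> W'" using that by (auto simp: bad_def)
        have "(-1) *s (c' *s x + y) \<in> W'" using S 2 unfolding left_submodule_def by blast
        then have "(c *s x + y) + (-1) *s (c' *s x + y) \<in> W'" using S 1 unfolding left_submodule_def by blast
        moreover have "(c *s x + y) + (-1) *s (c' *s x + y) = (c - c') *s x"
          by (simp add: vec_eq_iff algebra_simps)
        ultimately have "inverse (c - c') *s ((c - c') *s x) \<in> W'" using S unfolding left_submodule_def by metis
        moreover have "x = inverse (c - c') *s ((c - c') *s x)" by (rule scalar_cancel) (use ne in auto)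
        ultimately show False using x[OF W'] by metis
      qed
      then show ?thesis by blast
    qed
    then have "finite (bad W')" if "W' \<in> \<W>" for W' using that by (meson finite.emptyI finite.insertI finite_subset)
    then have "finite (\<Union>(bad ` \<W>))" using insert.hyps(1) by blast
    then obtain c where c: "c \<notin> \<Union>(bad ` \<W>)" using inf ex_new_if_finite by blast
    have "c *s x + y \<notin> W"
    proof
      assume m: "c *s x + y \<in> W"
      have S: "left_submodule W" using sub by blast
      have "(- c) *s x \<in> W" using S True unfolding left_submodule_def by blast
      then have "(c *s x + y) + (- c) *s x \<in> W" using S m unfolding left_submodule_def by blast
      moreover have "(c *s x + y) + (- c) *s x = y" by (simp add: vec_eq_iff)
      ultimately show False using y by simp
    qed
    moreover have "c *s x + y \<notin> W'" if "W' \<in> \<W>" for W' using c that by (auto simp: bad_def)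
    ultimately show ?thesis by blast
  next
    case False
    then show ?thesis using x by blast
  qed
qed simp

text \<open>General position for all subsets at once: each new vector is chosen outside the spans of
  the small sets of earlier ones. These spans are proper and finite in number.\<close>

lemma generic_vectors:
  assumes inf: "infinite (UNIV :: 'd::division_ring set)" and "finite V"
  shows "\<exists>r :: 'v \<Rightarrow> 'd ^ 'm::finite. \<forall>A\<subseteq>V. card A \<le> CARD('m) \<longrightarrow> left_independent A r"
  using assms(2)
proof (induction V rule: finite_induct)
  case empty
  then show ?case by (auto simp: left_independent_def)
next
  case (insert v V)
  then obtain r :: "'v \<Rightarrow> 'd ^ 'm" where r: "\<And>A. A \<subseteq> V \<Longrightarrow> card A \<le> CARD('m) \<Longrightarrow> left_independent A r" by blast
  let ?\<W> = "(\<lambda>A. left_span (r ` A)) ` {A. A \<subseteq> V \<and> card A < CARD('m)}"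
  have "\<exists>x. \<forall>W\<in>?\<W>. x \<notin> W"
  proof (rule avoid_submodules[OF inf])
    show "finite ?\<W>" using insert.hyps(1) by simp
    fix W assume "W \<in> ?\<W>"
    then obtain A where A: "A \<subseteq> V" "card A < CARD('m)" "W = left_span (r ` A)" by blast
    then show "left_submodule W \<and> W \<noteq> UNIV"
      using left_submodule_span left_span_proper[of A r] finite_subset[OF A(1) insert.hyps(1)] by blast
  qed
  then obtain x where x: "\<And>A. A \<subseteq> V \<Longrightarrow> card A < CARD('m) \<Longrightarrow> x \<notin> left_span (r ` A)" by blast
  define r' where "r' = r(v := x)"
  have "left_independent A r'" if A: "A \<subseteq> insert v V" "card A \<le> CARD('m)" for A
  proof (cases "v \<in> A")
    case False
    then have "A \<subseteq> V" using A by blast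
    then have "left_independent A r" using r A by blast
    moreover have "(\<Sum>i\<in>A. c i *s r' i) = (\<Sum>i\<in>A. c i *s r i)" for c
      by (rule sum.cong) (use False in \<open>auto simp: r'_def\<close>)
    ultimately show ?thesis by (simp add: left_independent_def)
  next
    case True
    define B where "B = A - {v}"
    have finA: "finite A" using A(1) insert.hyps(1) finite_subset by blast
    have B: "B \<subseteq> V" "card B < CARD('m)" using A True finA card_Diff1_less[OF finA True] by (auto simp: B_def)
    have rB: "left_independent B r" using r[OF B(1)] B(2) by simp
    show ?thesis unfolding left_independent_def
    proof (intro allI impI)
      fix c assume s: "(\<Sum>i\<in>A. c i *s r' i) = 0"
      have "(\<Sum>i\<in>A. c i *s r' i) = c v *s r' v + (\<Sum>i\<in>B. c i *s r' i)"
        unfolding B_def using finA True by (rule sum.remove)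
      also have "(\<Sum>i\<in>B. c i *s r' i) = (\<Sum>i\<in>B. c i *s r i)"
        by (rule sum.cong) (auto simp: r'_def B_def)
      finally have e: "c v *s x + (\<Sum>i\<in>B. c i *s r i) = 0" using s by (simp add: r'_def)
      have cv: "c v = 0"
      proof (rule ccontr)
        assume ne: "c v \<noteq> 0"
        have "c v *s x = - (\<Sum>i\<in>B. c i *s r i)" using e by (simp add: eq_neg_iff_add_eq_0)
        also have "\<dots> = (\<Sum>i\<in>B. (- c i) *s r i)" by (simp only: vector_smult_lneg sum_negf)
        finally have "x = inverse (c v) *s (\<Sum>i\<in>B. (- c i) *s r i)" by (rule scalar_cancel[OF ne])
        also have "\<dots> = (\<Sum>i\<in>B. (inverse (c v) * (- c i)) *s r i)" by (simp add: scalar_sum_right vector_smult_assoc)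
        finally have "x \<in> left_span (r ` B)" using left_span_combination[of B r "r ` B"] by auto
        then show False using x B by blast
      qed
      then have "(\<Sum>i\<in>B. c i *s r i) = 0" using e by simp
      then have "\<forall>i\<in>B. c i = 0" using rB by (auto simp: left_independent_def)
      then show "\<forall>i\<in>A. c i = 0" using cv by (auto simp: B_def)
    qed
  qed
  then show ?case by blast
qed

section \<open>Points and the Menelaus condition\<close>

lemma proj_space_represents: "P \<in> proj_space \<Longrightarrow> \<exists>v. represents v P"
proof -
  assume "P \<in> proj_space"
  then obtain b where b: "left_independent {..<1::nat} b" "P = left_span (b ` {..<1})"
    by (auto simp: proj_space_def has_left_rank_def)
  have "b 0 \<noteq> 0"
  proof
    assume "b 0 = 0"
    then show False using b(1)[unfolded left_independent_def, rule_format, of "\<lambda>_. 1" 0] by simp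
  qed
  moreover have "P = left_span {b 0}" using b(2) by (simp add: lessThan_Suc)
  ultimately show ?thesis unfolding represents_def by blast
qed

lemma singleton_independent: "v \<noteq> 0 \<Longrightarrow> left_independent {..<1::nat} (\<lambda>_. v :: 'd::division_ring ^ 'm)"
  unfolding left_independent_def by (auto simp: lessThan_Suc vec_eq_iff)

lemma span_in_proj_space:
  assumes "v \<noteq> 0"
  shows "left_span {v} \<in> proj_space"
proof -
  have "left_span {v} = left_span ((\<lambda>_. v) ` {..<1::nat})" by (simp add: lessThan_Suc)
  then show ?thesis unfolding proj_space_def has_left_rank_def
    using left_submodule_span singleton_independent[OF assms] by blast
qed

lemma represents_scale:
  assumes "represents v P" "represents v' P"
  obtains c where "c \<noteq> 0" "v' = c *s v"
proof -
  have "v' \<in> left_span {v'}" using left_span_superset[of "{v'}"] by blast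
  then have "v' \<in> range (\<lambda>c. c *s v)" using assms left_span_singleton[of v] unfolding represents_def by auto
  then obtain c where "v' = c *s v" by blast
  moreover from this have "c \<noteq> 0" using assms(2) by (auto simp: represents_def)
  ultimately show ?thesis using that by blast
qed

lemma represents_scaled:
  assumes "represents v P" "c \<noteq> 0"
  shows "represents (c *s v) P"
proof -
  have v: "v \<noteq> 0" "P = range (\<lambda>k. k *s v)" using assms(1) left_span_singleton[of v] by (auto simp: represents_def)
  have "c *s v \<noteq> 0" using v(1) assms(2) scalar_cancel[OF assms(2), of v 0] by auto
  moreover have "range (\<lambda>k. k *s (c *s v)) = range (\<lambda>k. k *s v)"
  proof
    show "range (\<lambda>k. k *s (c *s v)) \<subseteq> range (\<lambda>k. k *s v)" by (auto simp: vector_smult_assoc)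
    have "k *s v = (k * inverse c) *s (c *s v)" for k using assms(2) by (simp add: vector_smult_assoc mult.assoc)
    then show "range (\<lambda>k. k *s v) \<subseteq> range (\<lambda>k. k *s (c *s v))" by blast
  qed
  ultimately show ?thesis unfolding represents_def left_span_singleton using v(2) by simp
qed

text \<open>Two representatives of a point differ by a nonzero left factor, which the coefficients
  absorb.\<close>

lemma points_independent_iff:
  assumes "\<And>i. i \<in> I \<Longrightarrow> represents (r i) (p i)"
  shows "points_independent I p \<longleftrightarrow> left_independent I r"
proof
  assume "points_independent I p"
  then obtain r' where r': "\<And>i. i \<in> I \<Longrightarrow> represents (r' i) (p i)" "left_independent I r'"
    by (auto simp: points_independent_def)
  have "\<forall>i. \<exists>k. i \<in> I \<longrightarrow> k \<noteq> 0 \<and> r i = k *s r' i"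
    using represents_scale[OF r'(1) assms] by metis
  then obtain k where k: "\<And>i. i \<in> I \<Longrightarrow> k i \<noteq> 0 \<and> r i = k i *s r' i" by metis
  show "left_independent I r" unfolding left_independent_def
  proof (intro allI impI)
    fix c assume "(\<Sum>i\<in>I. c i *s r i) = 0"
    moreover have "(\<Sum>i\<in>I. c i *s r i) = (\<Sum>i\<in>I. (c i * k i) *s r' i)"
      by (rule sum.cong) (use k in \<open>auto simp: vector_smult_assoc\<close>)
    ultimately have "(\<Sum>i\<in>I. (c i * k i) *s r' i) = 0" by simp
    then have "\<forall>i\<in>I. c i * k i = 0" using r'(2)[unfolded left_independent_def, rule_format, of "\<lambda>i. c i * k i"] by blast
    then show "\<forall>i\<in>I. c i = 0" using k by auto
  qed
qed (use assms in \<open>auto simp: points_independent_def\<close>)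

text \<open>Rank at most \<open>2\<close> yields a relation between the three representatives.
  Distinctness of the points makes all three coefficients nonzero, so the relation can be solved for
  the edge point and scaled to coefficient \<open>1\<close> at \<open>v\<close>.\<close>

lemma collinear_point:
  assumes col: "points_collinear P Q R" and dist: "distinct [P, Q, R]" and v: "represents v Q" and w: "represents w R"
  obtains a where "a \<noteq> 0" "represents (v - a *s w) P"
proof -
  obtain u0 v0 w0 k where r: "represents u0 P" "represents v0 Q" "represents w0 R" "k \<le> 2"
    "has_left_rank (left_span {u0, v0, w0}) k" using col by (auto simp: points_collinear_def)
  obtain b where b: "left_span {u0, v0, w0} = left_span (b ` {..<k})" using r(5) by (auto simp: has_left_rank_def)
  define x where "x n = (if n = (0::nat) then u0 else if n = 1 then v0 else w0)" for n
  have "\<not> left_independent {..<3} x"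
  proof (rule dependent_of_card)
    show "card {..<k} < card {..<3::nat}" using r(4) by simp
    fix i assume "i \<in> {..<3::nat}"
    have "x i \<in> {u0, v0, w0}" by (simp add: x_def)
    then show "x i \<in> left_span (b ` {..<k})" using left_span_superset[of "{u0, v0, w0}"] b by blast
  qed auto
  then obtain c i where c: "(\<Sum>i<3. c i *s x i) = 0" "i < 3" "c i \<noteq> 0" by (auto simp: left_independent_def)
  have e: "c 0 *s u0 + c 1 *s v0 + c 2 *s w0 = 0"
    using c(1) by (simp add: x_def numeral_3_eq_3 numeral_2_eq_2 lessThan_Suc add_ac)
  have nz: "u0 \<noteq> 0" "v0 \<noteq> 0" "w0 \<noteq> 0" using r by (auto simp: represents_def)
  \<comment> \<open>A nontrivial relation between representatives of only two points would make the
    points equal.\<close>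
  have line: False if "\<alpha> *s y + \<beta> *s z = 0" "represents y S" "represents z T" "S \<noteq> T" "\<alpha> \<noteq> 0 \<or> \<beta> \<noteq> 0" for \<alpha> \<beta> y z S T
  proof -
    have yz: "y \<noteq> 0" "z \<noteq> 0" using that by (auto simp: represents_def)
    have "\<alpha> \<noteq> 0"
    proof
      assume "\<alpha> = 0"
      then have "\<beta> *s z = 0" "\<beta> \<noteq> 0" using that(1,5) by auto
      then show False using scalar_cancel[of \<beta> z 0] yz by simp
    qed
    have "\<alpha> *s y = (- \<beta>) *s z" using that(1) by (simp add: vector_smult_lneg eq_neg_iff_add_eq_0)
    then have y: "y = inverse \<alpha> *s ((- \<beta>) *s z)" by (rule scalar_cancel[OF \<open>\<alpha> \<noteq> 0\<close>])
    then have y2: "y = (inverse \<alpha> * - \<beta>) *s z" by (simp only: vector_smult_assoc)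
    then have "inverse \<alpha> * - \<beta> \<noteq> 0" using yz(1) by auto
    then have "represents y T" unfolding y2 by (rule represents_scaled[OF that(3)])
    then have "S = T" using that(2) by (simp add: represents_def)
    then show False using that(4) by blast
  qed
  have ne: "c 0 \<noteq> 0 \<or> c 1 \<noteq> 0 \<or> c 2 \<noteq> 0"
  proof -
    have "i = 0 \<or> i = 1 \<or> i = 2" using c(2) by auto
    then show ?thesis using c(3) by auto
  qed
  have c0: "c 0 \<noteq> 0" using line[OF _ r(2,3), of "c 1" "c 2"] e ne dist by auto
  have c1: "c 1 \<noteq> 0" using line[OF _ r(1,3), of "c 0" "c 2"] e c0 dist by auto
  have c2: "c 2 \<noteq> 0" using line[OF _ r(1,2), of "c 0" "c 1"] e c0 dist by auto
  obtain k1 where k1: "k1 \<noteq> 0" "v0 = k1 *s v" using represents_scale[OF v r(2)] .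
  obtain k2 where k2: "k2 \<noteq> 0" "w0 = k2 *s w" using represents_scale[OF w r(3)] .
  define s where "s = c 1 * k1"
  define t where "t = c 2 * k2"
  have st: "s \<noteq> 0" "t \<noteq> 0" using c1 c2 k1 k2 by (auto simp: s_def t_def)
  have e2: "c 0 *s u0 + s *s v + t *s w = 0" using e k1 k2 by (simp add: s_def t_def vector_smult_assoc)
  have "v + (inverse s * t) *s w = (- inverse s * c 0) *s u0"
  proof -
    have "inverse s *s (c 0 *s u0 + s *s v + t *s w) = 0" using e2 by simp
    then have "(inverse s * c 0) *s u0 + v + (inverse s * t) *s w = 0"
      using st by (simp add: vector_add_ldistrib vector_smult_assoc)
    then show ?thesis by (simp add: vector_smult_lneg eq_neg_iff_add_eq_0 add_ac)
  qed
  moreover have "represents ((- inverse s * c 0) *s u0) P"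
    by (rule represents_scaled[OF r(1)]) (use st c0 in auto)
  ultimately have "represents (v - (- (inverse s * t)) *s w) P" by (simp add: vector_smult_lneg)
  moreover have "- (inverse s * t) \<noteq> 0" using st by simp
  ultimately show ?thesis using that by blast
qed

text \<open>The theorem of Menelaus. Comparing coefficients at \<open>x j\<close>, a relation has to
  satisfy \<open>c j = c (j - 1) * a (j - 1)\<close> around the cycle, so \<open>c j\<close> is
  \<open>c 0\<close> times a partial product. With \<open>c 0\<close> nonzero this closes up exactly
  when the full product is \<open>1\<close>.\<close>

lemma cyclic_independent:
  fixes x :: "nat \<Rightarrow> 'd::division_ring ^ 'm"
  assumes k: "0 < k" and x: "left_independent {..<k} x"
  shows "left_independent {..<k} (\<lambda>j. x j - a j *s x (Suc j mod k)) \<longleftrightarrow> prod_list (map a [0..<k]) \<noteq> 1"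
proof -
  define \<sigma> where "\<sigma> j = Suc j mod k" for j
  define \<pi> where "\<pi> j = (if j = 0 then k - 1 else j - 1)" for j
  have \<sigma>\<pi>: "\<sigma> (\<pi> j) = j" "\<pi> j < k" if "j < k" for j using that by (auto simp: \<sigma>_def \<pi>_def)
  have \<pi>\<sigma>: "\<pi> (\<sigma> j) = j" "\<sigma> j < k" if "j < k" for j
    using that by (auto simp: \<sigma>_def \<pi>_def mod_Suc)
  \<comment> \<open>Summation by parts on the cycle, with \<open>\<sigma>\<close> the successor and
    \<open>\<pi>\<close> the predecessor of an index.\<close>
  have sum: "(\<Sum>j<k. c j *s (x j - a j *s x (\<sigma> j))) = (\<Sum>j<k. (c j - c (\<pi> j) * a (\<pi> j)) *s x j)" for c
  proof -
    have "(\<Sum>j<k. c j *s (x j - a j *s x (\<sigma> j))) = (\<Sum>j<k. c j *s x j) - (\<Sum>j<k. (c j * a j) *s x (\<sigma> j))"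
      by (simp add: sum_subtractf vector_ssub_ldistrib vector_smult_assoc)
    also have "(\<Sum>j<k. (c j * a j) *s x (\<sigma> j)) = (\<Sum>j<k. (c (\<pi> j) * a (\<pi> j)) *s x j)"
      by (rule sum.reindex_bij_witness[of _ \<pi> \<sigma>]) (use \<sigma>\<pi> \<pi>\<sigma> in auto)
    also have "(\<Sum>j<k. c j *s x j) - (\<Sum>j<k. (c (\<pi> j) * a (\<pi> j)) *s x j) = (\<Sum>j<k. (c j - c (\<pi> j) * a (\<pi> j)) *s x j)"
      by (simp add: sum_subtractf[symmetric] vec_eq_iff algebra_simps)
    finally show ?thesis .
  qed
  define h where "h j = prod_list (map a [0..<j])" for j
  have hS: "h (Suc j) = h j * a j" for j by (simp add: h_def)
  show ?thesis unfolding h_def[symmetric] \<sigma>_def[symmetric]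
  proof
    assume ind: "left_independent {..<k} (\<lambda>j. x j - a j *s x (\<sigma> j))"
    show "h k \<noteq> 1"
    proof
      assume hk: "h k = 1"
      have "h j - h (\<pi> j) * a (\<pi> j) = 0" if "j < k" for j
      proof (cases j)
        case 0
        have "h (k - 1) * a (k - 1) = h k" using hS[of "k - 1"] k by simp
        then show ?thesis using 0 hk by (simp add: \<pi>_def h_def)
      next
        case (Suc i)
        then show ?thesis using hS[of i] by (simp add: \<pi>_def)
      qed
      then have "(\<Sum>j<k. h j *s (x j - a j *s x (\<sigma> j))) = 0" unfolding sum by simp
      then have "\<forall>j\<in>{..<k}. h j = 0" using ind unfolding left_independent_def by blast
      then have "h 0 = 0" using k by blast
      then show False by (simp add: h_def)
    qed
  next
    assume hk: "h k \<noteq> 1"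
    show "left_independent {..<k} (\<lambda>j. x j - a j *s x (\<sigma> j))"
      unfolding left_independent_def
    proof (intro allI impI)
      fix c assume "(\<Sum>j<k. c j *s (x j - a j *s x (\<sigma> j))) = 0"
      then have "(\<Sum>j<k. (c j - c (\<pi> j) * a (\<pi> j)) *s x j) = 0" by (simp only: sum)
      then have "\<forall>j\<in>{..<k}. c j - c (\<pi> j) * a (\<pi> j) = 0"
        using x[unfolded left_independent_def, rule_format, of "\<lambda>j. c j - c (\<pi> j) * a (\<pi> j)"] by blast
      then have rec: "c j = c (\<pi> j) * a (\<pi> j)" if "j < k" for j using that by simp
      have ch: "c j = c 0 * h j" if "j < k" for j
        using that
      proof (induction j)
        case 0 then show ?case by (simp add: h_def)
      next
        case (Suc j)
        then show ?case using rec[of "Suc j"] by (simp add: \<pi>_def hS mult.assoc)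
      qed
      have "c 0 = c (k - 1) * a (k - 1)" using rec[of 0] k by (simp add: \<pi>_def)
      also have "\<dots> = c 0 * h k" using ch[of "k - 1"] k hS[of "k - 1"] by (simp add: mult.assoc)
      finally have "c 0 * (1 - h k) = 0" by (simp add: right_diff_distrib)
      then have "c 0 = 0" using hk by simp
      then show "\<forall>j\<in>{..<k}. c j = 0" using ch by simp
    qed
  qed
qed

section \<open>Realizations and gains\<close>

lemma left_independent_reindex:
  assumes "bij_betw h J I"
  shows "left_independent I x \<longleftrightarrow> left_independent J (\<lambda>j. x (h j))"
proof -
  have inj: "inj_on h J" and I: "I = h ` J" using assms by (auto simp: bij_betw_def)
  have sum: "(\<Sum>i\<in>I. c i *s x i) = (\<Sum>j\<in>J. c (h j) *s x (h j))" for c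
    unfolding I by (simp add: sum.reindex[OF inj] comp_def)
  show ?thesis
  proof
    assume L: "left_independent I x"
    show "left_independent J (\<lambda>j. x (h j))" unfolding left_independent_def
    proof (intro allI impI ballI)
      fix c j assume c: "(\<Sum>j\<in>J. c j *s x (h j)) = 0" and j: "j \<in> J"
      have "(\<Sum>j\<in>J. c (inv_into J h (h j)) *s x (h j)) = (\<Sum>j\<in>J. c j *s x (h j))"
        by (rule sum.cong) (simp_all add: inv_into_f_f[OF inj])
      then have "(\<Sum>i\<in>I. c (inv_into J h i) *s x i) = 0" using c sum[of "\<lambda>i. c (inv_into J h i)"] by simp
      then have "c (inv_into J h (h j)) = 0"
        using L[unfolded left_independent_def, rule_format, of "\<lambda>i. c (inv_into J h i)" "h j"] j I by blast
      then show "c j = 0" using inv_into_f_f[OF inj j] by simp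
    qed
  next
    assume L: "left_independent J (\<lambda>j. x (h j))"
    show "left_independent I x" unfolding left_independent_def
    proof (intro allI impI ballI)
      fix c i assume c: "(\<Sum>i\<in>I. c i *s x i) = 0" and "i \<in> I"
      then obtain j where "j \<in> J" "i = h j" using I by blast
      then show "c i = 0" using L[unfolded left_independent_def, rule_format, of "\<lambda>j. c (h j)" j] c sum[of c] by simp
    qed
  qed
qed

lemma left_independent_pair:
  assumes fin: "finite A" and L: "left_independent A r" and vw: "v \<in> A" "w \<in> A" "v \<noteq> w" and e: "c *s r v = c' *s r w"
  shows "c = 0" "c' = 0"
proof -
  define k where "k u = (if u = v then c else if u = w then - c' else 0)" for u
  have "(\<Sum>u\<in>A. k u *s r u) = (\<Sum>u\<in>{v, w}. k u *s r u)"
    by (rule sum.mono_neutral_right) (use fin vw in \<open>auto simp: k_def\<close>)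
  also have "\<dots> = c *s r v - c' *s r w" using vw(3) by (simp add: k_def vector_smult_lneg)
  finally have "(\<Sum>u\<in>A. k u *s r u) = 0" using e by simp
  then have "k v = 0" "k w = 0" using L vw unfolding left_independent_def by blast+
  then show "c = 0" "c' = 0" using vw(3) by (simp_all add: k_def)
qed

lemma represents_flip:
  assumes "represents (v - a *s w) P" "a \<noteq> 0"
  shows "represents (w - inverse a *s v) P"
proof -
  have "- inverse a *s (v - a *s w) = w - inverse a *s v"
    using assms(2) by (simp add: vec_eq_iff right_diff_distrib mult.assoc[symmetric])
  then show ?thesis using represents_scaled[OF assms(1), of "- inverse a"] assms(2) by simp
qed

lemma left_span_insert:
  assumes "u \<in> left_span S"
  shows "left_span (insert u S) = left_span S"
proof
  show "left_span (insert u S) \<subseteq> left_span S"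
    using assms left_span_superset[of S] by (intro left_span_minimal left_submodule_span) simp
  show "left_span S \<subseteq> left_span (insert u S)"
    using left_span_superset[of "insert u S"] by (intro left_span_minimal left_submodule_span) simp
qed

lemma points_collinear_commute:
  assumes "points_collinear P Q R"
  shows "points_collinear P R Q"
proof -
  obtain u v w k where c: "represents u P" "represents v Q" "represents w R" "k \<le> 2" "has_left_rank (left_span {u, v, w}) k"
    using assms unfolding points_collinear_def by blast
  have "has_left_rank (left_span {u, w, v}) k" using c(5) by (simp only: insert_commute[of w v])
  with c(1-4) show ?thesis unfolding points_collinear_def by blast
qed

text \<open>A realization demands pairwise distinct points on the line of an edge; independence of
  the end vectors together with a nonzero gain guarantees this.\<close>

lemma collinear_distinct_on_line:
  assumes fin: "finite A" and L: "left_independent A r" and vw: "v \<in> A" "w \<in> A" "v \<noteq> w" and a: "a \<noteq> 0"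
  defines "u \<equiv> r v - a *s r w"
  shows "u \<noteq> 0" "r v \<noteq> 0" "r w \<noteq> 0"
    "points_collinear (left_span {u}) (left_span {r v}) (left_span {r w})"
    "distinct [left_span {u}, left_span {r v}, left_span {r w}]"
proof -
  have pair: "c = 0 \<and> c' = 0" if "c *s r v = c' *s r w" for c c'
    using left_independent_pair[OF fin L vw that] by blast
  have u_mult: "(1 - c) *s r v = a *s r w" if "u = c *s r v" for c
    using that by (simp add: u_def vec_eq_iff algebra_simps)
  have u_mult': "1 *s r v = (c + a) *s r w" if "u = c *s r w" for c
    using that by (simp add: u_def vec_eq_iff algebra_simps)
  show u: "u \<noteq> 0" using u_mult[of 0] pair[of 1 a] by auto
  show v: "r v \<noteq> 0" using pair[of 1 0] by auto
  show w: "r w \<noteq> 0" using pair[of 0 1] by auto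
  have rep: "represents u (left_span {u})" "represents (r v) (left_span {r v})" "represents (r w) (left_span {r w})"
    using u v w by (simp_all add: represents_def)
  have "left_span {u} \<noteq> left_span {r v}"
  proof
    assume "left_span {u} = left_span {r v}"
    then obtain c where "u = c *s r v" using represents_scale[OF rep(2), of u] rep(1) by metis
    from pair[OF u_mult[OF this]] show False using a by simp
  qed
  moreover have "left_span {u} \<noteq> left_span {r w}"
  proof
    assume "left_span {u} = left_span {r w}"
    then obtain c where "u = c *s r w" using represents_scale[OF rep(3), of u] rep(1) by metis
    from pair[OF u_mult'[OF this]] show False by simp
  qed
  moreover have "left_span {r v} \<noteq> left_span {r w}"
  proof
    assume "left_span {r v} = left_span {r w}"
    then obtain c where "r v = c *s r w" using represents_scale[OF rep(3), of "r v"] rep(2) by metis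
    then show False using pair[of 1 c] by simp
  qed
  ultimately show "distinct [left_span {u}, left_span {r v}, left_span {r w}]" by simp
  define b where "b i = (if i = (0::nat) then r v else r w)" for i
  have img: "b ` {..<2} = {r v, r w}" by (auto simp: b_def numeral_2_eq_2 lessThan_Suc)
  have "left_independent {..<2} b" unfolding left_independent_def
  proof (intro allI impI)
    fix c assume "(\<Sum>i<2. c i *s b i) = 0"
    then have "c 0 *s r v = (- c 1) *s r w" by (simp add: numeral_2_eq_2 b_def vector_smult_lneg eq_neg_iff_add_eq_0)
    then have "c 0 = 0 \<and> c 1 = 0" using pair[of "c 0" "- c 1"] by simp
    then show "\<forall>i\<in>{..<2}. c i = 0" by (auto simp: less_2_cases_iff)
  qed
  moreover have "u \<in> left_span {r v, r w}"
  proof -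
    have sm: "left_submodule (left_span {r v, r w})" by (rule left_submodule_span)
    have "r v \<in> left_span {r v, r w}" "r w \<in> left_span {r v, r w}" using left_span_superset by blast+
    moreover from this(2) have "(- a) *s r w \<in> left_span {r v, r w}" using sm unfolding left_submodule_def by blast
    ultimately have "r v + (- a) *s r w \<in> left_span {r v, r w}" using sm unfolding left_submodule_def by blast
    then show ?thesis by (simp add: u_def vector_smult_lneg)
  qed
  ultimately have "has_left_rank (left_span {u, r v, r w}) 2"
    unfolding has_left_rank_def using img left_span_insert by metis
  then show "points_collinear (left_span {u}) (left_span {r v}) (left_span {r w})"
    unfolding points_collinear_def using rep by blast
qed

context subdivided_surface
begin

text \<open>Links the set of edges of a face to the cyclic order of its word. As the polygon is
  embedded, positions correspond bijectively to edges and to vertices, so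
  \<open>cyclic_independent\<close> applies.\<close>

lemma face_points_independent_iff:
  fixes r :: "'a \<Rightarrow> 'd::division_ring ^ 'm"
  assumes f: "f \<in> F" and r: "left_independent (face_vertices X V f) r"
    and rep: "\<And>d. d \<in> set (fw f) \<Longrightarrow> represents (r (dpath d 0) - a d *s r (dpath d 1)) (pe (fst d))"
  shows "points_independent (face_edges X E f) pe \<longleftrightarrow> hol a (fw f) \<noteq> 1"
proof -
  define k where "k = length (fw f)"
  define D where "D j = fw f ! j" for j
  define h where "h j = fst (D j)" for j
  define x where "x j = r (dpath (D j) 0)" for j
  define u where "u j = x j - a (D j) *s x (Suc j mod k)" for j
  have k: "0 < k" using fw_props(2)[OF f] unfolding k_def by linarith
  have D: "D j \<in> set (fw f)" if "j < k" for j using that by (simp add: D_def k_def)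
  have "bij_betw ((!) (map fst (fw f))) {..<k} (face_edges X E f)"
    by (rule bij_betw_nth[OF fw_props(3)[OF f]]) (simp_all add: k_def face_edges_eq[OF f])
  then have h: "bij_betw h {..<k} (face_edges X E f)"
    by (rule bij_betw_cong[THEN iffD1, rotated]) (simp add: h_def D_def k_def)
  have "bij_betw ((!) (map (\<lambda>d. dpath d 0) (fw f))) {..<k} (face_vertices X V f)"
    by (rule bij_betw_nth[OF fw_props(4)[OF f]]) (simp_all add: k_def face_vertices_eq[OF f])
  then have "bij_betw (\<lambda>j. dpath (D j) 0) {..<k} (face_vertices X V f)"
    by (rule bij_betw_cong[THEN iffD1, rotated]) (simp add: D_def k_def)
  then have x: "left_independent {..<k} x" unfolding x_def using left_independent_reindex r by blast
  have urep: "represents (u j) (pe (h j))" if j: "j < k" for j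
    using rep[OF D[OF j]] fw_consecutive[OF f, of j] j by (simp add: u_def x_def h_def D_def k_def)
  define g where "g = inv_into {..<k} h"
  have gh: "g (h j) = j" if "j < k" for j
    using h that unfolding g_def bij_betw_def by (simp add: inv_into_f_f)
  have "represents (u (g e)) (pe e)" if e: "e \<in> face_edges X E f" for e
  proof -
    obtain j where "j < k" "e = h j" using h e by (auto simp: bij_betw_def)
    then show ?thesis using urep gh by simp
  qed
  then have "points_independent (face_edges X E f) pe \<longleftrightarrow> left_independent (face_edges X E f) (\<lambda>e. u (g e))"
    by (rule points_independent_iff)
  also have "\<dots> \<longleftrightarrow> left_independent {..<k} (\<lambda>j. u (g (h j)))" by (rule left_independent_reindex[OF h])
  also have "\<dots> \<longleftrightarrow> left_independent {..<k} u"
  proof -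
    have "(\<Sum>j<k. c j *s u (g (h j))) = (\<Sum>j<k. c j *s u j)" for c
      by (rule sum.cong) (simp_all add: gh)
    then show ?thesis by (simp add: left_independent_def)
  qed
  also have "\<dots> \<longleftrightarrow> prod_list (map (\<lambda>j. a (D j)) [0..<k]) \<noteq> 1"
    unfolding u_def by (rule cyclic_independent[OF k x])
  also have "map (\<lambda>j. a (D j)) [0..<k] = map a (fw f)"
    by (rule nth_equalityI) (simp_all add: D_def k_def)
  finally show ?thesis by (simp add: hol_def)
qed

lemma finite_face_vertices: "finite (face_vertices X V f)"
  using finites(1) by (simp add: face_vertices_def)

lemma edge_ends_in_face:
  assumes d: "fst d \<in> E"
  obtains f where "f \<in> F" "dpath d 0 \<in> face_vertices X V f" "dpath d 1 \<in> face_vertices X V f"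
proof -
  have "{f \<in> F. fst d \<in> fst ` set (fw f)} \<noteq> {}"
  proof
    assume "{f \<in> F. fst d \<in> fst ` set (fw f)} = {}"
    then have "card {f \<in> F. fst d \<in> fst ` set (fw f)} = 0" by (simp only: card.empty)
    then show False using edge_two_faces[OF d] by simp
  qed
  then obtain f where f: "f \<in> F" "fst d \<in> fst ` set (fw f)" by blast
  then have "fst d \<subseteq> X closure_of f" using face_edges_eq by (auto simp: face_edges_def)
  then have "X closure_of (fst d) \<subseteq> X closure_of f" by (simp add: closure_of_minimal)
  moreover have "dpath d 0 \<in> X closure_of (fst d)" "dpath d 1 \<in> X closure_of (fst d)"
    using edge_ends(1)[OF d] by auto
  ultimately show ?thesis using that[OF f(1)] dpath_ends[OF d] by (auto simp: face_vertices_def)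
qed

text \<open>Vertex vectors are chosen once for the whole surface, so the gain of an edge is the same
  in both of its faces and all Menelaus conditions refer to one gain.\<close>

lemma realization_gain:
  fixes pv :: "'a \<Rightarrow> ('d::division_ring ^ 'm) set"
  assumes R: "realization X V E F pv pe"
  obtains a :: "'a dart \<Rightarrow> 'd" where "gain a" "\<And>f. f \<in> F \<Longrightarrow> menelaus X E pe f \<longleftrightarrow> hol a (fw f) = 1"
proof -
  have "\<forall>v. \<exists>x. v \<in> V \<longrightarrow> represents x (pv v)" using R proj_space_represents by (auto simp: realization_def)
  then obtain r where r: "\<And>v. v \<in> V \<Longrightarrow> represents (r v) (pv v)" by metis
  have "\<exists>b. b \<noteq> 0 \<and> (e \<in> E \<longrightarrow> represents (r (dpath (e, True) 0) - b *s r (dpath (e, True) 1)) (pe e))" for e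
  proof (cases "e \<in> E")
    case True
    let ?v = "dpath (e, True) 0" and ?w = "dpath (e, True) 1"
    have vw: "?v \<in> V" "?w \<in> V" using dpath_ends[of "(e, True)"] True by simp_all
    have "joins X e ?v ?w" using edge_ends(2)[of "(e, True)"] True by (simp add: joins_def)
    then have "points_collinear (pe e) (pv ?v) (pv ?w)" "distinct [pe e, pv ?v, pv ?w]"
      using R True vw unfolding realization_def by blast+
    then obtain b where "b \<noteq> 0" "represents (r ?v - b *s r ?w) (pe e)"
      using collinear_point r vw by metis
    then show ?thesis by blast
  qed (use zero_neq_one in metis)
  then obtain b where b: "\<And>e. b e \<noteq> 0"
    "\<And>e. e \<in> E \<Longrightarrow> represents (r (dpath (e, True) 0) - b e *s r (dpath (e, True) 1)) (pe e)" by metis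
  \<comment> \<open>Solving the line equation for the other end replaces the coefficient by its
    inverse, so this choice represents the edge point in both directions.\<close>
  define a where "a d = (if snd d then b (fst d) else inverse (b (fst d)))" for d
  have a: "gain a" using b(1) by (simp add: gain_def a_def rv_def)
  have rep: "represents (r (dpath d 0) - a d *s r (dpath d 1)) (pe (fst d))" if "fst d \<in> E" for d
    using b(2)[OF that] represents_flip[OF b(2)[OF that] b(1)] by (simp add: a_def dpath_def)
  have "menelaus X E pe f \<longleftrightarrow> hol a (fw f) = 1" if f: "f \<in> F" for f
  proof -
    have "points_independent (face_vertices X V f) pv" using R f by (simp add: realization_def)
    moreover have "face_vertices X V f \<subseteq> V" by (auto simp: face_vertices_def)
    ultimately have "left_independent (face_vertices X V f) r"
      using points_independent_iff[of "face_vertices X V f" r pv] r by blast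
    then have "points_independent (face_edges X E f) pe \<longleftrightarrow> hol a (fw f) \<noteq> 1"
      by (rule face_points_independent_iff[OF f]) (use fw_props(1)[OF f] rep in blast)
    then show ?thesis by (simp add: menelaus_def)
  qed
  with a show ?thesis by (rule that)
qed

text \<open>Generic vertex vectors make the vertices of every face independent simultaneously, as no
  face has more vertices than there are coordinates. The gains then place the edge points without
  further constraint.\<close>

lemma gain_realization:
  fixes a :: "'a dart \<Rightarrow> 'd::division_ring"
  assumes inf: "infinite (UNIV :: 'd set)" and small: "\<And>f. f \<in> F \<Longrightarrow> card (face_vertices X V f) \<le> CARD('m::finite)"
    and a: "gain a"
  obtains pv :: "'a \<Rightarrow> ('d ^ 'm) set" and pe
  where "realization X V E F pv pe" "\<And>f. f \<in> F \<Longrightarrow> menelaus X E pe f \<longleftrightarrow> hol a (fw f) = 1"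
proof -
  obtain r :: "'a \<Rightarrow> 'd ^ 'm" where r: "\<And>A. A \<subseteq> V \<Longrightarrow> card A \<le> CARD('m) \<Longrightarrow> left_independent A r"
    using generic_vectors[OF inf finites(1)] by blast
  have fr: "left_independent (face_vertices X V f) r" if "f \<in> F" for f
    using r small[OF that] by (auto simp: face_vertices_def)
  define u where "u e = r (dpath (e, True) 0) - a (e, True) *s r (dpath (e, True) 1)" for e
  define pv where "pv v = left_span {r v}" for v
  define pe where "pe e = left_span {u e}" for e
  have edge: "u e \<noteq> 0" "points_collinear (pe e) (pv (dpath (e, True) 0)) (pv (dpath (e, True) 1))"
    "distinct [pe e, pv (dpath (e, True) 0), pv (dpath (e, True) 1)]" if e: "e \<in> E" for e
  proof -
    obtain f where f: "f \<in> F" "dpath (e, True) 0 \<in> face_vertices X V f" "dpath (e, True) 1 \<in> face_vertices X V f"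
      using edge_ends_in_face[of "(e, True)"] e by auto
    have "dpath (e, True) 0 \<noteq> dpath (e, True) 1" using edge_ends(3)[of "(e, True)"] e by simp
    note C = collinear_distinct_on_line[OF finite_face_vertices fr[OF f(1)] f(2,3) this gainD(1)[OF a, of "(e, True)"]]
    show "u e \<noteq> 0" "points_collinear (pe e) (pv (dpath (e, True) 0)) (pv (dpath (e, True) 1))"
      "distinct [pe e, pv (dpath (e, True) 0), pv (dpath (e, True) 1)]"
      unfolding u_def pe_def pv_def by (rule C)+
  qed
  have rv0: "r v \<noteq> 0" if v: "v \<in> V" for v
  proof -
    obtain f where f: "f \<in> F" "v \<in> X closure_of f" using vertex_in_some_face[OF v] by blast
    have "left_independent {v} r" using v by (intro r) (auto simp: Suc_le_eq)
    then show ?thesis unfolding left_independent_def by (auto dest: spec[of _ "\<lambda>_. 1"])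
  qed
  have vrep: "represents (r v) (pv v)" if "v \<in> V" for v using rv0[OF that] by (simp add: represents_def pv_def)
  have real: "realization X V E F pv pe" unfolding realization_def
  proof (intro conjI ballI impI)
    show "pv v \<in> proj_space" if "v \<in> V" for v unfolding pv_def using span_in_proj_space rv0[OF that] .
    show "pe e \<in> proj_space" if "e \<in> E" for e unfolding pe_def using span_in_proj_space edge(1)[OF that] .
    show "points_independent (face_vertices X V f) pv" if "f \<in> F" for f
    proof -
      have "points_independent (face_vertices X V f) pv \<longleftrightarrow> left_independent (face_vertices X V f) r"
        by (rule points_independent_iff, rule vrep) (simp add: face_vertices_def)
      then show ?thesis using fr[OF that] by simp
    qed
    fix e v w assume e: "e \<in> E" and j: "joins X e v w"
    have "{v, w} = {dpath (e, True) 0, dpath (e, True) 1}"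
      using j edge_ends(2)[of "(e, True)"] e by (simp add: joins_def)
    then consider "v = dpath (e, True) 0" "w = dpath (e, True) 1" | "w = dpath (e, True) 0" "v = dpath (e, True) 1"
      by (metis doubleton_eq_iff)
    then have "points_collinear (pe e) (pv v) (pv w) \<and> distinct [pe e, pv v, pv w]"
    proof cases
      case 1
      then show ?thesis using edge(2,3)[OF e] by (simp only:)
    next
      case 2
      then show ?thesis using points_collinear_commute[OF edge(2)[OF e]] edge(3)[OF e] by auto
    qed
    then show "points_collinear (pe e) (pv v) (pv w)" "distinct [pe e, pv v, pv w]" by blast+
  qed
  have rep: "represents (r (dpath d 0) - a d *s r (dpath d 1)) (pe (fst d))" if d: "fst d \<in> E" for d
  proof -
    have 1: "represents (r (dpath (fst d, True) 0) - a (fst d, True) *s r (dpath (fst d, True) 1)) (pe (fst d))"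
      using edge(1)[OF d] by (simp add: represents_def pe_def u_def)
    show ?thesis
    proof (cases "snd d")
      case True
      then have "d = (fst d, True)" by (simp add: prod_eq_iff)
      then show ?thesis using 1 by metis
    next
      case False
      then have "d = rv (fst d, True)" by (simp add: rv_def prod_eq_iff)
      then have "a d = inverse (a (fst d, True))" using gainD(2)[OF a] by metis
      then show ?thesis using represents_flip[OF 1 gainD(1)[OF a]] False by (simp add: dpath_def)
    qed
  qed
  have "menelaus X E pe f \<longleftrightarrow> hol a (fw f) = 1" if f: "f \<in> F" for f
    using face_points_independent_iff[OF f fr[OF f], of a pe] fw_props(1)[OF f] rep
    unfolding menelaus_def by blast
  with real show ?thesis by (rule that)
qed

lemma no_realization:
  fixes pv :: "'a \<Rightarrow> ('d::division_ring ^ 'm::finite) set"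
  assumes "f \<in> F" "CARD('m) < card (face_vertices X V f)"
  shows "\<not> realization X V E F pv pe"
proof
  assume "realization X V E F pv pe"
  then obtain r where "left_independent (face_vertices X V f) (r :: 'a \<Rightarrow> 'd ^ 'm)"
    using assms(1) by (auto simp: realization_def points_independent_def)
  then show False using independent_card_le[OF finite_face_vertices, of f r] assms(2) by simp
qed

text \<open>When all faces but \<open>f\<close> satisfy Menelaus, the condition at \<open>f\<close>
  is equivalent to trivial holonomy of the word obtained by gluing from \<open>f\<close>.\<close>

lemma incidence_theorem_if_trivial_holonomy:
  assumes triv: "\<And>f0 w \<Phi> I (a :: 'a dart \<Rightarrow> 'd). f0 \<in> F \<Longrightarrow> glued TYPE('d) f0 F w \<Phi> I \<Longrightarrow> gain a \<Longrightarrow> hol a w = 1"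
  shows "incidence_theorem TYPE('d::division_ring ^ 'm) X V E F"
  unfolding incidence_theorem_def
proof (intro allI impI ballI)
  fix pv :: "'a \<Rightarrow> ('d ^ 'm) set" and pe f
  assume R: "realization X V E F pv pe" and f: "f \<in> F" and others: "\<forall>g\<in>F - {f}. menelaus X E pe g"
  obtain a :: "'a dart \<Rightarrow> 'd" where a: "gain a" "\<And>f. f \<in> F \<Longrightarrow> menelaus X E pe f \<longleftrightarrow> hol a (fw f) = 1"
    using realization_gain[OF R] by blast
  obtain w \<Phi> I where G: "glued TYPE('d) f F w \<Phi> I" using glued_all[OF f] by blast
  have "hol a w = 1 \<longleftrightarrow> hol a (fw f) = 1" using gluedD(8)[OF G a(1)] others a(2) by blast
  then show "menelaus X E pe f" using triv[OF f G a(1)] a(2)[OF f] by simp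
qed

end

section \<open>Holonomy of balanced words, and the equivalence\<close>

text \<open>Over a commutative ring \<open>rv d\<close> may be moved next to \<open>d\<close>, where
  the pair cancels.\<close>

lemma hol_balanced_commutative:
  assumes c: "\<And>x y :: 'd. x * y = y * x" and a: "gain (a :: 'a dart \<Rightarrow> 'd::division_ring)"
  shows "balanced w \<Longrightarrow> hol a w = 1"
proof (induction "length w" arbitrary: w rule: less_induct)
  case less
  show ?case
  proof (cases w)
    case (Cons d w')
    then have "rv d \<in> set w'" using less.prems by (auto simp: balanced_def)
    then obtain B C where w': "w' = B @ rv d # C" by (meson split_list)
    have "balanced ([] @ d # rv d # (B @ C))" using less.prems Cons w' by (auto simp: balanced_def)
    then have "balanced ([] @ (B @ C))" by (rule balanced_remove)
    then have "hol a (B @ C) = 1" using less.hyps[of "B @ C"] Cons w' by simp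
    moreover have "hol a w = hol a (B @ C)"
    proof -
      have "hol a w = a d * (hol a B * inverse (a d)) * hol a C" using Cons w' gainD(2)[OF a] by (simp add: mult.assoc)
      also have "hol a B * inverse (a d) = inverse (a d) * hol a B" by (rule c)
      finally show ?thesis using gainD(1)[OF a, of d] by (simp flip: mult.assoc)
    qed
    ultimately show ?thesis by simp
  qed simp
qed

text \<open>With gain \<open>x\<close> on \<open>r\<close>, \<open>y\<close> on \<open>s\<close> and
  \<open>1\<close> on all other edges, the word collapses to the commutator of \<open>x\<close> and
  \<open>y\<close>.\<close>

lemma crossing_holonomy:
  assumes b: "balanced w" and cr: "crossing w" and xy: "x * y \<noteq> y * (x :: 'd::division_ring)"
  obtains a where "gain a" "hol a w \<noteq> (1 :: 'd)"
proof -
  obtain A B C D G r s where w: "w = A @ r # B @ s # C @ rv r # D @ rv s # G" using cr by (rule crossingE)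
  have dist: "distinct w" using b by (simp add: balanced_def)
  have ne: "r \<noteq> s" "r \<noteq> rv s" "rv r \<noteq> s" "rv r \<noteq> rv s" "s \<noteq> rv s" "r \<noteq> rv r" using dist w by auto
  have x: "x \<noteq> 0" and y: "y \<noteq> 0" using xy by auto
  define a where "a d = (if d = r then x else if d = rv r then inverse x else if d = s then y
    else if d = rv s then inverse y else 1)" for d
  have rv_eq: "rv d = d' \<longleftrightarrow> d = rv d'" for d d' :: "'a dart" by auto
  have ga: "gain a" unfolding gain_def
    using x y ne by (auto simp: a_def rv_eq)
  have one: "hol a u = 1" if "set u \<inter> {r, rv r, s, rv s} = {}" for u
    using that by (induction u) (auto simp: a_def)
  have parts: "set A \<inter> {r, rv r, s, rv s} = {}" "set B \<inter> {r, rv r, s, rv s} = {}" "set C \<inter> {r, rv r, s, rv s} = {}"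
    "set D \<inter> {r, rv r, s, rv s} = {}" "set G \<inter> {r, rv r, s, rv s} = {}"
    using dist w by auto
  have "hol a w = a r * (a s * (a (rv r) * a (rv s)))"
    unfolding w by (simp add: one[OF parts(1)] one[OF parts(2)] one[OF parts(3)] one[OF parts(4)] one[OF parts(5)])
  also have "\<dots> = x * y * (inverse x * inverse y)" using ne by (simp add: a_def mult.assoc)
  finally have e: "hol a w = x * y * inverse (y * x)" using x y by (simp add: nonzero_inverse_mult_distrib)
  have "hol a w \<noteq> 1"
  proof
    assume "hol a w = 1"
    then have "x * y * inverse (y * x) * (y * x) = y * x" using e by simp
    then show False using x y xy by (simp add: mult.assoc[of "x * y"])
  qed
  with ga show ?thesis by (rule that)
qed

theorem theorem2p9:
  fixes X :: "'a topology"
    and V :: "'a set" and E F :: "'a set set"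
    and n :: nat
  assumes "closed_surface X" and "connected_space X" and "orientable_surface X"
    and "polygonal_subdivision X V E F"
    and "n \<ge> 1" and "CARD('m::finite) = n + 1"
  shows "incidence_theorem TYPE('d::division_ring ^ 'm) X V E F \<longleftrightarrow>
      (\<exists>f\<in>F. card (face_vertices X V f) > n + 1) \<or>
      (\<forall>a b :: 'd. a * b = b * a) \<or>
      X homeomorphic_space top_of_set (sphere (0 :: real^3) 1)"
    (is "?inc \<longleftrightarrow> ?big \<or> ?comm \<or> ?sphere")
proof
  interpret subdivided_surface X V E F using assms(1,2,4) by unfold_locales
  note O = assms(3)
  show ?inc if "?big \<or> ?comm \<or> ?sphere"
    using that
  proof (elim disjE)
    \<comment> \<open>A face with that many vertices leaves no room for independence: there are no
      realizations and the incidence theorem holds vacuously.\<close>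
    assume ?big
    then obtain f where "f \<in> F" "CARD('m) < card (face_vertices X V f)" using assms(6) by auto
    then have "\<not> realization X V E F pv pe" for pv :: "'a \<Rightarrow> ('d ^ 'm) set" and pe by (rule no_realization)
    then show ?inc by (simp add: incidence_theorem_def)
  next
    assume c: ?comm
    show ?inc
    proof (rule incidence_theorem_if_trivial_holonomy)
      fix f0 w \<Phi> I and a :: "'a dart \<Rightarrow> 'd" assume "glued TYPE('d) f0 F w \<Phi> I" "gain a"
      then show "hol a w = 1" using hol_balanced_commutative[of a w] glued_all_balanced(1) O c by blast
    qed
  next
    assume s: ?sphere
    show ?inc
    proof (rule incidence_theorem_if_trivial_holonomy)
      fix f0 w \<Phi> I and a :: "'a dart \<Rightarrow> 'd" assume G: "glued TYPE('d) f0 F w \<Phi> I" and a: "gain a"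
      note B = glued_all_balanced[OF G O]
      have "\<not> crossing w" using balanced_sphere_iff[OF gluedD(1)[OF G] B(2,1)] s by blast
      then show "hol a w = 1" using hol_cancels[OF _ a] cancels_or_crossing[OF B(1)] by blast
    qed
  qed
  show "?big \<or> ?comm \<or> ?sphere" if inc: ?inc
  proof (rule ccontr)
    assume no: "\<not> (?big \<or> ?comm \<or> ?sphere)"
    then obtain x y :: 'd where xy: "x * y \<noteq> y * x" by blast
    have inf: "infinite (UNIV :: 'd set)" using finite_division_ring_commutative xy by blast
    have small: "card (face_vertices X V f) \<le> CARD('m)" if "f \<in> F" for f using no that assms(6) by force
    have "F \<noteq> {}"
    proof
      assume "F = {}"
      moreover have "topspace X \<noteq> {}" using assms(1) by (simp add: closed_surface_def)
      ultimately show False using vertex_in_some_face edge_in_some_face cells_cover by blast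
    qed
    then obtain f where f: "f \<in> F" by blast
    obtain w \<Phi> I where G: "glued TYPE('d) f F w \<Phi> I" using glued_all[OF f] by blast
    note B = glued_all_balanced[OF G O]
    have "crossing w" using balanced_sphere_iff[OF gluedD(1)[OF G] B(2,1)] no by blast
    then obtain a :: "'a dart \<Rightarrow> 'd" where a: "gain a" "hol a w \<noteq> 1" using crossing_holonomy[OF B(1) _ xy] by blast
    \<comment> \<open>Retuning changes gains on \<open>I\<close> only, and no edge of
      \<open>I\<close> occurs in \<open>w\<close>. So the nontrivial value on \<open>w\<close>
      persists and, all other faces being trivial now, has to show up at \<open>f\<close>.\<close>
    obtain a' where a': "gain a'" "\<And>d. fst d \<notin> I \<Longrightarrow> a' d = a d" "\<forall>g\<in>F - {f}. hol a' (fw g) = 1"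
      using gluedD(9)[OF G a(1)] by blast
    have "hol a' w = hol a w" using gluedD(6)[OF G] by (intro hol_cong a'(2)) blast
    moreover have "hol a' w = 1 \<longleftrightarrow> hol a' (fw f) = 1" using gluedD(8)[OF G a'(1)] a'(3) by blast
    ultimately have nf: "hol a' (fw f) \<noteq> 1" using a(2) by simp
    obtain pv :: "'a \<Rightarrow> ('d ^ 'm) set" and pe where p: "realization X V E F pv pe"
      "\<And>f. f \<in> F \<Longrightarrow> menelaus X E pe f \<longleftrightarrow> hol a' (fw f) = 1"
      using gain_realization[OF inf small a'(1)] by blast
    have "menelaus X E pe g" if "g \<in> F - {f}" for g using p(2) a'(3) that by blast
    then have "menelaus X E pe f" using inc p(1) f unfolding incidence_theorem_def by blast
    then show False using p(2)[OF f] nf by simp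
  qed
qed

end
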